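(* Let $k$ be a field and let $R$ be a $k$-algebra which is oriented by three idempotents $e, e'_1, e'_2$. Put $e_i=e'_i+e$ and $A_i=e_iRe_i$ for $i=1,2$, and $C=eRe$. There exists a commutative diagram $$\begin{array}{ccccccccccc} &&\vdots&&\vdots&&\vdots&&\vdots&&\\ &&\downarrow&&\downarrow&&\downarrow&&\downarrow&&\\ \cdots&\to&{\rm H}_n(R)&\to&{\rm HC}_n(R)&\to&{\rm HC}_{n-2}(R)&\to&{\rm H}_{n-1}(R)&\to&\cdots\\ &&\downarrow&&\downarrow&&\downarrow&&\downarrow&&\\ \cdots&\to&{\rm H}_{n-1}(C)&\to&{\rm HC}_{n-1}(C)&\to&{\rm HC}_{n-3}(C)&\to&{\rm H}_{n-2}(C)&\to&\cdots\\ &&\downarrow&&\downarrow&&\downarrow&&\downarrow&&\\ \cdots&\to&\bigoplus_{i=1}^2{\rm H}_{n-1}(A_i)&\to&\bigoplus_{i=1}^2{\rm HC}_{n-1}(A_i)&\to&\bigoplus_{i=1}^2{\rm HC}_{n-3}(A_i)&\to&\bigoplus_{i=1}^2{\rm H}_{n-2}(A_i)&\to&\cdots\\ &&\downarrow&&\downarrow&&\downarrow&&\downarrow&&\\ \cdots&\to&{\rm H}_{n-1}(R)&\to&{\rm HC}_{n-1}(R)&\to&{\rm HC}_{n-3}(R)&\to&{\rm H}_{n-2}(R)&\to&\cdots\\ &&\downarrow&&\downarrow&&\downarrow&&\downarrow&&\\ &&\vdots&&\vdots&&\vdots&&\vdots&& \end{array}$$ in which the rows and columns are exact; the rows are Connes'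 long exact sequences (of $R$, of $C$, and the direct sum of those of $A_1$ and $A_2$) and the columns are long exact Mayer--Vietoris sequences $\cdots\to X_n(C)\to X_n(A_1)\oplus X_n(A_2)\to X_n(R)\to X_{n-1}(C)\to\cdots$ for $X={\rm H}$ (Hochschild homology) and $X={\rm HC}$ (cyclic homology).
   Context: Algebras are associative unital algebras over a field $k$; $\otimes=\otimes_k$. An algebra $R$ is \emph{oriented} by $e,e'_1,e'_2$ if $e,e'_1,e'_2$ are orthogonal idempotents of $R$ with $1_R=e'_1+e+e'_2$, such that $e'_1Re'_2=e'_2Re'_1=0$ and at least one of the following holds: (1) $eRe'_1=eRe'_2=0$; (2) $e'_1Re=e'_2Re=0$; (3) $e'_1Re=eRe'_2=0$. The algebras $C$, $A_1$, $A_2$ have units $e$, $e_1$, $e_2$. ${\rm H}_n(\Lambda)={\rm Tor}_n^{\Lambda^e}(\Lambda,\Lambda)$ with $\Lambda^e=\Lambda\otimes\Lambda^{op}$. Cyclic homology: on $\Lambda^{\otimes n+1}$ let $b'(r_0\otimes\cdots\otimes r_n)=\sum_{i=0}^{n-1}(-1)^ir_0\otimes\cdots\otimes r_ir_{i+1}\otimes\cdots\otimes r_n$, $b(r_0\otimes\cdots\otimes r_n)=b'(r_0\otimes\cdots\otimes r_n)+(-1)^nr_nr_0\otimes r_1\otimes\cdots\otimes r_{n-1}$, $t(r_0\otimes\cdots\otimes r_n)=(-1)^nr_n\otimes r_0\otimes\cdots\otimes r_{n-1}$, $N=1+t+\cdots+t^n$. The cyclic bicomplex $CC(\Lambda)$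 is the first quadrant bicomplex with $CC(\Lambda)_{p,q}=\Lambda^{\otimes q+1}$, vertical differential $b$ in even columns and $-b'$ in odd columns, horizontal differential $1-t$ from odd to even columns and $N$ from even to odd columns; ${\rm HC}_n(\Lambda)={\rm H}_n({\rm Tot}\,CC(\Lambda))$. Connes' exact sequence $\cdots\to{\rm H}_n(\Lambda)\to{\rm HC}_n(\Lambda)\to{\rm HC}_{n-2}(\Lambda)\to{\rm H}_{n-1}(\Lambda)\to\cdots$ is the long exact homology sequence of the total complexes of $0\to CC(\Lambda)^{\{2\}}\to CC(\Lambda)\to CC(\Lambda)[2,0]\to0$, where $CC(\Lambda)^{\{2\}}$ consists of the first two columns (its total homology is ${\rm H}_*(\Lambda)$) and $(CC(\Lambda)[2,0])_{p,q}=CC(\Lambda)_{p-2,q}$. *)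

theory Defs
  imports "HOL-Algebra.AbelCoset" "HOL-Algebra.Module"
begin

text \<open>
  Vector spaces over \<^term>\<open>K\<close> and \<^term>\<open>K\<close>-algebras are both given by the module records of
  HOL-Algebra; for a bare vector space the ring components \<open>mult\<close> and \<open>one\<close> of the record are
  irrelevant (and usually \<^const>\<open>undefined\<close>). The library's locale \<^locale>\<open>algebra\<close> is not
  used because it is restricted to commutative algebras.
\<close>

section \<open>Oriented algebras\<close>

definition k_algebra :: "('k, 'm) ring_scheme \<Rightarrow> ('k, 'a) module \<Rightarrow> bool" where
  "k_algebra K A \<longleftrightarrow> field K \<and> module K A \<and> ring A \<and>
     (\<forall>c\<in>carrier K. \<forall>x\<in>carrier A. \<forall>y\<in>carrier A.
        (c \<odot>\<^bsub>A\<^esub> x) \<otimes>\<^bsub>A\<^esub> y = c \<odot>\<^bsub>A\<^esub> (x \<otimes>\<^bsub>A\<^esub> y) \<and>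
        x \<otimes>\<^bsub>A\<^esub> (c \<odot>\<^bsub>A\<^esub> y) = c \<odot>\<^bsub>A\<^esub> (x \<otimes>\<^bsub>A\<^esub> y))"

definition peirce :: "('k, 'a) module \<Rightarrow> 'a \<Rightarrow> 'a \<Rightarrow> 'a set" where
  "peirce A f g = (\<lambda>x. f \<otimes>\<^bsub>A\<^esub> x \<otimes>\<^bsub>A\<^esub> g) ` carrier A"

definition corner :: "('k, 'a) module \<Rightarrow> 'a \<Rightarrow> ('k, 'a) module" where
  "corner A f = A\<lparr>carrier := peirce A f f, one := f\<rparr>"

definition orthogonal_idempotents :: "('k, 'a) module \<Rightarrow> 'a \<Rightarrow> 'a \<Rightarrow> 'a \<Rightarrow> bool" where
  "orthogonal_idempotents A f g h \<longleftrightarrow>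
     {f, g, h} \<subseteq> carrier A \<and>
     f \<otimes>\<^bsub>A\<^esub> f = f \<and> g \<otimes>\<^bsub>A\<^esub> g = g \<and> h \<otimes>\<^bsub>A\<^esub> h = h \<and>
     f \<otimes>\<^bsub>A\<^esub> g = \<zero>\<^bsub>A\<^esub> \<and> g \<otimes>\<^bsub>A\<^esub> f = \<zero>\<^bsub>A\<^esub> \<and>
     f \<otimes>\<^bsub>A\<^esub> h = \<zero>\<^bsub>A\<^esub> \<and> h \<otimes>\<^bsub>A\<^esub> f = \<zero>\<^bsub>A\<^esub> \<and>
     g \<otimes>\<^bsub>A\<^esub> h = \<zero>\<^bsub>A\<^esub> \<and> h \<otimes>\<^bsub>A\<^esub> g = \<zero>\<^bsub>A\<^esub>"

text \<open>The arguments \<open>e1'\<close> and \<open>e2'\<close> are the primed idempotents.\<close>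

definition oriented_by :: "('k, 'a) module \<Rightarrow> 'a \<Rightarrow> 'a \<Rightarrow> 'a \<Rightarrow> bool" where
  "oriented_by A e e1' e2' \<longleftrightarrow>
     orthogonal_idempotents A e e1' e2' \<and>
     \<one>\<^bsub>A\<^esub> = e1' \<oplus>\<^bsub>A\<^esub> e \<oplus>\<^bsub>A\<^esub> e2' \<and>
     peirce A e1' e2' = {\<zero>\<^bsub>A\<^esub>} \<and> peirce A e2' e1' = {\<zero>\<^bsub>A\<^esub>} \<and>
     (peirce A e e1' = {\<zero>\<^bsub>A\<^esub>} \<and> peirce A e e2' = {\<zero>\<^bsub>A\<^esub>} \<or>
      peirce A e1' e = {\<zero>\<^bsub>A\<^esub>} \<and> peirce A e2' e = {\<zero>\<^bsub>A\<^esub>} \<or>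
      peirce A e1' e = {\<zero>\<^bsub>A\<^esub>} \<and> peirce A e e2' = {\<zero>\<^bsub>A\<^esub>})"

section \<open>Linear algebra\<close>

text \<open>HOL-Algebra's \<^locale>\<open>module\<close> needs a commutative ring; \<^term>\<open>S\<close> below is not commutative.\<close>

locale left_module = S?: ring S + M?: abelian_group M for S :: "('s, 'm) ring_scheme" (structure) and M :: "('s, 'p) module" (structure) +
  assumes act_closed: "\<lbrakk>s \<in> carrier S; x \<in> carrier M\<rbrakk> \<Longrightarrow> s \<odot>\<^bsub>M\<^esub> x \<in> carrier M"
    and act_l_distr: "\<lbrakk>s \<in> carrier S; s' \<in> carrier S; x \<in> carrier M\<rbrakk>
      \<Longrightarrow> (s \<oplus>\<^bsub>S\<^esub> s') \<odot>\<^bsub>M\<^esub> x = (s \<odot>\<^bsub>M\<^esub> x) \<oplus>\<^bsub>M\<^esub> (s' \<odot>\<^bsub>M\<^esub> x)"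
    and act_r_distr: "\<lbrakk>s \<in> carrier S; x \<in> carrier M; y \<in> carrier M\<rbrakk>
      \<Longrightarrow> s \<odot>\<^bsub>M\<^esub> (x \<oplus>\<^bsub>M\<^esub> y) = (s \<odot>\<^bsub>M\<^esub> x) \<oplus>\<^bsub>M\<^esub> (s \<odot>\<^bsub>M\<^esub> y)"
    and act_assoc: "\<lbrakk>s \<in> carrier S; s' \<in> carrier S; x \<in> carrier M\<rbrakk>
      \<Longrightarrow> (s \<otimes>\<^bsub>S\<^esub> s') \<odot>\<^bsub>M\<^esub> x = s \<odot>\<^bsub>M\<^esub> (s' \<odot>\<^bsub>M\<^esub> x)"
    and act_one: "x \<in> carrier M \<Longrightarrow> \<one>\<^bsub>S\<^esub> \<odot>\<^bsub>M\<^esub> x = x"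

definition lin_maps ::
  "('s, 'm) ring_scheme \<Rightarrow> ('s, 'v) module \<Rightarrow> ('s, 'w) module \<Rightarrow> ('v \<Rightarrow> 'w) set" where
  "lin_maps S V W = {f \<in> carrier V \<rightarrow> carrier W.
     (\<forall>x\<in>carrier V. \<forall>y\<in>carrier V. f (x \<oplus>\<^bsub>V\<^esub> y) = f x \<oplus>\<^bsub>W\<^esub> f y) \<and>
     (\<forall>s\<in>carrier S. \<forall>x\<in>carrier V. f (s \<odot>\<^bsub>V\<^esub> x) = s \<odot>\<^bsub>W\<^esub> f x)}"

definition exact_at ::
  "('k, 'm) ring_scheme \<Rightarrow> ('k, 'u) module \<Rightarrow> ('u \<Rightarrow> 'v) \<Rightarrow> ('k, 'v) module
     \<Rightarrow> ('v \<Rightarrow> 'w) \<Rightarrow> ('k, 'w) module \<Rightarrow> bool" where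
  "exact_at K U f V g W \<longleftrightarrow> f \<in> lin_maps K U V \<and> g \<in> lin_maps K V W \<and>
     f ` carrier U = {v \<in> carrier V. g v = \<zero>\<^bsub>W\<^esub>}"

definition zero_mod :: "('k, 'v) module" where
  "zero_mod = \<lparr>carrier = {undefined}, mult = undefined, one = undefined, zero = undefined,
     add = (\<lambda>_ _. undefined), smult = (\<lambda>_ _. undefined)\<rparr>"

definition dsum :: "('k, 'v) module \<Rightarrow> ('k, 'w) module \<Rightarrow> ('k, 'v \<times> 'w) module" where
  "dsum V W = \<lparr>carrier = carrier V \<times> carrier W, mult = undefined, one = undefined,
     zero = (\<zero>\<^bsub>V\<^esub>, \<zero>\<^bsub>W\<^esub>),
     add = (\<lambda>(v, w) (v', w'). (v \<oplus>\<^bsub>V\<^esub> v', w \<oplus>\<^bsub>W\<^esub> w')),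
     smult = (\<lambda>c (v, w). (c \<odot>\<^bsub>V\<^esub> v, c \<odot>\<^bsub>W\<^esub> w))\<rparr>"

text \<open>Only used for finite index sets, where the direct sum is the product.\<close>

definition dsum_family :: "'i set \<Rightarrow> ('i \<Rightarrow> ('k, 'v) module) \<Rightarrow> ('k, 'i \<Rightarrow> 'v) module" where
  "dsum_family I V = \<lparr>carrier = (\<Pi>\<^sub>E i\<in>I. carrier (V i)), mult = undefined, one = undefined,
     zero = (\<lambda>i\<in>I. \<zero>\<^bsub>V i\<^esub>),
     add = (\<lambda>x y. \<lambda>i\<in>I. x i \<oplus>\<^bsub>V i\<^esub> y i),
     smult = (\<lambda>c x. \<lambda>i\<in>I. c \<odot>\<^bsub>V i\<^esub> x i)\<rparr>"

definition lin_span :: "('k, 'm) ring_scheme \<Rightarrow> ('k, 'v) module \<Rightarrow> 'v set \<Rightarrow> 'v set" where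
  "lin_span K V X = \<Inter>{W. submodule W K V \<and> X \<subseteq> W}"

definition quot_mod :: "('k, 'v) module \<Rightarrow> 'v set \<Rightarrow> ('k, 'v set) module" where
  "quot_mod V W = \<lparr>carrier = a_rcosets\<^bsub>V\<^esub> W, mult = undefined, one = undefined,
     zero = W,
     add = (\<lambda>X Y. X <+>\<^bsub>V\<^esub> Y),
     smult = (\<lambda>c X. \<Union>x\<in>X. W +>\<^bsub>V\<^esub> (c \<odot>\<^bsub>V\<^esub> x))\<rparr>"

definition free_mod :: "('s, 'm) ring_scheme \<Rightarrow> 'x set \<Rightarrow> ('s, 'x \<Rightarrow> 's) module" where
  "free_mod S X = \<lparr>carrier = {f. (\<forall>x. f x \<in> carrier S) \<and> (\<forall>x. x \<notin> X \<longrightarrow> f x = \<zero>\<^bsub>S\<^esub>) \<and>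
       finite {x. f x \<noteq> \<zero>\<^bsub>S\<^esub>}},
     mult = undefined, one = undefined,
     zero = (\<lambda>_. \<zero>\<^bsub>S\<^esub>),
     add = (\<lambda>f g x. f x \<oplus>\<^bsub>S\<^esub> g x),
     smult = (\<lambda>s f x. s \<otimes>\<^bsub>S\<^esub> f x)\<rparr>"

definition free_gen :: "('s, 'm) ring_scheme \<Rightarrow> 'x \<Rightarrow> 'x \<Rightarrow> 's" where
  "free_gen S x = (\<lambda>y. if y = x then \<one>\<^bsub>S\<^esub> else \<zero>\<^bsub>S\<^esub>)"

text \<open>The vector space with generators \<open>X\<close> and relations \<open>L\<close>, and the class of a generator.\<close>

definition presented ::
  "('k, 'm) ring_scheme \<Rightarrow> 'x set \<Rightarrow> ('x \<Rightarrow> 'k) set \<Rightarrow> ('k, ('x \<Rightarrow> 'k) set) module" where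
  "presented K X L = quot_mod (free_mod K X) (lin_span K (free_mod K X) L)"

definition gen_class ::
  "('k, 'm) ring_scheme \<Rightarrow> 'x set \<Rightarrow> ('x \<Rightarrow> 'k) set \<Rightarrow> 'x \<Rightarrow> ('x \<Rightarrow> 'k) set" where
  "gen_class K X L x = lin_span K (free_mod K X) L +>\<^bsub>free_mod K X\<^esub> free_gen K x"

text \<open>
  The linear map out of a presented space that sends the class of each generator \<open>x\<close> to \<open>\<phi> x\<close>.
  It does not depend on the representative picked by \<open>SOME\<close> as soon as \<open>\<phi>\<close> respects the
  relations, which is the case at every use below.
\<close>

definition lift :: "('k, 'm) ring_scheme \<Rightarrow> ('k, 'v) module \<Rightarrow> ('x \<Rightarrow> 'v) \<Rightarrow> ('x \<Rightarrow> 'k) set \<Rightarrow> 'v" where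
  "lift K V \<phi> u = (let f = (SOME f. f \<in> u) in
     finsum V (\<lambda>x. f x \<odot>\<^bsub>V\<^esub> \<phi> x) {x. f x \<noteq> \<zero>\<^bsub>K\<^esub>})"

section \<open>Homology\<close>

text \<open>
  A chain complex is a family \<open>X\<close> indexed by the integers with differentials
  \<open>d n : X n \<rightarrow> X (n - 1)\<close>; the complexes below are trivial in negative degrees.
\<close>

type_synonym ('k, 'v) graded = "int \<Rightarrow> ('k, 'v) module"
type_synonym 'v diffs = "int \<Rightarrow> 'v \<Rightarrow> 'v"

definition cycles :: "('k, 'v) graded \<Rightarrow> 'v diffs \<Rightarrow> int \<Rightarrow> 'v set" where
  "cycles X d n = {x \<in> carrier (X n). d n x = \<zero>\<^bsub>X (n - 1)\<^esub>}"

definition boundaries :: "('k, 'v) graded \<Rightarrow> 'v diffs \<Rightarrow> int \<Rightarrow> 'v set" where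
  "boundaries X d n = d (n + 1) ` carrier (X (n + 1))"

definition homology :: "('k, 'v) graded \<Rightarrow> 'v diffs \<Rightarrow> ('k, 'v set) graded" where
  "homology X d n = quot_mod ((X n)\<lparr>carrier := cycles X d n\<rparr>) (boundaries X d n)"

definition hclass :: "('k, 'v) graded \<Rightarrow> 'v diffs \<Rightarrow> int \<Rightarrow> 'v \<Rightarrow> 'v set" where
  "hclass X d n x = boundaries X d n +>\<^bsub>X n\<^esub> x"

text \<open>The map induced in degree \<open>n\<close> by a chain map with target complex \<open>(Y, d)\<close>.\<close>

definition hmap ::
  "('k, 'w) graded \<Rightarrow> 'w diffs \<Rightarrow> int \<Rightarrow> ('v \<Rightarrow> 'w) \<Rightarrow> 'v set \<Rightarrow> 'w set" where
  "hmap Y d n f \<zeta> = (\<Union>z\<in>\<zeta>. hclass Y d n (f z))"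

text \<open>
  The connecting map \<open>H\<^sub>n(Z) \<rightarrow> H\<^sub>n\<^sub>-\<^sub>1(X)\<close> of a short exact sequence of complexes
  \<open>0 \<rightarrow> X \<rightarrow> Y \<rightarrow> Z \<rightarrow> 0\<close> with maps \<open>i\<close> and \<open>s\<close>.
\<close>

definition connecting ::
  "('k, 'u) graded \<Rightarrow> 'u diffs \<Rightarrow> (int \<Rightarrow> 'u \<Rightarrow> 'v) \<Rightarrow> ('k, 'v) graded \<Rightarrow> 'v diffs
     \<Rightarrow> (int \<Rightarrow> 'v \<Rightarrow> 'w) \<Rightarrow> int \<Rightarrow> 'w set \<Rightarrow> 'u set" where
  "connecting X dX i Y dY s n \<zeta> =
     (THE \<xi>. \<exists>y\<in>carrier (Y n). \<exists>x\<in>carrier (X (n - 1)).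
        s n y \<in> \<zeta> \<and> i (n - 1) x = dY n y \<and> \<xi> = hclass X dX (n - 1) x)"

section \<open>Tensor products\<close>

text \<open>
  \<open>M \<otimes>\<^sub>S P\<close> over a \<^term>\<open>K\<close>-algebra \<open>S\<close>, for a right \<open>S\<close>-module given by the
  vector space \<open>M\<close> with right action \<open>act\<close> and a left \<open>S\<close>-module \<open>P\<close>.
\<close>

definition tens_rels ::
  "('k, 'm) ring_scheme \<Rightarrow> ('s, 'n) ring_scheme \<Rightarrow> ('k, 'v) module \<Rightarrow> ('v \<Rightarrow> 's \<Rightarrow> 'v)
     \<Rightarrow> ('s, 'w) module \<Rightarrow> ('v \<times> 'w \<Rightarrow> 'k) set" where
  "tens_rels K S M act P =
     (let F = free_mod K (carrier M \<times> carrier P); g = free_gen K in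
       {g (m \<oplus>\<^bsub>M\<^esub> m', p) \<ominus>\<^bsub>F\<^esub> (g (m, p) \<oplus>\<^bsub>F\<^esub> g (m', p)) | m m' p.
          m \<in> carrier M \<and> m' \<in> carrier M \<and> p \<in> carrier P} \<union>
       {g (m, p \<oplus>\<^bsub>P\<^esub> p') \<ominus>\<^bsub>F\<^esub> (g (m, p) \<oplus>\<^bsub>F\<^esub> g (m, p')) | m p p'.
          m \<in> carrier M \<and> p \<in> carrier P \<and> p' \<in> carrier P} \<union>
       {g (c \<odot>\<^bsub>M\<^esub> m, p) \<ominus>\<^bsub>F\<^esub> c \<odot>\<^bsub>F\<^esub> g (m, p) | c m p.
          c \<in> carrier K \<and> m \<in> carrier M \<and> p \<in> carrier P} \<union>
       {g (act m s, p) \<ominus>\<^bsub>F\<^esub> g (m, s \<odot>\<^bsub>P\<^esub> p) | m s p.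
          m \<in> carrier M \<and> s \<in> carrier S \<and> p \<in> carrier P})"

definition tens ::
  "('k, 'm) ring_scheme \<Rightarrow> ('s, 'n) ring_scheme \<Rightarrow> ('k, 'v) module \<Rightarrow> ('v \<Rightarrow> 's \<Rightarrow> 'v)
     \<Rightarrow> ('s, 'w) module \<Rightarrow> ('k, ('v \<times> 'w \<Rightarrow> 'k) set) module" where
  "tens K S M act P = presented K (carrier M \<times> carrier P) (tens_rels K S M act P)"

definition tens_pure ::
  "('k, 'm) ring_scheme \<Rightarrow> ('s, 'n) ring_scheme \<Rightarrow> ('k, 'v) module \<Rightarrow> ('v \<Rightarrow> 's \<Rightarrow> 'v)
     \<Rightarrow> ('s, 'w) module \<Rightarrow> 'v \<Rightarrow> 'w \<Rightarrow> ('v \<times> 'w \<Rightarrow> 'k) set" where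
  "tens_pure K S M act P m p = gen_class K (carrier M \<times> carrier P) (tens_rels K S M act P) (m, p)"

abbreviation (input) scal :: "('k, 'v) module \<Rightarrow> 'v \<Rightarrow> 'k \<Rightarrow> 'v" where
  "scal V \<equiv> (\<lambda>v c. c \<odot>\<^bsub>V\<^esub> v)"

definition tensor_alg ::
  "('k, 'm) ring_scheme \<Rightarrow> ('k, 'a) module \<Rightarrow> ('k, 'b) module
     \<Rightarrow> ('k, ('a \<times> 'b \<Rightarrow> 'k) set) module" where
  "tensor_alg K A B =
     (let T = tens K K A (scal A) B; pr = tens_pure K K A (scal A) B in
       T\<lparr>mult := (\<lambda>u v. lift K T (\<lambda>(a, b). lift K T (\<lambda>(a', b').
                    pr (a \<otimes>\<^bsub>A\<^esub> a') (b \<otimes>\<^bsub>B\<^esub> b')) v) u),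
         one := pr \<one>\<^bsub>A\<^esub> \<one>\<^bsub>B\<^esub>\<rparr>)"

definition opp_alg :: "('k, 'a) module \<Rightarrow> ('k, 'a) module" where
  "opp_alg A = A\<lparr>mult := (\<lambda>x y. y \<otimes>\<^bsub>A\<^esub> x)\<rparr>"

definition env_alg ::
  "('k, 'm) ring_scheme \<Rightarrow> ('k, 'a) module \<Rightarrow> ('k, ('a \<times> 'a \<Rightarrow> 'k) set) module" where
  "env_alg K A = tensor_alg K A (opp_alg A)"

definition tpow_gens :: "('k, 'a) module \<Rightarrow> nat \<Rightarrow> 'a list set" where
  "tpow_gens A m = {xs. length xs = m \<and> set xs \<subseteq> carrier A}"

definition tpow_rels :: "('k, 'm) ring_scheme \<Rightarrow> ('k, 'a) module \<Rightarrow> nat \<Rightarrow> ('a list \<Rightarrow> 'k) set" where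
  "tpow_rels K A m =
     (let F = free_mod K (tpow_gens A m); g = free_gen K in
       {g (xs[i := x \<oplus>\<^bsub>A\<^esub> y]) \<ominus>\<^bsub>F\<^esub> (g (xs[i := x]) \<oplus>\<^bsub>F\<^esub> g (xs[i := y])) | xs i x y.
          xs \<in> tpow_gens A m \<and> i < m \<and> x \<in> carrier A \<and> y \<in> carrier A} \<union>
       {g (xs[i := c \<odot>\<^bsub>A\<^esub> x]) \<ominus>\<^bsub>F\<^esub> c \<odot>\<^bsub>F\<^esub> g (xs[i := x]) | xs i c x.
          xs \<in> tpow_gens A m \<and> i < m \<and> c \<in> carrier K \<and> x \<in> carrier A})"

definition tpow ::
  "('k, 'm) ring_scheme \<Rightarrow> ('k, 'a) module \<Rightarrow> nat \<Rightarrow> ('k, ('a list \<Rightarrow> 'k) set) module" where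
  "tpow K A m = presented K (tpow_gens A m) (tpow_rels K A m)"

definition pure ::
  "('k, 'm) ring_scheme \<Rightarrow> ('k, 'a) module \<Rightarrow> nat \<Rightarrow> 'a list \<Rightarrow> ('a list \<Rightarrow> 'k) set" where
  "pure K A m xs = gen_class K (tpow_gens A m) (tpow_rels K A m) xs"

section \<open>The cyclic bicomplex\<close>

definition signed :: "('k, 'v) module \<Rightarrow> nat \<Rightarrow> 'v \<Rightarrow> 'v" where
  "signed V i v = (if even i then v else \<ominus>\<^bsub>V\<^esub> v)"

text \<open>\<open>bar_d K A m\<close> is \<open>b'\<close> and \<open>hoch_d K A m\<close> is \<open>b\<close>, from tensors of order \<open>m + 1\<close> to
  tensors of order \<open>m\<close>.\<close>

definition bar_d ::
  "('k, 'm) ring_scheme \<Rightarrow> ('k, 'a) module \<Rightarrow> nat \<Rightarrow> ('a list \<Rightarrow> 'k) set \<Rightarrow> ('a list \<Rightarrow> 'k) set" where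
  "bar_d K A m = lift K (tpow K A m) (\<lambda>xs. finsum (tpow K A m) (\<lambda>i.
     signed (tpow K A m) i
       (pure K A m (take i xs @ (xs ! i \<otimes>\<^bsub>A\<^esub> xs ! Suc i) # drop (i + 2) xs))) {..<m})"

definition hoch_d ::
  "('k, 'm) ring_scheme \<Rightarrow> ('k, 'a) module \<Rightarrow> nat \<Rightarrow> ('a list \<Rightarrow> 'k) set \<Rightarrow> ('a list \<Rightarrow> 'k) set" where
  "hoch_d K A m u = bar_d K A m u \<oplus>\<^bsub>tpow K A m\<^esub>
     lift K (tpow K A m) (\<lambda>xs. signed (tpow K A m) m
       (pure K A m ((last xs \<otimes>\<^bsub>A\<^esub> hd xs) # butlast (tl xs)))) u"

definition cyc ::
  "('k, 'm) ring_scheme \<Rightarrow> ('k, 'a) module \<Rightarrow> nat \<Rightarrow> ('a list \<Rightarrow> 'k) set \<Rightarrow> ('a list \<Rightarrow> 'k) set" where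
  "cyc K A m = lift K (tpow K A (Suc m)) (\<lambda>xs. signed (tpow K A (Suc m)) m
     (pure K A (Suc m) (last xs # butlast xs)))"

definition cyc_norm ::
  "('k, 'm) ring_scheme \<Rightarrow> ('k, 'a) module \<Rightarrow> nat \<Rightarrow> ('a list \<Rightarrow> 'k) set \<Rightarrow> ('a list \<Rightarrow> 'k) set" where
  "cyc_norm K A m u = finsum (tpow K A (Suc m)) (\<lambda>i. (cyc K A m ^^ i) u) {..m}"

definition CC :: "('k, 'm) ring_scheme \<Rightarrow> ('k, 'a) module \<Rightarrow> nat \<Rightarrow> nat
    \<Rightarrow> ('k, ('a list \<Rightarrow> 'k) set) module" where
  "CC K A p q = tpow K A (Suc q)"

text \<open>\<open>CC_vert K A p q\<close> goes from position \<open>(p, q + 1)\<close> to \<open>(p, q)\<close>, and \<open>CC_horiz K A p q\<close>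
  from \<open>(p + 1, q)\<close> to \<open>(p, q)\<close>.\<close>

definition CC_vert :: "('k, 'm) ring_scheme \<Rightarrow> ('k, 'a) module \<Rightarrow> nat \<Rightarrow> nat
    \<Rightarrow> ('a list \<Rightarrow> 'k) set \<Rightarrow> ('a list \<Rightarrow> 'k) set" where
  "CC_vert K A p q u =
     (if even p then hoch_d K A (Suc q) u else \<ominus>\<^bsub>CC K A p q\<^esub> bar_d K A (Suc q) u)"

definition CC_horiz :: "('k, 'm) ring_scheme \<Rightarrow> ('k, 'a) module \<Rightarrow> nat \<Rightarrow> nat
    \<Rightarrow> ('a list \<Rightarrow> 'k) set \<Rightarrow> ('a list \<Rightarrow> 'k) set" where
  "CC_horiz K A p q u =
     (if even p then u \<ominus>\<^bsub>CC K A p q\<^esub> cyc K A q u else cyc_norm K A q u)"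

text \<open>
  Total complex of the part of the bicomplex formed by the columns in \<open>J\<close>; an element of degree
  \<open>n\<close> is the family of its components at the positions \<open>(p, n - p)\<close>. The index set is empty,
  and the complex trivial, for \<open>n < 0\<close>.
\<close>

definition cols :: "nat set \<Rightarrow> int \<Rightarrow> nat set" where
  "cols J n = {p \<in> J. int p \<le> n}"

definition row :: "int \<Rightarrow> nat \<Rightarrow> nat" where
  "row n p = nat (n - int p)"

definition Tot :: "('k, 'm) ring_scheme \<Rightarrow> ('k, 'a) module \<Rightarrow> nat set
    \<Rightarrow> ('k, nat \<Rightarrow> ('a list \<Rightarrow> 'k) set) graded" where
  "Tot K A J n = dsum_family (cols J n) (\<lambda>p. CC K A p (row n p))"

definition Tot_d :: "('k, 'm) ring_scheme \<Rightarrow> ('k, 'a) module \<Rightarrow> nat set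
    \<Rightarrow> (nat \<Rightarrow> ('a list \<Rightarrow> 'k) set) diffs" where
  "Tot_d K A J n x = (\<lambda>p\<in>cols J (n - 1).
     CC_vert K A p (row (n - 1) p) (x p) \<oplus>\<^bsub>CC K A p (row (n - 1) p)\<^esub>
     (if Suc p \<in> J then CC_horiz K A p (row (n - 1) p) (x (Suc p))
      else \<zero>\<^bsub>CC K A p (row (n - 1) p)\<^esub>))"

definition HC :: "('k, 'm) ring_scheme \<Rightarrow> ('k, 'a) module
    \<Rightarrow> ('k, (nat \<Rightarrow> ('a list \<Rightarrow> 'k) set) set) graded" where
  "HC K A = homology (Tot K A UNIV) (Tot_d K A UNIV)"

abbreviation two_cols :: "nat set" where
  "two_cols \<equiv> {0, 1}"

definition HT :: "('k, 'm) ring_scheme \<Rightarrow> ('k, 'a) module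
    \<Rightarrow> ('k, (nat \<Rightarrow> ('a list \<Rightarrow> 'k) set) set) graded" where
  "HT K A = homology (Tot K A two_cols) (Tot_d K A two_cols)"

section \<open>Hochschild homology\<close>

definition env_right_act ::
  "('k, 'm) ring_scheme \<Rightarrow> ('k, 'a) module \<Rightarrow> 'a \<Rightarrow> ('a \<times> 'a \<Rightarrow> 'k) set \<Rightarrow> 'a" where
  "env_right_act K A x = lift K A (\<lambda>(a, b). b \<otimes>\<^bsub>A\<^esub> x \<otimes>\<^bsub>A\<^esub> a)"

definition env_left_mod ::
  "('k, 'm) ring_scheme \<Rightarrow> ('k, 'a) module \<Rightarrow> (('a \<times> 'a \<Rightarrow> 'k) set, 'a) module" where
  "env_left_mod K A = \<lparr>carrier = carrier A, mult = undefined, one = undefined,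
     zero = \<zero>\<^bsub>A\<^esub>, add = (\<lambda>x y. x \<oplus>\<^bsub>A\<^esub> y),
     smult = (\<lambda>s x. lift K A (\<lambda>(a, b). a \<otimes>\<^bsub>A\<^esub> x \<otimes>\<^bsub>A\<^esub> b) s)\<rparr>"

text \<open>
  Projective means: direct summand of a free module. Basis sets inside the type of the module
  itself suffice, since \<open>P\<close> is a quotient of the free module on its own elements.
\<close>

definition projective :: "('s, 'm) ring_scheme \<Rightarrow> ('s, 'p) module \<Rightarrow> bool" where
  "projective S P \<longleftrightarrow> left_module S P \<and>
     (\<exists>X::'p set. \<exists>i\<in>lin_maps S P (free_mod S X). \<exists>r\<in>lin_maps S (free_mod S X) P.
        \<forall>x\<in>carrier P. r (i x) = x)"

text \<open>Projective resolutions: \<open>rmod n\<close> is the module in degree \<open>n\<close>, and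
  \<open>rdiff n : rmod (n + 1) \<rightarrow> rmod n\<close>.\<close>

record ('s, 'p, 'a) resolution =
  rmod :: "nat \<Rightarrow> ('s, 'p) module"
  rdiff :: "nat \<Rightarrow> 'p \<Rightarrow> 'p"
  raug :: "'p \<Rightarrow> 'a"

definition proj_resolution ::
  "('s, 'm) ring_scheme \<Rightarrow> ('s, 'a) module \<Rightarrow> ('s, 'p, 'a) resolution \<Rightarrow> bool" where
  "proj_resolution S N Q \<longleftrightarrow>
     (\<forall>n. projective S (rmod Q n)) \<and>
     raug Q ` carrier (rmod Q 0) = carrier N \<and>
     exact_at S (rmod Q 1) (rdiff Q 0) (rmod Q 0) (raug Q) N \<and>
     (\<forall>n. exact_at S (rmod Q (Suc (Suc n))) (rdiff Q (Suc n)) (rmod Q (Suc n))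
            (rdiff Q n) (rmod Q n))"

text \<open>
  \<open>HH K A Q n\<close> is \<open>Tor\<^sub>n\<close> over the enveloping algebra of the right module \<open>A\<close> and the left
  module \<open>A\<close>, computed from the projective resolution \<open>Q\<close> of the latter.
\<close>

definition tor_cx ::
  "('k, 'm) ring_scheme \<Rightarrow> ('k, 'a) module \<Rightarrow> (('a \<times> 'a \<Rightarrow> 'k) set, 'p, 'a) resolution
     \<Rightarrow> ('k, ('a \<times> 'p \<Rightarrow> 'k) set) graded" where
  "tor_cx K A Q n = (if n < 0 then zero_mod
     else tens K (env_alg K A) A (env_right_act K A) (rmod Q (nat n)))"

definition tor_d ::
  "('k, 'm) ring_scheme \<Rightarrow> ('k, 'a) module \<Rightarrow> (('a \<times> 'a \<Rightarrow> 'k) set, 'p, 'a) resolution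
     \<Rightarrow> ('a \<times> 'p \<Rightarrow> 'k) set diffs" where
  "tor_d K A Q n u = (if n \<le> 0 then \<zero>\<^bsub>tor_cx K A Q (n - 1)\<^esub>
     else lift K (tor_cx K A Q (n - 1)) (\<lambda>(a, x).
       tens_pure K (env_alg K A) A (env_right_act K A) (rmod Q (nat (n - 1)))
         a (rdiff Q (nat (n - 1)) x)) u)"

definition HH ::
  "('k, 'm) ring_scheme \<Rightarrow> ('k, 'a) module \<Rightarrow> (('a \<times> 'a \<Rightarrow> 'k) set, 'p, 'a) resolution
     \<Rightarrow> ('k, ('a \<times> 'p \<Rightarrow> 'k) set set) graded" where
  "HH K A Q = homology (tor_cx K A Q) (tor_d K A Q)"

text \<open>
  The identification of Hochschild homology with the total homology of the first two columns: lift
  the identity of \<open>A\<close> to a chain map from the projective resolution \<open>Q\<close> to the bar resolution,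
  tensor with \<open>A\<close>, identify \<open>a \<otimes> (x\<^sub>0 \<otimes> \<dots> \<otimes> x\<^sub>n\<^sub>+\<^sub>1)\<close> with
  \<open>x\<^sub>n\<^sub>+\<^sub>1 a x\<^sub>0 \<otimes> x\<^sub>1 \<otimes> \<dots> \<otimes> x\<^sub>n\<close>, and put the result into column \<open>0\<close>. On homology the result
  does not depend on the lift.
\<close>

definition bar_mod ::
  "('k, 'm) ring_scheme \<Rightarrow> ('k, 'a) module \<Rightarrow> nat
     \<Rightarrow> (('a \<times> 'a \<Rightarrow> 'k) set, ('a list \<Rightarrow> 'k) set) module" where
  "bar_mod K A n = (let T = tpow K A (n + 2) in
     \<lparr>carrier = carrier T, mult = undefined, one = undefined,
      zero = \<zero>\<^bsub>T\<^esub>, add = (\<lambda>u v. u \<oplus>\<^bsub>T\<^esub> v),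
      smult = (\<lambda>s u. lift K T (\<lambda>(a, b). lift K T (\<lambda>xs.
        pure K A (n + 2) ((a \<otimes>\<^bsub>A\<^esub> hd xs) # butlast (tl xs) @ [last xs \<otimes>\<^bsub>A\<^esub> b])) u) s)\<rparr>)"

definition bar_lift ::
  "('k, 'm) ring_scheme \<Rightarrow> ('k, 'a) module \<Rightarrow> (('a \<times> 'a \<Rightarrow> 'k) set, 'p, 'a) resolution
     \<Rightarrow> (nat \<Rightarrow> 'p \<Rightarrow> ('a list \<Rightarrow> 'k) set) \<Rightarrow> bool" where
  "bar_lift K A Q \<phi> \<longleftrightarrow>
     (\<forall>n. \<phi> n \<in> lin_maps (env_alg K A) (rmod Q n) (bar_mod K A n)) \<and>
     (\<forall>n. \<forall>x\<in>carrier (rmod Q (Suc n)). \<phi> n (rdiff Q n x) = bar_d K A (n + 2) (\<phi> (Suc n) x)) \<and>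
     (\<forall>x\<in>carrier (rmod Q 0). lift K A (\<lambda>xs. xs ! 0 \<otimes>\<^bsub>A\<^esub> xs ! 1) (\<phi> 0 x) = raug Q x)"

definition theta_chain ::
  "('k, 'm) ring_scheme \<Rightarrow> ('k, 'a) module \<Rightarrow> (nat \<Rightarrow> 'p \<Rightarrow> ('a list \<Rightarrow> 'k) set)
     \<Rightarrow> int \<Rightarrow> ('a \<times> 'p \<Rightarrow> 'k) set \<Rightarrow> nat \<Rightarrow> ('a list \<Rightarrow> 'k) set" where
  "theta_chain K A \<phi> n u = (\<lambda>p\<in>cols two_cols n.
     let T = CC K A p (row n p) in
     if p = 0 then lift K T (\<lambda>(a, x). lift K T (\<lambda>xs.
         pure K A (Suc (row n p)) ((last xs \<otimes>\<^bsub>A\<^esub> a \<otimes>\<^bsub>A\<^esub> hd xs) # butlast (tl xs))) (\<phi> (nat n) x)) u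
     else \<zero>\<^bsub>T\<^esub>)"

definition theta ::
  "('k, 'm) ring_scheme \<Rightarrow> ('k, 'a) module \<Rightarrow> (nat \<Rightarrow> 'p \<Rightarrow> ('a list \<Rightarrow> 'k) set)
     \<Rightarrow> int \<Rightarrow> ('a \<times> 'p \<Rightarrow> 'k) set set \<Rightarrow> (nat \<Rightarrow> ('a list \<Rightarrow> 'k) set) set" where
  "theta K A \<phi> n = hmap (Tot K A two_cols) (Tot_d K A two_cols) n (theta_chain K A \<phi> n)"

section \<open>Connes' sequence\<close>

definition cols_incl ::
  "('k, 'm) ring_scheme \<Rightarrow> ('k, 'a) module \<Rightarrow> int
     \<Rightarrow> (nat \<Rightarrow> ('a list \<Rightarrow> 'k) set) \<Rightarrow> nat \<Rightarrow> ('a list \<Rightarrow> 'k) set" where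
  "cols_incl K A n x =
     (\<lambda>p\<in>cols UNIV n. if p \<in> two_cols then x p else \<zero>\<^bsub>CC K A p (row n p)\<^esub>)"

text \<open>
  The projection onto the bicomplex shifted by two columns; the total complex of the latter in
  degree \<open>n\<close> is \<open>Tot K A UNIV (n - 2)\<close>.
\<close>

definition cols_shift :: "int \<Rightarrow> (nat \<Rightarrow> 'v) \<Rightarrow> nat \<Rightarrow> 'v" where
  "cols_shift n x = (\<lambda>p\<in>cols UNIV (n - 2). x (p + 2))"

text \<open>
  \<open>H\<^sub>n \<rightarrow> HC\<^sub>n\<close>, \<open>HC\<^sub>n \<rightarrow> HC\<^sub>n\<^sub>-\<^sub>2\<close> and \<open>HC\<^sub>n\<^sub>-\<^sub>2 \<rightarrow> H\<^sub>n\<^sub>-\<^sub>1\<close>, the first and the last via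
  the identification \<^const>\<open>theta\<close>.
\<close>

definition connes_I ::
  "('k, 'm) ring_scheme \<Rightarrow> ('k, 'a) module \<Rightarrow> (nat \<Rightarrow> 'p \<Rightarrow> ('a list \<Rightarrow> 'k) set)
     \<Rightarrow> int \<Rightarrow> ('a \<times> 'p \<Rightarrow> 'k) set set \<Rightarrow> (nat \<Rightarrow> ('a list \<Rightarrow> 'k) set) set" where
  "connes_I K A \<phi> n = hmap (Tot K A UNIV) (Tot_d K A UNIV) n (cols_incl K A n) \<circ> theta K A \<phi> n"

definition connes_S ::
  "('k, 'm) ring_scheme \<Rightarrow> ('k, 'a) module
     \<Rightarrow> int \<Rightarrow> (nat \<Rightarrow> ('a list \<Rightarrow> 'k) set) set \<Rightarrow> (nat \<Rightarrow> ('a list \<Rightarrow> 'k) set) set" where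
  "connes_S K A n = hmap (Tot K A UNIV) (Tot_d K A UNIV) (n - 2) (cols_shift n)"

definition connes_B ::
  "('k, 'm) ring_scheme \<Rightarrow> ('k, 'a) module \<Rightarrow> (('a \<times> 'a \<Rightarrow> 'k) set, 'p, 'a) resolution
     \<Rightarrow> (nat \<Rightarrow> 'p \<Rightarrow> ('a list \<Rightarrow> 'k) set)
     \<Rightarrow> int \<Rightarrow> (nat \<Rightarrow> ('a list \<Rightarrow> 'k) set) set \<Rightarrow> ('a \<times> 'p \<Rightarrow> 'k) set set" where
  "connes_B K A Q \<phi> n =
     inv_into (carrier (HH K A Q (n - 1))) (theta K A \<phi> (n - 1)) \<circ>
     connecting (Tot K A two_cols) (Tot_d K A two_cols) (cols_incl K A)
       (Tot K A UNIV) (Tot_d K A UNIV) cols_shift n"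

section \<open>Diagrams\<close>

text \<open>\<open>\<dots> \<rightarrow> X\<^sub>n \<rightarrow> Y\<^sub>n \<rightarrow> Y\<^sub>n\<^sub>-\<^sub>2 \<rightarrow> X\<^sub>n\<^sub>-\<^sub>1 \<rightarrow> \<dots>\<close> with maps \<open>I n\<close>, \<open>S n\<close> and \<open>B n\<close>.\<close>

definition exact_row ::
  "('k, 'm) ring_scheme \<Rightarrow> ('k, 'x) graded \<Rightarrow> ('k, 'y) graded
     \<Rightarrow> (int \<Rightarrow> 'x \<Rightarrow> 'y) \<Rightarrow> (int \<Rightarrow> 'y \<Rightarrow> 'y) \<Rightarrow> (int \<Rightarrow> 'y \<Rightarrow> 'x) \<Rightarrow> bool" where
  "exact_row K X Y I S B \<longleftrightarrow> (\<forall>n.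
     exact_at K (X n) (I n) (Y n) (S n) (Y (n - 2)) \<and>
     exact_at K (Y n) (S n) (Y (n - 2)) (B n) (X (n - 1)) \<and>
     exact_at K (Y (n - 2)) (B n) (X (n - 1)) (I (n - 1)) (Y (n - 1)))"

text \<open>Commutativity of all squares between two consecutive rows, where the vertical maps
  \<open>f n : X n \<rightarrow> X' (n - r)\<close> and \<open>g n : Y n \<rightarrow> Y' (n - r)\<close> lower the degree by \<open>r\<close>.\<close>

definition rows_commute ::
  "int \<Rightarrow> ('k, 'x) graded \<Rightarrow> ('k, 'y) graded
     \<Rightarrow> (int \<Rightarrow> 'x \<Rightarrow> 'y) \<Rightarrow> (int \<Rightarrow> 'y \<Rightarrow> 'y) \<Rightarrow> (int \<Rightarrow> 'y \<Rightarrow> 'x)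
     \<Rightarrow> (int \<Rightarrow> 'x' \<Rightarrow> 'y') \<Rightarrow> (int \<Rightarrow> 'y' \<Rightarrow> 'y') \<Rightarrow> (int \<Rightarrow> 'y' \<Rightarrow> 'x')
     \<Rightarrow> (int \<Rightarrow> 'x \<Rightarrow> 'x') \<Rightarrow> (int \<Rightarrow> 'y \<Rightarrow> 'y') \<Rightarrow> bool" where
  "rows_commute r X Y I S B I' S' B' f g \<longleftrightarrow> (\<forall>n.
     (\<forall>x\<in>carrier (X n). g n (I n x) = I' (n - r) (f n x)) \<and>
     (\<forall>y\<in>carrier (Y n). g (n - 2) (S n y) = S' (n - r) (g n y)) \<and>
     (\<forall>y\<in>carrier (Y (n - 2)). f (n - 1) (B n y) = B' (n - r) (g (n - 2) y)))"

definition exact_column ::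
  "('k, 'm) ring_scheme \<Rightarrow> ('k, 'x) graded \<Rightarrow> ('k, 'y) graded \<Rightarrow> ('k, 'z) graded
     \<Rightarrow> (int \<Rightarrow> 'x \<Rightarrow> 'y) \<Rightarrow> (int \<Rightarrow> 'y \<Rightarrow> 'z) \<Rightarrow> (int \<Rightarrow> 'z \<Rightarrow> 'x) \<Rightarrow> bool" where
  "exact_column K X Y Z \<alpha> \<beta> \<delta> \<longleftrightarrow> (\<forall>n.
     exact_at K (X n) (\<alpha> n) (Y n) (\<beta> n) (Z n) \<and>
     exact_at K (Y n) (\<beta> n) (Z n) (\<delta> n) (X (n - 1)) \<and>
     exact_at K (Z n) (\<delta> n) (X (n - 1)) (\<alpha> (n - 1)) (Y (n - 1)))"

text \<open>
  The map on total homology induced by an inclusion of algebras \<open>A \<subseteq> A'\<close>. The inclusions of corner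
  algebras do not preserve units, but \<open>b\<close>, \<open>b'\<close> and \<open>t\<close> do not involve the unit.
\<close>

definition incl_map ::
  "('k, 'm) ring_scheme \<Rightarrow> nat set \<Rightarrow> ('k, 'a) module \<Rightarrow> int
     \<Rightarrow> (nat \<Rightarrow> ('a list \<Rightarrow> 'k) set) set \<Rightarrow> (nat \<Rightarrow> ('a list \<Rightarrow> 'k) set) set" where
  "incl_map K J A' n = hmap (Tot K A' J) (Tot_d K A' J) n (\<lambda>x. \<lambda>p\<in>cols J n.
     lift K (CC K A' p (row n p)) (pure K A' (Suc (row n p))) (x p))"

text \<open>
  A column \<open>X\<^sub>n(C) \<rightarrow> X\<^sub>n(A\<^sub>1) \<oplus> X\<^sub>n(A\<^sub>2) \<rightarrow> X\<^sub>n(R)\<close> has the Mayer--Vietoris maps if the first map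
  is the inclusion with a minus sign in the second component and the second map is the sum of
  the inclusions. The arguments \<open>\<theta>\<close> identify the spaces with total homology of columns \<open>J\<close>.
\<close>

definition mv_maps ::
  "('k, 'm) ring_scheme \<Rightarrow> nat set \<Rightarrow> ('k, 'a) module \<Rightarrow> ('k, 'a) module \<Rightarrow> ('k, 'a) module
     \<Rightarrow> ('k, 'c) graded \<Rightarrow> ('k, 'b1) graded \<Rightarrow> ('k, 'b2) graded
     \<Rightarrow> (int \<Rightarrow> 'c \<Rightarrow> (nat \<Rightarrow> ('a list \<Rightarrow> 'k) set) set)
     \<Rightarrow> (int \<Rightarrow> 'b1 \<Rightarrow> (nat \<Rightarrow> ('a list \<Rightarrow> 'k) set) set)
     \<Rightarrow> (int \<Rightarrow> 'b2 \<Rightarrow> (nat \<Rightarrow> ('a list \<Rightarrow> 'k) set) set)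
     \<Rightarrow> (int \<Rightarrow> 'r \<Rightarrow> (nat \<Rightarrow> ('a list \<Rightarrow> 'k) set) set)
     \<Rightarrow> (int \<Rightarrow> 'c \<Rightarrow> 'b1 \<times> 'b2) \<Rightarrow> (int \<Rightarrow> 'b1 \<times> 'b2 \<Rightarrow> 'r) \<Rightarrow> bool" where
  "mv_maps K J A1 A2 R XC X1 X2 \<theta>C \<theta>1 \<theta>2 \<theta>R \<alpha> \<beta> \<longleftrightarrow> (\<forall>n.
     (\<forall>x\<in>carrier (XC n).
        \<theta>1 n (fst (\<alpha> n x)) = incl_map K J A1 n (\<theta>C n x) \<and>
        \<theta>2 n (snd (\<alpha> n x)) =
          \<ominus>\<^bsub>homology (Tot K A2 J) (Tot_d K A2 J) n\<^esub> incl_map K J A2 n (\<theta>C n x)) \<and>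
     (\<forall>y\<in>carrier (X1 n). \<forall>z\<in>carrier (X2 n).
        \<theta>R n (\<beta> n (y, z)) =
          incl_map K J R n (\<theta>1 n y) \<oplus>\<^bsub>homology (Tot K R J) (Tot_d K R J) n\<^esub>
          incl_map K J R n (\<theta>2 n z)))"

end

theory Submission imports Defs begin

text \<open>
  By orientation the compressions \<open>x \<mapsto> e\<^sub>i x e\<^sub>i\<close> and \<open>x \<mapsto> e x e\<close> are multiplicative, so the inclusions
  \<open>C \<subseteq> A\<^sub>i \<subseteq> R\<close> are split on homology and the composite \<open>A\<^sub>1 \<rightarrow> R \<rightarrow> A\<^sub>2\<close> factors through \<open>C\<close>.
  Hence all connecting maps can be taken to be zero, and what remains is that \<open>A\<^sub>1\<close> and \<open>A\<^sub>2\<close> together hit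
  the homology of \<open>R\<close>. Now \<open>1 = e\<^sub>1 + e\<^sub>2'\<close> is a triangular decomposition \<open>1 = f + g\<close>, \<open>g R f = 0\<close>. The
  projection of the bar resolution onto the bar resolution relative to \<open>k f + k g\<close> lifts the identity of \<open>R\<close>,
  so it is homotopic to the identity; after tensoring with \<open>R\<close> the vanishing of \<open>g R f\<close> turns it into
  \<open>x \<mapsto> f x f + g x g\<close>, which therefore is the identity on Hochschild homology. In cyclic homology the
  defect of this identity is killed by both compressions and, by induction along Connes' sequence, comes from
  Hochschild homology, so it vanishes too.
\<close>

text \<open>Hochschild homology is given by arbitrary projective resolutions, while Connes' sequence
  and the compressions live on explicit tensor powers. The bridge is the isomorphism of
  \<open>A \<otimes> B n\<close>, over the enveloping algebra, with the tensor power of order n + 1,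
  encoded by \<open>mu\<close>: identities in the Hochschild complex become identities in the bar
  complex, where induction on the first factor works. The bar modules enter through a lifting
  property: over a field the middle factors lift linearly, and the action on the outer factors
  extends the lift. The column of \<open>b'\<close> is contracted by prepending the unit, so the
  first two columns compute the homology of the Hochschild complex. Why 1 = e1 + e2' and not the
  three given idempotents: since e1' R e2' and e2' R e1' vanish, e1 R e2' reduces to e R e2' and e2'
  R e1 to e2' R e, and every orientation kills one of the two. So one triangular argument serves all
  cases, up to the order of the two idempotents. The part cut out by e2' already lies in A2, hence
  A1 and A2 exhaust the homology of R.\<close>

context abelian_group begin
text \<open>Declares the additive laws to the \<open>algebra\<close> normaliser for plain abelian
  groups: tensor powers and homology spaces are module records without a usable multiplication, so
  the ring rules do not reach them.\<close>

lemmas abgroup_simprules [algebra abgroup "zero G" "add G" "a_inv G" "a_minus G"] =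
  a_closed zero_closed a_inv_closed minus_closed a_assoc l_zero l_neg a_comm minus_eq
  r_zero r_neg r_neg2 r_neg1 minus_add minus_minus add.inv_one a_lcomm

lemma minus_eq_zero_iff:
  assumes "x \<in> carrier G" "y \<in> carrier G"
  shows "x \<ominus> y = \<zero> \<longleftrightarrow> x = y"
  using assms by (metis add.inv_solve_right' l_zero minus_eq zero_closed)

lemma minus_zero_right: "x \<in> carrier G \<Longrightarrow> x \<ominus> \<zero> = x"
  by (simp add: minus_eq)

lemma minus_add_cancel:
  assumes "x \<in> carrier G" "y \<in> carrier G"
  shows "(x \<ominus> y) \<oplus> y = x" "y \<oplus> (x \<ominus> y) = x"
  using assms by (algebra, algebra)

end

section \<open>Linear maps\<close>

lemma lin_mapsI:
  assumes "\<And>x. x \<in> carrier V \<Longrightarrow> f x \<in> carrier W"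
    and "\<And>x y. \<lbrakk>x \<in> carrier V; y \<in> carrier V\<rbrakk> \<Longrightarrow> f (x \<oplus>\<^bsub>V\<^esub> y) = f x \<oplus>\<^bsub>W\<^esub> f y"
    and "\<And>s x. \<lbrakk>s \<in> carrier S; x \<in> carrier V\<rbrakk> \<Longrightarrow> f (s \<odot>\<^bsub>V\<^esub> x) = s \<odot>\<^bsub>W\<^esub> f x"
  shows "f \<in> lin_maps S V W"
  using assms by (auto simp: lin_maps_def)

lemma lin_closed: "\<lbrakk>f \<in> lin_maps S V W; x \<in> carrier V\<rbrakk> \<Longrightarrow> f x \<in> carrier W"
  and lin_add: "\<lbrakk>f \<in> lin_maps S V W; x \<in> carrier V; y \<in> carrier V\<rbrakk> \<Longrightarrow> f (x \<oplus>\<^bsub>V\<^esub> y) = f x \<oplus>\<^bsub>W\<^esub> f y"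
  and lin_smult: "\<lbrakk>f \<in> lin_maps S V W; s \<in> carrier S; x \<in> carrier V\<rbrakk> \<Longrightarrow> f (s \<odot>\<^bsub>V\<^esub> x) = s \<odot>\<^bsub>W\<^esub> f x"
  by (auto simp: lin_maps_def)

lemma lin_cong:
  assumes "f \<in> lin_maps S V W" "\<And>x. x \<in> carrier V \<Longrightarrow> f x = g x"
    and "\<And>x y. \<lbrakk>x \<in> carrier V; y \<in> carrier V\<rbrakk> \<Longrightarrow> x \<oplus>\<^bsub>V\<^esub> y \<in> carrier V"
    and "\<And>s x. \<lbrakk>s \<in> carrier S; x \<in> carrier V\<rbrakk> \<Longrightarrow> s \<odot>\<^bsub>V\<^esub> x \<in> carrier V"
  shows "g \<in> lin_maps S V W"
  using assms by (auto simp: lin_maps_def Pi_def)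

lemma lin_comp:
  assumes "f \<in> lin_maps S U V" "g \<in> lin_maps S V W"
  shows "(\<lambda>x. g (f x)) \<in> lin_maps S U W"
  using assms by (auto simp: lin_maps_def Pi_def)

lemma lin_id: "(\<lambda>x. x) \<in> lin_maps S V V"
  by (auto simp: lin_maps_def)

lemma lin_zero:
  assumes f: "f \<in> lin_maps S V W" and V: "abelian_group V" and W: "abelian_group W"
  shows "f \<zero>\<^bsub>V\<^esub> = \<zero>\<^bsub>W\<^esub>"
proof -
  interpret V: abelian_group V by fact
  interpret W: abelian_group W by fact
  have "f \<zero>\<^bsub>V\<^esub> \<oplus>\<^bsub>W\<^esub> f \<zero>\<^bsub>V\<^esub> = f \<zero>\<^bsub>V\<^esub>"
    using lin_add[OF f, of "\<zero>\<^bsub>V\<^esub>" "\<zero>\<^bsub>V\<^esub>"] by simp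
  then show ?thesis using lin_closed[OF f] by (metis V.zero_closed W.add.r_cancel_one')
qed

lemma lin_uminus:
  assumes f: "f \<in> lin_maps S V W" and V: "abelian_group V" and W: "abelian_group W"
    and x: "x \<in> carrier V"
  shows "f (\<ominus>\<^bsub>V\<^esub> x) = \<ominus>\<^bsub>W\<^esub> f x"
proof -
  interpret V: abelian_group V by fact
  interpret W: abelian_group W by fact
  have "f (\<ominus>\<^bsub>V\<^esub> x) \<oplus>\<^bsub>W\<^esub> f x = \<zero>\<^bsub>W\<^esub>"
    using lin_add[OF f, of "\<ominus>\<^bsub>V\<^esub> x" x] x lin_zero[OF f V W] by (simp add: V.l_neg)
  then show ?thesis using lin_closed[OF f] x by (metis V.a_inv_closed W.minus_equality)
qed

lemma lin_minus:
  assumes f: "f \<in> lin_maps S V W" and V: "abelian_group V" and W: "abelian_group W"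
    and "x \<in> carrier V" "y \<in> carrier V"
  shows "f (x \<ominus>\<^bsub>V\<^esub> y) = f x \<ominus>\<^bsub>W\<^esub> f y"
proof -
  interpret V: abelian_group V by fact
  show ?thesis using assms by (simp add: a_minus_def lin_add[OF f] lin_uminus[OF f V W])
qed

lemma additive_finsum:
  assumes V: "abelian_group V" and W: "abelian_group W"
    and f: "\<And>x. x \<in> carrier V \<Longrightarrow> f x \<in> carrier W"
      "\<And>x y. \<lbrakk>x \<in> carrier V; y \<in> carrier V\<rbrakk> \<Longrightarrow> f (x \<oplus>\<^bsub>V\<^esub> y) = f x \<oplus>\<^bsub>W\<^esub> f y"
    and A: "finite A" and g: "g \<in> A \<rightarrow> carrier V"
  shows "f (finsum V g A) = finsum W (\<lambda>i. f (g i)) A"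
proof -
  interpret V: abelian_group V by fact
  interpret W: abelian_group W by fact
  have z: "f \<zero>\<^bsub>V\<^esub> = \<zero>\<^bsub>W\<^esub>"
    using f(1)[of "\<zero>\<^bsub>V\<^esub>"] f(2)[of "\<zero>\<^bsub>V\<^esub>" "\<zero>\<^bsub>V\<^esub>"] by (metis V.zero_closed V.l_zero W.add.r_cancel_one')
  show ?thesis using A g
  proof (induction A)
    case empty then show ?case by (simp add: z)
  next
    case (insert a A)
    then have "(\<lambda>i. f (g i)) \<in> A \<rightarrow> carrier W" using f by auto
    then show ?case using insert f by (simp add: Pi_def)
  qed
qed

lemma lin_finsum:
  assumes f: "f \<in> lin_maps S V W" and V: "abelian_group V" and W: "abelian_group W"
    and "finite A" "g \<in> A \<rightarrow> carrier V"
  shows "f (finsum V g A) = finsum W (\<lambda>i. f (g i)) A"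
  by (rule additive_finsum[OF V W]) (use assms in \<open>auto simp: lin_closed lin_add\<close>)

section \<open>Modules over rings that need not be commutative\<close>

context left_module begin

lemma act_zero_l: assumes x: "x \<in> carrier M" shows "\<zero>\<^bsub>S\<^esub> \<odot>\<^bsub>M\<^esub> x = \<zero>\<^bsub>M\<^esub>"
proof -
  have "\<zero>\<^bsub>S\<^esub> \<odot>\<^bsub>M\<^esub> x \<oplus>\<^bsub>M\<^esub> \<zero>\<^bsub>S\<^esub> \<odot>\<^bsub>M\<^esub> x = \<zero>\<^bsub>S\<^esub> \<odot>\<^bsub>M\<^esub> x"
    using act_l_distr[of "\<zero>\<^bsub>S\<^esub>" "\<zero>\<^bsub>S\<^esub>" x] x by simp
  then show ?thesis using act_closed[of "\<zero>\<^bsub>S\<^esub>" x] x by (metis M.add.r_cancel_one' S.zero_closed)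
qed

lemma act_neg: "s \<in> carrier S \<Longrightarrow> x \<in> carrier M \<Longrightarrow> s \<odot>\<^bsub>M\<^esub> (\<ominus>\<^bsub>M\<^esub> x) = \<ominus>\<^bsub>M\<^esub> (s \<odot>\<^bsub>M\<^esub> x)"
  and act_zero_r: "s \<in> carrier S \<Longrightarrow> s \<odot>\<^bsub>M\<^esub> \<zero>\<^bsub>M\<^esub> = \<zero>\<^bsub>M\<^esub>"
  and act_finsum: "s \<in> carrier S \<Longrightarrow> finite A \<Longrightarrow> g \<in> A \<rightarrow> carrier M \<Longrightarrow>
    s \<odot>\<^bsub>M\<^esub> finsum M g A = finsum M (\<lambda>i. s \<odot>\<^bsub>M\<^esub> g i) A"
proof -
  assume s: "s \<in> carrier S"
  \<comment> \<open>Acting by \<open>s\<close> is additive, but over a noncommutative ring it need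
    not be linear. Scalars with empty carrier make the homogeneity clause of \<open>lin_maps\<close>
    vacuous, so the additive facts on linear maps apply.\<close>
  have l: "(\<lambda>x. s \<odot>\<^bsub>M\<^esub> x) \<in> lin_maps \<lparr>carrier = {}, mult = undefined, one = undefined, zero = undefined, add = undefined\<rparr> M M"
    using s by (auto intro!: lin_mapsI simp: act_closed act_r_distr)
  note G = M.abelian_group_axioms
  show "s \<odot>\<^bsub>M\<^esub> \<zero>\<^bsub>M\<^esub> = \<zero>\<^bsub>M\<^esub>" by (rule lin_zero[OF l G G])
  show "x \<in> carrier M \<Longrightarrow> s \<odot>\<^bsub>M\<^esub> (\<ominus>\<^bsub>M\<^esub> x) = \<ominus>\<^bsub>M\<^esub> (s \<odot>\<^bsub>M\<^esub> x)" by (rule lin_uminus[OF l G G])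
  show "finite A \<Longrightarrow> g \<in> A \<rightarrow> carrier M \<Longrightarrow>
    s \<odot>\<^bsub>M\<^esub> finsum M g A = finsum M (\<lambda>i. s \<odot>\<^bsub>M\<^esub> g i) A"
    by (rule lin_finsum[OF l G G])
qed

end

lemma left_moduleI:
  assumes "ring S" "abelian_group M"
    and "\<And>s x. \<lbrakk>s \<in> carrier S; x \<in> carrier M\<rbrakk> \<Longrightarrow> s \<odot>\<^bsub>M\<^esub> x \<in> carrier M"
    and "\<And>s s' x. \<lbrakk>s \<in> carrier S; s' \<in> carrier S; x \<in> carrier M\<rbrakk>
      \<Longrightarrow> (s \<oplus>\<^bsub>S\<^esub> s') \<odot>\<^bsub>M\<^esub> x = (s \<odot>\<^bsub>M\<^esub> x) \<oplus>\<^bsub>M\<^esub> (s' \<odot>\<^bsub>M\<^esub> x)"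
    and "\<And>s x y. \<lbrakk>s \<in> carrier S; x \<in> carrier M; y \<in> carrier M\<rbrakk>
      \<Longrightarrow> s \<odot>\<^bsub>M\<^esub> (x \<oplus>\<^bsub>M\<^esub> y) = (s \<odot>\<^bsub>M\<^esub> x) \<oplus>\<^bsub>M\<^esub> (s \<odot>\<^bsub>M\<^esub> y)"
    and "\<And>s s' x. \<lbrakk>s \<in> carrier S; s' \<in> carrier S; x \<in> carrier M\<rbrakk>
      \<Longrightarrow> (s \<otimes>\<^bsub>S\<^esub> s') \<odot>\<^bsub>M\<^esub> x = s \<odot>\<^bsub>M\<^esub> (s' \<odot>\<^bsub>M\<^esub> x)"
    and "\<And>x. x \<in> carrier M \<Longrightarrow> \<one>\<^bsub>S\<^esub> \<odot>\<^bsub>M\<^esub> x = x"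
  shows "left_module S M"
  using assms by (auto simp: left_module_def left_module_axioms_def)

lemma module_iff_left_module: "module K V \<longleftrightarrow> cring K \<and> left_module K V"
  by (auto simp: module_def module_axioms_def left_module_def left_module_axioms_def cring.axioms)

lemma module_left_module: "module K V \<Longrightarrow> left_module K V"
  by (simp add: module_iff_left_module)

lemma module_abelian_group: "module K V \<Longrightarrow> abelian_group V"
  by (simp add: module_def)

lemma lin_zero_fun:
  assumes "left_module S W"
  shows "(\<lambda>x. \<zero>\<^bsub>W\<^esub>) \<in> lin_maps S V W"
proof -
  interpret W: left_module S W by fact
  show ?thesis by (rule lin_mapsI) (auto simp: W.act_zero_r)
qed

lemma lin_add_fun:
  assumes "left_module S W" and f: "f \<in> lin_maps S V W" and g: "g \<in> lin_maps S V W"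
  shows "(\<lambda>x. f x \<oplus>\<^bsub>W\<^esub> g x) \<in> lin_maps S V W"
proof -
  interpret W: left_module S W by fact
  show ?thesis
  proof (rule lin_mapsI)
    fix x y assume xy: "x \<in> carrier V" "y \<in> carrier V"
    have "f x \<in> carrier W" "f y \<in> carrier W" "g x \<in> carrier W" "g y \<in> carrier W"
      using xy f g by (auto intro: lin_closed)
    then show "f (x \<oplus>\<^bsub>V\<^esub> y) \<oplus>\<^bsub>W\<^esub> g (x \<oplus>\<^bsub>V\<^esub> y) = f x \<oplus>\<^bsub>W\<^esub> g x \<oplus>\<^bsub>W\<^esub> (f y \<oplus>\<^bsub>W\<^esub> g y)"
      unfolding lin_add[OF f xy] lin_add[OF g xy] by algebra
  qed (auto simp: lin_closed[OF f] lin_closed[OF g] lin_smult[OF f] lin_smult[OF g] W.act_r_distr)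
qed

lemma lin_uminus_fun:
  assumes "left_module S W" and f: "f \<in> lin_maps S V W"
  shows "(\<lambda>x. \<ominus>\<^bsub>W\<^esub> f x) \<in> lin_maps S V W"
proof -
  interpret W: left_module S W by fact
  show ?thesis
    by (rule lin_mapsI)
      (auto simp: lin_closed[OF f] lin_smult[OF f] lin_add[OF f] W.act_neg W.minus_add)
qed

lemma lin_minus_fun:
  assumes "left_module S W" and "f \<in> lin_maps S V W" and "g \<in> lin_maps S V W"
  shows "(\<lambda>x. f x \<ominus>\<^bsub>W\<^esub> g x) \<in> lin_maps S V W"
  unfolding a_minus_def by (intro lin_add_fun lin_uminus_fun assms)

lemma lin_finsum_fun:
  assumes "left_module S W" and "finite A" and "\<And>i. i \<in> A \<Longrightarrow> f i \<in> lin_maps S V W"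
  shows "(\<lambda>x. finsum W (\<lambda>i. f i x) A) \<in> lin_maps S V W"
proof -
  interpret W: left_module S W by fact
  have c: "\<And>i x. i \<in> A \<Longrightarrow> x \<in> carrier V \<Longrightarrow> f i x \<in> carrier W" using assms(3) lin_closed by metis
  show ?thesis
  proof (rule lin_mapsI)
    fix x y assume xy: "x \<in> carrier V" "y \<in> carrier V"
    have "finsum W (\<lambda>i. f i (x \<oplus>\<^bsub>V\<^esub> y)) A = finsum W (\<lambda>i. f i x \<oplus>\<^bsub>W\<^esub> f i y) A"
      using c xy by (intro W.finsum_cong') (auto simp: lin_add[OF assms(3)])
    also have "\<dots> = finsum W (\<lambda>i. f i x) A \<oplus>\<^bsub>W\<^esub> finsum W (\<lambda>i. f i y) A"
      using c xy by (intro W.finsum_addf) auto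
    finally show "finsum W (\<lambda>i. f i (x \<oplus>\<^bsub>V\<^esub> y)) A = finsum W (\<lambda>i. f i x) A \<oplus>\<^bsub>W\<^esub> finsum W (\<lambda>i. f i y) A" .
  next
    fix s x assume sx: "s \<in> carrier S" "x \<in> carrier V"
    have "finsum W (\<lambda>i. f i (s \<odot>\<^bsub>V\<^esub> x)) A = finsum W (\<lambda>i. s \<odot>\<^bsub>W\<^esub> f i x) A"
      using c sx by (intro W.finsum_cong') (auto simp: lin_smult[OF assms(3)] W.act_closed)
    then show "finsum W (\<lambda>i. f i (s \<odot>\<^bsub>V\<^esub> x)) A = s \<odot>\<^bsub>W\<^esub> finsum W (\<lambda>i. f i x) A"
      using c sx assms(2) by (simp add: W.act_finsum Pi_def)
  qed (use c in \<open>auto intro!: W.finsum_closed\<close>)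
qed

lemma lin_smult_fun:
  assumes "module K W" and f: "f \<in> lin_maps K V W" and c: "c \<in> carrier K"
  shows "(\<lambda>x. c \<odot>\<^bsub>W\<^esub> f x) \<in> lin_maps K V W"
proof -
  interpret W: module K W by fact
  show ?thesis
    by (rule lin_mapsI) (use c in \<open>auto simp: lin_closed[OF f] lin_smult[OF f] lin_add[OF f] W.smult_r_distr
      W.smult_assoc1[symmetric] W.R.m_comm\<close>)
qed

section \<open>Free modules and presentations\<close>

text \<open>The sum inside \<open>lift\<close> at a fixed representative. Linearity is shown here
  for arbitrary rings, before passing to quotients; the same extension defines maps out of free
  modules over the enveloping algebra.\<close>

definition lext where
  "lext S V \<phi> f = finsum V (\<lambda>x. f x \<odot>\<^bsub>V\<^esub> \<phi> x) {x. f x \<noteq> \<zero>\<^bsub>S\<^esub>}"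

lemma free_mod_left_module:
  assumes "ring S" shows "left_module S (free_mod S X)"
proof -
  interpret S: ring S by fact
  have *: "finite {x. f x \<oplus>\<^bsub>S\<^esub> g x \<noteq> \<zero>\<^bsub>S\<^esub>}" if "finite {x. f x \<noteq> \<zero>\<^bsub>S\<^esub>}" "finite {x. g x \<noteq> \<zero>\<^bsub>S\<^esub>}" for f g :: "_ \<Rightarrow> 'a"
    by (rule finite_subset[OF _ finite_UnI[OF that]]) auto
  have **: "finite {x. s \<otimes>\<^bsub>S\<^esub> g x \<noteq> \<zero>\<^bsub>S\<^esub>}" if "finite {x. g x \<noteq> \<zero>\<^bsub>S\<^esub>}" "s \<in> carrier S" for s and g :: "_ \<Rightarrow> 'a"
    by (rule finite_subset[OF _ that(1)]) (use that in auto)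
  have ***: "finite {x. \<ominus>\<^bsub>S\<^esub> g x \<noteq> \<zero>\<^bsub>S\<^esub>}" if "finite {x. g x \<noteq> \<zero>\<^bsub>S\<^esub>}" "\<forall>x. g x \<in> carrier S" for g :: "_ \<Rightarrow> 'a"
    by (rule finite_subset[OF _ that(1)]) (use that in auto)
  have "abelian_group (free_mod S X)"
  proof (rule abelian_groupI)
    fix x assume "x \<in> carrier (free_mod S X)"
    then show "\<exists>y\<in>carrier (free_mod S X). y \<oplus>\<^bsub>free_mod S X\<^esub> x = \<zero>\<^bsub>free_mod S X\<^esub>"
      by (intro bexI[of _ "\<lambda>i. \<ominus>\<^bsub>S\<^esub> x i"]) (auto simp: free_mod_def *** S.l_neg)
  qed (auto simp: free_mod_def * S.a_ac fun_eq_iff)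
  then show ?thesis
    using assms by (intro left_moduleI) (auto simp: free_mod_def ** S.l_distr S.r_distr S.m_assoc)
qed

lemma free_mod_module:
  assumes "cring K" shows "module K (free_mod K X)"
  using assms free_mod_left_module[of K X] by (simp add: module_iff_left_module cring.axioms)

lemma free_gen_closed: "ring S \<Longrightarrow> x \<in> X \<Longrightarrow> free_gen S x \<in> carrier (free_mod S X)"
  by (auto simp: free_mod_def free_gen_def ring.ring_simprules intro: finite_subset[of _ "{x}"])

text \<open>The support changes under sums and multiples, so additivity needs all sums taken over
  one common finite set; the extra terms have coefficient zero.\<close>

lemma lext_eq:
  assumes M: "left_module S M" and f: "f \<in> carrier (free_mod S X)" and \<phi>: "\<phi> \<in> X \<rightarrow> carrier M"
    and A: "finite A" "{x. f x \<noteq> \<zero>\<^bsub>S\<^esub>} \<subseteq> A" "A \<subseteq> X"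
  shows "lext S M \<phi> f = finsum M (\<lambda>x. f x \<odot>\<^bsub>M\<^esub> \<phi> x) A"
proof -
  interpret M: left_module S M by fact
  show ?thesis unfolding lext_def
    by (rule M.add.finprod_mono_neutral_cong_left)
      (use A f \<phi> in \<open>auto simp: free_mod_def M.act_zero_l Pi_def subset_eq intro!: M.act_closed\<close>)
qed

lemma free_mod_supp:
  assumes "f \<in> carrier (free_mod S X)"
  shows "finite {x. f x \<noteq> \<zero>\<^bsub>S\<^esub>}" "{x. f x \<noteq> \<zero>\<^bsub>S\<^esub>} \<subseteq> X" "\<And>x. f x \<in> carrier S"
  using assms by (auto simp: free_mod_def)

lemma lext_lin:
  assumes M: "left_module S M" and \<phi>: "\<phi> \<in> X \<rightarrow> carrier M"
  shows "lext S M \<phi> \<in> lin_maps S (free_mod S X) M"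
proof (rule lin_mapsI)
  interpret M: left_module S M by fact
  let ?F = "free_mod S X"
  interpret F: left_module S ?F by (rule free_mod_left_module) (rule M.S.ring_axioms)
  have \<phi>': "\<phi> x \<in> carrier M" if "x \<in> X" for x using \<phi> that by auto
  { fix f assume f: "f \<in> carrier ?F"
    show "lext S M \<phi> f \<in> carrier M"
      unfolding lext_def using free_mod_supp[OF f] \<phi>'
      by (intro M.finsum_closed) (auto intro!: M.act_closed) }
  { fix f g assume fg: "f \<in> carrier ?F" "g \<in> carrier ?F"
    note ff = free_mod_supp[OF fg(1)] and gg = free_mod_supp[OF fg(2)]
    let ?A = "{x. f x \<noteq> \<zero>\<^bsub>S\<^esub>} \<union> {x. g x \<noteq> \<zero>\<^bsub>S\<^esub>}"
    have A: "finite ?A" "?A \<subseteq> X" using ff gg by auto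
    have "lext S M \<phi> (f \<oplus>\<^bsub>?F\<^esub> g) = finsum M (\<lambda>x. (f \<oplus>\<^bsub>?F\<^esub> g) x \<odot>\<^bsub>M\<^esub> \<phi> x) ?A"
      by (rule lext_eq[OF M F.a_closed[OF fg] \<phi> A(1) _ A(2)]) (auto simp: free_mod_def)
    also have "\<dots> = finsum M (\<lambda>x. f x \<odot>\<^bsub>M\<^esub> \<phi> x \<oplus>\<^bsub>M\<^esub> g x \<odot>\<^bsub>M\<^esub> \<phi> x) ?A"
      by (intro M.finsum_cong') (use A ff gg \<phi>' in \<open>auto simp: free_mod_def M.act_l_distr subset_eq intro!: M.a_closed M.act_closed\<close>)
    also have "\<dots> = finsum M (\<lambda>x. f x \<odot>\<^bsub>M\<^esub> \<phi> x) ?A \<oplus>\<^bsub>M\<^esub> finsum M (\<lambda>x. g x \<odot>\<^bsub>M\<^esub> \<phi> x) ?A"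
      by (intro M.finsum_addf) (use A ff gg \<phi>' in \<open>auto intro!: M.act_closed\<close>)
    also have "finsum M (\<lambda>x. f x \<odot>\<^bsub>M\<^esub> \<phi> x) ?A = lext S M \<phi> f"
      by (rule lext_eq[OF M fg(1) \<phi> A(1) _ A(2), symmetric]) auto
    also have "finsum M (\<lambda>x. g x \<odot>\<^bsub>M\<^esub> \<phi> x) ?A = lext S M \<phi> g"
      by (rule lext_eq[OF M fg(2) \<phi> A(1) _ A(2), symmetric]) auto
    finally show "lext S M \<phi> (f \<oplus>\<^bsub>?F\<^esub> g) = lext S M \<phi> f \<oplus>\<^bsub>M\<^esub> lext S M \<phi> g" . }
  { fix s f assume s: "s \<in> carrier S" and f: "f \<in> carrier ?F"
    note ff = free_mod_supp[OF f]
    let ?A = "{x. f x \<noteq> \<zero>\<^bsub>S\<^esub>}"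
    have "lext S M \<phi> (s \<odot>\<^bsub>?F\<^esub> f) = finsum M (\<lambda>x. (s \<odot>\<^bsub>?F\<^esub> f) x \<odot>\<^bsub>M\<^esub> \<phi> x) ?A"
      by (rule lext_eq[OF M F.act_closed[OF s f] \<phi> ff(1) _ ff(2)]) (use s in \<open>auto simp: free_mod_def\<close>)
    also have "\<dots> = finsum M (\<lambda>x. s \<odot>\<^bsub>M\<^esub> (f x \<odot>\<^bsub>M\<^esub> \<phi> x)) ?A"
      by (intro M.finsum_cong') (use ff \<phi>' s in \<open>auto simp: free_mod_def M.act_assoc subset_eq intro!: M.act_closed\<close>)
    also have "\<dots> = s \<odot>\<^bsub>M\<^esub> lext S M \<phi> f" unfolding lext_def
      by (intro M.act_finsum[symmetric]) (use ff \<phi>' s in \<open>auto intro!: M.act_closed\<close>)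
    finally show "lext S M \<phi> (s \<odot>\<^bsub>?F\<^esub> f) = s \<odot>\<^bsub>M\<^esub> lext S M \<phi> f" . }
qed

lemma lext_gen:
  assumes M: "left_module S M" and \<phi>: "\<phi> \<in> X \<rightarrow> carrier M" and x: "x \<in> X"
  shows "lext S M \<phi> (free_gen S x) = \<phi> x"
proof -
  interpret M: left_module S M by fact
  have "lext S M \<phi> (free_gen S x) = finsum M (\<lambda>y. free_gen S x y \<odot>\<^bsub>M\<^esub> \<phi> y) {x}"
    by (rule lext_eq[OF M free_gen_closed[OF M.S.ring_axioms x] \<phi>]) (use x in \<open>auto simp: free_gen_def\<close>)
  also have "\<dots> = \<phi> x" using funcset_mem[OF \<phi> x]
    by (subst M.finsum_insert) (auto simp: free_gen_def M.act_one)
  finally show ?thesis .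
qed

text \<open>Induction on the support: resetting one value to zero removes one point, and what was
  removed is a multiple of a generator.\<close>

lemma free_mod_induct [consumes 2, case_names zero add gen]:
  assumes S: "ring S" and f: "f \<in> carrier (free_mod S X)"
    and P0: "P \<zero>\<^bsub>free_mod S X\<^esub>"
    and Padd: "\<And>f g. \<lbrakk>f \<in> carrier (free_mod S X); g \<in> carrier (free_mod S X); P f; P g\<rbrakk> \<Longrightarrow> P (f \<oplus>\<^bsub>free_mod S X\<^esub> g)"
    and Pgen: "\<And>s x. \<lbrakk>s \<in> carrier S; x \<in> X\<rbrakk> \<Longrightarrow> P (s \<odot>\<^bsub>free_mod S X\<^esub> free_gen S x)"
  shows "P f"
proof -
  interpret S: ring S by fact
  let ?F = "free_mod S X"
  interpret F: left_module S ?F by (rule free_mod_left_module) fact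
  have "\<forall>f. f \<in> carrier ?F \<longrightarrow> {x. f x \<noteq> \<zero>\<^bsub>S\<^esub>} = A \<longrightarrow> P f" if "finite A" for A
    using that
  proof (induction A)
    case empty
    have "f = \<zero>\<^bsub>?F\<^esub>" if "{x. f x \<noteq> \<zero>\<^bsub>S\<^esub>} = {}" for f :: "'c \<Rightarrow> 'a" using that by (auto simp: free_mod_def)
    then show ?case using P0 by auto
  next
    case (insert a A)
    show ?case
    proof (intro allI impI)
      fix f assume f: "f \<in> carrier ?F" "{x. f x \<noteq> \<zero>\<^bsub>S\<^esub>} = insert a A"
      have aX: "a \<in> X" and fa: "f a \<in> carrier S" using f by (auto simp: free_mod_def)
      let ?g = "f(a := \<zero>\<^bsub>S\<^esub>)"
      have sg: "{x. ?g x \<noteq> \<zero>\<^bsub>S\<^esub>} = A" using f(2) insert by auto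
      then have g: "?g \<in> carrier ?F" using f insert(1) by (auto simp: free_mod_def simp del: fun_upd_apply) (auto)
      have "f = ?g \<oplus>\<^bsub>?F\<^esub> f a \<odot>\<^bsub>?F\<^esub> free_gen S a"
        using f(1) by (auto simp: free_mod_def free_gen_def fun_eq_iff)
      moreover have "P ?g" using insert.IH g sg by blast
      ultimately show "P f"
        using Padd[OF g F.act_closed[OF fa free_gen_closed[OF S aX]]] Pgen[OF fa aX] by simp
    qed
  qed
  then show ?thesis using free_mod_supp(1)[OF f] f by blast
qed

section \<open>Submodules and quotient spaces\<close>

locale kmod = module R M for R :: "('k, 'm) ring_scheme" (structure) and M :: "('k, 'v) module" (structure)

lemma (in kmod) span_submodule:
  assumes "X \<subseteq> carrier M" shows "submodule (lin_span R M X) R M"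
proof -
  have 1: "submodule (carrier M) R M" by (rule carrier_is_submodule)
  have 2: "lin_span R M X \<subseteq> carrier M" using 1 assms by (auto simp: lin_span_def)
  show ?thesis
    by (rule submoduleI[OF 2])
      (auto simp: lin_span_def submoduleE dest: submodule.axioms(1) intro: subgroup.one_closed[where G="add_monoid M", simplified])
qed

lemma span_superset: "X \<subseteq> lin_span K V X"
  by (auto simp: lin_span_def)

text \<open>The kernel of \<open>f\<close> is a submodule containing \<open>X\<close>, hence one of
  the sets intersected in \<open>lin_span\<close>.\<close>

lemma span_kernel:
  assumes "module K V" "module K W" and f: "f \<in> lin_maps K V W" and X: "X \<subseteq> carrier V"
    and f0: "\<And>x. x \<in> X \<Longrightarrow> f x = \<zero>\<^bsub>W\<^esub>" and u: "u \<in> lin_span K V X"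
  shows "f u = \<zero>\<^bsub>W\<^esub>"
proof -
  interpret V: module K V by fact
  interpret W: module K W by fact
  note G = V.M.abelian_group_axioms W.M.abelian_group_axioms
  have "submodule {v \<in> carrier V. f v = \<zero>\<^bsub>W\<^esub>} K V"
    by (rule V.submoduleI) (auto simp: lin_add[OF f] lin_smult[OF f] lin_zero[OF f G] lin_uminus[OF f G])
  then show ?thesis using X f0 u unfolding lin_span_def by blast
qed

lemma (in kmod) submodule_abelian_subgroup:
  "submodule W R M \<Longrightarrow> abelian_subgroup W M"
  by (rule abelian_subgroupI3)
    (auto simp: additive_subgroup_def submodule_def abelian_group_axioms)

lemma (in kmod) coset_eq_iff:
  assumes W: "submodule W R M" and "x \<in> carrier M" "y \<in> carrier M"
  shows "W +>\<^bsub>M\<^esub> x = W +>\<^bsub>M\<^esub> y \<longleftrightarrow> x \<ominus>\<^bsub>M\<^esub> y \<in> W"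
proof -
  interpret W: abelian_subgroup W M by (rule submodule_abelian_subgroup) fact
  have "W +>\<^bsub>M\<^esub> x = W +>\<^bsub>M\<^esub> y \<longleftrightarrow> x \<in> W +>\<^bsub>M\<^esub> y"
    using W.a_repr_independence'[of x y] W.a_rcos_self[of x] assms(2,3) by metis
  then show ?thesis
    using W.a_rcos_module[of y x] assms(2,3) by (simp add: a_minus_def)
qed

lemma (in kmod) quot_carrier: "carrier (quot_mod M W) = (\<lambda>x. W +>\<^bsub>M\<^esub> x) ` carrier M"
  by (auto simp: quot_mod_def A_RCOSETS_def RCOSETS_def a_r_coset_def)

lemma (in kmod) quot_add:
  assumes W: "submodule W R M" and "x \<in> carrier M" "y \<in> carrier M"
  shows "(W +>\<^bsub>M\<^esub> x) \<oplus>\<^bsub>quot_mod M W\<^esub> (W +>\<^bsub>M\<^esub> y) = W +>\<^bsub>M\<^esub> (x \<oplus>\<^bsub>M\<^esub> y)"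
proof -
  interpret W: abelian_subgroup W M by (rule submodule_abelian_subgroup) fact
  show ?thesis using assms by (simp add: quot_mod_def W.a_rcos_sum)
qed

text \<open>In \<open>quot_mod\<close> the scalar action is a union over all representatives of the
  coset; it has to be seen that every term is the same coset and that the union is not
  empty.\<close>

lemma (in kmod) quot_smult:
  assumes W: "submodule W R M" and c: "c \<in> carrier R" and x: "x \<in> carrier M"
  shows "c \<odot>\<^bsub>quot_mod M W\<^esub> (W +>\<^bsub>M\<^esub> x) = W +>\<^bsub>M\<^esub> (c \<odot>\<^bsub>M\<^esub> x)"
proof -
  interpret W: abelian_subgroup W M by (rule submodule_abelian_subgroup) fact
  have "W +>\<^bsub>M\<^esub> (c \<odot>\<^bsub>M\<^esub> y) = W +>\<^bsub>M\<^esub> (c \<odot>\<^bsub>M\<^esub> x)" if y: "y \<in> W +>\<^bsub>M\<^esub> x" for y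
  proof -
    have yc: "y \<in> carrier M" using y x W.a_elemrcos_carrier by blast
    have yx: "W +>\<^bsub>M\<^esub> y = W +>\<^bsub>M\<^esub> x" using y x W.a_repr_independence' by metis
    then have "y \<ominus>\<^bsub>M\<^esub> x \<in> W" using coset_eq_iff[OF W] yc x by blast
    then have "c \<odot>\<^bsub>M\<^esub> (y \<ominus>\<^bsub>M\<^esub> x) \<in> W" using submodule.smult_closed[OF W] c by blast
    then have "c \<odot>\<^bsub>M\<^esub> y \<ominus>\<^bsub>M\<^esub> c \<odot>\<^bsub>M\<^esub> x \<in> W"
      using yc x c by (simp add: a_minus_def smult_r_distr smult_r_minus)
    then show ?thesis using coset_eq_iff[OF W] yc x c by simp
  qed
  then have "(\<Union>y\<in>W +>\<^bsub>M\<^esub> x. W +>\<^bsub>M\<^esub> (c \<odot>\<^bsub>M\<^esub> y)) = (\<Union>y\<in>W +>\<^bsub>M\<^esub> x. W +>\<^bsub>M\<^esub> (c \<odot>\<^bsub>M\<^esub> x))"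
    by (intro SUP_cong refl)
  also have "\<dots> = W +>\<^bsub>M\<^esub> (c \<odot>\<^bsub>M\<^esub> x)" using W.a_rcos_self[OF x] by (intro SUP_const) auto
  finally show ?thesis by (simp add: quot_mod_def)
qed

lemma (in kmod) quot_module:
  assumes W: "submodule W R M" shows "module R (quot_mod M W)"
proof (rule moduleI)
  interpret W: abelian_subgroup W M by (rule submodule_abelian_subgroup) fact
  have z: "\<zero>\<^bsub>quot_mod M W\<^esub> = W +>\<^bsub>M\<^esub> \<zero>\<^bsub>M\<^esub>"
    using W.a_subset by (simp add: quot_mod_def)
  note s = quot_carrier z quot_add[OF W] quot_smult[OF W]
  show "abelian_group (quot_mod M W)"
  proof (rule abelian_groupI)
    fix x assume "x \<in> carrier (quot_mod M W)"
    then obtain u where u: "u \<in> carrier M" "x = W +>\<^bsub>M\<^esub> u" by (auto simp: s)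
    then show "\<exists>y\<in>carrier (quot_mod M W). y \<oplus>\<^bsub>quot_mod M W\<^esub> x = \<zero>\<^bsub>quot_mod M W\<^esub>"
      by (intro bexI[of _ "W +>\<^bsub>M\<^esub> (\<ominus>\<^bsub>M\<^esub> u)"]) (auto simp: s l_neg)
  qed (auto simp: s M.a_ac)
qed (auto simp: quot_carrier quot_add[OF W] quot_smult[OF W] smult_l_distr smult_r_distr smult_assoc1 R.is_cring)

lemma (in kmod) quot_zero:
  assumes W: "submodule W R M" and "x \<in> carrier M"
  shows "W +>\<^bsub>M\<^esub> x = \<zero>\<^bsub>quot_mod M W\<^esub> \<longleftrightarrow> x \<in> W"
proof -
  interpret W: abelian_subgroup W M by (rule submodule_abelian_subgroup) fact
  have z: "\<zero>\<^bsub>quot_mod M W\<^esub> = W +>\<^bsub>M\<^esub> \<zero>\<^bsub>M\<^esub>"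
    using W.a_subset by (simp add: quot_mod_def)
  have "x \<ominus>\<^bsub>M\<^esub> \<zero>\<^bsub>M\<^esub> = x" using assms(2) by (simp add: a_minus_def)
  then show ?thesis using coset_eq_iff[OF W, of x "\<zero>\<^bsub>M\<^esub>"] z assms by simp
qed

lemma (in kmod) quot_lin:
  assumes W: "submodule W R M" shows "(\<lambda>x. W +>\<^bsub>M\<^esub> x) \<in> lin_maps R M (quot_mod M W)"
  by (rule lin_mapsI) (auto simp: quot_carrier quot_add[OF W] quot_smult[OF W])

lemma (in kmod) quot_rep:
  assumes W: "submodule W R M" and X: "X \<in> carrier (quot_mod M W)" and y: "y \<in> X"
  shows "y \<in> carrier M" "X = W +>\<^bsub>M\<^esub> y"
proof -
  interpret W: abelian_subgroup W M by (rule submodule_abelian_subgroup) fact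
  obtain x where x: "x \<in> carrier M" "X = W +>\<^bsub>M\<^esub> x" using X by (auto simp: quot_carrier)
  show "y \<in> carrier M" using x y W.a_elemrcos_carrier by blast
  show "X = W +>\<^bsub>M\<^esub> y" using x y W.a_repr_independence' by metis
qed

lemma (in kmod) quot_self:
  assumes W: "submodule W R M" and "x \<in> carrier M"
  shows "x \<in> W +>\<^bsub>M\<^esub> x"
proof -
  interpret W: abelian_subgroup W M by (rule submodule_abelian_subgroup) fact
  show ?thesis using assms W.a_rcos_self by blast
qed

section \<open>Spaces given by generators and relations\<close>

locale presentation =
  fixes K :: "('k, 'm) ring_scheme" and X :: "'x set" and L :: "('x \<Rightarrow> 'k) set"
  assumes cring: "cring K" and L: "L \<subseteq> carrier (free_mod K X)"
begin

sublocale F: kmod K "free_mod K X" by (rule kmod.intro, rule free_mod_module) (rule cring)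

lemma span_sub: "submodule (lin_span K (free_mod K X) L) K (free_mod K X)"
  by (rule F.span_submodule[OF L])

lemma presented_module: "module K (presented K X L)"
  unfolding presented_def by (rule F.quot_module[OF span_sub])

lemma gen_class_closed: "x \<in> X \<Longrightarrow> gen_class K X L x \<in> carrier (presented K X L)"
  unfolding presented_def gen_class_def F.quot_carrier
  by (rule imageI) (rule free_gen_closed[OF F.R.ring_axioms])

lemma presented_induct [consumes 1, case_names zero add gen]:
  assumes u: "u \<in> carrier (presented K X L)"
    and P0: "P \<zero>\<^bsub>presented K X L\<^esub>"
    and Padd: "\<And>u v. \<lbrakk>u \<in> carrier (presented K X L); v \<in> carrier (presented K X L); P u; P v\<rbrakk> \<Longrightarrow> P (u \<oplus>\<^bsub>presented K X L\<^esub> v)"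
    and Pgen: "\<And>c x. \<lbrakk>c \<in> carrier K; x \<in> X\<rbrakk> \<Longrightarrow> P (c \<odot>\<^bsub>presented K X L\<^esub> gen_class K X L x)"
  shows "P u"
proof -
  let ?q = "\<lambda>f. lin_span K (free_mod K X) L +>\<^bsub>free_mod K X\<^esub> f"
  have q: "?q \<in> lin_maps K (free_mod K X) (presented K X L)"
    unfolding presented_def by (rule F.quot_lin[OF span_sub])
  interpret P: module K "presented K X L" by (rule presented_module)
  obtain f where f: "f \<in> carrier (free_mod K X)" "u = ?q f"
    using u unfolding presented_def F.quot_carrier by blast
  have "P (?q f)" using F.R.ring_axioms f(1)
  proof (induction f rule: free_mod_induct)
    case zero
    then show ?case using P0 lin_zero[OF q F.M.abelian_group_axioms P.M.abelian_group_axioms] by simp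
  next
    case (add f g)
    then show ?case using Padd lin_add[OF q] lin_closed[OF q] by simp
  next
    case (gen s x)
    then show ?case using Pgen[of s x] lin_smult[OF q, of s "free_gen K x"] free_gen_closed[OF F.R.ring_axioms, of x X]
      by (simp add: gen_class_def)
  qed
  then show ?thesis using f by simp
qed

text \<open>The representative chosen by \<open>SOME\<close> differs from \<open>f\<close> by an
  element of the span of the relations, where the linear extension vanishes. So the choice inside
  \<open>lift\<close> is harmless once \<open>\<phi>\<close> respects the relations.\<close>

lemma lift_coset:
  assumes V: "module K V" and \<phi>: "\<phi> \<in> X \<rightarrow> carrier V" and L0: "\<And>l. l \<in> L \<Longrightarrow> lext K V \<phi> l = \<zero>\<^bsub>V\<^esub>"
    and f: "f \<in> carrier (free_mod K X)"
  shows "lift K V \<phi> (lin_span K (free_mod K X) L +>\<^bsub>free_mod K X\<^esub> f) = lext K V \<phi> f"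
proof -
  let ?u = "lin_span K (free_mod K X) L +>\<^bsub>free_mod K X\<^esub> f"
  interpret V: module K V by fact
  note lin = lext_lin[OF module_left_module[OF V] \<phi>]
  define g where "g = (SOME g. g \<in> ?u)"
  have "g \<in> ?u" unfolding g_def by (rule someI[where P="\<lambda>g. g \<in> ?u", OF F.quot_self[OF span_sub f]])
  moreover have "?u \<in> carrier (quot_mod (free_mod K X) (lin_span K (free_mod K X) L))"
    using f by (auto simp: F.quot_carrier)
  ultimately have g: "g \<in> carrier (free_mod K X)" and eq: "?u = lin_span K (free_mod K X) L +>\<^bsub>free_mod K X\<^esub> g"
    using F.quot_rep[OF span_sub] by blast+
  then have "g \<ominus>\<^bsub>free_mod K X\<^esub> f \<in> lin_span K (free_mod K X) L"
    using F.coset_eq_iff[OF span_sub g f] by simp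
  then have "lext K V \<phi> (g \<ominus>\<^bsub>free_mod K X\<^esub> f) = \<zero>\<^bsub>V\<^esub>"
    using span_kernel[OF F.module_axioms V lin L L0] by blast
  then have "lext K V \<phi> g = lext K V \<phi> f"
    using g f lin_minus[OF lin F.M.abelian_group_axioms V.M.abelian_group_axioms g f]
     V.minus_eq_zero_iff lin_closed[OF lin] by metis
  then show ?thesis by (simp add: lift_def g_def lext_def)
qed

lemma lift_lin:
  assumes V: "module K V" and \<phi>: "\<phi> \<in> X \<rightarrow> carrier V" and L0: "\<And>l. l \<in> L \<Longrightarrow> lext K V \<phi> l = \<zero>\<^bsub>V\<^esub>"
  shows "lift K V \<phi> \<in> lin_maps K (presented K X L) V"
proof (rule lin_mapsI)
  interpret V: module K V by fact
  note lin = lext_lin[OF module_left_module[OF V] \<phi>]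
  note c = lift_coset[OF V \<phi> L0]
  note s = presented_def F.quot_carrier
  show "lift K V \<phi> u \<in> carrier V" if "u \<in> carrier (presented K X L)" for u
    using that by (auto simp: s c lin_closed[OF lin])
  show "lift K V \<phi> (u \<oplus>\<^bsub>presented K X L\<^esub> v) = lift K V \<phi> u \<oplus>\<^bsub>V\<^esub> lift K V \<phi> v"
    if "u \<in> carrier (presented K X L)" "v \<in> carrier (presented K X L)" for u v
    using that by (auto simp: s c F.quot_add[OF span_sub] lin_add[OF lin])
  show "lift K V \<phi> (a \<odot>\<^bsub>presented K X L\<^esub> v) = a \<odot>\<^bsub>V\<^esub> lift K V \<phi> v"
    if "a \<in> carrier K" "v \<in> carrier (presented K X L)" for a v
    using that by (auto simp: s c F.quot_smult[OF span_sub] lin_smult[OF lin])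
qed

lemma lift_gen:
  assumes V: "module K V" and \<phi>: "\<phi> \<in> X \<rightarrow> carrier V" and L0: "\<And>l. l \<in> L \<Longrightarrow> lext K V \<phi> l = \<zero>\<^bsub>V\<^esub>"
    and x: "x \<in> X"
  shows "lift K V \<phi> (gen_class K X L x) = \<phi> x"
  using lift_coset[OF V \<phi> _ free_gen_closed[OF F.R.ring_axioms x]] L0
    lext_gen[OF module_left_module[OF V] \<phi> x] by (simp add: gen_class_def)

lemma lin_eq_presented:
  assumes V: "module K V" and f: "f \<in> lin_maps K (presented K X L) V" and g: "g \<in> lin_maps K (presented K X L) V"
    and eq: "\<And>x. x \<in> X \<Longrightarrow> f (gen_class K X L x) = g (gen_class K X L x)"
    and u: "u \<in> carrier (presented K X L)"
  shows "f u = g u"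
proof -
  interpret P: module K "presented K X L" by (rule presented_module)
  interpret V: module K V by fact
  note G = P.M.abelian_group_axioms V.M.abelian_group_axioms
  show ?thesis using u
  proof (induction rule: presented_induct)
    case zero then show ?case by (simp add: lin_zero[OF f G] lin_zero[OF g G])
  next
    case (add u v) then show ?case by (simp add: lin_add[OF f] lin_add[OF g])
  next
    case (gen c x) then show ?case by (simp add: lin_smult[OF f] lin_smult[OF g] gen_class_closed eq)
  qed
qed

lemma gen_class_rel:
  assumes f: "f \<in> carrier (free_mod K X)" and g: "g \<in> carrier (free_mod K X)" and "f \<ominus>\<^bsub>free_mod K X\<^esub> g \<in> L"
  shows "lin_span K (free_mod K X) L +>\<^bsub>free_mod K X\<^esub> f = lin_span K (free_mod K X) L +>\<^bsub>free_mod K X\<^esub> g"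
  using F.coset_eq_iff[OF span_sub f g] subsetD[OF span_superset assms(3)] by simp

end

section \<open>Homology of complexes\<close>

lemma exact_atI:
  assumes "f \<in> lin_maps K U V" "g \<in> lin_maps K V W"
    and a: "\<And>v. v \<in> f ` carrier U \<Longrightarrow> v \<in> {v \<in> carrier V. g v = \<zero>\<^bsub>W\<^esub>}"
    and b: "\<And>v. v \<in> {v \<in> carrier V. g v = \<zero>\<^bsub>W\<^esub>} \<Longrightarrow> v \<in> f ` carrier U"
  shows "exact_at K U f V g W"
proof -
  have "f ` carrier U = {v \<in> carrier V. g v = \<zero>\<^bsub>W\<^esub>}"
    by (rule subset_antisym; rule subsetI) (erule a, erule b)
  then show ?thesis unfolding exact_at_def by (intro conjI assms(1,2))
qed

locale chain_complex =
  fixes K :: "('k, 'm) ring_scheme" and X :: "('k, 'v) graded" and d :: "'v diffs"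
  assumes X_module: "\<And>n. module K (X n)"
    and d_lin: "\<And>n. d n \<in> lin_maps K (X n) (X (n - 1))"
    and dd: "\<And>n x. x \<in> carrier (X n) \<Longrightarrow> d (n - 1) (d n x) = \<zero>\<^bsub>X (n - 1 - 1)\<^esub>"
begin

lemma Xag: "abelian_group (X n)" by (rule module_abelian_group[OF X_module])

lemma d_closed: "x \<in> carrier (X n) \<Longrightarrow> d n x \<in> carrier (X (n - 1))"
  using lin_closed[OF d_lin] .

lemma d_closed': "x \<in> carrier (X (n + 1)) \<Longrightarrow> d (n + 1) x \<in> carrier (X n)"
  using d_closed[of x "n + 1"] by simp

lemma dd': "x \<in> carrier (X (n + 1)) \<Longrightarrow> d n (d (n + 1) x) = \<zero>\<^bsub>X (n - 1)\<^esub>"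
  using dd[of x "n + 1"] by simp

lemma d_add: "x \<in> carrier (X n) \<Longrightarrow> y \<in> carrier (X n) \<Longrightarrow> d n (x \<oplus>\<^bsub>X n\<^esub> y) = d n x \<oplus>\<^bsub>X (n - 1)\<^esub> d n y"
  and d_minus: "x \<in> carrier (X n) \<Longrightarrow> y \<in> carrier (X n) \<Longrightarrow> d n (x \<ominus>\<^bsub>X n\<^esub> y) = d n x \<ominus>\<^bsub>X (n - 1)\<^esub> d n y"
  and d_zero: "d n \<zero>\<^bsub>X n\<^esub> = \<zero>\<^bsub>X (n - 1)\<^esub>"
  and d_smult: "c \<in> carrier K \<Longrightarrow> x \<in> carrier (X n) \<Longrightarrow> d n (c \<odot>\<^bsub>X n\<^esub> x) = c \<odot>\<^bsub>X (n - 1)\<^esub> d n x"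
  and d_uminus: "x \<in> carrier (X n) \<Longrightarrow> d n (\<ominus>\<^bsub>X n\<^esub> x) = \<ominus>\<^bsub>X (n - 1)\<^esub> d n x"
  using lin_add[OF d_lin] lin_minus[OF d_lin Xag Xag] lin_zero[OF d_lin Xag Xag] lin_smult[OF d_lin]
   lin_uminus[OF d_lin Xag Xag]
  by auto

lemma cycles_submodule: "submodule (cycles X d n) K (X n)"
proof -
  interpret M: module K "X n" by (rule X_module)
  interpret N: module K "X (n - 1)" by (rule X_module)
  show ?thesis
    by (rule M.submoduleI) (auto simp: cycles_def d_add d_zero d_smult d_uminus)
qed

abbreviation Z where "Z n \<equiv> (X n)\<lparr>carrier := cycles X d n\<rparr>"

lemma Z_module: "module K (Z n)"
  by (rule submodule.submodule_is_module[OF cycles_submodule X_module])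

lemma Z_kmod: "kmod K (Z n)"
  by (rule kmod.intro) (rule Z_module)

lemma boundaries_cycles: "boundaries X d n \<subseteq> cycles X d n"
  using d_closed' dd' by (auto simp: boundaries_def cycles_def)

lemma boundaries_submodule: "submodule (boundaries X d n) K (Z n)"
proof -
  interpret M: module K "X n" by (rule X_module)
  interpret M': module K "X (n + 1)" by (rule X_module)
  interpret ZZ: module K "Z n" by (rule Z_module)
  \<comment> \<open>The boundaries are first shown to be a submodule of \<open>X n\<close>; the
    ambient module is then cut down to the cycles, in which the quotient is formed.\<close>
  have "module K ((X n)\<lparr>carrier := boundaries X d n\<rparr>)"
  proof (rule submodule.submodule_is_module[OF _ X_module], rule M.submoduleI)
    show "boundaries X d n \<subseteq> carrier (X n)" using boundaries_cycles by (auto simp: cycles_def)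
    show "\<zero>\<^bsub>X n\<^esub> \<in> boundaries X d n"
      unfolding boundaries_def using d_zero[of "n + 1"] by (intro image_eqI[of _ _ "\<zero>\<^bsub>X (n + 1)\<^esub>"]) auto
    show "\<ominus>\<^bsub>X n\<^esub> a \<in> boundaries X d n" if a: "a \<in> boundaries X d n" for a
    proof -
      obtain x where "x \<in> carrier (X (n + 1))" "a = d (n + 1) x" using a by (auto simp: boundaries_def)
      then show ?thesis unfolding boundaries_def using d_uminus[of x "n + 1"]
        by (intro image_eqI[of _ _ "\<ominus>\<^bsub>X (n + 1)\<^esub> x"]) auto
    qed
    show "a \<oplus>\<^bsub>X n\<^esub> b \<in> boundaries X d n" if ab: "a \<in> boundaries X d n" "b \<in> boundaries X d n" for a b
    proof -
      obtain x where x: "x \<in> carrier (X (n + 1))" "a = d (n + 1) x" using ab by (auto simp: boundaries_def)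
      obtain y where y: "y \<in> carrier (X (n + 1))" "b = d (n + 1) y" using ab by (auto simp: boundaries_def)
      show ?thesis unfolding boundaries_def using d_add[of x "n + 1" y] x y
        by (intro image_eqI[of _ _ "x \<oplus>\<^bsub>X (n + 1)\<^esub> y"]) auto
    qed
    show "c \<odot>\<^bsub>X n\<^esub> a \<in> boundaries X d n" if c: "c \<in> carrier K" and a: "a \<in> boundaries X d n" for c a
    proof -
      obtain x where "x \<in> carrier (X (n + 1))" "a = d (n + 1) x" using a by (auto simp: boundaries_def)
      then show ?thesis unfolding boundaries_def using d_smult[of c x "n + 1"] c
        by (intro image_eqI[of _ _ "c \<odot>\<^bsub>X (n + 1)\<^esub> x"]) auto
    qed
  qed
  then show ?thesis using ZZ.module_incl_imp_submodule[of "boundaries X d n"] boundaries_cycles by simp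
qed

lemma homology_module: "module K (homology X d n)"
  unfolding homology_def by (rule kmod.quot_module[OF Z_kmod boundaries_submodule])

lemma homology_abelian_group: "abelian_group (homology X d n)"
  by (rule module_abelian_group[OF homology_module])

lemma hclass_coset: "hclass X d n x = boundaries X d n +>\<^bsub>Z n\<^esub> x"
  by (simp add: hclass_def a_r_coset_def r_coset_def)

lemma hclass_lin: "hclass X d n \<in> lin_maps K (Z n) (homology X d n)"
  using kmod.quot_lin[OF Z_kmod boundaries_submodule] unfolding homology_def hclass_coset[symmetric] .

lemma cycle_closed: "x \<in> cycles X d n \<Longrightarrow> x \<in> carrier (X n)"
  by (simp add: cycles_def)

lemma cycle_minus: assumes "x \<in> cycles X d n" "y \<in> cycles X d n" shows "x \<ominus>\<^bsub>X n\<^esub> y \<in> cycles X d n"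
proof -
  interpret M: module K "X n" by (rule X_module)
  show ?thesis using assms M.submoduleE(3,5)[OF cycles_submodule] by (simp add: a_minus_def)
qed

lemma cycle_add: assumes "x \<in> cycles X d n" "y \<in> cycles X d n" shows "x \<oplus>\<^bsub>X n\<^esub> y \<in> cycles X d n"
proof -
  interpret M: module K "X n" by (rule X_module)
  show ?thesis using assms M.submoduleE(3,5)[OF cycles_submodule] by simp
qed

text \<open>Additive inverses are defined relative to the carrier, so subtraction could a priori
  change on passing to the cycles. Both differences solve u + y = x, which has one solution.\<close>

lemma Z_minus: assumes "x \<in> cycles X d n" "y \<in> cycles X d n" shows "x \<ominus>\<^bsub>Z n\<^esub> y = x \<ominus>\<^bsub>X n\<^esub> y"
proof -
  interpret M: module K "X n" by (rule X_module)
  interpret N: module K "Z n" by (rule Z_module)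
  have "x \<ominus>\<^bsub>Z n\<^esub> y \<in> cycles X d n" using N.M.minus_closed[of x y] assms by simp
  moreover have "(x \<ominus>\<^bsub>Z n\<^esub> y) \<oplus>\<^bsub>X n\<^esub> y = x" using N.M.minus_add_cancel[of x y] assms by simp
  ultimately show ?thesis using assms M.M.minus_add_cancel[of x y] cycle_closed
    by (metis M.add.m_closed M.M.add.right_cancel M.M.minus_closed)
qed

lemma hclass_closed: "x \<in> cycles X d n \<Longrightarrow> hclass X d n x \<in> carrier (homology X d n)"
  using lin_closed[OF hclass_lin] by simp

lemma hclass_add: "x \<in> cycles X d n \<Longrightarrow> y \<in> cycles X d n \<Longrightarrow>
    hclass X d n (x \<oplus>\<^bsub>X n\<^esub> y) = hclass X d n x \<oplus>\<^bsub>homology X d n\<^esub> hclass X d n y"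
  using lin_add[OF hclass_lin] by simp

lemma hclass_smult: "c \<in> carrier K \<Longrightarrow> x \<in> cycles X d n \<Longrightarrow>
    hclass X d n (c \<odot>\<^bsub>X n\<^esub> x) = c \<odot>\<^bsub>homology X d n\<^esub> hclass X d n x"
  using lin_smult[OF hclass_lin] by simp

lemma hclass_eq_iff: "x \<in> cycles X d n \<Longrightarrow> y \<in> cycles X d n \<Longrightarrow>
    hclass X d n x = hclass X d n y \<longleftrightarrow> x \<ominus>\<^bsub>X n\<^esub> y \<in> boundaries X d n"
  using kmod.coset_eq_iff[OF Z_kmod boundaries_submodule, of x n y] by (simp add: hclass_coset Z_minus)

lemma hclass_zero_iff: "x \<in> cycles X d n \<Longrightarrow> hclass X d n x = \<zero>\<^bsub>homology X d n\<^esub> \<longleftrightarrow> x \<in> boundaries X d n"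
  using kmod.quot_zero[OF Z_kmod boundaries_submodule, of x n] by (simp add: hclass_coset homology_def)

lemma hclass_minus: assumes "x \<in> cycles X d n" "y \<in> cycles X d n"
  shows "hclass X d n (x \<ominus>\<^bsub>X n\<^esub> y) = hclass X d n x \<ominus>\<^bsub>homology X d n\<^esub> hclass X d n y"
  using lin_minus[OF hclass_lin module_abelian_group[OF Z_module] homology_abelian_group, of x n y] assms by (simp add: Z_minus)

lemma homology_rep: assumes "\<zeta> \<in> carrier (homology X d n)" obtains z where "z \<in> cycles X d n" "\<zeta> = hclass X d n z"
  using assms kmod.quot_carrier[OF Z_kmod, of n "boundaries X d n"] by (auto simp: homology_def hclass_coset)

lemma homology_mem: assumes "\<zeta> \<in> carrier (homology X d n)" "z \<in> \<zeta>" shows "z \<in> cycles X d n" "\<zeta> = hclass X d n z"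
  using kmod.quot_rep[OF Z_kmod boundaries_submodule, of \<zeta> n z] assms by (auto simp: homology_def hclass_coset)

lemma hclass_self: "z \<in> cycles X d n \<Longrightarrow> z \<in> hclass X d n z"
  using kmod.quot_self[OF Z_kmod boundaries_submodule, of z n] by (simp add: hclass_coset)

lemma hclass_mem_iff: "z \<in> cycles X d n \<Longrightarrow> x \<in> hclass X d n z \<longleftrightarrow> x \<in> cycles X d n \<and> x \<ominus>\<^bsub>X n\<^esub> z \<in> boundaries X d n"
  using homology_mem[OF hclass_closed, of z n x] hclass_eq_iff[of x n z] hclass_self[of x] by blast

end

text \<open>The quotient in Connes' sequence is the total complex shifted by two, and the
  definitions of cycles and boundaries mention n - 1 and n + 1. These rules express its homology
  through the unshifted complex.\<close>

lemma homology_shift: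
  "homology (\<lambda>n. X (n - r)) (\<lambda>n. d (n - r)) n = homology X d (n - r)"
  "hclass (\<lambda>n. X (n - r)) (\<lambda>n. d (n - r)) n = hclass X d (n - r)"
  "hmap (\<lambda>n. X (n - r)) (\<lambda>n. d (n - r)) n = hmap X d (n - r)"
proof -
  have [simp]: "n - 1 - r = n - r - 1" "n + 1 - r = n - r + 1" by auto
  show 1: "homology (\<lambda>n. X (n - r)) (\<lambda>n. d (n - r)) n = homology X d (n - r)"
    by (simp add: homology_def cycles_def boundaries_def)
  show "hclass (\<lambda>n. X (n - r)) (\<lambda>n. d (n - r)) n = hclass X d (n - r)"
    by (simp add: hclass_def[abs_def] boundaries_def)
  then show "hmap (\<lambda>n. X (n - r)) (\<lambda>n. d (n - r)) n = hmap X d (n - r)"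
    by (simp add: hmap_def[abs_def])
qed

lemma complex_shift: assumes "chain_complex K X d" shows "chain_complex K (\<lambda>n. X (n - r)) (\<lambda>n. d (n - r))"
proof -
  interpret chain_complex K X d by fact
  have [simp]: "n - 1 - r = n - r - 1" "n - 2 - r = n - r - 2" for n by auto
  show ?thesis by (rule chain_complex.intro) (use X_module d_lin dd in auto)
qed

section \<open>Chain maps and the maps they induce on homology\<close>

locale chain_map = X: chain_complex K X dX + Y: chain_complex K Y dY
  for K :: "('k, 'm) ring_scheme" and X :: "('k, 'v) graded" and dX and Y :: "('k, 'w) graded" and dY +
  fixes f :: "int \<Rightarrow> 'v \<Rightarrow> 'w"
  assumes f_lin: "\<And>n. f n \<in> lin_maps K (X n) (Y n)"
    and f_d: "\<And>n x. x \<in> carrier (X n) \<Longrightarrow> dY n (f n x) = f (n - 1) (dX n x)"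
begin

lemma f_closed: "x \<in> carrier (X n) \<Longrightarrow> f n x \<in> carrier (Y n)"
  by (rule lin_closed[OF f_lin])

lemma f_cycle: "x \<in> cycles X dX n \<Longrightarrow> f n x \<in> cycles Y dY n"
  using f_closed f_d[of x n] lin_zero[OF f_lin X.Xag Y.Xag] by (auto simp: cycles_def)

lemma f_boundary: "x \<in> boundaries X dX n \<Longrightarrow> f n x \<in> boundaries Y dY n"
  using f_closed f_d[of _ "n + 1"] by (force simp: boundaries_def)

lemma f_minus: "x \<in> carrier (X n) \<Longrightarrow> y \<in> carrier (X n) \<Longrightarrow> f n (x \<ominus>\<^bsub>X n\<^esub> y) = f n x \<ominus>\<^bsub>Y n\<^esub> f n y"
  by (rule lin_minus[OF f_lin X.Xag Y.Xag])

text \<open>\<open>hmap\<close> takes a union over all cycles in a class; they differ by boundaries,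
  which go to boundaries, so all terms of the union coincide.\<close>

lemma hmap_hclass:
  assumes z: "z \<in> cycles X dX n" shows "hmap Y dY n (f n) (hclass X dX n z) = hclass Y dY n (f n z)"
proof -
  have "hclass Y dY n (f n x) = hclass Y dY n (f n z)" if "x \<in> hclass X dX n z" for x
  proof -
    have x: "x \<in> cycles X dX n" "x \<ominus>\<^bsub>X n\<^esub> z \<in> boundaries X dX n" using that X.hclass_mem_iff[OF z] by auto
    then have "f n x \<ominus>\<^bsub>Y n\<^esub> f n z \<in> boundaries Y dY n"
      using f_boundary[OF x(2)] f_minus X.cycle_closed x z by metis
    then show ?thesis using Y.hclass_eq_iff f_cycle x z by blast
  qed
  then have "hmap Y dY n (f n) (hclass X dX n z) = (\<Union>x\<in>hclass X dX n z. hclass Y dY n (f n z))"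
    unfolding hmap_def by (intro SUP_cong refl)
  also have "\<dots> = hclass Y dY n (f n z)" using X.hclass_self[OF z] by (intro SUP_const) auto
  finally show ?thesis .
qed

lemma hmap_lin: "hmap Y dY n (f n) \<in> lin_maps K (homology X dX n) (homology Y dY n)"
proof (rule lin_mapsI)
  show "hmap Y dY n (f n) x \<in> carrier (homology Y dY n)" if "x \<in> carrier (homology X dX n)" for x
    using that by (auto elim!: X.homology_rep simp: hmap_hclass f_cycle Y.hclass_closed)
  show "hmap Y dY n (f n) (x \<oplus>\<^bsub>homology X dX n\<^esub> y) = hmap Y dY n (f n) x \<oplus>\<^bsub>homology Y dY n\<^esub> hmap Y dY n (f n) y"
    if "x \<in> carrier (homology X dX n)" "y \<in> carrier (homology X dX n)" for x y
    using that by (auto elim!: X.homology_rep simp: hmap_hclass f_cycle X.hclass_add[symmetric] Y.hclass_add[symmetric] X.cycle_add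
      lin_add[OF f_lin] X.cycle_closed)
  show "hmap Y dY n (f n) (c \<odot>\<^bsub>homology X dX n\<^esub> x) = c \<odot>\<^bsub>homology Y dY n\<^esub> hmap Y dY n (f n) x"
    if "c \<in> carrier K" "x \<in> carrier (homology X dX n)" for c x
    using that submodule.smult_closed[OF X.cycles_submodule]
    by (auto elim!: X.homology_rep simp: hmap_hclass f_cycle X.hclass_smult[symmetric] Y.hclass_smult[symmetric]
      lin_smult[OF f_lin] X.cycle_closed)
qed

end

section \<open>The long exact homology sequence\<close>

locale short_exact = i: chain_map K X dX Y dY i + s: chain_map K Y dY Z dZ s
  for K :: "('k, 'm) ring_scheme" and X :: "('k, 'u) graded" and dX and Y :: "('k, 'v) graded" and dY
    and Z :: "('k, 'w) graded" and dZ and i and s +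
  assumes i_inj: "\<And>n x. x \<in> carrier (X n) \<Longrightarrow> i n x = \<zero>\<^bsub>Y n\<^esub> \<Longrightarrow> x = \<zero>\<^bsub>X n\<^esub>"
    and s_surj: "\<And>n z. z \<in> carrier (Z n) \<Longrightarrow> \<exists>y\<in>carrier (Y n). s n y = z"
    and si: "\<And>n x. x \<in> carrier (X n) \<Longrightarrow> s n (i n x) = \<zero>\<^bsub>Z n\<^esub>"
    and ker_s: "\<And>n y. y \<in> carrier (Y n) \<Longrightarrow> s n y = \<zero>\<^bsub>Z n\<^esub> \<Longrightarrow> \<exists>x\<in>carrier (X n). i n x = y"
begin

abbreviation conn where "conn \<equiv> connecting X dX i Y dY s"

lemma i_inj': "x \<in> carrier (X n) \<Longrightarrow> y \<in> carrier (X n) \<Longrightarrow> i n x = i n y \<Longrightarrow> x = y"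
proof -
  interpret M: module K "X n" by (rule i.X.X_module)
  interpret N: module K "Y n" by (rule i.Y.X_module)
  assume *: "x \<in> carrier (X n)" "y \<in> carrier (X n)" "i n x = i n y"
  then have "i n (x \<ominus>\<^bsub>X n\<^esub> y) = \<zero>\<^bsub>Y n\<^esub>"
    using i.f_minus[of x n y] N.M.minus_eq_zero_iff[of "i n x" "i n y"] i.f_closed by simp
  then show "x = y" using i_inj[of "x \<ominus>\<^bsub>X n\<^esub> y"] M.M.minus_eq_zero_iff[of x y] * by simp
qed

lemma conn_cycle:
  assumes "x \<in> carrier (X (n - 1))" "y \<in> carrier (Y n)" "i (n - 1) x = dY n y"
  shows "x \<in> cycles X dX (n - 1)"
proof -
  have "i (n - 1 - 1) (dX (n - 1) x) = \<zero>\<^bsub>Y (n - 1 - 1)\<^esub>"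
    using i.f_d[OF assms(1)] assms(2,3) i.Y.dd by simp
  then show ?thesis using i_inj i.X.d_closed[OF assms(1)] assms(1) by (simp add: cycles_def)
qed

lemma conn_ex:
  assumes "z \<in> cycles Z dZ n"
  shows "\<exists>y\<in>carrier (Y n). \<exists>x\<in>carrier (X (n - 1)). s n y = z \<and> i (n - 1) x = dY n y"
proof -
  have z: "z \<in> carrier (Z n)" "dZ n z = \<zero>\<^bsub>Z (n - 1)\<^esub>" using assms by (auto simp: cycles_def)
  obtain y where y: "y \<in> carrier (Y n)" "s n y = z" using s_surj z(1) by blast
  have "s (n - 1) (dY n y) = \<zero>\<^bsub>Z (n - 1)\<^esub>" using s.f_d[OF y(1)] y z by simp
  then show ?thesis using ker_s[OF i.Y.d_closed[OF y(1)]] y by blast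
qed

text \<open>Two admissible lifts \<open>y\<close> and \<open>y'\<close> differ, modulo the boundary
  of a lift \<open>v\<close> of the bounding chain \<open>w\<close>, by an element of the image of
  \<open>i\<close>; its preimage \<open>u\<close> bounds x - x'. This is what gives the
  \<open>THE\<close> in \<open>connecting\<close> a meaning.\<close>

lemma conn_unique:
  assumes z: "\<zeta> \<in> carrier (homology Z dZ n)"
    and y: "y \<in> carrier (Y n)" and x: "x \<in> carrier (X (n - 1))" and "s n y \<in> \<zeta>" and ix: "i (n - 1) x = dY n y"
    and y': "y' \<in> carrier (Y n)" and x': "x' \<in> carrier (X (n - 1))" and "s n y' \<in> \<zeta>" and ix': "i (n - 1) x' = dY n y'"
  shows "hclass X dX (n - 1) x = hclass X dX (n - 1) x'"
proof -
  interpret Xn: module K "X n" by (rule i.X.X_module)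
  interpret Xn1: module K "X (n - 1)" by (rule i.X.X_module)
  interpret Yn: module K "Y n" by (rule i.Y.X_module)
  interpret Yn1: module K "Y (n - 1)" by (rule i.Y.X_module)
  interpret Zn: module K "Z n" by (rule s.Y.X_module)
  have "s n y \<in> cycles Z dZ n" "s n y' \<in> cycles Z dZ n" "hclass Z dZ n (s n y) = hclass Z dZ n (s n y')"
    using s.Y.homology_mem[OF z] assms(4,8) by metis+
  then have "s n y \<ominus>\<^bsub>Z n\<^esub> s n y' \<in> boundaries Z dZ n" using s.Y.hclass_eq_iff by blast
  then obtain w where w: "w \<in> carrier (Z (n + 1))" "s n y \<ominus>\<^bsub>Z n\<^esub> s n y' = dZ (n + 1) w" by (auto simp: boundaries_def)
  obtain v where v: "v \<in> carrier (Y (n + 1))" "s (n + 1) v = w" using s_surj w(1) by blast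
  note dv = i.Y.d_closed'[OF v(1)]
  let ?t = "y \<ominus>\<^bsub>Y n\<^esub> y' \<ominus>\<^bsub>Y n\<^esub> dY (n + 1) v"
  have tc: "?t \<in> carrier (Y n)" using y y' dv by simp
  have "s n ?t = s n y \<ominus>\<^bsub>Z n\<^esub> s n y' \<ominus>\<^bsub>Z n\<^esub> dZ (n + 1) w"
    using y y' dv s.f_d[OF v(1)] v(2) by (simp add: s.f_minus)
  also have "\<dots> = \<zero>\<^bsub>Z n\<^esub>" using w Zn.M.minus_eq_zero_iff s.Y.d_closed'[OF w(1)] by simp
  finally obtain u where u: "u \<in> carrier (X n)" "i n u = ?t" using ker_s[OF tc] by blast
  have "i (n - 1) (dX n u) = dY n ?t" using i.f_d[OF u(1)] u by simp
  also have "\<dots> = dY n y \<ominus>\<^bsub>Y (n - 1)\<^esub> dY n y' \<ominus>\<^bsub>Y (n - 1)\<^esub> \<zero>\<^bsub>Y (n - 1)\<^esub>"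
    using y y' dv i.Y.dd'[OF v(1)] by (simp add: i.Y.d_minus)
  also have "\<dots> = i (n - 1) (x \<ominus>\<^bsub>X (n - 1)\<^esub> x')"
    using x x' ix ix' i.Y.d_closed[OF y] i.Y.d_closed[OF y'] by (simp add: i.f_minus Yn1.M.minus_zero_right)
  finally have "dX n u = x \<ominus>\<^bsub>X (n - 1)\<^esub> x'"
    using i_inj'[OF i.X.d_closed[OF u(1)]] x x' by simp
  then have "x \<ominus>\<^bsub>X (n - 1)\<^esub> x' \<in> boundaries X dX (n - 1)" unfolding boundaries_def by (intro image_eqI[of _ _ u]) (use u in simp_all)
  then show ?thesis using i.X.hclass_eq_iff conn_cycle[OF x y ix] conn_cycle[OF x' y' ix'] by blast
qed

lemma conn_eq:
  assumes z: "\<zeta> \<in> carrier (homology Z dZ n)"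
    and y: "y \<in> carrier (Y n)" and x: "x \<in> carrier (X (n - 1))" and sy: "s n y \<in> \<zeta>" and ix: "i (n - 1) x = dY n y"
  shows "conn n \<zeta> = hclass X dX (n - 1) x"
  unfolding connecting_def
proof (rule the_equality)
  show "\<exists>y\<in>carrier (Y n). \<exists>x'\<in>carrier (X (n - 1)). s n y \<in> \<zeta> \<and> i (n - 1) x' = dY n y \<and> hclass X dX (n - 1) x = hclass X dX (n - 1) x'"
    using y x sy ix by blast
  fix \<xi> assume "\<exists>y\<in>carrier (Y n). \<exists>x\<in>carrier (X (n - 1)). s n y \<in> \<zeta> \<and> i (n - 1) x = dY n y \<and> \<xi> = hclass X dX (n - 1) x"
  then show "\<xi> = hclass X dX (n - 1) x" using conn_unique[OF z _ _ _ _ y x sy ix] by blast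
qed

lemma conn_rep:
  assumes z: "\<zeta> \<in> carrier (homology Z dZ n)"
  obtains y x where "y \<in> carrier (Y n)" "x \<in> carrier (X (n - 1))" "s n y \<in> cycles Z dZ n" "\<zeta> = hclass Z dZ n (s n y)"
    "i (n - 1) x = dY n y" "x \<in> cycles X dX (n - 1)" "conn n \<zeta> = hclass X dX (n - 1) x"
proof -
  obtain w where w: "w \<in> cycles Z dZ n" "\<zeta> = hclass Z dZ n w" by (rule s.Y.homology_rep[OF z])
  obtain y x where yx: "y\<in>carrier (Y n)" "x\<in>carrier (X (n - 1))" "s n y = w" "i (n - 1) x = dY n y"
    using conn_ex[OF w(1)] by blast
  moreover have "conn n \<zeta> = hclass X dX (n - 1) x"
    by (rule conn_eq[OF z yx(1,2) _ yx(4)]) (use w yx s.Y.hclass_self in auto)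
  ultimately show ?thesis using that conn_cycle w by blast
qed

text \<open>Sums and multiples of witness pairs are again witness pairs, and \<open>conn_eq\<close>
  reads off the value from any such pair.\<close>

lemma conn_lin: "conn n \<in> lin_maps K (homology Z dZ n) (homology X dX (n - 1))"
proof (rule lin_mapsI)
  interpret H: module K "homology Z dZ n" by (rule s.Y.homology_module)
  interpret Xn1: module K "X (n - 1)" by (rule i.X.X_module)
  interpret Yn: module K "Y n" by (rule i.Y.X_module)
  show "conn n u \<in> carrier (homology X dX (n - 1))" if "u \<in> carrier (homology Z dZ n)" for u
    using that by (elim conn_rep) (simp add: i.X.hclass_closed)
  show "conn n (u \<oplus>\<^bsub>homology Z dZ n\<^esub> v) = conn n u \<oplus>\<^bsub>homology X dX (n - 1)\<^esub> conn n v"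
    if u: "u \<in> carrier (homology Z dZ n)" and v: "v \<in> carrier (homology Z dZ n)" for u v
  proof -
    obtain y x where 1: "y \<in> carrier (Y n)" "x \<in> carrier (X (n - 1))" "s n y \<in> cycles Z dZ n" "u = hclass Z dZ n (s n y)"
    "i (n - 1) x = dY n y" "x \<in> cycles X dX (n - 1)" "conn n u = hclass X dX (n - 1) x" by (rule conn_rep[OF u])
    obtain y' x' where 2: "y' \<in> carrier (Y n)" "x' \<in> carrier (X (n - 1))" "s n y' \<in> cycles Z dZ n" "v = hclass Z dZ n (s n y')"
    "i (n - 1) x' = dY n y'" "x' \<in> cycles X dX (n - 1)" "conn n v = hclass X dX (n - 1) x'" by (rule conn_rep[OF v])
    have "conn n (u \<oplus>\<^bsub>homology Z dZ n\<^esub> v) = hclass X dX (n - 1) (x \<oplus>\<^bsub>X (n - 1)\<^esub> x')"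
    proof (rule conn_eq[OF H.M.a_closed[OF u v]])
      show "s n (y \<oplus>\<^bsub>Y n\<^esub> y') \<in> u \<oplus>\<^bsub>homology Z dZ n\<^esub> v"
        using 1 2 s.Y.hclass_self[OF s.Y.cycle_add[OF 1(3) 2(3)]] by (simp add: lin_add[OF s.f_lin] s.Y.hclass_add)
      show "i (n - 1) (x \<oplus>\<^bsub>X (n - 1)\<^esub> x') = dY n (y \<oplus>\<^bsub>Y n\<^esub> y')"
        using 1 2 by (simp add: lin_add[OF i.f_lin] i.Y.d_add)
    qed (use 1 2 in auto)
    then show ?thesis using 1 2 by (simp add: i.X.hclass_add)
  qed
  show "conn n (c \<odot>\<^bsub>homology Z dZ n\<^esub> u) = c \<odot>\<^bsub>homology X dX (n - 1)\<^esub> conn n u"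
    if c: "c \<in> carrier K" and u: "u \<in> carrier (homology Z dZ n)" for c u
  proof -
    obtain y x where 1: "y \<in> carrier (Y n)" "x \<in> carrier (X (n - 1))" "s n y \<in> cycles Z dZ n" "u = hclass Z dZ n (s n y)"
    "i (n - 1) x = dY n y" "x \<in> cycles X dX (n - 1)" "conn n u = hclass X dX (n - 1) x" by (rule conn_rep[OF u])
    have "conn n (c \<odot>\<^bsub>homology Z dZ n\<^esub> u) = hclass X dX (n - 1) (c \<odot>\<^bsub>X (n - 1)\<^esub> x)"
    proof (rule conn_eq[OF H.smult_closed[OF c u]])
      show "s n (c \<odot>\<^bsub>Y n\<^esub> y) \<in> c \<odot>\<^bsub>homology Z dZ n\<^esub> u"
        using 1 c s.Y.hclass_self[OF submodule.smult_closed[OF s.Y.cycles_submodule c 1(3)]] by (simp add: lin_smult[OF s.f_lin] s.Y.hclass_smult)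
      show "i (n - 1) (c \<odot>\<^bsub>X (n - 1)\<^esub> x) = dY n (c \<odot>\<^bsub>Y n\<^esub> y)"
        using 1 c by (simp add: lin_smult[OF i.f_lin] i.Y.d_smult)
    qed (use 1 c in auto)
    then show ?thesis using 1 c by (simp add: i.X.hclass_smult)
  qed
qed

lemma exact_middle:
  "exact_at K (homology X dX n) (hmap Y dY n (i n)) (homology Y dY n) (hmap Z dZ n (s n)) (homology Z dZ n)"
  proof (rule exact_atI, rule i.hmap_lin, rule s.hmap_lin)
  interpret Yn: module K "Y n" by (rule i.Y.X_module)
  interpret Zn: module K "Z n" by (rule s.Y.X_module)
  fix v
  { assume "v \<in> hmap Y dY n (i n) ` carrier (homology X dX n)"
    then obtain x where x: "x \<in> cycles X dX n" "v = hclass Y dY n (i n x)"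
      by (auto elim!: i.X.homology_rep simp: i.hmap_hclass)
    have "\<zero>\<^bsub>Z n\<^esub> \<in> boundaries Z dZ n"
      using subgroup.one_closed[OF submodule.axioms(1)[OF s.Y.boundaries_submodule]] by simp
    then have "hmap Z dZ n (s n) v = \<zero>\<^bsub>homology Z dZ n\<^esub>"
      using x i.f_cycle s.f_cycle[OF i.f_cycle[OF x(1)]] by (simp add: s.hmap_hclass s.Y.hclass_zero_iff i.X.cycle_closed si)
    then show "v \<in> {v \<in> carrier (homology Y dY n). hmap Z dZ n (s n) v = \<zero>\<^bsub>homology Z dZ n\<^esub>}"
      using x i.f_cycle i.Y.hclass_closed by auto }
  { assume "v \<in> {v \<in> carrier (homology Y dY n). hmap Z dZ n (s n) v = \<zero>\<^bsub>homology Z dZ n\<^esub>}"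
    then obtain y where y: "y \<in> cycles Y dY n" "v = hclass Y dY n y" and 0: "hmap Z dZ n (s n) v = \<zero>\<^bsub>homology Z dZ n\<^esub>"
      by (auto elim!: i.Y.homology_rep)
    have "s n y \<in> boundaries Z dZ n" using y 0 s.f_cycle[OF y(1)] by (simp add: s.hmap_hclass s.Y.hclass_zero_iff)
    then obtain w where w: "w \<in> carrier (Z (n + 1))" "s n y = dZ (n + 1) w" by (auto simp: boundaries_def)
    obtain t where t: "t \<in> carrier (Y (n + 1))" "s (n + 1) t = w" using s_surj w(1) by blast
    \<comment> \<open>Subtracting the boundary of a lift of the bounding chain puts \<open>y\<close>
      into the kernel of \<open>s\<close> without changing its class.\<close>
    let ?y = "y \<ominus>\<^bsub>Y n\<^esub> dY (n + 1) t"
    note yc = i.Y.cycle_closed[OF y(1)] and dtc = i.Y.d_closed'[OF t(1)]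
    have bd: "dY (n + 1) t \<in> boundaries Y dY n" using t by (auto simp: boundaries_def)
    have "s n ?y = \<zero>\<^bsub>Z n\<^esub>" using y yc dtc t w s.f_d[OF t(1)] Zn.M.minus_eq_zero_iff s.Y.d_closed'[OF w(1)]
      by (simp add: s.f_minus)
    then obtain x where x: "x \<in> carrier (X n)" "i n x = ?y" using ker_s[of ?y] yc dtc by auto
    have yZ: "?y \<in> cycles Y dY n" using y(1) bd i.Y.boundaries_cycles i.Y.cycle_minus by blast
    have "i (n - 1) (dX n x) = \<zero>\<^bsub>Y (n - 1)\<^esub>" using i.f_d[OF x(1)] x yZ by (simp add: cycles_def)
    then have xZ: "x \<in> cycles X dX n" using x(1) i_inj i.X.d_closed[OF x(1)] by (simp add: cycles_def)
    have "?y \<ominus>\<^bsub>Y n\<^esub> y = \<ominus>\<^bsub>Y n\<^esub> dY (n + 1) t" using yc dtc by algebra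
    moreover have "\<ominus>\<^bsub>Y n\<^esub> dY (n + 1) t \<in> boundaries Y dY n"
      using t i.Y.d_uminus[of t "n + 1"] abelian_group.a_inv_closed[OF i.Y.Xag t(1)]
      by (auto simp: boundaries_def intro!: image_eqI[of _ _ "\<ominus>\<^bsub>Y (n + 1)\<^esub> t"])
    ultimately have "v = hmap Y dY n (i n) (hclass X dX n x)"
      using i.Y.hclass_eq_iff[OF yZ y(1)] y x xZ by (simp add: i.hmap_hclass)
    then show "v \<in> hmap Y dY n (i n) ` carrier (homology X dX n)" using i.X.hclass_closed[OF xZ] by blast }
qed

lemma exact_right:
  "exact_at K (homology Y dY n) (hmap Z dZ n (s n)) (homology Z dZ n) (conn n) (homology X dX (n - 1))"
  proof (rule exact_atI, rule s.hmap_lin, rule conn_lin)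
  interpret Yn: module K "Y n" by (rule i.Y.X_module)
  interpret Xn: module K "X (n - 1)" by (rule i.X.X_module)
  interpret Zn: module K "Z n" by (rule s.Y.X_module)
  fix v
  { assume "v \<in> hmap Z dZ n (s n) ` carrier (homology Y dY n)"
    then obtain y where y: "y \<in> cycles Y dY n" "v = hclass Z dZ n (s n y)"
      by (auto elim!: i.Y.homology_rep simp: s.hmap_hclass)
    have c: "v \<in> carrier (homology Z dZ n)" using y s.f_cycle s.Y.hclass_closed by auto
    have "\<zero>\<^bsub>X (n - 1)\<^esub> \<in> boundaries X dX (n - 1)"
      using subgroup.one_closed[OF submodule.axioms(1)[OF i.X.boundaries_submodule[of "n - 1"]]] by simp
    moreover have "conn n v = hclass X dX (n - 1) \<zero>\<^bsub>X (n - 1)\<^esub>"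
      by (rule conn_eq[OF c i.Y.cycle_closed[OF y(1)]])
        (use y s.f_cycle s.Y.hclass_self lin_zero[OF i.f_lin i.X.Xag i.Y.Xag] in \<open>auto simp: cycles_def\<close>)
    ultimately have "conn n v = \<zero>\<^bsub>homology X dX (n - 1)\<^esub>"
      using i.X.hclass_zero_iff subsetD[OF i.X.boundaries_cycles] by simp
    then show "v \<in> {v \<in> carrier (homology Z dZ n). conn n v = \<zero>\<^bsub>homology X dX (n - 1)\<^esub>}" using c by auto }
  { assume "v \<in> {v \<in> carrier (homology Z dZ n). conn n v = \<zero>\<^bsub>homology X dX (n - 1)\<^esub>}"
    then have v: "v \<in> carrier (homology Z dZ n)" and 0: "conn n v = \<zero>\<^bsub>homology X dX (n - 1)\<^esub>" by auto
    obtain y x where 1: "y \<in> carrier (Y n)" "x \<in> carrier (X (n - 1))" "s n y \<in> cycles Z dZ n" "v = hclass Z dZ n (s n y)"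
      "i (n - 1) x = dY n y" "x \<in> cycles X dX (n - 1)" "conn n v = hclass X dX (n - 1) x" by (rule conn_rep[OF v])
    have "x \<in> boundaries X dX (n - 1)" using 1 0 i.X.hclass_zero_iff by auto
    then obtain u where u: "u \<in> carrier (X n)" "x = dX n u" by (auto simp: boundaries_def)
    \<comment> \<open>\<open>x\<close> is the boundary of \<open>u\<close>, so subtracting
      \<open>i n u\<close> turns the lift \<open>y\<close> into a cycle with the same image under
      \<open>s\<close>.\<close>
    let ?y = "y \<ominus>\<^bsub>Y n\<^esub> i n u"
    have iu: "i n u \<in> carrier (Y n)" using i.f_closed[OF u(1)] .
    have "dY n ?y = \<zero>\<^bsub>Y (n - 1)\<^esub>"
      using 1 u iu i.f_d[OF u(1)] i.Y.d_closed[OF 1(1)] abelian_group.minus_eq_zero_iff[OF i.Y.Xag] by (simp add: i.Y.d_minus)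
    then have yZ: "?y \<in> cycles Y dY n" using 1 iu by (simp add: cycles_def)
    have "s n ?y = s n y" using 1 iu si[OF u(1)] s.f_closed[OF 1(1)] by (simp add: s.f_minus Zn.M.minus_zero_right)
    then have "v = hmap Z dZ n (s n) (hclass Y dY n ?y)" using 1 yZ by (simp add: s.hmap_hclass)
    then show "v \<in> hmap Z dZ n (s n) ` carrier (homology Y dY n)" using i.Y.hclass_closed[OF yZ] by blast }
qed

lemma exact_left:
  "exact_at K (homology Z dZ n) (conn n) (homology X dX (n - 1)) (hmap Y dY (n - 1) (i (n - 1))) (homology Y dY (n - 1))"
  proof (rule exact_atI, rule conn_lin, rule i.hmap_lin)
  fix v
  { assume "v \<in> conn n ` carrier (homology Z dZ n)"
    then obtain \<zeta> where z: "\<zeta> \<in> carrier (homology Z dZ n)" "v = conn n \<zeta>" by blast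
    obtain y x where 1: "y \<in> carrier (Y n)" "x \<in> carrier (X (n - 1))" "s n y \<in> cycles Z dZ n" "\<zeta> = hclass Z dZ n (s n y)"
      "i (n - 1) x = dY n y" "x \<in> cycles X dX (n - 1)" "conn n \<zeta> = hclass X dX (n - 1) x" by (rule conn_rep[OF z(1)])
    have "i (n - 1) x \<in> boundaries Y dY (n - 1)" using 1 by (auto simp: boundaries_def)
    then show "v \<in> {v \<in> carrier (homology X dX (n - 1)). hmap Y dY (n - 1) (i (n - 1)) v = \<zero>\<^bsub>homology Y dY (n - 1)\<^esub>}"
      using 1 z i.f_cycle[OF 1(6)] by (auto simp: i.hmap_hclass i.Y.hclass_zero_iff i.X.hclass_closed) }
  { assume "v \<in> {v \<in> carrier (homology X dX (n - 1)). hmap Y dY (n - 1) (i (n - 1)) v = \<zero>\<^bsub>homology Y dY (n - 1)\<^esub>}"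
    then obtain x where x: "x \<in> cycles X dX (n - 1)" "v = hclass X dX (n - 1) x" and
      0: "hmap Y dY (n - 1) (i (n - 1)) v = \<zero>\<^bsub>homology Y dY (n - 1)\<^esub>" by (auto elim!: i.X.homology_rep)
    have "i (n - 1) x \<in> boundaries Y dY (n - 1)" using x 0 i.f_cycle[OF x(1)] by (simp add: i.hmap_hclass i.Y.hclass_zero_iff)
    then obtain y where y: "y \<in> carrier (Y n)" "i (n - 1) x = dY n y" by (auto simp: boundaries_def)
    have "dZ n (s n y) = \<zero>\<^bsub>Z (n - 1)\<^esub>" using s.f_d[OF y(1)] y(2) si i.X.cycle_closed[OF x(1)] by metis
    then have sZ: "s n y \<in> cycles Z dZ n" using s.f_closed[OF y(1)] by (simp add: cycles_def)
    have "conn n (hclass Z dZ n (s n y)) = v" unfolding x(2)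
      by (rule conn_eq[OF s.Y.hclass_closed[OF sZ] y(1) i.X.cycle_closed[OF x(1)] s.Y.hclass_self[OF sZ] y(2)])
    then show "v \<in> conn n ` carrier (homology Z dZ n)" using s.Y.hclass_closed[OF sZ] by blast }
qed

end

text \<open>A witness pair \<open>(y, x)\<close> for the first sequence is carried by
  \<open>b\<close> and \<open>a\<close> to a witness pair for the second.\<close>

lemma connecting_natural:
  assumes "short_exact K X dX Y dY Z dZ i s" and "short_exact K X' dX' Y' dY' Z' dZ' i' s'"
    and "chain_map K X dX X' dX' a" and "chain_map K Y dY Y' dY' b" and "chain_map K Z dZ Z' dZ' c"
    and bi: "\<And>n x. x \<in> carrier (X n) \<Longrightarrow> b n (i n x) = i' n (a n x)"
    and cs: "\<And>n y. y \<in> carrier (Y n) \<Longrightarrow> c n (s n y) = s' n (b n y)"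
    and \<zeta>: "\<zeta> \<in> carrier (homology Z dZ n)"
  shows "hmap X' dX' (n - 1) (a (n - 1)) (connecting X dX i Y dY s n \<zeta>) =
    connecting X' dX' i' Y' dY' s' n (hmap Z' dZ' n (c n) \<zeta>)"
proof -
  interpret E: short_exact K X dX Y dY Z dZ i s by fact
  interpret E': short_exact K X' dX' Y' dY' Z' dZ' i' s' by fact
  interpret a: chain_map K X dX X' dX' a by fact
  interpret b: chain_map K Y dY Y' dY' b by fact
  interpret c: chain_map K Z dZ Z' dZ' c by fact
  obtain y x where 1: "y \<in> carrier (Y n)" "x \<in> carrier (X (n - 1))" "s n y \<in> cycles Z dZ n" "\<zeta> = hclass Z dZ n (s n y)"
      "i (n - 1) x = dY n y" "x \<in> cycles X dX (n - 1)" "E.conn n \<zeta> = hclass X dX (n - 1) x" by (rule E.conn_rep[OF \<zeta>])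
  have "E'.conn n (hmap Z' dZ' n (c n) \<zeta>) = hclass X' dX' (n - 1) (a (n - 1) x)"
  proof (rule E'.conn_eq)
    show "hmap Z' dZ' n (c n) \<zeta> \<in> carrier (homology Z' dZ' n)" by (rule lin_closed[OF c.hmap_lin \<zeta>])
    show "s' n (b n y) \<in> hmap Z' dZ' n (c n) \<zeta>"
      using 1 c.f_cycle[OF 1(3)] E'.s.Y.hclass_self by (simp add: c.hmap_hclass cs[symmetric])
    show "i' (n - 1) (a (n - 1) x) = dY' n (b n y)" using 1 by (simp add: bi[symmetric] b.f_d)
  qed (use 1 a.f_closed b.f_closed in auto)
  then show ?thesis using 1 by (simp add: a.hmap_hclass)
qed

lemma hmap_comp:
  assumes "chain_map K X dX Y dY f" "chain_map K Y dY Z dZ g" and "chain_map K X dX Z dZ h"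
    and h: "\<And>x. x \<in> carrier (X n) \<Longrightarrow> g n (f n x) = h n x" and \<zeta>: "\<zeta> \<in> carrier (homology X dX n)"
  shows "hmap Z dZ n (g n) (hmap Y dY n (f n) \<zeta>) = hmap Z dZ n (h n) \<zeta>"
proof -
  interpret f: chain_map K X dX Y dY f by fact
  interpret g: chain_map K Y dY Z dZ g by fact
  interpret h: chain_map K X dX Z dZ h by fact
  show ?thesis using \<zeta>
    by (elim f.X.homology_rep) (simp add: f.hmap_hclass g.hmap_hclass h.hmap_hclass f.f_cycle h f.X.cycle_closed)
qed

section \<open>Exact sequences\<close>

lemma lin_inv_into:
  assumes V: "module K V" and f: "f \<in> lin_maps K V W" and b: "bij_betw f (carrier V) (carrier W)"
  shows "inv_into (carrier V) f \<in> lin_maps K W V"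
proof (rule lin_mapsI)
  interpret V: module K V by fact
  let ?g = "inv_into (carrier V) f"
  have g: "?g x \<in> carrier V" "f (?g x) = x" if "x \<in> carrier W" for x
    using that b by (metis bij_betw_def inv_into_into f_inv_into_f)+
  have i: "x = y" if "f x = f y" "x \<in> carrier V" "y \<in> carrier V" for x y
    using that b by (meson bij_betw_def inj_onD)
  show "?g x \<in> carrier V" if "x \<in> carrier W" for x using g that by blast
  show "?g (x \<oplus>\<^bsub>W\<^esub> y) = ?g x \<oplus>\<^bsub>V\<^esub> ?g y" if "x \<in> carrier W" "y \<in> carrier W" for x y
  proof -
    have *: "f (?g x \<oplus>\<^bsub>V\<^esub> ?g y) = x \<oplus>\<^bsub>W\<^esub> y" using lin_add[OF f] g that by simp
    then have "x \<oplus>\<^bsub>W\<^esub> y \<in> carrier W" using lin_closed[OF f, of "?g x \<oplus>\<^bsub>V\<^esub> ?g y"] g that by simp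
    then show ?thesis using i[of "?g (x \<oplus>\<^bsub>W\<^esub> y)" "?g x \<oplus>\<^bsub>V\<^esub> ?g y"] * g that by simp
  qed
  show "?g (c \<odot>\<^bsub>W\<^esub> x) = c \<odot>\<^bsub>V\<^esub> ?g x" if "c \<in> carrier K" "x \<in> carrier W" for c x
  proof -
    have *: "f (c \<odot>\<^bsub>V\<^esub> ?g x) = c \<odot>\<^bsub>W\<^esub> x" using lin_smult[OF f] g that by simp
    then have "c \<odot>\<^bsub>W\<^esub> x \<in> carrier W" using lin_closed[OF f, of "c \<odot>\<^bsub>V\<^esub> ?g x"] g that by simp
    then show ?thesis using i[of "?g (c \<odot>\<^bsub>W\<^esub> x)" "c \<odot>\<^bsub>V\<^esub> ?g x"] * g that by simp
  qed
qed

lemma dsum_simps: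
  "carrier (dsum V W) = carrier V \<times> carrier W" "\<zero>\<^bsub>dsum V W\<^esub> = (\<zero>\<^bsub>V\<^esub>, \<zero>\<^bsub>W\<^esub>)"
  "(v, w) \<oplus>\<^bsub>dsum V W\<^esub> (v', w') = (v \<oplus>\<^bsub>V\<^esub> v', w \<oplus>\<^bsub>W\<^esub> w')"
  "c \<odot>\<^bsub>dsum V W\<^esub> (v, w) = (c \<odot>\<^bsub>V\<^esub> v, c \<odot>\<^bsub>W\<^esub> w)"
  by (auto simp: dsum_def)

lemma dsum_module:
  assumes "module K V" "module K W" shows "module K (dsum V W)"
proof (rule moduleI)
  interpret V: module K V by fact
  interpret W: module K W by fact
  show "cring K" by (rule V.R.is_cring)
  show "abelian_group (dsum V W)"
  proof (rule abelian_groupI)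
    fix x assume "x \<in> carrier (dsum V W)"
    then show "\<exists>y\<in>carrier (dsum V W). y \<oplus>\<^bsub>dsum V W\<^esub> x = \<zero>\<^bsub>dsum V W\<^esub>"
      by (intro bexI[of _ "(\<ominus>\<^bsub>V\<^esub> fst x, \<ominus>\<^bsub>W\<^esub> snd x)"]) (auto simp: dsum_simps V.M.l_neg W.M.l_neg)
  qed (auto simp: dsum_simps V.M.a_ac W.M.a_ac)
qed (use assms in \<open>auto simp: dsum_simps module.smult_l_distr module.smult_r_distr module.smult_assoc1 module.smult_closed module.smult_one\<close>)

lemma lin_map_prod:
  assumes "f \<in> lin_maps K V W" "f' \<in> lin_maps K V' W'"
  shows "map_prod f f' \<in> lin_maps K (dsum V V') (dsum W W')"
  using assms by (auto simp: lin_maps_def dsum_simps Pi_def)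

lemma exact_at_dsum:
  assumes "exact_at K U f V g W" "exact_at K U' f' V' g' W'"
  shows "exact_at K (dsum U U') (map_prod f f') (dsum V V') (map_prod g g') (dsum W W')"
proof -
  have "f ` carrier U = {v \<in> carrier V. g v = \<zero>\<^bsub>W\<^esub>}" "f' ` carrier U' = {v \<in> carrier V'. g' v = \<zero>\<^bsub>W'\<^esub>}"
    using assms by (auto simp: exact_at_def)
  then have "map_prod f f' ` carrier (dsum U U') = {v \<in> carrier (dsum V V'). map_prod g g' v = \<zero>\<^bsub>dsum W W'\<^esub>}"
    by (auto simp: dsum_simps map_prod_surj_on[OF refl refl])
  then show ?thesis using assms by (auto simp: exact_at_def lin_map_prod)
qed

lemma exact_row_dsum:
  assumes "exact_row K X Y I S B" "exact_row K X' Y' I' S' B'"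
  shows "exact_row K (\<lambda>n. dsum (X n) (X' n)) (\<lambda>n. dsum (Y n) (Y' n))
    (\<lambda>n. map_prod (I n) (I' n)) (\<lambda>n. map_prod (S n) (S' n)) (\<lambda>n. map_prod (B n) (B' n))"
  using assms by (simp add: exact_row_def exact_at_dsum)

text \<open>The homological core: the three-term sequence is short exact, so zero maps serve as
  connecting maps, and \<open>D\<close> may be whatever stands next in the column. A pair with i1 y
  + i2 z = 0 is recovered by applying \<open>p1\<close> and \<open>p2\<close>: because
  \<open>p1 i2\<close> and \<open>p2 i1\<close> factor through C, this gives y = - j1 (r2 z) and z =
  - j2 (r1 y). By r1 j1 = 1 the first equation yields r1 y = - r2 z, so the pair comes from - r2
  z.\<close>

lemma split_mayer_vietoris:
  assumes C: "module K C" and A1: "module K A1" and A2: "module K A2" and R: "module K R"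
    and j1: "j1 \<in> lin_maps K C A1" and j2: "j2 \<in> lin_maps K C A2"
    and i1: "i1 \<in> lin_maps K A1 R" and i2: "i2 \<in> lin_maps K A2 R"
    and p1: "p1 \<in> lin_maps K R A1" and p2: "p2 \<in> lin_maps K R A2"
    and r1: "r1 \<in> lin_maps K A1 C" and r2: "r2 \<in> lin_maps K A2 C"
    and r1j1: "\<And>x. x \<in> carrier C \<Longrightarrow> r1 (j1 x) = x"
    and ij: "\<And>x. x \<in> carrier C \<Longrightarrow> i1 (j1 x) = i2 (j2 x)"
    and p1i1: "\<And>x. x \<in> carrier A1 \<Longrightarrow> p1 (i1 x) = x" and p2i2: "\<And>x. x \<in> carrier A2 \<Longrightarrow> p2 (i2 x) = x"
    and p2i1: "\<And>x. x \<in> carrier A1 \<Longrightarrow> p2 (i1 x) = j2 (r1 x)"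
    and p1i2: "\<And>x. x \<in> carrier A2 \<Longrightarrow> p1 (i2 x) = j1 (r2 x)"
    and surj: "\<And>x. x \<in> carrier R \<Longrightarrow> \<exists>y\<in>carrier A1. \<exists>z\<in>carrier A2. x = i1 y \<oplus>\<^bsub>R\<^esub> i2 z"
  defines "\<alpha> \<equiv> \<lambda>x. (j1 x, \<ominus>\<^bsub>A2\<^esub> j2 x)" and "\<beta> \<equiv> \<lambda>(y, z). i1 y \<oplus>\<^bsub>R\<^esub> i2 z"
  shows "exact_at K C \<alpha> (dsum A1 A2) \<beta> R"
    and "module K D \<Longrightarrow> exact_at K (dsum A1 A2) \<beta> R (\<lambda>_. \<zero>\<^bsub>D\<^esub>) D"
    and "module K D \<Longrightarrow> exact_at K D (\<lambda>_. \<zero>\<^bsub>C\<^esub>) C \<alpha> (dsum A1 A2)"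
proof -
  interpret C: module K C by fact
  interpret A1: module K A1 by fact
  interpret A2: module K A2 by fact
  interpret R: module K R by fact
  note G = C.M.abelian_group_axioms A1.M.abelian_group_axioms A2.M.abelian_group_axioms R.M.abelian_group_axioms
  note cl = lin_closed[OF j1] lin_closed[OF j2] lin_closed[OF i1] lin_closed[OF i2]
    lin_closed[OF p1] lin_closed[OF p2] lin_closed[OF r1] lin_closed[OF r2]
  have \<alpha>: "\<alpha> \<in> lin_maps K C (dsum A1 A2)"
    unfolding \<alpha>_def by (rule lin_mapsI)
      (auto simp: dsum_simps cl lin_add[OF j1] lin_add[OF j2] lin_smult[OF j1] lin_smult[OF j2] A2.M.minus_add A2.smult_r_minus)
  have \<beta>: "\<beta> \<in> lin_maps K (dsum A1 A2) R"
    unfolding \<beta>_def by (rule lin_mapsI)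
      (auto simp: dsum_simps cl lin_add[OF i1] lin_add[OF i2] lin_smult[OF i1] lin_smult[OF i2] R.smult_r_distr R.M.a_ac)
  show "exact_at K C \<alpha> (dsum A1 A2) \<beta> R"
    proof (rule exact_atI, rule \<alpha>, rule \<beta>)
    fix v
    { assume "v \<in> \<alpha> ` carrier C"
      then obtain x where x: "x \<in> carrier C" "v = \<alpha> x" by blast
      then have "\<beta> v = \<zero>\<^bsub>R\<^esub>" unfolding \<alpha>_def \<beta>_def
        by (simp add: ij cl lin_uminus[OF i2 G(3,4)] R.M.r_neg)
      then show "v \<in> {v \<in> carrier (dsum A1 A2). \<beta> v = \<zero>\<^bsub>R\<^esub>}" using x lin_closed[OF \<alpha>] by simp }
    { assume "v \<in> {v \<in> carrier (dsum A1 A2). \<beta> v = \<zero>\<^bsub>R\<^esub>}"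
      then obtain y z where v: "v = (y, z)" "y \<in> carrier A1" "z \<in> carrier A2" "i1 y \<oplus>\<^bsub>R\<^esub> i2 z = \<zero>\<^bsub>R\<^esub>"
        by (auto simp: dsum_simps \<beta>_def)
      have "p1 (i1 y \<oplus>\<^bsub>R\<^esub> i2 z) = y \<oplus>\<^bsub>A1\<^esub> j1 (r2 z)" using v(2,3) by (simp add: lin_add[OF p1] cl p1i1 p1i2)
      then have "y \<oplus>\<^bsub>A1\<^esub> j1 (r2 z) = \<zero>\<^bsub>A1\<^esub>" using v lin_zero[OF p1 G(4,2)] by simp
      then have y: "y = \<ominus>\<^bsub>A1\<^esub> j1 (r2 z)" using v cl by (metis A1.M.minus_equality)
      have "p2 (i1 y \<oplus>\<^bsub>R\<^esub> i2 z) = j2 (r1 y) \<oplus>\<^bsub>A2\<^esub> z" using v(2,3) by (simp add: lin_add[OF p2] cl p2i1 p2i2)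
      then have "z \<oplus>\<^bsub>A2\<^esub> j2 (r1 y) = \<zero>\<^bsub>A2\<^esub>" using v lin_zero[OF p2 G(4,3)] cl A2.M.a_comm by simp
      then have z: "z = \<ominus>\<^bsub>A2\<^esub> j2 (r1 y)" using v cl by (metis A2.M.minus_equality)
      have y': "y = j1 (\<ominus>\<^bsub>C\<^esub> r2 z)" unfolding lin_uminus[OF j1 G(1,2) cl(8)[OF v(3)]] by (rule y)
      have rc: "\<ominus>\<^bsub>C\<^esub> r2 z \<in> carrier C" using v(3) cl(8) by simp
      have ry: "r1 y = \<ominus>\<^bsub>C\<^esub> r2 z" using y' r1j1[OF rc] by metis
      have "v = \<alpha> (\<ominus>\<^bsub>C\<^esub> r2 z)"
        unfolding v(1) \<alpha>_def prod.inject using y' z[unfolded ry] by (rule conjI)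
      then show "v \<in> \<alpha> ` carrier C" using rc by (rule image_eqI) }
  qed
  show "exact_at K (dsum A1 A2) \<beta> R (\<lambda>_. \<zero>\<^bsub>D\<^esub>) D" if D: "module K D"
  proof (rule exact_atI)
    show "\<beta> \<in> lin_maps K (dsum A1 A2) R" by (rule \<beta>)
    show "(\<lambda>_. \<zero>\<^bsub>D\<^esub>) \<in> lin_maps K R D" by (rule lin_zero_fun[OF module_left_module[OF D]])
    show "v \<in> {v \<in> carrier R. \<zero>\<^bsub>D\<^esub> = \<zero>\<^bsub>D\<^esub>}" if "v \<in> \<beta> ` carrier (dsum A1 A2)" for v
      using that lin_closed[OF \<beta>] by blast
    show "v \<in> \<beta> ` carrier (dsum A1 A2)" if v: "v \<in> {v \<in> carrier R. \<zero>\<^bsub>D\<^esub> = \<zero>\<^bsub>D\<^esub>}" for v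
    proof -
      obtain y z where "y \<in> carrier A1" "z \<in> carrier A2" "v = i1 y \<oplus>\<^bsub>R\<^esub> i2 z" using surj v by blast
      then show ?thesis by (intro image_eqI[of _ _ "(y, z)"]) (simp_all add: \<beta>_def dsum_simps)
    qed
  qed
  show "exact_at K D (\<lambda>_. \<zero>\<^bsub>C\<^esub>) C \<alpha> (dsum A1 A2)" if D: "module K D"
  proof -
    have j0: "x = \<zero>\<^bsub>C\<^esub>" if "x \<in> carrier C" "j1 x = \<zero>\<^bsub>A1\<^esub>" for x
      using r1j1[OF that(1)] that(2) lin_zero[OF r1 G(2,1)] by simp
    have D0: "\<zero>\<^bsub>D\<^esub> \<in> carrier D" using D by (simp add: module_def abelian_group_def abelian_monoid.zero_closed)
    have a0: "\<alpha> \<zero>\<^bsub>C\<^esub> = \<zero>\<^bsub>dsum A1 A2\<^esub>"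
      using lin_zero[OF \<alpha> G(1) module_abelian_group[OF dsum_module[OF A1 A2]]] .
    show ?thesis
    proof (rule exact_atI)
      show "v \<in> {v \<in> carrier C. \<alpha> v = \<zero>\<^bsub>dsum A1 A2\<^esub>}" if "v \<in> (\<lambda>_. \<zero>\<^bsub>C\<^esub>) ` carrier D" for v
        using that a0 by (elim imageE) simp
      show "v \<in> (\<lambda>_. \<zero>\<^bsub>C\<^esub>) ` carrier D" if v: "v \<in> {v \<in> carrier C. \<alpha> v = \<zero>\<^bsub>dsum A1 A2\<^esub>}" for v
      proof (rule image_eqI[OF j0 D0])
        show "v \<in> carrier C" "j1 v = \<zero>\<^bsub>A1\<^esub>" using v unfolding \<alpha>_def by (simp_all add: dsum_simps)
      qed
    qed (rule lin_zero_fun[OF module_left_module[OF C]], rule \<alpha>)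
  qed
qed

section \<open>Tensor powers\<close>

lemma signed_lin:
  assumes "left_module S W" "f \<in> lin_maps S V W" shows "(\<lambda>x. signed W i (f x)) \<in> lin_maps S V W"
  using assms by (cases "even i") (simp_all add: signed_def lin_uminus_fun)

lemma lin_signed:
  assumes "f \<in> lin_maps S V W" "abelian_group V" "abelian_group W" "x \<in> carrier V"
  shows "f (signed V i x) = signed W i (f x)"
  using assms by (simp add: signed_def lin_uminus)

context
  fixes V :: "('k, 'v) module" assumes V: "abelian_group V"
begin

interpretation V: abelian_group V by (rule V)

lemma signed_closed: "x \<in> carrier V \<Longrightarrow> signed V i x \<in> carrier V"
  by (simp add: signed_def)

lemma signed_signed: "x \<in> carrier V \<Longrightarrow> signed V i (signed V j x) = signed V (i + j) x"
  by (simp add: signed_def)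

lemma signed_Suc: "x \<in> carrier V \<Longrightarrow> signed V (Suc i) x = \<ominus>\<^bsub>V\<^esub> signed V i x"
  by (simp add: signed_def)

lemma signed_add: "x \<in> carrier V \<Longrightarrow> y \<in> carrier V \<Longrightarrow> signed V i (x \<oplus>\<^bsub>V\<^esub> y) = signed V i x \<oplus>\<^bsub>V\<^esub> signed V i y"
  by (simp add: signed_def V.minus_add)

lemma signed_uminus: "x \<in> carrier V \<Longrightarrow> signed V i (\<ominus>\<^bsub>V\<^esub> x) = \<ominus>\<^bsub>V\<^esub> signed V i x"
  by (simp add: signed_def)

end

lemma signed_0: "signed V 0 x = x"
  by (simp add: signed_def)

lemma signed_parity: "even i = even j \<Longrightarrow> signed V i x = signed V j x"
  by (simp add: signed_def)

text \<open>Hides the coset construction behind a linear map \<open>q\<close> that identifies any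
  two elements whose difference is a relation; tensor powers and tensor products of modules both
  derive their laws from it.\<close>

lemma (in presentation) gen_class_lin:
  obtains q where "q \<in> lin_maps K (free_mod K X) (presented K X L)" "\<And>x. gen_class K X L x = q (free_gen K x)"
    "\<And>f g. f \<in> carrier (free_mod K X) \<Longrightarrow> g \<in> carrier (free_mod K X) \<Longrightarrow> f \<ominus>\<^bsub>free_mod K X\<^esub> g \<in> L \<Longrightarrow> q f = q g"
proof
  let ?q = "\<lambda>f. lin_span K (free_mod K X) L +>\<^bsub>free_mod K X\<^esub> f"
  show "?q \<in> lin_maps K (free_mod K X) (presented K X L)"
    unfolding presented_def by (rule F.quot_lin[OF span_sub])
  show "gen_class K X L x = ?q (free_gen K x)" for x by (simp add: gen_class_def)
  show "f \<in> carrier (free_mod K X) \<Longrightarrow> g \<in> carrier (free_mod K X) \<Longrightarrow> f \<ominus>\<^bsub>free_mod K X\<^esub> g \<in> L \<Longrightarrow> ?q f = ?q g" for f g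
    by (rule gen_class_rel)
qed

text \<open>Multilinearity, with the varying entry singled out by splitting the list. Unlike the
  list updates in \<open>tpow_rels\<close>, this form passes to lists extended at either end, which
  is how most multilinear maps below are built up.\<close>

definition mlin :: "('k, 'm) ring_scheme \<Rightarrow> ('k, 'a) module \<Rightarrow> nat \<Rightarrow> ('k, 'v) module \<Rightarrow> ('a list \<Rightarrow> 'v) \<Rightarrow> bool" where
  "mlin K A m V F \<longleftrightarrow> (\<forall>xs\<in>tpow_gens A m. F xs \<in> carrier V) \<and>
     (\<forall>us vs. set us \<subseteq> carrier A \<longrightarrow> set vs \<subseteq> carrier A \<longrightarrow> length us + Suc (length vs) = m \<longrightarrow>
        (\<lambda>x. F (us @ x # vs)) \<in> lin_maps K A V)"

lemma gens_iff: "xs \<in> tpow_gens A m \<longleftrightarrow> length xs = m \<and> set xs \<subseteq> carrier A"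
  by (simp add: tpow_gens_def)

lemma gens_Suc_E:
  assumes "xs \<in> tpow_gens A (Suc m)"
  obtains y ys where "xs = y # ys" "y \<in> carrier A" "ys \<in> tpow_gens A m"
  using assms by (cases xs) (auto simp: gens_iff)

lemma gens_snoc_E:
  assumes "xs \<in> tpow_gens A (Suc m)"
  obtains y ys where "xs = ys @ [y]" "y \<in> carrier A" "ys \<in> tpow_gens A m"
  using assms by (cases xs rule: rev_cases) (auto simp: gens_iff)

lemma mlin_closed: "mlin K A m V F \<Longrightarrow> xs \<in> tpow_gens A m \<Longrightarrow> F xs \<in> carrier V"
  by (simp add: mlin_def)

lemma mlin_lin: "mlin K A m V F \<Longrightarrow> set us \<subseteq> carrier A \<Longrightarrow> set vs \<subseteq> carrier A \<Longrightarrow> length us + Suc (length vs) = m \<Longrightarrow>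
        (\<lambda>x. F (us @ x # vs)) \<in> lin_maps K A V"
  by (simp add: mlin_def)

lemma mlin_upd:
  assumes "mlin K A m V F" "xs \<in> tpow_gens A m" "i < m"
  shows "(\<lambda>x. F (xs[i := x])) \<in> lin_maps K A V"
proof -
  have *: "xs[i := x] = take i xs @ x # drop (Suc i) xs" for x
    using assms(2,3) by (simp add: gens_iff upd_conv_take_nth_drop)
  show ?thesis unfolding * using assms(2,3)
    by (intro mlin_lin[OF assms(1)]) (auto simp: gens_iff dest: in_set_takeD in_set_dropD)
qed

lemma mlin_0I: "F [] \<in> carrier V \<Longrightarrow> mlin K A 0 V F"
  by (simp add: mlin_def gens_iff)

lemma mlin_ConsI:
  assumes 1: "\<And>x. x \<in> carrier A \<Longrightarrow> mlin K A m V (\<lambda>xs. F (x # xs))"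
    and 2: "\<And>xs. xs \<in> tpow_gens A m \<Longrightarrow> (\<lambda>x. F (x # xs)) \<in> lin_maps K A V"
  shows "mlin K A (Suc m) V F"
  unfolding mlin_def
proof (intro conjI ballI allI impI)
  show "F xs \<in> carrier V" if "xs \<in> tpow_gens A (Suc m)" for xs
    using that by (rule gens_Suc_E) (simp add: mlin_closed[OF 1])
  show "(\<lambda>x. F (us @ x # vs)) \<in> lin_maps K A V"
    if "set us \<subseteq> carrier A" "set vs \<subseteq> carrier A" "length us + Suc (length vs) = Suc m" for us vs
  proof (cases us)
    case Nil then show ?thesis using 2[of vs] that by (simp add: gens_iff)
  next
    case (Cons u us') then show ?thesis using mlin_lin[OF 1[of u], of us' vs] that by simp
  qed
qed

lemma mlin_snocI:
  assumes 1: "\<And>x. x \<in> carrier A \<Longrightarrow> mlin K A m V (\<lambda>xs. F (xs @ [x]))"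
    and 2: "\<And>xs. xs \<in> tpow_gens A m \<Longrightarrow> (\<lambda>x. F (xs @ [x])) \<in> lin_maps K A V"
  shows "mlin K A (Suc m) V F"
  unfolding mlin_def
proof (intro conjI ballI allI impI)
  show "F xs \<in> carrier V" if "xs \<in> tpow_gens A (Suc m)" for xs
    using that by (rule gens_snoc_E) (simp add: mlin_closed[OF 1])
  show "(\<lambda>x. F (us @ x # vs)) \<in> lin_maps K A V"
    if "set us \<subseteq> carrier A" "set vs \<subseteq> carrier A" "length us + Suc (length vs) = Suc m" for us vs
  proof (cases vs rule: rev_cases)
    case Nil then show ?thesis using 2[of us] that by (simp add: gens_iff)
  next
    case (snoc vs' v) then show ?thesis using mlin_lin[OF 1[of v], of us vs'] that by simp
  qed
qed

lemma mlin_Cons: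
  assumes "mlin K A (Suc m) V F"
  shows "x \<in> carrier A \<Longrightarrow> mlin K A m V (\<lambda>xs. F (x # xs))"
    and "xs \<in> tpow_gens A m \<Longrightarrow> (\<lambda>x. F (x # xs)) \<in> lin_maps K A V"
    and "x \<in> carrier A \<Longrightarrow> mlin K A m V (\<lambda>xs. F (xs @ [x]))"
    and "xs \<in> tpow_gens A m \<Longrightarrow> (\<lambda>x. F (xs @ [x])) \<in> lin_maps K A V"
proof -
  { assume x: "x \<in> carrier A"
    show "mlin K A m V (\<lambda>xs. F (x # xs))" unfolding mlin_def
    proof (intro conjI ballI allI impI)
      show "F (x # xs) \<in> carrier V" if "xs \<in> tpow_gens A m" for xs
        using mlin_closed[OF assms, of "x # xs"] x that by (simp add: gens_iff)
      show "(\<lambda>y. F (x # us @ y # vs)) \<in> lin_maps K A V"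
        if "set us \<subseteq> carrier A" "set vs \<subseteq> carrier A" "length us + Suc (length vs) = m" for us vs
        using mlin_lin[OF assms, of "x # us" vs] that x by simp
    qed
    show "mlin K A m V (\<lambda>xs. F (xs @ [x]))" unfolding mlin_def
    proof (intro conjI ballI allI impI)
      show "F (xs @ [x]) \<in> carrier V" if "xs \<in> tpow_gens A m" for xs
        using mlin_closed[OF assms, of "xs @ [x]"] x that by (simp add: gens_iff)
      show "(\<lambda>y. F ((us @ y # vs) @ [x])) \<in> lin_maps K A V"
        if "set us \<subseteq> carrier A" "set vs \<subseteq> carrier A" "length us + Suc (length vs) = m" for us vs
        using mlin_lin[OF assms, of us "vs @ [x]"] that x by simp
    qed }
  { assume xs: "xs \<in> tpow_gens A m"
    show "(\<lambda>x. F (x # xs)) \<in> lin_maps K A V" using mlin_lin[OF assms, of "[]" xs] xs by (simp add: gens_iff)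
    show "(\<lambda>x. F (xs @ [x])) \<in> lin_maps K A V" using mlin_lin[OF assms, of xs "[]"] xs by (simp add: gens_iff) }
qed

lemma mlin_comp:
  assumes F: "mlin K A m V F" and g: "g \<in> lin_maps K V W" shows "mlin K A m W (\<lambda>xs. g (F xs))"
  unfolding mlin_def
proof (intro conjI ballI allI impI)
  show "g (F xs) \<in> carrier W" if "xs \<in> tpow_gens A m" for xs
    by (rule lin_closed[OF g mlin_closed[OF F that]])
  show "(\<lambda>x. g (F (us @ x # vs))) \<in> lin_maps K A W"
    if "set us \<subseteq> carrier A" "set vs \<subseteq> carrier A" "length us + Suc (length vs) = m" for us vs
    by (rule lin_comp[OF mlin_lin[OF F that] g])
qed

lemma mlin_signed: "mlin K A m V F \<Longrightarrow> module K V \<Longrightarrow> mlin K A m V (\<lambda>xs. signed V i (F xs))"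
  by (rule mlin_comp) (auto intro: signed_lin lin_id module_left_module)

lemma mlin_finsum:
  assumes "module K V" "finite I" "\<And>i. i \<in> I \<Longrightarrow> mlin K A m V (F i)"
  shows "mlin K A m V (\<lambda>xs. finsum V (\<lambda>i. F i xs) I)"
  unfolding mlin_def
proof (intro conjI ballI allI impI)
  interpret V: module K V by fact
  show "finsum V (\<lambda>i. F i xs) I \<in> carrier V" if "xs \<in> tpow_gens A m" for xs
    using that assms(3) by (intro V.M.finsum_closed) (auto simp: mlin_def)
  show "(\<lambda>x. finsum V (\<lambda>i. F i (us @ x # vs)) I) \<in> lin_maps K A V"
    if "set us \<subseteq> carrier A" "set vs \<subseteq> carrier A" "length us + Suc (length vs) = m" for us vs
    by (rule lin_finsum_fun[OF module_left_module[OF assms(1)] assms(2)]) (rule mlin_lin[OF assms(3) that])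
qed

lemma mlin_cong:
  assumes F: "mlin K A m V F" and eq: "\<And>xs. xs \<in> tpow_gens A m \<Longrightarrow> F xs = G xs" and A: "module K A"
  shows "mlin K A m V G"
  unfolding mlin_def
proof (intro conjI ballI allI impI)
  interpret A: module K A by fact
  show "G xs \<in> carrier V" if "xs \<in> tpow_gens A m" for xs
    using that mlin_closed[OF F] eq by metis
  show "(\<lambda>x. G (us @ x # vs)) \<in> lin_maps K A V"
    if "set us \<subseteq> carrier A" "set vs \<subseteq> carrier A" "length us + Suc (length vs) = m" for us vs
    by (rule lin_cong[OF mlin_lin[OF F that]]) (use that in \<open>auto simp: eq gens_iff\<close>)
qed

section \<open>Tensor powers of an algebra and operators on them\<close>

locale kalg =
  fixes K :: "('k, 'm) ring_scheme" and A :: "('k, 'a) module" (structure)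
  assumes alg: "k_algebra K A"
begin

sublocale AM: module K A using alg by (simp add: k_algebra_def)

abbreviation AC where "AC \<equiv> carrier A"

sublocale AR: ring A using alg by (simp add: k_algebra_def)

lemma smult_mult: "\<lbrakk>c \<in> carrier K; x \<in> AC; y \<in> AC\<rbrakk> \<Longrightarrow> (c \<odot> x) \<otimes> y = c \<odot> (x \<otimes> y)"
  and mult_smult: "\<lbrakk>c \<in> carrier K; x \<in> AC; y \<in> AC\<rbrakk> \<Longrightarrow> x \<otimes> (c \<odot> y) = c \<odot> (x \<otimes> y)"
  using alg by (auto simp: k_algebra_def)

lemma field_K: "field K" using alg by (simp add: k_algebra_def)

lemma lmult_lin: "x \<in> AC \<Longrightarrow> (\<lambda>y. x \<otimes> y) \<in> lin_maps K A A"
  and rmult_lin: "x \<in> AC \<Longrightarrow> (\<lambda>y. y \<otimes> x) \<in> lin_maps K A A"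
  by (auto intro!: lin_mapsI simp: smult_mult mult_smult AR.l_distr AR.r_distr)

abbreviation T where "T m \<equiv> tpow K A m"

abbreviation TC where "TC m \<equiv> carrier (T m)"

abbreviation TG where "TG m \<equiv> tpow_gens A m"

abbreviation pt where "pt m \<equiv> pure K A m"

abbreviation bd where "bd m \<equiv> bar_d K A m"

lemma tpow_pres: "presentation K (TG m) (tpow_rels K A m)"
proof (rule presentation.intro)
  show "cring K" by (rule AM.R.is_cring)
  interpret F: module K "free_mod K (TG m)" by (rule free_mod_module) (rule AM.R.is_cring)
  have g: "free_gen K (xs[i := x]) \<in> carrier (free_mod K (TG m))" if "xs \<in> TG m" "x \<in> AC" for xs i x
    by (rule free_gen_closed[OF AM.R.ring_axioms])
      (use that in \<open>simp add: gens_iff set_update_subsetI\<close>)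
  show "tpow_rels K A m \<subseteq> carrier (free_mod K (TG m))"
    unfolding tpow_rels_def Let_def by (auto simp: g)
qed

lemma tpow_module: "module K (T m)"
  unfolding tpow_def by (rule presentation.presented_module[OF tpow_pres])

sublocale TM: module K "T m" for m by (rule tpow_module)

lemma tpow_ag: "abelian_group (T m)" by (rule module_abelian_group[OF tpow_module])

lemma tpow_lm: "left_module K (T m)" by (rule module_left_module[OF tpow_module])

lemma pure_closed: "xs \<in> TG m \<Longrightarrow> pt m xs \<in> TC m"
  unfolding tpow_def pure_def by (rule presentation.gen_class_closed[OF tpow_pres])

lemma pure_mlin: "mlin K A m (T m) (pt m)"
  unfolding mlin_def
proof (intro conjI ballI allI impI)
  show "pt m xs \<in> TC m" if "xs \<in> TG m" for xs
    using that by (rule pure_closed)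
  fix us vs assume uv: "set us \<subseteq> AC" "set vs \<subseteq> AC" "length us + Suc (length vs) = m"
  let ?F = "free_mod K (TG m)"
  interpret F: module K ?F by (rule free_mod_module) (rule AM.R.is_cring)
  obtain q where q: "q \<in> lin_maps K ?F (T m)"
    and pq: "\<And>xs. pt m xs = q (free_gen K xs)"
    and rel: "\<And>f g. f \<in> carrier ?F \<Longrightarrow> g \<in> carrier ?F \<Longrightarrow> f \<ominus>\<^bsub>?F\<^esub> g \<in> tpow_rels K A m \<Longrightarrow> q f = q g"
    using presentation.gen_class_lin[OF tpow_pres, of m] unfolding pure_def[symmetric] tpow_def[symmetric] by metis
  \<comment> \<open>The entry at position \<open>?i\<close> is overwritten in every relation that is
    used; zero only holds the place.\<close>
  let ?xs = "us @ \<zero> # vs" and ?i = "length us"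
  have xs: "?xs \<in> TG m" "?i < m" using uv by (auto simp: gens_iff)
  have g: "free_gen K (us @ x # vs) \<in> carrier ?F" if "x \<in> AC" for x
    by (rule free_gen_closed[OF AM.R.ring_axioms]) (use that uv in \<open>auto simp: gens_iff\<close>)
  show "(\<lambda>x. pt m (us @ x # vs)) \<in> lin_maps K A (T m)"
  proof (rule lin_mapsI)
    show "pt m (us @ x # vs) \<in> TC m" if "x \<in> AC" for x
      by (rule pure_closed) (use that uv in \<open>auto simp: gens_iff\<close>)
    show "pt m (us @ (x \<oplus> y) # vs) = pt m (us @ x # vs) \<oplus>\<^bsub>T m\<^esub> pt m (us @ y # vs)"
      if xy: "x \<in> AC" "y \<in> AC" for x y
    proof -
      have "free_gen K (us @ (x \<oplus> y) # vs) \<ominus>\<^bsub>?F\<^esub> (free_gen K (us @ x # vs) \<oplus>\<^bsub>?F\<^esub> free_gen K (us @ y # vs)) \<in> tpow_rels K A m"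
        unfolding tpow_rels_def Let_def
        by (rule UnI1, rule CollectI, rule exI[of _ ?xs], rule exI[of _ ?i], rule exI[of _ x], rule exI[of _ y])
          (use xs xy in simp)
      from rel[OF g F.M.a_closed[OF g g] this] show ?thesis
        using xy by (simp add: pq lin_add[OF q g g])
    qed
    show "pt m (us @ (c \<odot> x) # vs) = c \<odot>\<^bsub>T m\<^esub> pt m (us @ x # vs)"
      if cx: "c \<in> carrier K" "x \<in> AC" for c x
    proof -
      have "free_gen K (us @ (c \<odot> x) # vs) \<ominus>\<^bsub>?F\<^esub> (c \<odot>\<^bsub>?F\<^esub> free_gen K (us @ x # vs)) \<in> tpow_rels K A m"
        unfolding tpow_rels_def Let_def
        by (rule UnI2, rule CollectI, rule exI[of _ ?xs], rule exI[of _ ?i], rule exI[of _ c], rule exI[of _ x])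
          (use xs cx in simp)
      from rel[OF g F.smult_closed[OF _ g] this] show ?thesis
        using cx by (simp add: pq lin_smult[OF q _ g])
    qed
  qed
qed

lemma tpow_lift:
  assumes V: "module K V" and F: "mlin K A m V F"
  shows "lift K V F \<in> lin_maps K (T m) V"
    and "xs \<in> TG m \<Longrightarrow> lift K V F (pt m xs) = F xs"
proof -
  let ?F = "free_mod K (TG m)"
  interpret V: module K V by fact
  interpret F: module K ?F by (rule free_mod_module) (rule AM.R.is_cring)
  have FF: "F \<in> TG m \<rightarrow> carrier V" using F by (auto simp: mlin_def)
  note l = lext_lin[OF module_left_module[OF V] FF]
  note G = F.M.abelian_group_axioms V.M.abelian_group_axioms
  have g: "free_gen K (xs[i := x]) \<in> carrier ?F" "xs[i := x] \<in> TG m" if "xs \<in> TG m" "x \<in> AC" for xs i x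
    using that by (simp_all add: gens_iff set_update_subsetI free_gen_closed[OF AM.R.ring_axioms])
  have e: "lext K V F (free_gen K (xs[i := x])) = F (xs[i := x])" if "xs \<in> TG m" "x \<in> AC" for xs i x
    using lext_gen[OF module_left_module[OF V] FF g(2)[OF that]] .
  have L0: "lext K V F r = \<zero>\<^bsub>V\<^esub>" if "r \<in> tpow_rels K A m" for r
    using that unfolding tpow_rels_def Let_def
  proof (elim UnE CollectE exE conjE, goal_cases)
    case (1 xs i x y)
    then show ?case
      using lin_add[OF mlin_upd[OF F], of xs i x y] lin_closed[OF mlin_upd[OF F]]
      by (simp add: lin_minus[OF l G] lin_add[OF l] g e V.M.minus_eq_zero_iff)
  next
    case (2 xs i c x)
    then show ?case
      using lin_smult[OF mlin_upd[OF F], of xs i c x] lin_closed[OF mlin_upd[OF F]]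
      by (simp add: lin_minus[OF l G] lin_smult[OF l] g e V.M.minus_eq_zero_iff)
  qed
  show "lift K V F \<in> lin_maps K (T m) V"
    unfolding tpow_def by (rule presentation.lift_lin[OF tpow_pres V FF L0])
  show "lift K V F (pt m xs) = F xs" if "xs \<in> TG m"
    unfolding pure_def by (rule presentation.lift_gen[OF tpow_pres V FF L0 that])
qed

text \<open>Nearly all identities between linear maps on tensor powers are reduced by this rule to
  lists of entries.\<close>

lemma tpow_eqI:
  assumes "module K V" "f \<in> lin_maps K (T m) V" "g \<in> lin_maps K (T m) V"
    and "\<And>xs. xs \<in> TG m \<Longrightarrow> f (pt m xs) = g (pt m xs)" and "u \<in> TC m"
  shows "f u = g u"
  using presentation.lin_eq_presented[OF tpow_pres, of V f m g u] assms unfolding tpow_def pure_def by blast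

definition tcons where
  "tcons m x = lift K (T (Suc m)) (\<lambda>xs. pt (Suc m) (x # xs))"

definition tsnoc where
  "tsnoc m x = lift K (T (Suc m)) (\<lambda>xs. pt (Suc m) (xs @ [x]))"

definition lmul where
  "lmul m x = lift K (T m) (\<lambda>xs. pt m ((x \<otimes> hd xs) # tl xs))"

definition rmul where
  "rmul m x = lift K (T m) (\<lambda>xs. pt m (butlast xs @ [last xs \<otimes> x]))"

text \<open>The image of \<open>a \<otimes> u\<close> under the isomorphism of
  \<open>A \<otimes> B m\<close>, over the enveloping algebra, with the tensor power of order m + 1:
  the two outer factors are folded around \<open>a\<close>. At the unit it is, up to sign, the
  cyclic last term of the Hochschild differential.\<close>

definition mu where
  "mu m a = lift K (T (Suc m)) (\<lambda>xs. pt (Suc m) ((last xs \<otimes> a \<otimes> hd xs) # butlast (tl xs)))"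

context
  fixes x assumes x: "x \<in> AC"
begin

lemma tcons_mlin: "mlin K A m (T (Suc m)) (\<lambda>xs. pt (Suc m) (x # xs))"
  by (rule mlin_Cons(1)[OF pure_mlin x])

lemma tsnoc_mlin: "mlin K A m (T (Suc m)) (\<lambda>xs. pt (Suc m) (xs @ [x]))"
  by (rule mlin_Cons(3)[OF pure_mlin x])

lemma lmul_mlin: "mlin K A (Suc m) (T (Suc m)) (\<lambda>xs. pt (Suc m) ((x \<otimes> hd xs) # tl xs))"
  by (rule mlin_ConsI)
    (auto simp: x intro!: mlin_Cons(1)[OF pure_mlin] lin_comp[OF lmult_lin mlin_Cons(2)[OF pure_mlin]])

lemma rmul_mlin: "mlin K A (Suc m) (T (Suc m)) (\<lambda>xs. pt (Suc m) (butlast xs @ [last xs \<otimes> x]))"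
  by (rule mlin_snocI)
    (auto simp: x intro!: mlin_Cons(3)[OF pure_mlin] lin_comp[OF rmult_lin mlin_Cons(4)[OF pure_mlin]])

lemma mu_mlin: "mlin K A (Suc (Suc m)) (T (Suc m)) (\<lambda>xs. pt (Suc m) ((last xs \<otimes> x \<otimes> hd xs) # butlast (tl xs)))"
proof (rule mlin_ConsI)
  fix y assume y: "y \<in> AC"
  show "mlin K A (Suc m) (T (Suc m)) (\<lambda>xs. pt (Suc m) ((last (y # xs) \<otimes> x \<otimes> hd (y # xs)) # butlast (tl (y # xs))))"
    by (rule mlin_snocI)
      (auto simp: x y intro!: mlin_Cons(1)[OF pure_mlin] lin_comp[OF lin_comp[OF rmult_lin rmult_lin] mlin_Cons(2)[OF pure_mlin]])
next
  fix xs assume xs: "xs \<in> TG (Suc m)"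
  then obtain z zs where z: "xs = zs @ [z]" "z \<in> AC" "zs \<in> TG m" by (rule gens_snoc_E)
  show "(\<lambda>xa. pt (Suc m) ((last (xa # xs) \<otimes> x \<otimes> hd (xa # xs)) # butlast (tl (xa # xs)))) \<in> lin_maps K A (T (Suc m))"
    using z x by (auto intro!: lin_comp[OF lmult_lin mlin_Cons(2)[OF pure_mlin]])
qed

lemma tcons_lin: "tcons m x \<in> lin_maps K (T m) (T (Suc m))"
  and tsnoc_lin: "tsnoc m x \<in> lin_maps K (T m) (T (Suc m))"
  and lmul_lin: "lmul (Suc m) x \<in> lin_maps K (T (Suc m)) (T (Suc m))"
  and rmul_lin: "rmul (Suc m) x \<in> lin_maps K (T (Suc m)) (T (Suc m))"
  and mu_lin: "mu m x \<in> lin_maps K (T (Suc (Suc m))) (T (Suc m))"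
  unfolding tcons_def tsnoc_def lmul_def rmul_def mu_def
  by (rule tpow_lift(1)[OF tpow_module], rule tcons_mlin tsnoc_mlin lmul_mlin rmul_mlin mu_mlin)+

lemma tcons_pure: "xs \<in> TG m \<Longrightarrow> tcons m x (pt m xs) = pt (Suc m) (x # xs)"
  unfolding tcons_def by (rule tpow_lift(2)[OF tpow_module tcons_mlin])

lemma tsnoc_pure: "xs \<in> TG m \<Longrightarrow> tsnoc m x (pt m xs) = pt (Suc m) (xs @ [x])"
  unfolding tsnoc_def by (rule tpow_lift(2)[OF tpow_module tsnoc_mlin])

lemma lmul_pure: "y \<in> AC \<Longrightarrow> xs \<in> TG m \<Longrightarrow> lmul (Suc m) x (pt (Suc m) (y # xs)) = pt (Suc m) ((x \<otimes> y) # xs)"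
  unfolding lmul_def by (subst tpow_lift(2)[OF tpow_module lmul_mlin]) (auto simp: gens_iff)

lemma rmul_pure: "y \<in> AC \<Longrightarrow> xs \<in> TG m \<Longrightarrow> rmul (Suc m) x (pt (Suc m) (xs @ [y])) = pt (Suc m) (xs @ [y \<otimes> x])"
  unfolding rmul_def by (subst tpow_lift(2)[OF tpow_module rmul_mlin]) (auto simp: gens_iff)

lemma mu_pure: "y \<in> AC \<Longrightarrow> xs \<in> TG m \<Longrightarrow> z \<in> AC \<Longrightarrow>
    mu m x (pt (Suc (Suc m)) (y # xs @ [z])) = pt (Suc m) ((z \<otimes> x \<otimes> y) # xs)"
  unfolding mu_def by (subst tpow_lift(2)[OF tpow_module mu_mlin]) (auto simp: gens_iff)

end

lemma gens_simps: "x # xs \<in> TG (Suc m) \<longleftrightarrow> x \<in> AC \<and> xs \<in> TG m"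
  "xs @ [x] \<in> TG (Suc m) \<longleftrightarrow> x \<in> AC \<and> xs \<in> TG m" "[] \<in> TG 0"
  by (auto simp: gens_iff)

text \<open>Linearity in the new entry for an arbitrary tensor \<open>u\<close>. In particular
  prepending zero gives zero, the form in which a relation such as g x f = 0 acts on
  tensors.\<close>

lemma tcons_lin2: "u \<in> TC m \<Longrightarrow> (\<lambda>x. tcons m x u) \<in> lin_maps K A (T (Suc m))"
proof -
  assume u: "u \<in> TC m"
  show ?thesis
  proof (rule lin_mapsI)
    show "tcons m x u \<in> TC (Suc m)" if "x \<in> AC" for x using lin_closed[OF tcons_lin[OF that] u] .
    show "tcons m (x \<oplus> y) u = tcons m x u \<oplus>\<^bsub>T (Suc m)\<^esub> tcons m y u" if "x \<in> AC" "y \<in> AC" for x y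
      by (rule tpow_eqI[OF tpow_module _ _ _ u])
        (use that in \<open>auto intro!: tcons_lin lin_add_fun[OF tpow_lm] simp: tcons_pure lin_add[OF mlin_Cons(2)[OF pure_mlin]]\<close>)
    show "tcons m (c \<odot> x) u = c \<odot>\<^bsub>T (Suc m)\<^esub> tcons m x u" if "c \<in> carrier K" "x \<in> AC" for c x
      by (rule tpow_eqI[OF tpow_module _ _ _ u])
        (use that in \<open>auto intro!: tcons_lin lin_smult_fun[OF tpow_module] simp: tcons_pure lin_smult[OF mlin_Cons(2)[OF pure_mlin]]\<close>)
  qed
qed

section \<open>The bar differential\<close>

definition face :: "nat \<Rightarrow> 'a list \<Rightarrow> 'a list" where
  "face i xs = take i xs @ (xs ! i \<otimes> xs ! Suc i) # drop (i + 2) xs"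

lemma face_simps: "face 0 (x # y # xs) = (x \<otimes> y) # xs" "face (Suc i) (x # xs) = x # face i xs"
  by (simp_all add: face_def)

lemma face_snoc: "length xs = Suc n \<Longrightarrow> i < n \<Longrightarrow> face i (xs @ [y]) = face i xs @ [y]"
  by (simp add: face_def nth_append)

lemma face_last: "length xs = Suc n \<Longrightarrow> face n (xs @ [y]) = butlast xs @ [last xs \<otimes> y]"
  by (cases xs rule: rev_cases) (simp_all add: face_def nth_append)

lemma face_gens: "i < m \<Longrightarrow> xs \<in> TG (Suc m) \<Longrightarrow> face i xs \<in> TG m"
proof (induction i arbitrary: m xs)
  case 0
  then show ?case by (auto simp: gr0_conv_Suc face_simps gens_simps elim!: gens_Suc_E)
next
  case (Suc i)
  then obtain n where n: "m = Suc n" "i < n" by (cases m) auto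
  then show ?case using Suc by (auto simp: face_simps gens_simps elim!: gens_Suc_E)
qed

lemma face_mlin: "i < m \<Longrightarrow> mlin K A (Suc m) (T m) (\<lambda>xs. pt m (face i xs))"
proof (induction i arbitrary: m)
  case 0
  then obtain n where n: "m = Suc n" by (cases m) auto
  show ?case unfolding n
    by (intro mlin_ConsI)
      (auto simp: face_simps intro!: mlin_Cons(1)[OF pure_mlin] lin_comp[OF lmult_lin mlin_Cons(2)[OF pure_mlin]]
         lin_comp[OF rmult_lin mlin_Cons(2)[OF pure_mlin]] elim!: gens_Suc_E)
next
  case (Suc i)
  then obtain n where n: "m = Suc n" "i < n" by (cases m) auto
  show ?case unfolding n
  proof (rule mlin_ConsI)
    show "mlin K A (Suc n) (T (Suc n)) (\<lambda>xs. pt (Suc n) (face (Suc i) (x # xs)))" if x: "x \<in> AC" for x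
      by (rule mlin_cong[OF mlin_comp[OF Suc.IH[OF n(2)] tcons_lin[OF x]]])
        (auto simp: tcons_pure x face_gens n face_simps AM.module_axioms)
    show "(\<lambda>x. pt (Suc n) (face (Suc i) (x # xs))) \<in> lin_maps K A (T (Suc n))" if "xs \<in> TG (Suc n)" for xs
      using that n by (auto simp: face_simps face_gens intro!: mlin_Cons(2)[OF pure_mlin])
  qed
qed

lemma bar_mlin: "mlin K A (Suc m) (T m) (\<lambda>xs. finsum (T m) (\<lambda>i. signed (T m) i (pt m (face i xs))) {..<m})"
  by (intro mlin_finsum[OF tpow_module] mlin_signed[OF _ tpow_module] face_mlin) auto

lemma bar_d_alt: "bd m = lift K (T m) (\<lambda>xs. finsum (T m) (\<lambda>i. signed (T m) i (pt m (face i xs))) {..<m})"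
  by (simp add: bar_d_def face_def)

lemma bar_lin: "bd m \<in> lin_maps K (T (Suc m)) (T m)"
  unfolding bar_d_alt by (rule tpow_lift(1)[OF tpow_module bar_mlin])

lemma bar_pure: "xs \<in> TG (Suc m) \<Longrightarrow>
    bd m (pt (Suc m) xs) = finsum (T m) (\<lambda>i. signed (T m) i (pt m (face i xs))) {..<m}"
  unfolding bar_d_alt by (rule tpow_lift(2)[OF tpow_module bar_mlin])

lemma bar_0: "u \<in> TC (Suc 0) \<Longrightarrow> bd 0 u = \<zero>\<^bsub>T 0\<^esub>"
proof (rule tpow_eqI[OF tpow_module bar_lin lin_zero_fun[OF tpow_lm]])
  show "bd 0 (pt (Suc 0) xs) = \<zero>\<^bsub>T 0\<^esub>" if "xs \<in> TG (Suc 0)" for xs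
    by (simp add: bar_pure[OF that])
qed

text \<open>Face 0 multiplies \<open>x\<close> into the next entry, and every later face acts on the
  tail with the opposite sign. This recursion replaces the alternating sum in almost everything that
  follows.\<close>

lemma bar_Cons_pure:
  assumes x: "x \<in> AC" and xs: "xs \<in> TG (Suc m)"
  shows "bd (Suc m) (pt (Suc (Suc m)) (x # xs)) =
    lmul (Suc m) x (pt (Suc m) xs) \<ominus>\<^bsub>T (Suc m)\<^esub> tcons m x (bd m (pt (Suc m) xs))"
proof -
  let ?f = "\<lambda>i. signed (T (Suc m)) i (pt (Suc m) (face i (x # xs)))"
  have f: "?f i \<in> TC (Suc m)" if "i < Suc m" for i
    using that x xs by (intro signed_closed[OF tpow_ag] pure_closed face_gens) (auto simp: gens_simps)
  obtain y ys where y: "xs = y # ys" "y \<in> AC" "ys \<in> TG m" using xs by (rule gens_Suc_E)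
  have "bd (Suc m) (pt (Suc (Suc m)) (x # xs)) = finsum (T (Suc m)) ?f {..<Suc m}"
    using x xs by (intro bar_pure) (simp add: gens_simps)
  also have "{..<Suc m} = insert 0 (Suc ` {..<m})" by (auto simp: less_Suc_eq_0_disj)
  also have "finsum (T (Suc m)) ?f \<dots> = ?f 0 \<oplus>\<^bsub>T (Suc m)\<^esub> finsum (T (Suc m)) ?f (Suc ` {..<m})"
    using f by (intro TM.M.finsum_insert) auto
  also have "finsum (T (Suc m)) ?f (Suc ` {..<m}) = finsum (T (Suc m)) (\<lambda>i. ?f (Suc i)) {..<m}"
    using f by (intro TM.M.finsum_reindex) auto
  also have "\<dots> = finsum (T (Suc m)) (\<lambda>i. \<ominus>\<^bsub>T (Suc m)\<^esub> tcons m x (signed (T m) i (pt m (face i xs)))) {..<m}"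
  proof (rule TM.M.finsum_cong')
    show "(\<lambda>i. \<ominus>\<^bsub>T (Suc m)\<^esub> tcons m x (signed (T m) i (pt m (face i xs)))) \<in> {..<m} \<rightarrow> TC (Suc m)"
      using xs by (auto intro!: TM.M.a_inv_closed lin_closed[OF tcons_lin[OF x]] signed_closed[OF tpow_ag] pure_closed face_gens)
    show "?f (Suc i) = \<ominus>\<^bsub>T (Suc m)\<^esub> tcons m x (signed (T m) i (pt m (face i xs)))" if "i \<in> {..<m}" for i
      using that x xs face_gens[of i m xs]
      by (simp add: face_simps signed_Suc[OF tpow_ag] pure_closed gens_simps lin_signed[OF tcons_lin[OF x] tpow_ag tpow_ag] tcons_pure)
  qed simp
  also have "\<dots> = \<ominus>\<^bsub>T (Suc m)\<^esub> tcons m x (bd m (pt (Suc m) xs))"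
    unfolding bar_pure[OF xs]
    by (rule lin_finsum[OF lin_uminus_fun[OF tpow_lm tcons_lin[OF x]] tpow_ag tpow_ag, symmetric])
      (use xs in \<open>auto intro!: signed_closed[OF tpow_ag] pure_closed face_gens\<close>)
  also have "?f 0 = lmul (Suc m) x (pt (Suc m) xs)"
    using y x by (simp add: face_simps lmul_pure signed_0)
  finally show ?thesis by (simp add: a_minus_def)
qed

text \<open>Peeling off the last face in place of the first. This side is needed for the right
  action and wherever the two ends of a tensor meet, as in \<open>hoch_mu\<close> and
  \<open>hoch_cyc\<close>.\<close>

lemma bar_snoc_pure:
  assumes y: "y \<in> AC" and xs: "xs \<in> TG (Suc m)"
  shows "bd (Suc m) (pt (Suc (Suc m)) (xs @ [y])) =
    tsnoc m y (bd m (pt (Suc m) xs)) \<oplus>\<^bsub>T (Suc m)\<^esub> signed (T (Suc m)) m (rmul (Suc m) y (pt (Suc m) xs))"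
proof -
  let ?f = "\<lambda>i. signed (T (Suc m)) i (pt (Suc m) (face i (xs @ [y])))"
  have f: "?f i \<in> TC (Suc m)" if "i < Suc m" for i
    using that y xs by (intro signed_closed[OF tpow_ag] pure_closed face_gens) (auto simp: gens_simps)
  have "bd (Suc m) (pt (Suc (Suc m)) (xs @ [y])) = finsum (T (Suc m)) ?f {..<Suc m}"
    using y xs by (intro bar_pure) (simp add: gens_simps)
  also have "\<dots> = ?f m \<oplus>\<^bsub>T (Suc m)\<^esub> finsum (T (Suc m)) ?f {..<m}"
    unfolding lessThan_Suc using f by (intro TM.M.finsum_insert) auto
  also have "finsum (T (Suc m)) ?f {..<m} = finsum (T (Suc m)) (\<lambda>i. tsnoc m y (signed (T m) i (pt m (face i xs)))) {..<m}"
  proof (rule TM.M.finsum_cong')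
    show "(\<lambda>i. tsnoc m y (signed (T m) i (pt m (face i xs)))) \<in> {..<m} \<rightarrow> TC (Suc m)"
      using xs by (auto intro!: lin_closed[OF tsnoc_lin[OF y]] signed_closed[OF tpow_ag] pure_closed face_gens)
    show "?f i = tsnoc m y (signed (T m) i (pt m (face i xs)))" if "i \<in> {..<m}" for i
      using that y xs face_gens[of i m xs] face_snoc[of xs m i y]
      by (simp add: pure_closed gens_simps lin_signed[OF tsnoc_lin[OF y] tpow_ag tpow_ag] tsnoc_pure gens_iff)
  qed simp
  also have "\<dots> = tsnoc m y (bd m (pt (Suc m) xs))"
    unfolding bar_pure[OF xs]
    by (rule lin_finsum[OF tsnoc_lin[OF y] tpow_ag tpow_ag, symmetric])
      (use xs in \<open>auto intro!: signed_closed[OF tpow_ag] pure_closed face_gens\<close>)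
  also have fm: "?f m = signed (T (Suc m)) m (rmul (Suc m) y (pt (Suc m) xs))"
  proof -
    obtain z zs where "xs = zs @ [z]" "z \<in> AC" "zs \<in> TG m" using xs by (rule gens_snoc_E)
    then show ?thesis using face_last[of xs m y] y by (simp add: rmul_pure gens_iff)
  qed
  finally show ?thesis using TM.M.a_comm[of "?f m"] f[of m]
    lin_closed[OF tsnoc_lin[OF y] lin_closed[OF bar_lin pure_closed[OF xs]]]
    fm by simp
qed

lemma bar_tcons:
  assumes x: "x \<in> AC" and u: "u \<in> TC (Suc m)"
  shows "bd (Suc m) (tcons (Suc m) x u) = lmul (Suc m) x u \<ominus>\<^bsub>T (Suc m)\<^esub> tcons m x (bd m u)"
  by (rule tpow_eqI[OF tpow_module lin_comp[OF tcons_lin[OF x] bar_lin]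
        lin_minus_fun[OF tpow_lm lmul_lin[OF x] lin_comp[OF bar_lin tcons_lin[OF x]]] _ u])
    (simp add: tcons_pure x bar_Cons_pure)

lemma lmul_tcons: "x \<in> AC \<Longrightarrow> y \<in> AC \<Longrightarrow> u \<in> TC m \<Longrightarrow> lmul (Suc m) x (tcons m y u) = tcons m (x \<otimes> y) u"
  by (rule tpow_eqI[OF tpow_module lin_comp[OF tcons_lin lmul_lin] tcons_lin]) (auto simp: tcons_pure lmul_pure)

lemma rmul_tsnoc: "x \<in> AC \<Longrightarrow> y \<in> AC \<Longrightarrow> u \<in> TC m \<Longrightarrow> rmul (Suc m) x (tsnoc m y u) = tsnoc m (y \<otimes> x) u"
  by (rule tpow_eqI[OF tpow_module lin_comp[OF tsnoc_lin rmul_lin] tsnoc_lin]) (auto simp: tsnoc_pure rmul_pure)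

lemma rmul_tcons: "x \<in> AC \<Longrightarrow> y \<in> AC \<Longrightarrow> u \<in> TC (Suc m) \<Longrightarrow>
    rmul (Suc (Suc m)) x (tcons (Suc m) y u) = tcons (Suc m) y (rmul (Suc m) x u)"
  by (rule tpow_eqI[OF tpow_module lin_comp[OF tcons_lin rmul_lin] lin_comp[OF rmul_lin tcons_lin]])
    (auto simp: tcons_pure rmul_pure gens_simps simp flip: append_Cons elim!: gens_snoc_E)

lemma lmul_lmul: "x \<in> AC \<Longrightarrow> y \<in> AC \<Longrightarrow> u \<in> TC (Suc m) \<Longrightarrow> lmul (Suc m) x (lmul (Suc m) y u) = lmul (Suc m) (x \<otimes> y) u"
  by (rule tpow_eqI[OF tpow_module lin_comp[OF lmul_lin lmul_lin] lmul_lin])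
    (auto simp: lmul_pure AR.m_assoc elim!: gens_Suc_E)

lemma rmul_rmul: "x \<in> AC \<Longrightarrow> y \<in> AC \<Longrightarrow> u \<in> TC (Suc m) \<Longrightarrow> rmul (Suc m) x (rmul (Suc m) y u) = rmul (Suc m) (y \<otimes> x) u"
  by (rule tpow_eqI[OF tpow_module lin_comp[OF rmul_lin rmul_lin] rmul_lin])
    (auto simp: rmul_pure AR.m_assoc elim!: gens_snoc_E)

lemma lmul_one: "u \<in> TC (Suc m) \<Longrightarrow> lmul (Suc m) \<one> u = u"
  by (rule tpow_eqI[OF tpow_module lmul_lin lin_id]) (auto simp: lmul_pure elim!: gens_Suc_E)

lemma rmul_one: "u \<in> TC (Suc m) \<Longrightarrow> rmul (Suc m) \<one> u = u"
  by (rule tpow_eqI[OF tpow_module rmul_lin lin_id]) (auto simp: rmul_pure elim!: gens_snoc_E)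

text \<open>Together with \<open>bar_rmul\<close> this makes the bar differential linear over the
  enveloping algebra.\<close>

lemma bar_lmul:
  assumes x: "x \<in> AC" and u: "u \<in> TC (Suc (Suc m))"
  shows "bd (Suc m) (lmul (Suc (Suc m)) x u) = lmul (Suc m) x (bd (Suc m) u)"
proof (rule tpow_eqI[OF tpow_module lin_comp[OF lmul_lin[OF x] bar_lin] lin_comp[OF bar_lin lmul_lin[OF x]] _ u])
  fix xs assume "xs \<in> TG (Suc (Suc m))"
  then obtain y ys where y: "xs = y # ys" "y \<in> AC" "ys \<in> TG (Suc m)" by (rule gens_Suc_E)
  note p = pure_closed[OF y(3)] lin_closed[OF bar_lin pure_closed[OF y(3)]]
  show "bd (Suc m) (lmul (Suc (Suc m)) x (pt (Suc (Suc m)) xs)) =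
    lmul (Suc m) x (bd (Suc m) (pt (Suc (Suc m)) xs))"
    using x y p
    by (simp add: lmul_pure bar_Cons_pure lin_minus[OF lmul_lin[OF x] tpow_ag tpow_ag] lin_closed[OF lmul_lin]
        lin_closed[OF tcons_lin] lmul_lmul lmul_tcons)
qed

lemma bar_rmul:
  assumes x: "x \<in> AC" and u: "u \<in> TC (Suc (Suc m))"
  shows "bd (Suc m) (rmul (Suc (Suc m)) x u) = rmul (Suc m) x (bd (Suc m) u)"
proof (rule tpow_eqI[OF tpow_module lin_comp[OF rmul_lin[OF x] bar_lin] lin_comp[OF bar_lin rmul_lin[OF x]] _ u])
  fix xs assume "xs \<in> TG (Suc (Suc m))"
  then obtain y ys where y: "xs = ys @ [y]" "y \<in> AC" "ys \<in> TG (Suc m)" by (rule gens_snoc_E)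
  note p = pure_closed[OF y(3)] lin_closed[OF bar_lin pure_closed[OF y(3)]]
  show "bd (Suc m) (rmul (Suc (Suc m)) x (pt (Suc (Suc m)) xs)) =
    rmul (Suc m) x (bd (Suc m) (pt (Suc (Suc m)) xs))"
    using x y p
    by (simp add: rmul_pure bar_snoc_pure lin_add[OF rmul_lin[OF x]] lin_closed[OF rmul_lin]
        lin_closed[OF tsnoc_lin] rmul_rmul rmul_tsnoc signed_closed[OF tpow_ag] lin_signed[OF rmul_lin[OF x] tpow_ag tpow_ag])
qed

text \<open>With d for the bar differential, the recursion turns d d (x \<otimes> u) into x (d u) -
  (x (d u) - x \<otimes> d d u). Only x \<otimes> d d u survives, which vanishes by
  induction.\<close>

lemma bar_bar: "u \<in> TC (Suc (Suc m)) \<Longrightarrow> bd m (bd (Suc m) u) = \<zero>\<^bsub>T m\<^esub>"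
proof (induction m arbitrary: u)
  case 0
  then show ?case using bar_0 lin_closed[OF bar_lin] by simp
next
  case (Suc m)
  show ?case
  proof (rule tpow_eqI[OF tpow_module lin_comp[OF bar_lin bar_lin] lin_zero_fun[OF tpow_lm] _ Suc.prems])
    fix xs assume "xs \<in> TG (Suc (Suc (Suc m)))"
    then obtain y ys where y: "xs = y # ys" "y \<in> AC" "ys \<in> TG (Suc (Suc m))" by (rule gens_Suc_E)
    let ?u = "pt (Suc (Suc m)) ys"
    note p = pure_closed[OF y(3)]
    note q = lin_closed[OF bar_lin p]
    have "bd (Suc m) (bd (Suc (Suc m)) (pt (Suc (Suc (Suc m))) xs)) =
      lmul (Suc m) y (bd (Suc m) ?u) \<ominus>\<^bsub>T (Suc m)\<^esub> (lmul (Suc m) y (bd (Suc m) ?u) \<ominus>\<^bsub>T (Suc m)\<^esub> tcons m y (bd m (bd (Suc m) ?u)))"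
      using y p q
      by (simp add: bar_Cons_pure lin_minus[OF bar_lin tpow_ag tpow_ag] lin_closed[OF lmul_lin] lin_closed[OF tcons_lin] bar_lmul bar_tcons)
    also have "\<dots> = \<zero>\<^bsub>T (Suc m)\<^esub>"
      using Suc.IH[OF p] lin_zero[OF tcons_lin[OF y(2)] tpow_ag tpow_ag, of m] lin_closed[OF lmul_lin[OF y(2)] q]
      by (simp add: TM.M.minus_zero_right TM.M.minus_eq_zero_iff)
    finally show "bd (Suc m) (bd (Suc (Suc m)) (pt (Suc (Suc (Suc m))) xs)) = \<zero>\<^bsub>T (Suc m)\<^esub>" .
  qed
qed

text \<open>Prepending the unit is a contracting homotopy, because the face that multiplies the unit
  into the tensor is the identity.\<close>

lemma bar_contract:
  assumes "u \<in> TC (Suc m)"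
  shows "bd (Suc m) (tcons (Suc m) \<one> u) = u \<ominus>\<^bsub>T (Suc m)\<^esub> tcons m \<one> (bd m u)"
  using assms by (simp add: bar_tcons lmul_one)

lemma bar_exact:
  assumes u: "u \<in> TC (Suc m)" and "bd m u = \<zero>\<^bsub>T m\<^esub>"
  shows "bd (Suc m) (tcons (Suc m) \<one> u) = u"
proof -
  show ?thesis unfolding bar_contract[OF u] assms(2) lin_zero[OF tcons_lin[OF AR.one_closed] tpow_ag tpow_ag]
    by (rule TM.M.minus_zero_right[OF u])
qed

end

section \<open>The cyclic bicomplex\<close>

text \<open>Moving the last entry to the front is undone by \<open>rotate1\<close>, and rotating by
  the length is the identity.\<close>

lemma rotate_last:
  assumes "length xs = Suc m" shows "((\<lambda>xs. last xs # butlast xs) ^^ Suc m) xs = xs"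
proof -
  let ?r = "\<lambda>xs::'a list. last xs # butlast xs"
  have len: "length ((?r ^^ i) xs) = Suc m" for i using assms by (induction i) auto
  have "rotate i ((?r ^^ i) xs) = xs" for i
  proof (induction i)
    case (Suc i)
    have ne: "(?r ^^ i) xs \<noteq> []" using len[of i] by (metis length_0_conv nat.distinct(1))
    have "rotate (Suc i) ((?r ^^ Suc i) xs) = rotate i (rotate1 (?r ((?r ^^ i) xs)))"
      by (simp add: rotate_def funpow_swap1[of rotate1])
    also have "rotate1 (?r ((?r ^^ i) xs)) = (?r ^^ i) xs" using ne by simp
    finally show ?case using Suc by simp
  qed simp
  from this[of "Suc m"] show ?thesis using rotate_id[of "Suc m" "(?r ^^ Suc m) xs"] len[of "Suc m"] by simp
qed

lemma signed_even: "even i \<Longrightarrow> signed V i x = x"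
  by (simp add: signed_def)

context kalg begin

text \<open>The cyclic term multiplies the last entry into the first, which is what
  \<open>mu\<close> does at the unit; in this form \<open>b\<close> is covered by the facts on
  \<open>mu\<close>.\<close>

lemma hoch_alt:
  assumes u: "u \<in> TC (Suc (Suc q))"
  shows "hoch_d K A (Suc q) u = bd (Suc q) u \<oplus>\<^bsub>T (Suc q)\<^esub> signed (T (Suc q)) (Suc q) (mu q \<one> u)"
proof -
  let ?F = "\<lambda>xs. signed (T (Suc q)) (Suc q) (pt (Suc q) ((last xs \<otimes> hd xs) # butlast (tl xs)))"
  have 1: "last xs \<otimes> \<one> = last xs" if "xs \<in> TG (Suc (Suc q))" for xs
    using that by (elim gens_snoc_E) simp
  have m: "mlin K A (Suc (Suc q)) (T (Suc q)) ?F"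
    by (rule mlin_cong[OF mlin_signed[OF mu_mlin[OF AR.one_closed] tpow_module]]) (simp_all add: 1 AM.module_axioms)
  have "lift K (T (Suc q)) ?F u = signed (T (Suc q)) (Suc q) (mu q \<one> u)"
  proof (rule tpow_eqI[OF tpow_module tpow_lift(1)[OF tpow_module m] signed_lin[OF tpow_lm mu_lin[OF AR.one_closed]] _ u])
    fix xs assume xs: "xs \<in> TG (Suc (Suc q))"
    show "lift K (T (Suc q)) ?F (pt (Suc (Suc q)) xs) = signed (T (Suc q)) (Suc q) (mu q \<one> (pt (Suc (Suc q)) xs))"
      unfolding mu_def tpow_lift(2)[OF tpow_module m xs] tpow_lift(2)[OF tpow_module mu_mlin[OF AR.one_closed] xs] 1[OF xs] ..
  qed
  then show ?thesis by (simp only: hoch_d_def)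
qed

lemma hoch_lin: "hoch_d K A (Suc q) \<in> lin_maps K (T (Suc (Suc q))) (T (Suc q))"
proof -
  show ?thesis
    by (rule lin_cong[OF lin_add_fun[OF tpow_lm bar_lin signed_lin[OF tpow_lm mu_lin[OF AR.one_closed]]] hoch_alt[symmetric]]) simp_all
qed

lemma mu_tcons_tsnoc: "a \<in> AC \<Longrightarrow> x \<in> AC \<Longrightarrow> z \<in> AC \<Longrightarrow> v \<in> TC m \<Longrightarrow>
    mu m a (tcons (Suc m) x (tsnoc m z v)) = tcons m (z \<otimes> a \<otimes> x) v"
  by (rule tpow_eqI[OF tpow_module lin_comp[OF lin_comp[OF tsnoc_lin tcons_lin] mu_lin] tcons_lin])
    (auto simp: tcons_pure tsnoc_pure mu_pure gens_simps)

text \<open>Under the identification \<open>mu\<close>, \<open>b\<close> is the bar differential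
  with coefficients in A. For x \<otimes> ys \<otimes> z the outermost faces multiply
  \<open>x\<close> into the front and \<open>z\<close> into the back of \<open>ys\<close>; after
  folding they become the first face and the cyclic term of w \<otimes> ys with w = z a x, and the
  inner faces agree.\<close>

lemma hoch_mu:
  assumes a: "a \<in> AC" and u: "u \<in> carrier (T (Suc (Suc (Suc m))))"
  shows "hoch_d K A (Suc m) (mu (Suc m) a u) = mu m a (bd (Suc (Suc m)) u)"
proof (rule tpow_eqI[OF tpow_module lin_comp[OF mu_lin[OF a] hoch_lin] lin_comp[OF bar_lin mu_lin[OF a]] _ u])
  fix xs assume "xs \<in> TG (Suc (Suc (Suc m)))"
  then obtain x xs' where xs: "xs = x # xs'" "x \<in> AC" "xs' \<in> TG (Suc (Suc m))" by (rule gens_Suc_E)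
  obtain z ys where z: "xs' = ys @ [z]" "z \<in> AC" "ys \<in> TG (Suc m)" using xs(3) by (rule gens_snoc_E)
  obtain y0 ys0 where y0: "ys = y0 # ys0" "y0 \<in> AC" "ys0 \<in> TG m" using z(3) by (rule gens_Suc_E)
  obtain y1 ys1 where y1: "ys = ys1 @ [y1]" "y1 \<in> AC" "ys1 \<in> TG m" using z(3) by (rule gens_snoc_E)
  let ?w = "z \<otimes> a \<otimes> x" and ?py = "pt (Suc m) ys"
  let ?v = "bd m ?py"
  let ?M = "pt (Suc m) ((y1 \<otimes> ?w) # ys1)"
  have w: "?w \<in> AC" using a xs z by simp
  have py: "?py \<in> TC (Suc m)" using z by (simp add: pure_closed)
  have v: "?v \<in> TC m" by (rule lin_closed[OF bar_lin py])
  have M: "?M \<in> TC (Suc m)" using y1 w by (simp add: pure_closed gens_simps)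
  have L: "lmul (Suc m) ?w ?py \<in> TC (Suc m)" by (rule lin_closed[OF lmul_lin[OF w] py])
  have C: "tcons m ?w ?v \<in> TC (Suc m)" by (rule lin_closed[OF tcons_lin[OF w] v])
  have mu1: "mu m \<one> (pt (Suc (Suc m)) (?w # ys)) = ?M"
    unfolding y1(1) using y1 w by (simp add: mu_pure)
  have m1: "mu m a (lmul (Suc (Suc m)) x (pt (Suc (Suc m)) (ys @ [z]))) = lmul (Suc m) ?w ?py"
    using y0 xs z a w by (simp add: lmul_pure mu_pure gens_simps AR.m_assoc)
  have m2: "mu m a (tcons (Suc m) x (rmul (Suc m) z ?py)) = ?M"
    unfolding y1(1) using y1(2,3) xs(2) z(2) a w by (simp add: rmul_pure tcons_pure mu_pure gens_simps AR.m_assoc)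
  have B: "bd (Suc m) (pt (Suc (Suc m)) (ys @ [z])) = tsnoc m z ?v \<oplus>\<^bsub>T (Suc m)\<^esub> signed (T (Suc m)) m (rmul (Suc m) z ?py)"
    by (rule bar_snoc_pure[OF z(2,3)])
  have cl: "tsnoc m z ?v \<in> TC (Suc m)" "rmul (Suc m) z ?py \<in> TC (Suc m)"
    using lin_closed[OF tsnoc_lin[OF z(2)] v] lin_closed[OF rmul_lin[OF z(2)] py] by auto
  note lc = lin_add[OF tcons_lin[OF xs(2)]] lin_add[OF mu_lin[OF a]] lin_minus[OF mu_lin[OF a] tpow_ag tpow_ag]
    lin_signed[OF mu_lin[OF a] tpow_ag tpow_ag] lin_signed[OF tcons_lin[OF xs(2)] tpow_ag tpow_ag]
    lin_closed[OF tcons_lin[OF xs(2)]] signed_closed[OF tpow_ag]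
  have "mu m a (bd (Suc (Suc m)) (pt (Suc (Suc (Suc m))) xs)) =
    mu m a (lmul (Suc (Suc m)) x (pt (Suc (Suc m)) (ys @ [z])) \<ominus>\<^bsub>T (Suc (Suc m))\<^esub>
      (tcons (Suc m) x (tsnoc m z ?v) \<oplus>\<^bsub>T (Suc (Suc m))\<^esub> signed (T (Suc (Suc m))) m (tcons (Suc m) x (rmul (Suc m) z ?py))))"
    unfolding xs(1) bar_Cons_pure[OF xs(2,3)] unfolding z(1) B using cl by (simp add: lc)
  also have "\<dots> = lmul (Suc m) ?w ?py \<ominus>\<^bsub>T (Suc m)\<^esub> (tcons m ?w ?v \<oplus>\<^bsub>T (Suc m)\<^esub> signed (T (Suc m)) m ?M)"
    using cl lin_closed[OF lmul_lin[OF xs(2)] pure_closed, of "ys @ [z]" "Suc m"] z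
    by (simp add: lc m1 m2 mu_tcons_tsnoc a xs v gens_simps)
  also have "\<dots> = lmul (Suc m) ?w ?py \<ominus>\<^bsub>T (Suc m)\<^esub> tcons m ?w ?v \<oplus>\<^bsub>T (Suc m)\<^esub> signed (T (Suc m)) (Suc m) ?M"
    unfolding signed_Suc[OF tpow_ag M] using L C signed_closed[OF tpow_ag M, of m] by algebra
  also have "\<dots> = hoch_d K A (Suc m) (pt (Suc (Suc m)) (?w # ys))"
    using z w by (simp add: hoch_alt pure_closed gens_simps mu1 bar_Cons_pure)
  also have "pt (Suc (Suc m)) (?w # ys) = mu (Suc m) a (pt (Suc (Suc (Suc m))) xs)"
    unfolding xs(1) z(1) using mu_pure[OF a xs(2) z(3,2)] by simp
  finally show "hoch_d K A (Suc m) (mu (Suc m) a (pt (Suc (Suc (Suc m))) xs)) =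
    mu m a (bd (Suc (Suc m)) (pt (Suc (Suc (Suc m))) xs))" ..
qed

text \<open>Placing units at both ends undoes the folding, so \<open>mu\<close> reaches every tensor
  and identities in the Hochschild complex can be pulled back to the bar complex.\<close>

lemma pure_as_mu:
  assumes "a \<in> AC" "ys \<in> TG m"
  shows "pt (Suc m) (a # ys) = mu m a (pt (Suc (Suc m)) (\<one> # ys @ [\<one>]))"
  using assms by (simp add: mu_pure)

text \<open>Transported along \<open>mu\<close> from the vanishing square of the bar differential,
  where no cyclic face occurs.\<close>

lemma hoch_hoch:
  assumes u: "u \<in> carrier (T (Suc (Suc (Suc m))))"
  shows "hoch_d K A (Suc m) (hoch_d K A (Suc (Suc m)) u) = \<zero>\<^bsub>T (Suc m)\<^esub>"
proof (rule tpow_eqI[OF tpow_module lin_comp[OF hoch_lin hoch_lin] lin_zero_fun[OF tpow_lm] _ u])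
  fix xs assume "xs \<in> TG (Suc (Suc (Suc m)))"
  then obtain a ys where a: "xs = a # ys" "a \<in> AC" "ys \<in> TG (Suc (Suc m))" by (rule gens_Suc_E)
  let ?v = "pt (Suc (Suc (Suc (Suc m)))) (\<one> # ys @ [\<one>])"
  have v: "?v \<in> carrier (T (Suc (Suc (Suc (Suc m)))))" using a by (simp add: pure_closed gens_simps)
  show "hoch_d K A (Suc m) (hoch_d K A (Suc (Suc m)) (pt (Suc (Suc (Suc m))) xs)) = \<zero>\<^bsub>T (Suc m)\<^esub>"
    unfolding a(1) pure_as_mu[OF a(2,3)] hoch_mu[OF a(2) v] hoch_mu[OF a(2) lin_closed[OF bar_lin v]] bar_bar[OF v]
    by (rule lin_zero[OF mu_lin[OF a(2)] tpow_ag tpow_ag])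
qed

section \<open>The cyclic operator and the norm\<close>

lemma cyc_mlin: "mlin K A (Suc m) (T (Suc m)) (\<lambda>xs. signed (T (Suc m)) m (pt (Suc m) (last xs # butlast xs)))"
  by (rule mlin_signed[OF mlin_snocI tpow_module])
    (auto intro!: mlin_Cons[OF pure_mlin])

lemma cyc_lin: "cyc K A m \<in> lin_maps K (T (Suc m)) (T (Suc m))"
  unfolding cyc_def by (rule tpow_lift(1)[OF tpow_module cyc_mlin])

lemma cyc_pure': "xs \<in> TG (Suc m) \<Longrightarrow>
    cyc K A m (pt (Suc m) xs) = signed (T (Suc m)) m (pt (Suc m) (last xs # butlast xs))"
  unfolding cyc_def by (rule tpow_lift(2)[OF tpow_module cyc_mlin])

lemma cyc_pure: "xs \<in> TG m \<Longrightarrow> y \<in> AC \<Longrightarrow>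
    cyc K A m (pt (Suc m) (xs @ [y])) = signed (T (Suc m)) m (pt (Suc m) (y # xs))"
  using cyc_pure'[of "xs @ [y]" m] by (simp add: gens_simps)

lemma cyc_tsnoc: "y \<in> AC \<Longrightarrow> v \<in> TC m \<Longrightarrow> cyc K A m (tsnoc m y v) = signed (T (Suc m)) m (tcons m y v)"
  by (rule tpow_eqI[OF tpow_module lin_comp[OF tsnoc_lin cyc_lin] signed_lin[OF tpow_lm tcons_lin]])
    (auto simp: tcons_pure tsnoc_pure cyc_pure)

text \<open>The cyclic term of \<open>b\<close> on \<open>u\<close> reappears in b (t u) as the face
  that joins the moved entry to its right neighbour. It therefore cancels in the difference, which
  yields b (1 - t) = (1 - t) b'.\<close>

lemma hoch_cyc:
  assumes u: "u \<in> TC (Suc (Suc q))"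
  shows "hoch_d K A (Suc q) (cyc K A (Suc q) u) =
    cyc K A q (bd (Suc q) u) \<oplus>\<^bsub>T (Suc q)\<^esub> signed (T (Suc q)) (Suc q) (mu q \<one> u)"
proof (rule tpow_eqI[OF tpow_module lin_comp[OF cyc_lin hoch_lin] lin_add_fun[OF tpow_lm lin_comp[OF bar_lin cyc_lin]
     signed_lin[OF tpow_lm mu_lin[OF AR.one_closed]]] _ u])
  fix xs' assume "xs' \<in> TG (Suc (Suc q))"
  then obtain y xs where y: "xs' = xs @ [y]" "y \<in> AC" "xs \<in> TG (Suc q)" by (rule gens_snoc_E)
  obtain x0 xs0 where x0: "xs = x0 # xs0" "x0 \<in> AC" "xs0 \<in> TG q" using y(3) by (rule gens_Suc_E)
  obtain x1 xs1 where x1: "xs = xs1 @ [x1]" "x1 \<in> AC" "xs1 \<in> TG q" using y(3) by (rule gens_snoc_E)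
  let ?p = "pt (Suc q) xs"
  let ?v = "bd q ?p" and ?M = "pt (Suc q) ((x1 \<otimes> y) # xs1)"
  have p: "?p \<in> TC (Suc q)" using y by (simp add: pure_closed)
  have v: "?v \<in> TC q" by (rule lin_closed[OF bar_lin p])
  have M: "?M \<in> TC (Suc q)" using y x1 by (simp add: pure_closed gens_simps)
  have L: "lmul (Suc q) y ?p \<in> TC (Suc q)" by (rule lin_closed[OF lmul_lin[OF y(2)] p])
  have C: "tcons q y ?v \<in> TC (Suc q)" by (rule lin_closed[OF tcons_lin[OF y(2)] v])
  have cl: "tsnoc q y ?v \<in> TC (Suc q)" "rmul (Suc q) y ?p \<in> TC (Suc q)"
    using lin_closed[OF tsnoc_lin[OF y(2)] v] lin_closed[OF rmul_lin[OF y(2)] p] by auto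
  have yxs: "pt (Suc (Suc q)) (y # xs) \<in> TC (Suc (Suc q))" using y by (simp add: pure_closed gens_simps)
  have m1: "mu q \<one> (pt (Suc (Suc q)) (y # xs)) = ?M"
    unfolding x1(1) using x1 y by (simp add: mu_pure)
  have m2: "mu q \<one> (pt (Suc (Suc q)) (xs @ [y])) = lmul (Suc q) y ?p"
    using x0 y by (simp add: mu_pure lmul_pure)
  have m3: "cyc K A q (rmul (Suc q) y ?p) = signed (T (Suc q)) q ?M"
    unfolding x1(1) using x1(2,3) y by (simp add: rmul_pure cyc_pure)
  note sc = signed_closed[OF tpow_ag L] signed_closed[OF tpow_ag C] signed_closed[OF tpow_ag M]
  have "hoch_d K A (Suc q) (cyc K A (Suc q) (pt (Suc (Suc q)) xs')) =
    signed (T (Suc q)) (Suc q) (lmul (Suc q) y ?p \<ominus>\<^bsub>T (Suc q)\<^esub> tcons q y ?v \<oplus>\<^bsub>T (Suc q)\<^esub> signed (T (Suc q)) (Suc q) ?M)"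
    unfolding y(1) using y(2,3) yxs
    by (simp add: cyc_pure lin_signed[OF hoch_lin tpow_ag tpow_ag] hoch_alt bar_Cons_pure m1)
  also have "\<dots> = signed (T (Suc q)) (Suc q) (lmul (Suc q) y ?p) \<ominus>\<^bsub>T (Suc q)\<^esub> signed (T (Suc q)) (Suc q) (tcons q y ?v)
      \<oplus>\<^bsub>T (Suc q)\<^esub> ?M"
    using L C M sc signed_signed[OF tpow_ag M, of "Suc q" "Suc q"]
    by (simp add: a_minus_def signed_add[OF tpow_ag] signed_uminus[OF tpow_ag] signed_even)
  also have "\<dots> = signed (T (Suc q)) q (tcons q y ?v) \<oplus>\<^bsub>T (Suc q)\<^esub> ?M \<oplus>\<^bsub>T (Suc q)\<^esub> signed (T (Suc q)) (Suc q) (lmul (Suc q) y ?p)"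
    unfolding signed_Suc[OF tpow_ag C] using sc M by algebra
  also have "?M = signed (T (Suc q)) q (signed (T (Suc q)) q ?M)"
    using signed_signed[OF tpow_ag M, of q q] by (simp add: signed_even)
  also have "signed (T (Suc q)) q (tcons q y ?v) \<oplus>\<^bsub>T (Suc q)\<^esub> \<dots> = cyc K A q (bd (Suc q) (pt (Suc (Suc q)) xs'))"
    unfolding y(1) bar_snoc_pure[OF y(2,3)] using cl
    by (simp add: lin_add[OF cyc_lin] signed_closed[OF tpow_ag] lin_signed[OF cyc_lin tpow_ag tpow_ag] m3 cyc_tsnoc[OF y(2) v])
  also have "lmul (Suc q) y ?p = mu q \<one> (pt (Suc (Suc q)) xs')" unfolding y(1) m2 ..
  finally show "hoch_d K A (Suc q) (cyc K A (Suc q) (pt (Suc (Suc q)) xs')) =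
    cyc K A q (bd (Suc q) (pt (Suc (Suc q)) xs')) \<oplus>\<^bsub>T (Suc q)\<^esub>
    signed (T (Suc q)) (Suc q) (mu q \<one> (pt (Suc (Suc q)) xs'))" .
qed

lemma hoch_one_minus_cyc:
  assumes u: "u \<in> TC (Suc (Suc q))"
  shows "hoch_d K A (Suc q) (u \<ominus>\<^bsub>T (Suc (Suc q))\<^esub> cyc K A (Suc q) u) =
    bd (Suc q) u \<ominus>\<^bsub>T (Suc q)\<^esub> cyc K A q (bd (Suc q) u)"
proof -
  let ?M = "signed (T (Suc q)) (Suc q) (mu q \<one> u)"
  have c: "?M \<in> TC (Suc q)" "bd (Suc q) u \<in> TC (Suc q)" "cyc K A q (bd (Suc q) u) \<in> TC (Suc q)"
    using lin_closed[OF signed_lin[OF tpow_lm mu_lin[OF AR.one_closed]] u] lin_closed[OF bar_lin u]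
      lin_closed[OF cyc_lin lin_closed[OF bar_lin u]] by auto
  show ?thesis
    unfolding lin_minus[OF hoch_lin tpow_ag tpow_ag u lin_closed[OF cyc_lin u]] hoch_cyc[OF u] hoch_alt[OF u]
    using c by algebra
qed

lemma cyc_pow_lin: "(cyc K A m ^^ i) \<in> lin_maps K (T (Suc m)) (T (Suc m))"
proof (induction i)
  case 0 then show ?case using lin_id[of K "T (Suc m)"] by (simp add: id_def)
next
  case (Suc i) then show ?case using lin_comp[OF Suc cyc_lin] by (simp add: o_def)
qed

lemma cyc_pow_closed: "u \<in> TC (Suc m) \<Longrightarrow> (cyc K A m ^^ i) u \<in> TC (Suc m)"
  by (rule lin_closed[OF cyc_pow_lin])

lemma cyc_pow_period:
  assumes u: "u \<in> TC (Suc m)" shows "(cyc K A m ^^ Suc m) u = u"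
proof (rule tpow_eqI[OF tpow_module cyc_pow_lin lin_id _ u])
  fix xs assume xs: "xs \<in> TG (Suc m)"
  let ?r = "\<lambda>xs::'a list. last xs # butlast xs"
  have r: "?r ys \<in> TG (Suc m)" if "ys \<in> TG (Suc m)" for ys
    using that by (elim gens_snoc_E) (simp add: gens_simps)
  have ri: "(?r ^^ i) xs \<in> TG (Suc m)" for i by (induction i) (use xs r in auto)
  have "(cyc K A m ^^ i) (pt (Suc m) xs) = signed (T (Suc m)) (m * i) (pt (Suc m) ((?r ^^ i) xs))" for i
  proof (induction i)
    case 0 then show ?case by (simp add: signed_0)
  next
    case (Suc i)
    then show ?case using ri[of i] r[OF ri[of i]]
      by (simp add: lin_signed[OF cyc_lin tpow_ag tpow_ag] pure_closed cyc_pure' signed_signed[OF tpow_ag] add.commute)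
  qed
  from this[of "Suc m"] have "(cyc K A m ^^ Suc m) (pt (Suc m) xs) = signed (T (Suc m)) (m * Suc m) (pt (Suc m) xs)"
    using rotate_last[of xs m] xs by (simp only: gens_iff)
  \<comment> \<open>One full turn accumulates the sign \<open>(-1)^(m (m + 1))\<close>, whose
    exponent is always even.\<close>
  also have "\<dots> = pt (Suc m) xs" using signed_parity[of "m * Suc m" 0] by (simp add: signed_0)
  finally show "(cyc K A m ^^ Suc m) (pt (Suc m) xs) = pt (Suc m) xs" .
qed

lemma norm_lin: "cyc_norm K A m \<in> lin_maps K (T (Suc m)) (T (Suc m))"
  unfolding cyc_norm_def[abs_def] by (rule lin_finsum_fun[OF tpow_lm _ cyc_pow_lin]) simp

text \<open>Shifting the sum by one trades the power 0 of \<open>t\<close> for the power m + 1, and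
  these agree because \<open>t\<close> has period m + 1.\<close>

lemma norm_shift:
  assumes u: "u \<in> TC (Suc m)"
  shows "finsum (T (Suc m)) (\<lambda>i. (cyc K A m ^^ Suc i) u) {..m} = cyc_norm K A m u"
proof -
  let ?f = "\<lambda>i. (cyc K A m ^^ i) u"
  have f: "?f \<in> I \<rightarrow> TC (Suc m)" for I using cyc_pow_closed[OF u] by blast
  have "finsum (T (Suc m)) (\<lambda>i. ?f (Suc i)) {..m} \<oplus>\<^bsub>T (Suc m)\<^esub> ?f 0 = ?f (Suc m) \<oplus>\<^bsub>T (Suc m)\<^esub> finsum (T (Suc m)) ?f {..m}"
    using TM.M.finsum_Suc2[of ?f m] TM.M.finsum_Suc[of ?f m] f by simp
  then have "finsum (T (Suc m)) (\<lambda>i. ?f (Suc i)) {..m} \<oplus>\<^bsub>T (Suc m)\<^esub> u = finsum (T (Suc m)) ?f {..m} \<oplus>\<^bsub>T (Suc m)\<^esub> u"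
    using cyc_pow_period[OF u] TM.M.finsum_closed[OF f] u TM.M.a_comm[of u] by (simp del: funpow.simps(2))
  then show ?thesis unfolding cyc_norm_def
    using u TM.M.finsum_closed[OF f] TM.M.finsum_closed[of "\<lambda>i. ?f (Suc i)" "{..m}"] cyc_pow_closed[OF u]
    by (simp del: funpow.simps(2) add: Pi_def)
qed

lemma norm_cyc: "u \<in> TC (Suc m) \<Longrightarrow> cyc_norm K A m (cyc K A m u) = cyc_norm K A m u"
  using norm_shift[of u m] by (simp add: cyc_norm_def funpow_swap1)

lemma cyc_norm': assumes u: "u \<in> TC (Suc m)" shows "cyc K A m (cyc_norm K A m u) = cyc_norm K A m u"
proof -
  have "cyc K A m (cyc_norm K A m u) = finsum (T (Suc m)) (\<lambda>i. (cyc K A m ^^ Suc i) u) {..m}"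
    unfolding cyc_norm_def using lin_finsum[OF cyc_lin tpow_ag tpow_ag, of "{..m}" "\<lambda>i. (cyc K A m ^^ i) u"] cyc_pow_closed[OF u]
    by (simp add: Pi_def)
  then show ?thesis using norm_shift[OF u] by simp
qed

lemma norm_one_minus_cyc:
  assumes u: "u \<in> TC (Suc m)" shows "cyc_norm K A m (u \<ominus>\<^bsub>T (Suc m)\<^esub> cyc K A m u) = \<zero>\<^bsub>T (Suc m)\<^esub>"
  using lin_minus[OF norm_lin tpow_ag tpow_ag u lin_closed[OF cyc_lin u]] lin_closed[OF norm_lin u]
  by (simp add: norm_cyc[OF u] abelian_group.minus_eq_zero_iff[OF tpow_ag])

lemma one_minus_cyc_norm:
  assumes u: "u \<in> TC (Suc m)" shows "cyc_norm K A m u \<ominus>\<^bsub>T (Suc m)\<^esub> cyc K A m (cyc_norm K A m u) = \<zero>\<^bsub>T (Suc m)\<^esub>"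
  using lin_closed[OF norm_lin u] by (simp add: cyc_norm'[OF u] abelian_group.minus_eq_zero_iff[OF tpow_ag])

section \<open>Signed faces under cyclic rotation\<close>

definition sface where
  "sface q c = lift K (T (Suc q)) (\<lambda>xs. signed (T (Suc q)) c (pt (Suc q) (face c xs)))"

lemma sface_mlin: "c \<le> q \<Longrightarrow> mlin K A (Suc (Suc q)) (T (Suc q)) (\<lambda>xs. signed (T (Suc q)) c (pt (Suc q) (face c xs)))"
  by (rule mlin_signed[OF face_mlin tpow_module]) simp

lemma sface_lin: "c \<le> q \<Longrightarrow> sface q c \<in> lin_maps K (T (Suc (Suc q))) (T (Suc q))"
  unfolding sface_def by (rule tpow_lift(1)[OF tpow_module sface_mlin])

lemma sface_pure: "c \<le> q \<Longrightarrow> xs \<in> TG (Suc (Suc q)) \<Longrightarrow>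
    sface q c (pt (Suc (Suc q)) xs) = signed (T (Suc q)) c (pt (Suc q) (face c xs))"
  unfolding sface_def by (rule tpow_lift(2)[OF tpow_module sface_mlin])

lemma bar_sface:
  assumes u: "u \<in> TC (Suc (Suc q))"
  shows "bd (Suc q) u = finsum (T (Suc q)) (\<lambda>c. sface q c u) {..q}"
proof (rule tpow_eqI[OF tpow_module bar_lin lin_finsum_fun[OF tpow_lm _ sface_lin] _ u])
  fix xs assume xs: "xs \<in> TG (Suc (Suc q))"
  show "bd (Suc q) (pt (Suc (Suc q)) xs) = finsum (T (Suc q)) (\<lambda>c. sface q c (pt (Suc (Suc q)) xs)) {..q}"
    unfolding bar_pure[OF xs] lessThan_Suc_atMost
    by (rule TM.M.finsum_cong') (use xs in \<open>auto simp: sface_pure intro!: lin_closed[OF sface_lin] pure_closed\<close>)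
qed auto

lemma sface_cyc:
  assumes c: "Suc c \<le> q" and u: "u \<in> TC (Suc (Suc q))"
  shows "sface q (Suc c) (cyc K A (Suc q) u) = cyc K A q (sface q c u)"
proof (rule tpow_eqI[OF tpow_module lin_comp[OF cyc_lin sface_lin[OF c]] lin_comp[OF sface_lin cyc_lin] _ u])
  show "c \<le> q" using c by simp
  fix xs' assume "xs' \<in> TG (Suc (Suc q))"
  then obtain y xs where y: "xs' = xs @ [y]" "y \<in> AC" "xs \<in> TG (Suc q)" by (rule gens_snoc_E)
  have g: "face c xs \<in> TG q" using c y by (intro face_gens) auto
  have f: "face c (xs @ [y]) = face c xs @ [y]" using y c by (intro face_snoc[of xs q c y]) (auto simp: gens_iff)
  \<comment> \<open>On the left, \<open>t\<close> acts on tensors of order q + 2 with sign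
    \<open>(-1)^(q+1)\<close> and the face c + 1 has sign \<open>(-1)^(c+1)\<close>. Both exponents
    exceed those on the right by one, so the products agree.\<close>
  have sg: "signed V (Suc (Suc (q + c))) x = signed V (c + q) x" for V :: "('k, 'v) module" and x
    by (rule signed_parity) auto
  have p: "pt (Suc q) (y # face c xs) \<in> TC (Suc q)" using g y by (simp add: pure_closed gens_simps)
  show "sface q (Suc c) (cyc K A (Suc q) (pt (Suc (Suc q)) xs')) = cyc K A q (sface q c (pt (Suc (Suc q)) xs'))"
    unfolding y(1) using y(2,3) c f g p sg
    by (simp add: cyc_pure lin_signed[OF sface_lin[OF c] tpow_ag tpow_ag] pure_closed gens_simps sface_pure face_simps signed_signed[OF tpow_ag]
      lin_signed[OF cyc_lin tpow_ag tpow_ag])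
qed

text \<open>Rotation brings the last entry next to the first, so the cyclic term of \<open>b\<close>
  is itself a zeroth face; in this form it joins the other faces in the computation of the
  norm.\<close>

lemma sface_0_cyc:
  assumes u: "u \<in> TC (Suc (Suc q))"
  shows "sface q 0 (cyc K A (Suc q) u) = signed (T (Suc q)) (Suc q) (mu q \<one> u)"
proof (rule tpow_eqI[OF tpow_module lin_comp[OF cyc_lin sface_lin] signed_lin[OF tpow_lm mu_lin[OF AR.one_closed]] _ u])
  fix xs' assume "xs' \<in> TG (Suc (Suc q))"
  then obtain y xs where y: "xs' = xs @ [y]" "y \<in> AC" "xs \<in> TG (Suc q)" by (rule gens_snoc_E)
  obtain x0 xs0 where x0: "xs = x0 # xs0" "x0 \<in> AC" "xs0 \<in> TG q" using y(3) by (rule gens_Suc_E)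
  show "sface q 0 (cyc K A (Suc q) (pt (Suc (Suc q)) xs')) = signed (T (Suc q)) (Suc q) (mu q \<one> (pt (Suc (Suc q)) xs'))"
    unfolding y(1) using y(2,3) mu_pure[OF AR.one_closed x0(2,3) y(2)] x0
    by (simp add: cyc_pure[of "x0 # xs0", simplified] lin_signed[OF sface_lin tpow_ag tpow_ag] pure_closed gens_simps sface_pure face_simps signed_0)
qed simp

text \<open>Read as d_c = t^c d_0 t^(-c): up to rotation there is only one signed face.\<close>

lemma sface_pow:
  assumes u: "u \<in> TC (Suc (Suc q))"
  shows "c \<le> q \<Longrightarrow> sface q c ((cyc K A (Suc q) ^^ c) u) = (cyc K A q ^^ c) (sface q 0 u)"
proof (induction c)
  case (Suc c)
  then show ?case using sface_cyc[OF Suc.prems cyc_pow_closed[OF u]] by simp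
qed simp

lemma norm_cyc_pow: "u \<in> TC (Suc m) \<Longrightarrow> cyc_norm K A m ((cyc K A m ^^ i) u) = cyc_norm K A m u"
  by (induction i) (auto simp: norm_cyc cyc_pow_closed)

lemma cyc_pow_norm: "u \<in> TC (Suc m) \<Longrightarrow> (cyc K A m ^^ i) (cyc_norm K A m u) = cyc_norm K A m u"
  by (induction i) (auto simp: cyc_norm')

text \<open>Both sides equal \<open>N D N\<close>, where \<open>D\<close> is the zeroth face.\<close>

lemma bar_norm:
  assumes u: "u \<in> TC (Suc (Suc q))"
  shows "bd (Suc q) (cyc_norm K A (Suc q) u) = cyc_norm K A q (hoch_d K A (Suc q) u)"
proof -
  let ?t = "cyc K A (Suc q)" and ?N = "cyc_norm K A (Suc q) u"
  let ?G = "\<lambda>j. cyc_norm K A q (sface q 0 ((?t ^^ j) u))"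
  note s0 = sface_lin[of 0 q, simplified]
  note l0 = lin_comp[OF s0 norm_lin]
  have N: "?N \<in> TC (Suc (Suc q))" by (rule lin_closed[OF norm_lin u])
  have s0N: "sface q 0 ?N \<in> TC (Suc q)" by (rule lin_closed[OF s0 N])
  have G: "?G j \<in> TC (Suc q)" for j by (rule lin_closed[OF l0 cyc_pow_closed[OF u]])
  have "bd (Suc q) ?N = finsum (T (Suc q)) (\<lambda>c. (cyc K A q ^^ c) (sface q 0 ?N)) {..q}"
    unfolding bar_sface[OF N]
  proof (rule TM.M.finsum_cong')
    show "(\<lambda>c. (cyc K A q ^^ c) (sface q 0 ?N)) \<in> {..q} \<rightarrow> TC (Suc q)" using cyc_pow_closed[OF s0N] by blast
    show "sface q c ?N = (cyc K A q ^^ c) (sface q 0 ?N)" if "c \<in> {..q}" for c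
      using sface_pow[OF N, of c] cyc_pow_norm[OF u, of c] that by simp
  qed simp
  then have 1: "bd (Suc q) ?N = cyc_norm K A q (sface q 0 ?N)" by (simp add: cyc_norm_def[of K A q])
  \<comment> \<open>With q + 2 tensor factors \<open>t\<close> has period q + 2, so
    \<open>t^(q+2-c)\<close> stands for \<open>t^(-c)\<close>; the power of \<open>t\<close> on the
    left of the face is absorbed by the norm.\<close>
  have Gc: "cyc_norm K A q (sface q c u) = ?G (q + 2 - c)" if c: "c \<le> q" for c
  proof -
    let ?u = "(?t ^^ (q + 2 - c)) u"
    have u': "?u \<in> TC (Suc (Suc q))" by (rule cyc_pow_closed[OF u])
    have "(?t ^^ c) ?u = (?t ^^ (c + (q + 2 - c))) u" by (simp only: funpow_add o_apply)
    also have "c + (q + 2 - c) = Suc (Suc q)" using c by simp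
    finally have e: "(?t ^^ c) ?u = u" using cyc_pow_period[OF u] by simp
    show ?thesis using sface_pow[OF u' c] norm_cyc_pow[OF lin_closed[OF s0 u'], of c] e by simp
  qed
  have "cyc_norm K A q (hoch_d K A (Suc q) u) = cyc_norm K A q (finsum (T (Suc q)) (\<lambda>c. sface q c u) {..q} \<oplus>\<^bsub>T (Suc q)\<^esub> sface q 0 (?t u))"
    unfolding hoch_alt[OF u] bar_sface[OF u] sface_0_cyc[OF u] ..
  also have "\<dots> = finsum (T (Suc q)) (\<lambda>c. cyc_norm K A q (sface q c u)) {..q} \<oplus>\<^bsub>T (Suc q)\<^esub> ?G 1"
    using lin_closed[OF sface_lin u] lin_closed[OF s0 lin_closed[OF cyc_lin u]]
    by (simp add: lin_add[OF norm_lin] TM.M.finsum_closed Pi_def lin_finsum[OF norm_lin tpow_ag tpow_ag])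
  also have "finsum (T (Suc q)) (\<lambda>c. cyc_norm K A q (sface q c u)) {..q} = finsum (T (Suc q)) (\<lambda>c. ?G ((q - c) + 2)) {..q}"
  proof (rule TM.M.finsum_cong')
    show "(\<lambda>c. ?G ((q - c) + 2)) \<in> {..q} \<rightarrow> TC (Suc q)" using G by blast
    show "cyc_norm K A q (sface q c u) = ?G ((q - c) + 2)" if "c \<in> {..q}" for c
      using Gc[of c] that by (simp only: atMost_iff Nat.add_diff_assoc2)
  qed simp
  also have "\<dots> = finsum (T (Suc q)) (\<lambda>i. ?G (i + 2)) ((\<lambda>c. q - c) ` {..q})"
    by (rule TM.M.finsum_reindex[symmetric]) (use G in blast, auto simp: inj_on_def)
  also have "(\<lambda>c. q - c) ` {..q} = {..q}"
  proof (intro subset_antisym subsetI)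
    show "c \<in> (\<lambda>c. q - c) ` {..q}" if "c \<in> {..q}" for c by (rule image_eqI[of _ _ "q - c"]) (use that in auto)
  qed auto
  \<comment> \<open>The faces contribute the exponents 2 up to q + 2 and the cyclic term contributes
    the exponent 1: together one full period.\<close>
  also have "finsum (T (Suc q)) (\<lambda>i. ?G (i + 2)) {..q} \<oplus>\<^bsub>T (Suc q)\<^esub> ?G 1 = finsum (T (Suc q)) (\<lambda>i. ?G (Suc i)) {..Suc q}"
  proof -
    have "(\<lambda>i. ?G (Suc i)) \<in> {..Suc q} \<rightarrow> TC (Suc q)" using G by blast
    from TM.M.finsum_Suc2[OF this] show ?thesis by (simp only: add_2_eq_Suc' One_nat_def)
  qed
  also have "\<dots> = cyc_norm K A q (sface q 0 (finsum (T (Suc (Suc q))) (\<lambda>i. (?t ^^ Suc i) u) {..Suc q}))"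
    by (rule lin_finsum[OF l0 tpow_ag tpow_ag, symmetric]) (use cyc_pow_closed[OF u] in blast)+
  also have "\<dots> = cyc_norm K A q (sface q 0 ?N)" unfolding norm_shift[OF u] ..
  finally show ?thesis using 1 by simp
qed


lemma CC_vert_lin: "CC_vert K A p q \<in> lin_maps K (T (Suc (Suc q))) (T (Suc q))"
  using hoch_lin[of q] lin_uminus_fun[OF tpow_lm bar_lin[of "Suc q"]]
  by (cases "even p") (simp_all add: CC_vert_def[abs_def] CC_def)

lemma CC_horiz_lin: "CC_horiz K A p q \<in> lin_maps K (T (Suc q)) (T (Suc q))"
  using norm_lin[of q] lin_minus_fun[OF tpow_lm lin_id cyc_lin[of q]]
  by (cases "even p") (simp_all add: CC_horiz_def[abs_def] CC_def)

lemma CC_vert_vert: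
  assumes u: "u \<in> carrier (T (Suc (Suc (Suc q))))" shows "CC_vert K A p q (CC_vert K A p (Suc q) u) = \<zero>\<^bsub>T (Suc q)\<^esub>"
proof (cases "even p")
  case True then show ?thesis using hoch_hoch[OF u] by (simp add: CC_vert_def)
next
  case False
  show ?thesis using False bar_bar[OF u] lin_uminus[OF bar_lin tpow_ag tpow_ag lin_closed[OF bar_lin u]]
    by (simp add: CC_vert_def CC_def)
qed

lemma CC_horiz_horiz:
  assumes u: "u \<in> TC (Suc q)" shows "CC_horiz K A p q (CC_horiz K A (Suc p) q u) = \<zero>\<^bsub>T (Suc q)\<^esub>"
  using one_minus_cyc_norm[OF u] norm_one_minus_cyc[OF u] by (simp add: CC_horiz_def CC_def)

text \<open>The sign of \<open>-b'\<close> in the odd columns makes the squares anticommute, so the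
  total differential carries no further signs. For even \<open>p\<close> this is b (1 - t) = (1 - t)
  b', for odd \<open>p\<close> it is b' N = N b.\<close>

lemma CC_vert_horiz:
  assumes u: "u \<in> TC (Suc (Suc q))"
  shows "CC_vert K A p q (CC_horiz K A p (Suc q) u) \<oplus>\<^bsub>T (Suc q)\<^esub> CC_horiz K A p q (CC_vert K A (Suc p) q u) = \<zero>\<^bsub>T (Suc q)\<^esub>"
proof -
  let ?b = "bd (Suc q) u"
  have b: "?b \<in> TC (Suc q)" by (rule lin_closed[OF bar_lin u])
  have tb: "cyc K A q ?b \<in> TC (Suc q)" by (rule lin_closed[OF cyc_lin b])
  show ?thesis
  proof (cases "even p")
    case True
    have "(?b \<ominus>\<^bsub>T (Suc q)\<^esub> cyc K A q ?b) \<oplus>\<^bsub>T (Suc q)\<^esub> (\<ominus>\<^bsub>T (Suc q)\<^esub> ?b \<ominus>\<^bsub>T (Suc q)\<^esub> \<ominus>\<^bsub>T (Suc q)\<^esub> cyc K A q ?b) = \<zero>\<^bsub>T (Suc q)\<^esub>"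
      using b tb by algebra
    then show ?thesis using True b
      by (simp add: CC_vert_def CC_horiz_def CC_def hoch_one_minus_cyc[OF u] lin_uminus[OF cyc_lin tpow_ag tpow_ag])
  next
    case False
    then show ?thesis using lin_closed[OF norm_lin lin_closed[OF hoch_lin u]]
      by (simp add: CC_vert_def CC_horiz_def CC_def bar_norm[OF u] TM.M.l_neg)
  qed
qed

end

section \<open>Total complexes of sets of columns\<close>

lemma dsum_family_module:
  assumes K: "cring K" and V: "\<And>i. i \<in> I \<Longrightarrow> module K (V i)"
  shows "module K (dsum_family I V)"
proof (rule moduleI)
  have ag: "abelian_group (V i)" and am: "abelian_monoid (V i)" if "i \<in> I" for i
    using V[OF that] by (auto simp: module_def abelian_group_def)
  have z: "\<zero>\<^bsub>V i\<^esub> \<in> carrier (V i)" if "i \<in> I" for i using am[OF that] by (rule abelian_monoid.zero_closed)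
  have mem: "x i \<in> carrier (V i)" if "x \<in> (\<Pi>\<^sub>E i\<in>I. carrier (V i))" "i \<in> I" for x i using that by auto
  show "cring K" by (rule K)
  show "abelian_group (dsum_family I V)"
  proof (rule abelian_groupI)
    fix x assume "x \<in> carrier (dsum_family I V)"
    then show "\<exists>y\<in>carrier (dsum_family I V). y \<oplus>\<^bsub>dsum_family I V\<^esub> x = \<zero>\<^bsub>dsum_family I V\<^esub>"
      by (intro bexI[of _ "\<lambda>i\<in>I. \<ominus>\<^bsub>V i\<^esub> x i"]) (auto simp: dsum_family_def mem abelian_group.a_inv_closed[OF ag] abelian_group.l_neg[OF ag] intro!: restrict_ext)
  qed (auto simp: dsum_family_def mem z abelian_monoid.a_closed[OF am] abelian_monoid.l_zero[OF am] abelian_monoid.a_assoc[OF am]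
      abelian_monoid.a_comm[OF am] abelian_monoid.a_lcomm[OF am] abelian_monoid.r_zero[OF am] PiE_iff intro!: restrict_ext extensionalityI[where A=I])
qed (auto simp: dsum_family_def PiE_iff module.smult_closed[OF V] module.smult_l_distr[OF V] module.smult_r_distr[OF V]
   module.smult_assoc1[OF V] module.smult_one[OF V] intro!: restrict_ext extensionalityI[where A=I])

lemma dsum_family_lin:
  assumes "\<And>i. i \<in> I \<Longrightarrow> (\<lambda>x. f x i) \<in> lin_maps K V (W i)"
  shows "(\<lambda>x. \<lambda>i\<in>I. f x i) \<in> lin_maps K V (dsum_family I W)"
  by (rule lin_mapsI) (auto simp: dsum_family_def lin_closed[OF assms] lin_add[OF assms] lin_smult[OF assms] intro!: restrict_ext)

lemma dsum_family_proj: "i \<in> I \<Longrightarrow> (\<lambda>x. x i) \<in> lin_maps K (dsum_family I W) (W i)"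
  by (rule lin_mapsI) (auto simp: dsum_family_def)

lemma dsum_family_ext:
  assumes "x \<in> carrier (dsum_family I V)" "y \<in> carrier (dsum_family I V)" "\<And>i. i \<in> I \<Longrightarrow> x i = y i"
  shows "x = y"
  using assms by (auto simp: dsum_family_def intro: PiE_ext)

lemma dsum_family_zero: "i \<in> I \<Longrightarrow> \<zero>\<^bsub>dsum_family I V\<^esub> i = \<zero>\<^bsub>V i\<^esub>"
  by (simp add: dsum_family_def)

text \<open>\<open>row\<close> is a truncated subtraction; the hypothesis guarantees that position
  \<open>p\<close> of degree n lies above the bottom row, so that nothing is cut off.\<close>

lemma row_simps:
  assumes "p \<in> cols J (n - 1)"
  shows "row n p = Suc (row (n - 1) p)" "row n (Suc p) = row (n - 1) p"
  using assms by (auto simp: row_def cols_def)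

lemma cols_simps: "p \<in> cols J (n - 1) \<Longrightarrow> p \<in> cols J n"
  "p \<in> cols J (n - 1) \<Longrightarrow> Suc p \<in> J \<Longrightarrow> Suc p \<in> cols J n"
  by (auto simp: cols_def)

context kalg begin

lemma Tot_module: "module K (Tot K A J n)"
  unfolding Tot_def CC_def by (rule dsum_family_module[OF AM.R.is_cring tpow_module])

lemma Tot_proj: "p \<in> cols J n \<Longrightarrow> (\<lambda>x. x p) \<in> lin_maps K (Tot K A J n) (T (Suc (row n p)))"
  unfolding Tot_def CC_def by (rule dsum_family_proj)

lemma Tot_d_lin: "Tot_d K A J n \<in> lin_maps K (Tot K A J n) (Tot K A J (n - 1))"
  unfolding Tot_d_def[abs_def] Tot_def[of K A J "n - 1"] CC_def
proof (rule dsum_family_lin)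
  fix p assume p: "p \<in> cols J (n - 1)"
  note pr = Tot_proj[OF cols_simps(1)[OF p], unfolded row_simps[OF p]]
    Tot_proj[OF cols_simps(2)[OF p], unfolded row_simps[OF p]]
  have 1: "(\<lambda>x. CC_vert K A p (row (n - 1) p) (x p)) \<in> lin_maps K (Tot K A J n) (T (Suc (row (n - 1) p)))"
    by (rule lin_comp[OF pr(1) CC_vert_lin])
  have 2: "(\<lambda>x. if Suc p \<in> J then CC_horiz K A p (row (n - 1) p) (x (Suc p)) else \<zero>\<^bsub>T (Suc (row (n - 1) p))\<^esub>)
    \<in> lin_maps K (Tot K A J n) (T (Suc (row (n - 1) p)))"
    using lin_comp[OF pr(2) CC_horiz_lin[of p "row (n - 1) p"]] lin_zero_fun[OF tpow_lm]
    by (cases "Suc p \<in> J") simp_all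
  show "(\<lambda>x. CC_vert K A p (row (n - 1) p) (x p) \<oplus>\<^bsub>T (Suc (row (n - 1) p))\<^esub>
      (if Suc p \<in> J then CC_horiz K A p (row (n - 1) p) (x (Suc p)) else \<zero>\<^bsub>T (Suc (row (n - 1) p))\<^esub>))
    \<in> lin_maps K (Tot K A J n) (T (Suc (row (n - 1) p)))"
    by (rule lin_add_fun[OF tpow_lm 1 2])
qed

lemma Tot_closed: "x \<in> carrier (Tot K A J n) \<Longrightarrow> p \<in> cols J n \<Longrightarrow> x p \<in> TC (Suc (row n p))"
  using lin_closed[OF Tot_proj] by blast

lemma Tot_ext: "x \<in> carrier (Tot K A J n) \<Longrightarrow> y \<in> carrier (Tot K A J n) \<Longrightarrow> (\<And>p. p \<in> cols J n \<Longrightarrow> x p = y p) \<Longrightarrow> x = y"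
  unfolding Tot_def by (rule dsum_family_ext)

lemma Tot_zero: "p \<in> cols J n \<Longrightarrow> \<zero>\<^bsub>Tot K A J n\<^esub> p = \<zero>\<^bsub>T (Suc (row n p))\<^esub>"
  by (simp add: Tot_def dsum_family_zero CC_def)

lemma Tot_d_comp: "p \<in> cols J (n - 1) \<Longrightarrow> Tot_d K A J n x p =
     CC_vert K A p (row (n - 1) p) (x p) \<oplus>\<^bsub>T (Suc (row (n - 1) p))\<^esub>
     (if Suc p \<in> J then CC_horiz K A p (row (n - 1) p) (x (Suc p)) else \<zero>\<^bsub>T (Suc (row (n - 1) p))\<^esub>)"
  by (simp add: Tot_d_def CC_def)

text \<open>Valid for every set \<open>J\<close> of columns: the two mixed terms and the horizontal
  square at \<open>p\<close> all pass through column p + 1 and disappear together when it is absent.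
  If only column p + 2 is absent, the horizontal square is missing, and it contributes zero in any
  case.\<close>

lemma Tot_dd:
  assumes x: "x \<in> carrier (Tot K A J n)"
  shows "Tot_d K A J (n - 1) (Tot_d K A J n x) = \<zero>\<^bsub>Tot K A J (n - 1 - 1)\<^esub>"
proof (rule Tot_ext)
  have y: "Tot_d K A J n x \<in> carrier (Tot K A J (n - 1))" by (rule lin_closed[OF Tot_d_lin x])
  show "Tot_d K A J (n - 1) (Tot_d K A J n x) \<in> carrier (Tot K A J (n - 1 - 1))" by (rule lin_closed[OF Tot_d_lin y])
  show "\<zero>\<^bsub>Tot K A J (n - 1 - 1)\<^esub> \<in> carrier (Tot K A J (n - 1 - 1))"
    using Tot_module[of J "n - 1 - 1"] by (simp add: module_def abelian_group_def abelian_monoid.zero_closed)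
  fix p assume p: "p \<in> cols J (n - 1 - 1)"
  note p1 = cols_simps(1)[OF p]
  define q where "q = row (n - 1 - 1) p"
  have q': "row (n - 2) p = q" by (simp add: q_def)
  have r: "row (n - 1) p = Suc q" "row (n - 1) (Suc p) = q" "row n p = Suc (Suc q)" "row n (Suc p) = Suc q"
    using row_simps[OF p] row_simps[OF p1] by (auto simp: q_def)
  have xp: "x p \<in> carrier (T (Suc (Suc (Suc q))))" using Tot_closed[OF x cols_simps(1)[OF p1]] r by simp
  have v: "CC_vert K A p (Suc q) (x p) \<in> TC (Suc (Suc q))" by (rule lin_closed[OF CC_vert_lin xp])
  have yp: "Tot_d K A J n x p = CC_vert K A p (Suc q) (x p) \<oplus>\<^bsub>T (Suc (Suc q))\<^esub>
     (if Suc p \<in> J then CC_horiz K A p (Suc q) (x (Suc p)) else \<zero>\<^bsub>T (Suc (Suc q))\<^esub>)"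
    using Tot_d_comp[OF p1] r by simp
  have "Tot_d K A J (n - 1) (Tot_d K A J n x) p = \<zero>\<^bsub>T (Suc q)\<^esub>"
  proof (cases "Suc p \<in> J")
    case False
    show ?thesis using Tot_d_comp[OF p] False yp v xp CC_vert_vert[OF xp] by (simp add: q')
  next
    case True
    then have sp: "Suc p \<in> cols J (n - 1)" using p by (auto simp: cols_def)
    have xs: "x (Suc p) \<in> TC (Suc (Suc q))" using Tot_closed[OF x cols_simps(1)[OF sp]] r by simp
    have h: "CC_horiz K A p (Suc q) (x (Suc p)) \<in> TC (Suc (Suc q))" by (rule lin_closed[OF CC_horiz_lin xs])
    have v1: "CC_vert K A (Suc p) q (x (Suc p)) \<in> TC (Suc q)" by (rule lin_closed[OF CC_vert_lin xs])
    have ysp: "Tot_d K A J n x (Suc p) = CC_vert K A (Suc p) q (x (Suc p)) \<oplus>\<^bsub>T (Suc q)\<^esub>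
      (if Suc (Suc p) \<in> J then CC_horiz K A (Suc p) q (x (Suc (Suc p))) else \<zero>\<^bsub>T (Suc q)\<^esub>)" (is "_ = _ \<oplus>\<^bsub>_\<^esub> ?w")
      using Tot_d_comp[OF sp] r by simp
    have w: "?w \<in> TC (Suc q) \<and> CC_horiz K A p q ?w = \<zero>\<^bsub>T (Suc q)\<^esub>"
    proof (cases "Suc (Suc p) \<in> J")
      case True
      then have "Suc (Suc p) \<in> cols J n" using sp by (auto simp: cols_def)
      then have "x (Suc (Suc p)) \<in> TC (Suc q)" using Tot_closed[OF x] row_simps(2)[OF sp] r by fastforce
      then show ?thesis using True CC_horiz_horiz lin_closed[OF CC_horiz_lin] by auto
    next
      case False
      then show ?thesis using lin_zero[OF CC_horiz_lin tpow_ag tpow_ag] by simp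
    qed
    have cl: "CC_vert K A p q (CC_horiz K A p (Suc q) (x (Suc p))) \<in> TC (Suc q)"
      "CC_horiz K A p q (CC_vert K A (Suc p) q (x (Suc p))) \<in> TC (Suc q)"
      using lin_closed[OF CC_vert_lin h] lin_closed[OF CC_horiz_lin v1] by auto
    have "Tot_d K A J (n - 1) (Tot_d K A J n x) p =
      CC_vert K A p q (CC_vert K A p (Suc q) (x p) \<oplus>\<^bsub>T (Suc (Suc q))\<^esub> CC_horiz K A p (Suc q) (x (Suc p))) \<oplus>\<^bsub>T (Suc q)\<^esub>
      CC_horiz K A p q (CC_vert K A (Suc p) q (x (Suc p)) \<oplus>\<^bsub>T (Suc q)\<^esub> ?w)"
      using Tot_d_comp[OF p] True yp ysp by (simp add: q')
    also have "\<dots> = CC_vert K A p q (CC_horiz K A p (Suc q) (x (Suc p))) \<oplus>\<^bsub>T (Suc q)\<^esub> CC_horiz K A p q (CC_vert K A (Suc p) q (x (Suc p)))"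
      using w cl by (simp add: lin_add[OF CC_vert_lin v h] lin_add[OF CC_horiz_lin v1] CC_vert_vert[OF xp])
    also have "\<dots> = \<zero>\<^bsub>T (Suc q)\<^esub>" by (rule CC_vert_horiz[OF xs])
    finally show ?thesis .
  qed
  then show "Tot_d K A J (n - 1) (Tot_d K A J n x) p = \<zero>\<^bsub>Tot K A J (n - 1 - 1)\<^esub> p"
    using Tot_zero[OF p] by (simp add: q_def)
qed

lemma Tot_complex: "chain_complex K (Tot K A J) (Tot_d K A J)"
  by (rule chain_complex.intro) (rule Tot_module Tot_d_lin Tot_dd, assumption?)+

end

section \<open>Connes' exact sequence\<close>

lemma row_add_2: "row n (Suc (Suc p)) = row (n - 2) p"
  by (simp add: row_def)

lemma cols_shift_iff: "p \<in> cols UNIV (n - 2) \<longleftrightarrow> Suc (Suc p) \<in> cols UNIV n"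
  by (auto simp: cols_def)

text \<open>Periodicity of the bicomplex, the reason why the quotient by the first two columns is a
  shifted copy of the whole.\<close>

lemma CC_add_2: "CC_vert K A (Suc (Suc p)) = CC_vert K A p" "CC_horiz K A (Suc (Suc p)) = CC_horiz K A p"
  by (simp_all add: fun_eq_iff CC_vert_def CC_horiz_def CC_def)

context kalg begin

lemma cols_incl_lin: "cols_incl K A n \<in> lin_maps K (Tot K A two_cols n) (Tot K A UNIV n)"
  unfolding cols_incl_def[abs_def] Tot_def[of K A UNIV]
proof (rule dsum_family_lin)
  fix p assume p: "p \<in> cols UNIV n"
  show "(\<lambda>x. if p \<in> two_cols then x p else \<zero>\<^bsub>CC K A p (row n p)\<^esub>) \<in> lin_maps K (Tot K A two_cols n) (CC K A p (row n p))"
  proof (cases "p \<in> two_cols")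
    case True
    then have "p \<in> cols two_cols n" using p by (auto simp: cols_def)
    from Tot_proj[OF this] show ?thesis using True by (simp add: CC_def)
  next
    case False
    then show ?thesis using lin_zero_fun[OF tpow_lm] by (simp add: CC_def)
  qed
qed

lemma cols_incl_chain: "chain_map K (Tot K A two_cols) (Tot_d K A two_cols) (Tot K A UNIV) (Tot_d K A UNIV) (cols_incl K A)"
proof (rule chain_map.intro[OF Tot_complex Tot_complex], rule chain_map_axioms.intro[OF cols_incl_lin])
  fix n and x :: "nat \<Rightarrow> ('a list \<Rightarrow> 'k) set" assume x: "x \<in> carrier (Tot K A two_cols n)"
  note d = lin_closed[OF Tot_d_lin]
  show "Tot_d K A UNIV n (cols_incl K A n x) = cols_incl K A (n - 1) (Tot_d K A two_cols n x)"
  proof (rule Tot_ext)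
    show "Tot_d K A UNIV n (cols_incl K A n x) \<in> carrier (Tot K A UNIV (n - 1))"
      by (rule d[OF lin_closed[OF cols_incl_lin x]])
    show "cols_incl K A (n - 1) (Tot_d K A two_cols n x) \<in> carrier (Tot K A UNIV (n - 1))"
      by (rule lin_closed[OF cols_incl_lin d[OF x]])
    fix p assume p: "p \<in> cols UNIV (n - 1)"
    let ?q = "row (n - 1) p"
    note pn = cols_simps[OF p, simplified]
    have r: "row n p = Suc ?q" "row n (Suc p) = ?q" using row_simps[OF p] by auto
    have z: "CC_vert K A p ?q \<zero>\<^bsub>T (Suc (Suc ?q))\<^esub> = \<zero>\<^bsub>T (Suc ?q)\<^esub>" "CC_horiz K A p ?q \<zero>\<^bsub>T (Suc ?q)\<^esub> = \<zero>\<^bsub>T (Suc ?q)\<^esub>"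
      by (rule lin_zero[OF CC_vert_lin tpow_ag tpow_ag], rule lin_zero[OF CC_horiz_lin tpow_ag tpow_ag])
    have D: "Tot_d K A UNIV n (cols_incl K A n x) p = CC_vert K A p ?q (cols_incl K A n x p) \<oplus>\<^bsub>T (Suc ?q)\<^esub> CC_horiz K A p ?q (cols_incl K A n x (Suc p))"
      using Tot_d_comp[OF p] by simp
    show "Tot_d K A UNIV n (cols_incl K A n x) p = cols_incl K A (n - 1) (Tot_d K A two_cols n x) p"
    proof (cases "p \<in> two_cols")
      case False
      then have "cols_incl K A n x p = \<zero>\<^bsub>T (Suc (Suc ?q))\<^esub>" "cols_incl K A n x (Suc p) = \<zero>\<^bsub>T (Suc ?q)\<^esub>"
        "cols_incl K A (n - 1) (Tot_d K A two_cols n x) p = \<zero>\<^bsub>T (Suc ?q)\<^esub>"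
        using pn p r by (auto simp: cols_incl_def CC_def)
      then show ?thesis unfolding D by (simp only: z) simp
    next
      case True
      then have p2: "p \<in> cols two_cols (n - 1)" using p by (auto simp: cols_def)
      have e: "cols_incl K A n x p = x p" "cols_incl K A (n - 1) (Tot_d K A two_cols n x) p = Tot_d K A two_cols n x p"
        using True pn p by (auto simp: cols_incl_def)
      show ?thesis
      proof (cases "Suc p \<in> two_cols")
        case True
        then show ?thesis unfolding D e Tot_d_comp[OF p2] using pn by (simp add: cols_incl_def)
      next
        case False
        \<comment> \<open>Here p = 1: column 2 carries zero in the large complex and is absent from
          the small one, so the horizontal contribution vanishes on both sides.\<close>
        then have "cols_incl K A n x (Suc p) = \<zero>\<^bsub>T (Suc ?q)\<^esub>" using pn r by (simp add: cols_incl_def CC_def)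
        then show ?thesis unfolding D e Tot_d_comp[OF p2] using False z by simp
      qed
    qed
  qed
qed

lemma cols_shift_lin: "cols_shift n \<in> lin_maps K (Tot K A UNIV n) (Tot K A UNIV (n - 2))"
  unfolding cols_shift_def[abs_def] Tot_def[of K A UNIV "n - 2"]
proof (rule dsum_family_lin)
  fix p assume p: "p \<in> cols UNIV (n - 2)"
  then have "Suc (Suc p) \<in> cols UNIV n" by (simp add: cols_shift_iff)
  from Tot_proj[OF this] show "(\<lambda>x. x (p + 2)) \<in> lin_maps K (Tot K A UNIV n) (CC K A p (row (n - 2) p))"
    by (simp add: CC_def row_add_2)
qed

lemma cols_shift_chain: "chain_map K (Tot K A UNIV) (Tot_d K A UNIV) (\<lambda>n. Tot K A UNIV (n - 2)) (\<lambda>n. Tot_d K A UNIV (n - 2)) cols_shift"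
proof (rule chain_map.intro[OF Tot_complex complex_shift[OF Tot_complex]], rule chain_map_axioms.intro[OF cols_shift_lin])
  fix n and x :: "nat \<Rightarrow> ('a list \<Rightarrow> 'k) set" assume x: "x \<in> carrier (Tot K A UNIV n)"
  note d = lin_closed[OF Tot_d_lin]
  have nn: "n - 2 - 1 = n - 1 - 2" by simp
  show "Tot_d K A UNIV (n - 2) (cols_shift n x) = cols_shift (n - 1) (Tot_d K A UNIV n x)"
  proof (rule Tot_ext)
    show "Tot_d K A UNIV (n - 2) (cols_shift n x) \<in> carrier (Tot K A UNIV (n - 1 - 2))"
      using d[OF lin_closed[OF cols_shift_lin x]] unfolding nn .
    show "cols_shift (n - 1) (Tot_d K A UNIV n x) \<in> carrier (Tot K A UNIV (n - 1 - 2))"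
      by (rule lin_closed[OF cols_shift_lin d[OF x]])
    fix p assume p: "p \<in> cols UNIV (n - 1 - 2)"
    then have p': "p \<in> cols UNIV (n - 2 - 1)" and p2: "Suc (Suc p) \<in> cols UNIV (n - 1)"
      unfolding nn by (simp, simp only: cols_shift_iff)
    have m: "p \<in> cols UNIV (n - 2)" "Suc p \<in> cols UNIV (n - 2)" using cols_simps[OF p'] by auto
    have r: "row (n - 1) (Suc (Suc p)) = row (n - 2 - 1) p" unfolding row_add_2 nn ..
    show "Tot_d K A UNIV (n - 2) (cols_shift n x) p = cols_shift (n - 1) (Tot_d K A UNIV n x) p"
      using p m r unfolding Tot_d_comp[OF p'] by (simp add: cols_shift_def Tot_d_comp[OF p2] CC_add_2)
  qed
qed

lemma connes_short_exact:
  "short_exact K (Tot K A two_cols) (Tot_d K A two_cols) (Tot K A UNIV) (Tot_d K A UNIV)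
    (\<lambda>n. Tot K A UNIV (n - 2)) (\<lambda>n. Tot_d K A UNIV (n - 2)) (cols_incl K A) cols_shift"
proof (rule short_exact.intro[OF cols_incl_chain cols_shift_chain], rule short_exact_axioms.intro)
  have z: "\<zero>\<^bsub>Tot K A J n\<^esub> \<in> carrier (Tot K A J n)" for J n
    using Tot_module[of J n] by (simp add: module_def abelian_group_def abelian_monoid.zero_closed)
  fix n
  show "x = \<zero>\<^bsub>Tot K A two_cols n\<^esub>" if x: "x \<in> carrier (Tot K A two_cols n)" and e: "cols_incl K A n x = \<zero>\<^bsub>Tot K A UNIV n\<^esub>" for x
  proof (rule Tot_ext[OF x z])
    fix p assume p: "p \<in> cols two_cols n"
    then have p': "p \<in> cols UNIV n" by (auto simp: cols_def)
    have "x p = cols_incl K A n x p" using p p' by (simp add: cols_incl_def cols_def)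
    then show "x p = \<zero>\<^bsub>Tot K A two_cols n\<^esub> p" unfolding e Tot_zero[OF p] Tot_zero[OF p'] .
  qed
  show "\<exists>y\<in>carrier (Tot K A UNIV n). cols_shift n y = w" if w: "w \<in> carrier (Tot K A UNIV (n - 2))" for w
  proof
    let ?y = "\<lambda>p\<in>cols UNIV n. if p < 2 then \<zero>\<^bsub>CC K A p (row n p)\<^esub> else w (p - 2)"
    show y: "?y \<in> carrier (Tot K A UNIV n)"
      unfolding Tot_def dsum_family_def partial_object.simps
    proof (rule restrict_PiE_iff[THEN iffD2], rule ballI)
      fix p assume p: "p \<in> cols UNIV n"
      show "(if p < 2 then \<zero>\<^bsub>CC K A p (row n p)\<^esub> else w (p - 2)) \<in> carrier (CC K A p (row n p))"
      proof (cases "p < 2")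
        case True then show ?thesis using tpow_ag[of "Suc (row n p)"]
          by (simp add: CC_def abelian_group_def abelian_monoid.zero_closed)
      next
        case False
        then obtain r where r: "p = Suc (Suc r)" by (metis add_2_eq_Suc le_Suc_ex not_less)
        show ?thesis using Tot_closed[OF w, of r] p False unfolding r by (simp add: CC_def cols_shift_iff row_add_2)
      qed
    qed
    show "cols_shift n ?y = w"
    proof (rule Tot_ext[OF lin_closed[OF cols_shift_lin y] w])
      fix p assume "p \<in> cols UNIV (n - 2)"
      then show "cols_shift n ?y p = w p" by (simp add: cols_shift_def cols_shift_iff)
    qed
  qed
  show "cols_shift n (cols_incl K A n x) = \<zero>\<^bsub>Tot K A UNIV (n - 2)\<^esub>" if x: "x \<in> carrier (Tot K A two_cols n)" for x
  proof (rule Tot_ext[OF lin_closed[OF cols_shift_lin lin_closed[OF cols_incl_lin x]] z])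
    fix p assume p: "p \<in> cols UNIV (n - 2)"
    then show "cols_shift n (cols_incl K A n x) p = \<zero>\<^bsub>Tot K A UNIV (n - 2)\<^esub> p"
      unfolding Tot_zero[OF p] by (simp add: cols_shift_def cols_shift_iff cols_incl_def CC_def row_add_2)
  qed
  show "\<exists>x\<in>carrier (Tot K A two_cols n). cols_incl K A n x = y"
    if y: "y \<in> carrier (Tot K A UNIV n)" and e: "cols_shift n y = \<zero>\<^bsub>Tot K A UNIV (n - 2)\<^esub>" for y
  proof
    let ?x = "\<lambda>p\<in>cols two_cols n. y p"
    show x: "?x \<in> carrier (Tot K A two_cols n)"
      unfolding Tot_def dsum_family_def partial_object.simps
    proof (rule restrict_PiE_iff[THEN iffD2], rule ballI)
      fix p assume "p \<in> cols two_cols n"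
      then have "p \<in> cols UNIV n" by (auto simp: cols_def)
      from Tot_closed[OF y this] show "y p \<in> carrier (CC K A p (row n p))" by (simp add: CC_def)
    qed
    show "cols_incl K A n ?x = y"
    proof (rule Tot_ext[OF lin_closed[OF cols_incl_lin x] y])
      fix p assume p: "p \<in> cols UNIV n"
      show "cols_incl K A n ?x p = y p"
      proof (cases "p \<in> two_cols")
        case True then show ?thesis using p by (auto simp: cols_incl_def cols_def)
      next
        case False
        then obtain r where r: "p = Suc (Suc r)" by (metis insertI1 insertI2 not0_implies_Suc One_nat_def)
        then have rp: "r \<in> cols UNIV (n - 2)" using p by (simp add: cols_shift_iff)
        have "y p = cols_shift n y r" using rp by (simp add: cols_shift_def r)
        also have "\<dots> = \<zero>\<^bsub>T (Suc (row n p))\<^esub>" unfolding e Tot_zero[OF rp] r row_add_2 ..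
        finally show ?thesis using False p by (simp add: cols_incl_def CC_def)
      qed
    qed
  qed
qed

text \<open>Connes' maps with the homology of the first two columns in place of Tor. Exactness and
  naturality are settled at this level; the identification \<open>theta\<close> enters only when the
  final diagram is assembled.\<close>

definition HI where
  "HI n = hmap (Tot K A UNIV) (Tot_d K A UNIV) n (cols_incl K A n)"

definition HB where
  "HB n = connecting (Tot K A two_cols) (Tot_d K A two_cols) (cols_incl K A)
       (Tot K A UNIV) (Tot_d K A UNIV) cols_shift n"

lemmas Tot_shift = homology_shift[of "Tot K A UNIV" 2 "Tot_d K A UNIV"]

lemma connes_row: "exact_row K (HT K A) (HC K A) HI (connes_S K A) HB"
proof -
  interpret E: short_exact K "Tot K A two_cols" "Tot_d K A two_cols" "Tot K A UNIV" "Tot_d K A UNIV"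
    "\<lambda>n. Tot K A UNIV (n - 2)" "\<lambda>n. Tot_d K A UNIV (n - 2)" "cols_incl K A" cols_shift
    by (rule connes_short_exact)
  show ?thesis
    using E.exact_middle E.exact_right E.exact_left
    unfolding Tot_shift exact_row_def HI_def[abs_def] HB_def[abs_def] connes_S_def[abs_def] HT_def HC_def by simp
qed

lemma HT_module: "module K (HT K A n)"
  unfolding HT_def by (rule chain_complex.homology_module[OF Tot_complex])

lemma HC_module: "module K (HC K A n)"
  unfolding HC_def by (rule chain_complex.homology_module[OF Tot_complex])

lemma HI_lin: "HI n \<in> lin_maps K (HT K A n) (HC K A n)"
  and HS_lin: "connes_S K A n \<in> lin_maps K (HC K A n) (HC K A (n - 2))"
  and HB_lin: "HB n \<in> lin_maps K (HC K A (n - 2)) (HT K A (n - 1))"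
  using connes_row by (auto simp: exact_row_def exact_at_def)

end

section \<open>Functoriality\<close>

text \<open>Homomorphisms that may move the unit, as an inclusion of corners does. The operators
  \<open>b\<close>, \<open>b'\<close> and \<open>t\<close> only multiply and permute entries, so
  such maps act on all the complexes.\<close>

locale alg_hom = A: kalg K A + B: kalg K B
  for K :: "('k, 'm) ring_scheme" and A :: "('k, 'a) module" and B :: "('k, 'a) module" +
  fixes f :: "'a \<Rightarrow> 'a"
  assumes f_lin: "f \<in> lin_maps K A B"
    and f_mult: "\<And>x y. \<lbrakk>x \<in> carrier A; y \<in> carrier A\<rbrakk> \<Longrightarrow> f (x \<otimes>\<^bsub>A\<^esub> y) = f x \<otimes>\<^bsub>B\<^esub> f y"
begin

definition tmap where
  "tmap m = lift K (tpow K B m) (\<lambda>xs. pure K B m (map f xs))"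

lemma map_gens: "xs \<in> tpow_gens A m \<Longrightarrow> map f xs \<in> tpow_gens B m"
  using lin_closed[OF f_lin] by (auto simp: gens_iff)

lemma map_mlin: "mlin K A m (tpow K B m) (\<lambda>xs. pure K B m (map f xs))"
  unfolding mlin_def
proof (intro conjI ballI allI impI)
  show "pure K B m (map f xs) \<in> carrier (tpow K B m)" if "xs \<in> tpow_gens A m" for xs
    by (rule B.pure_closed[OF map_gens[OF that]])
  fix us vs assume "set us \<subseteq> carrier A" "set vs \<subseteq> carrier A" "length us + Suc (length vs) = m"
  then have "(\<lambda>x. pure K B m (map f us @ x # map f vs)) \<in> lin_maps K B (tpow K B m)"
    by (intro mlin_lin[OF B.pure_mlin]) (auto intro: lin_closed[OF f_lin])
  from lin_comp[OF f_lin this] show "(\<lambda>x. pure K B m (map f (us @ x # vs))) \<in> lin_maps K A (tpow K B m)" by simp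
qed

lemma tmap_lin: "tmap m \<in> lin_maps K (A.T m) (B.T m)"
  unfolding tmap_def by (rule A.tpow_lift(1)[OF B.tpow_module map_mlin])

lemma tmap_pure: "xs \<in> tpow_gens A m \<Longrightarrow> tmap m (pure K A m xs) = pure K B m (map f xs)"
  unfolding tmap_def by (rule A.tpow_lift(2)[OF B.tpow_module map_mlin])

lemma map_face: "xs \<in> tpow_gens A (Suc m) \<Longrightarrow> i < m \<Longrightarrow> map f (A.face i xs) = B.face i (map f xs)"
  using f_mult by (auto simp: A.face_def B.face_def gens_iff take_map drop_map subset_eq)

lemma tmap_bar:
  assumes u: "u \<in> carrier (A.T (Suc m))"
  shows "tmap m (bar_d K A m u) = bar_d K B m (tmap (Suc m) u)"
proof (rule A.tpow_eqI[OF B.tpow_module lin_comp[OF A.bar_lin tmap_lin] lin_comp[OF tmap_lin B.bar_lin] _ u])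
  fix xs assume xs: "xs \<in> tpow_gens A (Suc m)"
  have c: "A.face i xs \<in> tpow_gens A m" if "i < m" for i by (rule A.face_gens[OF that xs])
  have "tmap m (bar_d K A m (pure K A (Suc m) xs)) =
    finsum (B.T m) (\<lambda>i. tmap m (signed (A.T m) i (pure K A m (A.face i xs)))) {..<m}"
    unfolding A.bar_pure[OF xs]
    by (rule lin_finsum[OF tmap_lin A.tpow_ag B.tpow_ag]) (auto intro!: signed_closed[OF A.tpow_ag] A.pure_closed c)
  also have "\<dots> = finsum (B.T m) (\<lambda>i. signed (B.T m) i (pure K B m (B.face i (map f xs)))) {..<m}"
  proof (rule B.TM.M.finsum_cong')
    show "(\<lambda>i. signed (B.T m) i (pure K B m (B.face i (map f xs)))) \<in> {..<m} \<rightarrow> carrier (B.T m)"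
      by (auto intro!: signed_closed[OF B.tpow_ag] B.pure_closed B.face_gens map_gens[OF xs])
    show "tmap m (signed (A.T m) i (pure K A m (A.face i xs))) = signed (B.T m) i (pure K B m (B.face i (map f xs)))" if "i \<in> {..<m}" for i
      using that c[of i] xs by (simp add: lin_signed[OF tmap_lin A.tpow_ag B.tpow_ag] A.pure_closed tmap_pure map_face)
  qed simp
  also have "\<dots> = bar_d K B m (tmap (Suc m) (pure K A (Suc m) xs))"
    unfolding tmap_pure[OF xs] B.bar_pure[OF map_gens[OF xs]] ..
  finally show "tmap m (bar_d K A m (pure K A (Suc m) xs)) = bar_d K B m (tmap (Suc m) (pure K A (Suc m) xs))" .
qed

text \<open>At the unit \<open>mu\<close> joins the two outer entries directly, so the image of the
  unit under \<open>f\<close> never enters.\<close>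

lemma tmap_mu:
  assumes u: "u \<in> carrier (A.T (Suc (Suc m)))"
  shows "tmap (Suc m) (A.mu m \<one>\<^bsub>A\<^esub> u) = B.mu m \<one>\<^bsub>B\<^esub> (tmap (Suc (Suc m)) u)"
proof (rule A.tpow_eqI[OF B.tpow_module lin_comp[OF A.mu_lin tmap_lin] lin_comp[OF tmap_lin B.mu_lin] _ u])
  fix xs assume "xs \<in> tpow_gens A (Suc (Suc m))"
  then obtain x xs' where xs: "xs = x # xs'" "x \<in> carrier A" "xs' \<in> tpow_gens A (Suc m)" by (rule gens_Suc_E)
  obtain z ys where z: "xs' = ys @ [z]" "z \<in> carrier A" "ys \<in> tpow_gens A m" using xs(3) by (rule gens_snoc_E)
  have c: "f x \<in> carrier B" "f z \<in> carrier B" "map f ys \<in> tpow_gens B m" "x # ys @ [z] \<in> tpow_gens A (Suc (Suc m))"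
    using xs z map_gens lin_closed[OF f_lin] by (auto simp: A.gens_simps)
  show "tmap (Suc m) (A.mu m \<one>\<^bsub>A\<^esub> (pure K A (Suc (Suc m)) xs)) = B.mu m \<one>\<^bsub>B\<^esub> (tmap (Suc (Suc m)) (pure K A (Suc (Suc m)) xs))"
    unfolding xs(1) z(1) tmap_pure[OF c(4)] using xs(2) z(2,3) c
    by (simp add: A.mu_pure tmap_pure A.gens_simps B.mu_pure f_mult)
qed auto

lemma tmap_hoch:
  assumes u: "u \<in> carrier (A.T (Suc (Suc m)))"
  shows "tmap (Suc m) (hoch_d K A (Suc m) u) = hoch_d K B (Suc m) (tmap (Suc (Suc m)) u)"
proof -
  have c: "bar_d K A (Suc m) u \<in> carrier (A.T (Suc m))" "A.mu m \<one>\<^bsub>A\<^esub> u \<in> carrier (A.T (Suc m))"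
    using lin_closed[OF A.bar_lin u] lin_closed[OF A.mu_lin u] by auto
  show ?thesis
    unfolding A.hoch_alt[OF u] B.hoch_alt[OF lin_closed[OF tmap_lin u]]
    using c by (simp add: lin_add[OF tmap_lin] signed_closed[OF A.tpow_ag] tmap_bar u lin_signed[OF tmap_lin A.tpow_ag B.tpow_ag] tmap_mu)
qed

lemma tmap_cyc:
  assumes u: "u \<in> carrier (A.T (Suc m))"
  shows "tmap (Suc m) (cyc K A m u) = cyc K B m (tmap (Suc m) u)"
proof (rule A.tpow_eqI[OF B.tpow_module lin_comp[OF A.cyc_lin tmap_lin] lin_comp[OF tmap_lin B.cyc_lin] _ u])
  fix xs assume "xs \<in> tpow_gens A (Suc m)"
  then obtain y ys where y: "xs = ys @ [y]" "y \<in> carrier A" "ys \<in> tpow_gens A m" by (rule gens_snoc_E)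
  show "tmap (Suc m) (cyc K A m (pure K A (Suc m) xs)) = cyc K B m (tmap (Suc m) (pure K A (Suc m) xs))"
    unfolding y(1) using y(2,3) lin_closed[OF f_lin] map_gens[OF y(3)]
    by (simp add: A.cyc_pure B.cyc_pure lin_signed[OF tmap_lin A.tpow_ag B.tpow_ag] A.pure_closed A.gens_simps tmap_pure)
qed

lemma tmap_norm:
  assumes u: "u \<in> carrier (A.T (Suc m))"
  shows "tmap (Suc m) (cyc_norm K A m u) = cyc_norm K B m (tmap (Suc m) u)"
proof -
  have p: "tmap (Suc m) ((cyc K A m ^^ i) u) = (cyc K B m ^^ i) (tmap (Suc m) u)" for i
    by (induction i) (simp_all add: tmap_cyc A.cyc_pow_closed[OF u])
  show ?thesis unfolding cyc_norm_def
    by (subst lin_finsum[OF tmap_lin A.tpow_ag B.tpow_ag]) (auto intro!: A.cyc_pow_closed[OF u] simp: p)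
qed

lemma tmap_vert:
  assumes u: "u \<in> carrier (A.T (Suc (Suc q)))"
  shows "tmap (Suc q) (CC_vert K A p q u) = CC_vert K B p q (tmap (Suc (Suc q)) u)"
  using lin_closed[OF A.bar_lin u]
  by (simp add: CC_vert_def CC_def tmap_hoch[OF u] tmap_bar[OF u] lin_uminus[OF tmap_lin A.tpow_ag B.tpow_ag])

lemma tmap_horiz:
  assumes u: "u \<in> carrier (A.T (Suc q))"
  shows "tmap (Suc q) (CC_horiz K A p q u) = CC_horiz K B p q (tmap (Suc q) u)"
  using lin_closed[OF A.cyc_lin u] u
  by (simp add: CC_horiz_def CC_def tmap_cyc[OF u] tmap_norm[OF u] lin_minus[OF tmap_lin A.tpow_ag B.tpow_ag])

section \<open>Induced maps on total complexes and on homology\<close>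

definition totmap where
  "totmap J n x = (\<lambda>p\<in>cols J n. tmap (Suc (row n p)) (x p))"

lemma totmap_lin: "totmap J n \<in> lin_maps K (Tot K A J n) (Tot K B J n)"
  unfolding totmap_def[abs_def] Tot_def[of K B] CC_def
  by (rule dsum_family_lin) (rule lin_comp[OF A.Tot_proj tmap_lin])

lemma totmap_chain: "chain_map K (Tot K A J) (Tot_d K A J) (Tot K B J) (Tot_d K B J) (totmap J)"
proof (rule chain_map.intro[OF A.Tot_complex B.Tot_complex], rule chain_map_axioms.intro[OF totmap_lin])
  fix n and x :: "nat \<Rightarrow> ('a list \<Rightarrow> 'k) set" assume x: "x \<in> carrier (Tot K A J n)"
  show "Tot_d K B J n (totmap J n x) = totmap J (n - 1) (Tot_d K A J n x)"
  proof (rule B.Tot_ext)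
    show "Tot_d K B J n (totmap J n x) \<in> carrier (Tot K B J (n - 1))"
      by (rule lin_closed[OF B.Tot_d_lin lin_closed[OF totmap_lin x]])
    show "totmap J (n - 1) (Tot_d K A J n x) \<in> carrier (Tot K B J (n - 1))"
      by (rule lin_closed[OF totmap_lin lin_closed[OF A.Tot_d_lin x]])
    fix p assume p: "p \<in> cols J (n - 1)"
    let ?q = "row (n - 1) p"
    note pn = cols_simps[OF p] and r = row_simps[OF p]
    have xp: "x p \<in> carrier (A.T (Suc (Suc ?q)))" using A.Tot_closed[OF x pn(1)] r by simp
    have v: "CC_vert K A p ?q (x p) \<in> carrier (A.T (Suc ?q))" by (rule lin_closed[OF A.CC_vert_lin xp])
    show "Tot_d K B J n (totmap J n x) p = totmap J (n - 1) (Tot_d K A J n x) p"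
    proof (cases "Suc p \<in> J")
      case True
      have xs: "x (Suc p) \<in> carrier (A.T (Suc ?q))" using A.Tot_closed[OF x pn(2)[OF True]] r by simp
      have h: "CC_horiz K A p ?q (x (Suc p)) \<in> carrier (A.T (Suc ?q))" by (rule lin_closed[OF A.CC_horiz_lin xs])
      show ?thesis unfolding B.Tot_d_comp[OF p]
        using True p pn(1) pn(2)[OF True] r
        by (simp add: totmap_def A.Tot_d_comp[OF p] lin_add[OF tmap_lin v h] tmap_vert[OF xp] tmap_horiz[OF xs])
    next
      case False
      have v': "CC_vert K B p ?q (tmap (Suc (Suc ?q)) (x p)) \<in> carrier (B.T (Suc ?q))"
        by (rule lin_closed[OF B.CC_vert_lin lin_closed[OF tmap_lin xp]])
      show ?thesis unfolding B.Tot_d_comp[OF p]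
        using False p pn(1) r v v'
        by (simp add: totmap_def A.Tot_d_comp[OF p] tmap_vert[OF xp])
    qed
  qed
qed

lemma totmap_cols_incl:
  assumes x: "x \<in> carrier (Tot K A two_cols n)"
  shows "totmap UNIV n (cols_incl K A n x) = cols_incl K B n (totmap two_cols n x)"
proof (rule B.Tot_ext)
  show "totmap UNIV n (cols_incl K A n x) \<in> carrier (Tot K B UNIV n)"
    by (rule lin_closed[OF totmap_lin lin_closed[OF A.cols_incl_lin x]])
  show "cols_incl K B n (totmap two_cols n x) \<in> carrier (Tot K B UNIV n)"
    by (rule lin_closed[OF B.cols_incl_lin lin_closed[OF totmap_lin x]])
  fix p assume p: "p \<in> cols UNIV n"
  show "totmap UNIV n (cols_incl K A n x) p = cols_incl K B n (totmap two_cols n x) p"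
  proof (cases "p \<in> two_cols")
    case True
    then have "p \<in> cols two_cols n" using p by (auto simp: cols_def)
    then show ?thesis using True p by (simp add: totmap_def cols_incl_def)
  next
    case False
    then show ?thesis using p lin_zero[OF tmap_lin A.tpow_ag B.tpow_ag] by (simp add: totmap_def cols_incl_def CC_def)
  qed
qed

lemma totmap_cols_shift:
  "totmap UNIV (n - 2) (cols_shift n x) = cols_shift n (totmap UNIV n x)"
  by (auto simp: totmap_def cols_shift_def cols_shift_iff row_add_2 intro!: restrict_ext)

definition hm where
  "hm J n = hmap (Tot K B J) (Tot_d K B J) n (totmap J n)"

lemma hm_lin: "hm J n \<in> lin_maps K (homology (Tot K A J) (Tot_d K A J) n) (homology (Tot K B J) (Tot_d K B J) n)"
  unfolding hm_def by (rule chain_map.hmap_lin[OF totmap_chain])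

lemma hm_HI: assumes x: "x \<in> carrier (HT K A n)" shows "hm UNIV n (A.HI n x) = B.HI n (hm two_cols n x)"
proof -
  interpret a: chain_map K "Tot K A two_cols" "Tot_d K A two_cols" "Tot K B two_cols" "Tot_d K B two_cols" "totmap two_cols" by (rule totmap_chain)
  interpret b: chain_map K "Tot K A UNIV" "Tot_d K A UNIV" "Tot K B UNIV" "Tot_d K B UNIV" "totmap UNIV" by (rule totmap_chain)
  interpret c: chain_map K "Tot K A two_cols" "Tot_d K A two_cols" "Tot K A UNIV" "Tot_d K A UNIV" "cols_incl K A" by (rule A.cols_incl_chain)
  interpret d: chain_map K "Tot K B two_cols" "Tot_d K B two_cols" "Tot K B UNIV" "Tot_d K B UNIV" "cols_incl K B" by (rule B.cols_incl_chain)
  obtain z where z: "z \<in> cycles (Tot K A two_cols) (Tot_d K A two_cols) n" "x = hclass (Tot K A two_cols) (Tot_d K A two_cols) n z"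
    using a.X.homology_rep x unfolding HT_def by metis
  show ?thesis unfolding z(2) hm_def A.HI_def B.HI_def c.hmap_hclass[OF z(1)] a.hmap_hclass[OF z(1)]
    b.hmap_hclass[OF c.f_cycle[OF z(1)]] d.hmap_hclass[OF a.f_cycle[OF z(1)]]
    totmap_cols_incl[OF a.X.cycle_closed[OF z(1)]] ..
qed

lemma hm_HS: assumes x: "x \<in> carrier (HC K A n)" shows "hm UNIV (n - 2) (connes_S K A n x) = connes_S K B n (hm UNIV n x)"
proof -
  interpret b: chain_map K "Tot K A UNIV" "Tot_d K A UNIV" "Tot K B UNIV" "Tot_d K B UNIV" "totmap UNIV" by (rule totmap_chain)
  interpret c: chain_map K "Tot K A UNIV" "Tot_d K A UNIV" "\<lambda>n. Tot K A UNIV (n - 2)" "\<lambda>n. Tot_d K A UNIV (n - 2)" cols_shift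
    by (rule A.cols_shift_chain)
  interpret d: chain_map K "Tot K B UNIV" "Tot_d K B UNIV" "\<lambda>n. Tot K B UNIV (n - 2)" "\<lambda>n. Tot_d K B UNIV (n - 2)" cols_shift
    by (rule B.cols_shift_chain)
  obtain z where z: "z \<in> cycles (Tot K A UNIV) (Tot_d K A UNIV) n" "x = hclass (Tot K A UNIV) (Tot_d K A UNIV) n z"
    using b.X.homology_rep x unfolding HC_def by metis
  have "cols_shift n z \<in> cycles (Tot K A UNIV) (Tot_d K A UNIV) (n - 2)"
    using c.f_cycle[OF z(1)] by (simp add: cycles_def)
  from b.hmap_hclass[OF this]
  show ?thesis unfolding z(2) hm_def connes_S_def c.hmap_hclass[OF z(1), unfolded A.Tot_shift]
    b.hmap_hclass[OF z(1)] d.hmap_hclass[OF b.f_cycle[OF z(1)], unfolded B.Tot_shift] totmap_cols_shift .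
qed

lemma hm_HB: assumes x: "x \<in> carrier (HC K A (n - 2))" shows "hm two_cols (n - 1) (A.HB n x) = B.HB n (hm UNIV (n - 2) x)"
proof -
  \<comment> \<open>The map on the quotients is the same map two degrees lower, regarded as a chain
    map between shifted complexes.\<close>
  have s: "chain_map K (\<lambda>n. Tot K A UNIV (n - 2)) (\<lambda>n. Tot_d K A UNIV (n - 2)) (\<lambda>n. Tot K B UNIV (n - 2)) (\<lambda>n. Tot_d K B UNIV (n - 2))
    (\<lambda>n. totmap UNIV (n - 2))"
  proof (rule chain_map.intro[OF complex_shift[OF A.Tot_complex] complex_shift[OF B.Tot_complex]], rule chain_map_axioms.intro)
    fix n :: int and x
    have nn: "n - 1 - 2 = n - 2 - (1 :: int)" by simp
    show "totmap UNIV (n - 2) \<in> lin_maps K (Tot K A UNIV (n - 2)) (Tot K B UNIV (n - 2))" by (rule totmap_lin)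
    show "x \<in> carrier (Tot K A UNIV (n - 2)) \<Longrightarrow>
      Tot_d K B UNIV (n - 2) (totmap UNIV (n - 2) x) = totmap UNIV (n - 1 - 2) (Tot_d K A UNIV (n - 2) x)"
      unfolding nn by (rule chain_map.f_d[OF totmap_chain])
  qed
  show ?thesis
    using connecting_natural[OF A.connes_short_exact B.connes_short_exact totmap_chain totmap_chain s, of x n] x
    unfolding A.Tot_shift B.Tot_shift hm_def A.HB_def B.HB_def HC_def
    by (simp add: totmap_cols_incl totmap_cols_shift)
qed

end

text \<open>The composite is given as a separate \<open>h\<close> that agrees with it on the
  carrier. Compositions that simplify there to an identity, to zero or to another compression are
  thereby treated uniformly.\<close>

lemma hm_comp:
  assumes "alg_hom K A B f" "alg_hom K B C g" "alg_hom K A C h" and h: "\<And>x. x \<in> carrier A \<Longrightarrow> g (f x) = h x"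
    and \<zeta>: "\<zeta> \<in> carrier (homology (Tot K A J) (Tot_d K A J) n)"
  shows "alg_hom.hm K C g J n (alg_hom.hm K B f J n \<zeta>) = alg_hom.hm K C h J n \<zeta>"
proof -
  interpret f: alg_hom K A B f by fact
  interpret g: alg_hom K B C g by fact
  interpret h: alg_hom K A C h by fact
  have t: "g.tmap m (f.tmap m u) = h.tmap m u" if u: "u \<in> carrier (f.A.T m)" for m u
  proof (rule f.A.tpow_eqI[OF g.B.tpow_module lin_comp[OF f.tmap_lin g.tmap_lin] h.tmap_lin _ u])
    fix xs assume xs: "xs \<in> tpow_gens A m"
    have "map g (map f xs) = map h xs" using xs h by (auto simp: gens_iff)
    then show "g.tmap m (f.tmap m (pure K A m xs)) = h.tmap m (pure K A m xs)"
      by (simp only: f.tmap_pure[OF xs] g.tmap_pure[OF f.map_gens[OF xs]] h.tmap_pure[OF xs])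
  qed
  show ?thesis unfolding f.hm_def g.hm_def h.hm_def
  proof (rule hmap_comp[OF f.totmap_chain g.totmap_chain h.totmap_chain _ \<zeta>])
    fix x assume "x \<in> carrier (Tot K A J n)"
    then show "g.totmap J n (f.totmap J n x) = h.totmap J n x"
      using f.A.Tot_closed t by (auto simp: f.totmap_def g.totmap_def h.totmap_def intro!: restrict_ext)
  qed
qed

lemma hm_id:
  assumes "alg_hom K A A f" and f: "\<And>x. x \<in> carrier A \<Longrightarrow> f x = x"
    and \<zeta>: "\<zeta> \<in> carrier (homology (Tot K A J) (Tot_d K A J) n)"
  shows "alg_hom.hm K A f J n \<zeta> = \<zeta>"
proof -
  interpret f: alg_hom K A A f by fact
  interpret c: chain_map K "Tot K A J" "Tot_d K A J" "Tot K A J" "Tot_d K A J" "f.totmap J" by (rule f.totmap_chain)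
  have t: "f.tmap m u = u" if u: "u \<in> carrier (f.A.T m)" for m u
  proof (rule f.A.tpow_eqI[OF f.A.tpow_module f.tmap_lin lin_id _ u])
    fix xs assume xs: "xs \<in> tpow_gens A m"
    have "map f xs = xs" using xs f by (intro map_idI) (auto simp: gens_iff)
    then show "f.tmap m (pure K A m xs) = pure K A m xs" unfolding f.tmap_pure[OF xs] by simp
  qed
  obtain z where z: "z \<in> cycles (Tot K A J) (Tot_d K A J) n" "\<zeta> = hclass (Tot K A J) (Tot_d K A J) n z"
    using c.X.homology_rep \<zeta> by metis
  note zc = c.X.cycle_closed[OF z(1)]
  have "f.totmap J n z = z"
    by (rule f.A.Tot_ext[OF c.f_closed[OF zc] zc]) (use f.A.Tot_closed[OF zc] in \<open>simp add: f.totmap_def t\<close>)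
  then show ?thesis unfolding f.hm_def z(2) c.hmap_hclass[OF z(1)] by simp
qed

lemma incl_map_hm:
  assumes "alg_hom K A B (\<lambda>x. x)"
  shows "incl_map K J B n = alg_hom.hm K B (\<lambda>x. x) J n"
proof -
  interpret f: alg_hom K A B "\<lambda>x. x" by fact
  show ?thesis by (simp add: incl_map_def[abs_def] f.hm_def f.totmap_def[abs_def] f.tmap_def CC_def)
qed

section \<open>Lifting along surjections\<close>

text \<open>By Zorn there is a maximal submodule \<open>G\<close> meeting \<open>N\<close>
  trivially. If \<open>w\<close> lay outside G + N, then G + K w would still meet \<open>N\<close>
  trivially: an element of \<open>N\<close> with nonzero coefficient at \<open>w\<close> could be
  divided by that coefficient and would put \<open>w\<close> into G + N.\<close>

lemma submodule_complement:
  fixes M (structure)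
  assumes K: "field K" and M: "module K M" and N: "submodule N K M"
  shows "\<exists>G. submodule G K M \<and> G \<inter> N \<subseteq> {\<zero>} \<and> (\<forall>w\<in>carrier M. \<exists>g\<in>G. \<exists>n\<in>N. w = g \<oplus> n)"
proof -
  interpret K: field K by fact
  interpret M: module K M by fact
  have neg: "\<ominus> a = (\<ominus>\<^bsub>K\<^esub> \<one>\<^bsub>K\<^esub>) \<odot> a" if "a \<in> carrier M" for a using that by (simp add: M.smult_l_minus)
  have sub: "submodule G K M" if G: "G \<subseteq> carrier M" "\<zero> \<in> G" "\<And>u v. u \<in> G \<Longrightarrow> v \<in> G \<Longrightarrow> u \<oplus> v \<in> G"
    "\<And>c u. c \<in> carrier K \<Longrightarrow> u \<in> G \<Longrightarrow> c \<odot> u \<in> G" for G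
    by (rule M.submoduleI) (use G in \<open>auto simp: neg subset_eq\<close>)
  have sD: "G \<subseteq> carrier M" "\<zero> \<in> G" "\<And>u v. u \<in> G \<Longrightarrow> v \<in> G \<Longrightarrow> u \<oplus> v \<in> G" "\<And>c u. c \<in> carrier K \<Longrightarrow> u \<in> G \<Longrightarrow> c \<odot> u \<in> G"
    if "submodule G K M" for G
    using M.submoduleE(1,4,5)[OF that] subgroup.one_closed[OF submodule.axioms(1)[OF that]] by auto
  define GG where "GG = {G. submodule G K M \<and> G \<inter> N \<subseteq> {\<zero>}}"
  have "\<exists>G\<in>GG. \<forall>X\<in>GG. G \<subseteq> X \<longrightarrow> X = G"
  proof (rule subset_Zorn_nonempty)
    have "submodule {\<zero>} K M" by (rule sub) auto
    then show "GG \<noteq> {}" unfolding GG_def by blast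
    fix C assume C: "C \<noteq> {}" "subset.chain GG C"
    then have s: "submodule X K M" "X \<inter> N \<subseteq> {\<zero>}" if "X \<in> C" for X
      using that by (auto simp: subset.chain_def GG_def)
    have ch: "X \<subseteq> Y \<or> Y \<subseteq> X" if "X \<in> C" "Y \<in> C" for X Y using C(2) that unfolding subset.chain_def by blast
    have "submodule (\<Union>C) K M"
    proof (rule sub)
      show "u \<oplus> v \<in> \<Union>C" if uv: "u \<in> \<Union>C" "v \<in> \<Union>C" for u v
      proof -
        obtain X Y where X: "X \<in> C" "u \<in> X" and Y: "Y \<in> C" "v \<in> Y" using uv by blast
        then obtain Z where "Z \<in> C" "u \<in> Z" "v \<in> Z" using ch[OF X(1) Y(1)] by blast
        then show ?thesis using sD(3)[OF s(1)] by blast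
      qed
      show "\<Union>C \<subseteq> carrier M" using sD(1)[OF s(1)] by blast
      show "\<zero> \<in> \<Union>C" using sD(2)[OF s(1)] C(1) by blast
      show "c \<odot> u \<in> \<Union>C" if "c \<in> carrier K" "u \<in> \<Union>C" for c u using that sD(4)[OF s(1)] by blast
    qed
    then show "\<Union>C \<in> GG" using s(2) unfolding GG_def by blast
  qed
  then obtain G where "G \<in> GG" and max: "\<And>X. X \<in> GG \<Longrightarrow> G \<subseteq> X \<Longrightarrow> X = G" by blast
  then have Gs: "submodule G K M" and GN: "G \<inter> N \<subseteq> {\<zero>}" by (simp_all add: GG_def)
  note GD = sD[OF Gs] and ND = sD[OF N]
  note Gc = subsetD[OF GD(1)] and Nc = subsetD[OF ND(1)]
  have "\<exists>g\<in>G. \<exists>n\<in>N. w = g \<oplus> n" if w: "w \<in> carrier M" for w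
  proof (rule ccontr)
    assume no: "\<not> ?thesis"
    define G' where "G' = (\<lambda>(g, c). g \<oplus> c \<odot> w) ` (G \<times> carrier K)"
    have G'I: "g \<oplus> c \<odot> w \<in> G'" if "g \<in> G" "c \<in> carrier K" for g c using that unfolding G'_def by force
    have "submodule G' K M"
    proof (rule sub)
      show "G' \<subseteq> carrier M" using w Gc by (auto simp: G'_def)
      show "\<zero> \<in> G'" using G'I[OF GD(2) K.zero_closed] w by simp
      show "x \<oplus> y \<in> G'" if "x \<in> G'" "y \<in> G'" for x y
      proof -
        obtain g c h d where x: "x = g \<oplus> c \<odot> w" "g \<in> G" "c \<in> carrier K" and y: "y = h \<oplus> d \<odot> w" "h \<in> G" "d \<in> carrier K"
          using \<open>x \<in> G'\<close> \<open>y \<in> G'\<close> unfolding G'_def by auto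
        have "x \<oplus> y = g \<oplus> h \<oplus> (c \<oplus>\<^bsub>K\<^esub> d) \<odot> w" unfolding x y using x y w Gc by (simp add: M.smult_l_distr M.M.a_ac)
        then show ?thesis using G'I[OF GD(3)[OF x(2) y(2)], of "c \<oplus>\<^bsub>K\<^esub> d"] x y by simp
      qed
      show "d \<odot> x \<in> G'" if d: "d \<in> carrier K" and "x \<in> G'" for d x
      proof -
        obtain g c where x: "x = g \<oplus> c \<odot> w" "g \<in> G" "c \<in> carrier K" using \<open>x \<in> G'\<close> unfolding G'_def by auto
        have "d \<odot> x = d \<odot> g \<oplus> (d \<otimes>\<^bsub>K\<^esub> c) \<odot> w" unfolding x using x w Gc d by (simp add: M.smult_r_distr M.smult_assoc1)
        then show ?thesis using G'I[OF GD(4)[OF d x(2)], of "d \<otimes>\<^bsub>K\<^esub> c"] x d by simp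
      qed
    qed
    moreover have "x = \<zero>" if "x \<in> G'" and xN: "x \<in> N" for x
    proof -
      obtain g c where x: "x = g \<oplus> c \<odot> w" "g \<in> G" "c \<in> carrier K" using \<open>x \<in> G'\<close> unfolding G'_def by auto
      note gc = Gc[OF x(2)]
      have "c = \<zero>\<^bsub>K\<^esub>"
      proof (rule ccontr)
        assume c: "c \<noteq> \<zero>\<^bsub>K\<^esub>"
        let ?i = "inv\<^bsub>K\<^esub> c"
        have i: "?i \<in> carrier K" "?i \<otimes>\<^bsub>K\<^esub> c = \<one>\<^bsub>K\<^esub>" using c x(3) K.field_Units K.Units_l_inv by auto
        have "?i \<odot> x = ?i \<odot> g \<oplus> w" unfolding x(1) using i gc w x(3) by (simp add: M.smult_r_distr M.smult_assoc1[symmetric])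
        then have "w = (\<ominus>\<^bsub>K\<^esub> ?i) \<odot> g \<oplus> ?i \<odot> x" using i gc w by (simp add: M.smult_l_minus M.M.r_neg1)
        moreover have "(\<ominus>\<^bsub>K\<^esub> ?i) \<odot> g \<in> G" "?i \<odot> x \<in> N" using GD(4) ND(4) i x(2) xN by simp_all
        ultimately show False using no by blast
      qed
      then have "x \<in> G" using x gc w by simp
      then show ?thesis using GN xN by blast
    qed
    ultimately have "G' \<in> GG" unfolding GG_def by blast
    moreover have "g \<in> G'" if "g \<in> G" for g using G'I[OF that K.zero_closed] Gc[OF that] w by simp
    ultimately have "G' = G" using max by blast
    then have "w \<in> G" using G'I[OF GD(2) K.one_closed] w by simp
    then show False using no ND(2) w M.M.r_zero by metis
  qed
  then show ?thesis using Gs GN by blast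
qed

text \<open>\<open>p\<close> is injective on a complement of its kernel, so preimages taken there
  are unique and therefore depend linearly on the vector.\<close>

lemma vector_space_lift:
  fixes M (structure)
  assumes K: "field K" and V: "module K V" and M: "module K M" and M': "module K M'"
    and p: "p \<in> lin_maps K M M'" and F: "F \<in> lin_maps K V M'"
    and img: "\<And>v. v \<in> carrier V \<Longrightarrow> \<exists>m\<in>carrier M. p m = F v"
  shows "\<exists>g\<in>lin_maps K V M. \<forall>v\<in>carrier V. p (g v) = F v"
proof -
  interpret V: module K V by fact
  interpret M: module K M by fact
  interpret M': module K M' by fact
  note ags = M.M.abelian_group_axioms M'.M.abelian_group_axioms
  have "submodule {m \<in> carrier M. p m = \<zero>\<^bsub>M'\<^esub>} K M"
    by (rule M.submoduleI) (auto simp: lin_zero[OF p ags] lin_add[OF p] lin_smult[OF p] lin_uminus[OF p ags])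
  from submodule_complement[OF K M this] obtain G where G: "submodule G K M"
    and GN: "\<And>x. x \<in> G \<Longrightarrow> x \<in> carrier M \<Longrightarrow> p x = \<zero>\<^bsub>M'\<^esub> \<Longrightarrow> x = \<zero>"
    and GM: "\<And>w. w \<in> carrier M \<Longrightarrow> \<exists>g\<in>G. \<exists>n\<in>carrier M. p n = \<zero>\<^bsub>M'\<^esub> \<and> w = g \<oplus> n" by blast
  note GE = M.submoduleE(1,3,4,5)[OF G]
  note Gc = subsetD[OF GE(1)]
  have uniq: "x = y" if "x \<in> G" "y \<in> G" "p x = p y" for x y
  proof -
    note c = Gc[OF that(1)] Gc[OF that(2)]
    have "x \<ominus> y \<in> G" using that(1,2) by (simp add: a_minus_def GE(2,4))
    moreover have "p (x \<ominus> y) = \<zero>\<^bsub>M'\<^esub>"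
      using lin_minus[OF p ags c] that(3) lin_closed[OF p c(2)] by (simp add: M'.M.minus_eq_zero_iff)
    ultimately show ?thesis using GN[of "x \<ominus> y"] c M.M.minus_eq_zero_iff by simp
  qed
  have "\<exists>g. g \<in> G \<and> p g = F v" if v: "v \<in> carrier V" for v
  proof -
    obtain m where m: "m \<in> carrier M" "p m = F v" using img[OF v] by blast
    obtain g n where "g \<in> G" "n \<in> carrier M" "p n = \<zero>\<^bsub>M'\<^esub>" "m = g \<oplus> n" using GM[OF m(1)] by blast
    then show ?thesis using m(2) Gc lin_add[OF p, of g n] lin_closed[OF p, of g] by auto
  qed
  then obtain g where g: "\<And>v. v \<in> carrier V \<Longrightarrow> g v \<in> G \<and> p (g v) = F v" by metis
  then have gG: "g v \<in> G" and pg: "p (g v) = F v" if "v \<in> carrier V" for v using that by auto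
  have "g \<in> lin_maps K V M"
  proof (rule lin_mapsI)
    show "g x \<in> carrier M" if "x \<in> carrier V" for x by (rule Gc[OF gG[OF that]])
    show "g (x \<oplus>\<^bsub>V\<^esub> y) = g x \<oplus> g y" if "x \<in> carrier V" "y \<in> carrier V" for x y
      by (rule uniq) (use that in \<open>simp_all add: gG GE(4) pg Gc lin_add[OF p] lin_add[OF F]\<close>)
    show "g (c \<odot>\<^bsub>V\<^esub> x) = c \<odot> g x" if "c \<in> carrier K" "x \<in> carrier V" for c x
      by (rule uniq) (use that in \<open>simp_all add: gG GE(3) pg Gc lin_smult[OF p] lin_smult[OF F]\<close>)
  qed
  then show ?thesis using g by blast
qed

text \<open>The usual argument through a free module. The condition is that \<open>f\<close> lands
  in the image of \<open>p\<close>; in a comparison of complexes that image is a module of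
  cycles.\<close>

lemma projective_lift:
  fixes P :: "('s, 'p) module"
  assumes P: "projective S P" and M: "left_module S M" and M': "left_module S M'"
    and p: "p \<in> lin_maps S M M'" and f: "f \<in> lin_maps S P M'"
    and img: "\<And>x. x \<in> carrier P \<Longrightarrow> \<exists>m\<in>carrier M. p m = f x"
  shows "\<exists>g\<in>lin_maps S P M. \<forall>x\<in>carrier P. p (g x) = f x"
proof -
  obtain X :: "'p set" and i r where i: "i \<in> lin_maps S P (free_mod S X)" and r: "r \<in> lin_maps S (free_mod S X) P"
    and ri: "\<And>x. x \<in> carrier P \<Longrightarrow> r (i x) = x"
    using P unfolding projective_def by blast
  interpret M: left_module S M by fact
  interpret M': left_module S M' by fact
  interpret F: left_module S "free_mod S X" by (rule free_mod_left_module) (rule M.S.ring_axioms)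
  have gen: "free_gen S x \<in> carrier (free_mod S X)" if "x \<in> X" for x by (rule free_gen_closed[OF M.S.ring_axioms that])
  have "\<forall>x\<in>X. \<exists>m. m \<in> carrier M \<and> p m = f (r (free_gen S x))"
    using img[OF lin_closed[OF r gen]] by blast
  then obtain m where "\<forall>x\<in>X. m x \<in> carrier M \<and> p (m x) = f (r (free_gen S x))"
    using bchoice by metis
  then have m: "\<And>x. x \<in> X \<Longrightarrow> m x \<in> carrier M \<and> p (m x) = f (r (free_gen S x))" by blast
  then have mX: "m \<in> X \<rightarrow> carrier M" by blast
  let ?G = "lext S M m"
  note G = lext_lin[OF M mX]
  have pr: "(\<lambda>x. p (?G x)) \<in> lin_maps S (free_mod S X) M'" by (rule lin_comp[OF G p])
  have fr: "(\<lambda>x. f (r x)) \<in> lin_maps S (free_mod S X) M'" by (rule lin_comp[OF r f])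
  note ags = F.M.abelian_group_axioms M'.M.abelian_group_axioms
  have e: "p (?G u) = f (r u)" if "u \<in> carrier (free_mod S X)" for u
    using M.S.ring_axioms that
  proof (induction u rule: free_mod_induct)
    case zero show ?case using lin_zero[OF pr ags] lin_zero[OF fr ags] by simp
  next
    case (add u v) then show ?case using lin_add[OF pr] lin_add[OF fr] by simp
  next
    case (gen s x) then show ?case
      using lin_smult[OF pr, of s "free_gen S x"] lin_smult[OF fr, of s "free_gen S x"] free_gen_closed[OF M.S.ring_axioms gen(2)] m[OF gen(2)]
        lext_gen[OF M mX gen(2)] by simp
  qed
  show ?thesis
  proof (intro bexI ballI)
    show "(\<lambda>x. ?G (i x)) \<in> lin_maps S P M" by (rule lin_comp[OF i G])
    show "p (?G (i x)) = f x" if "x \<in> carrier P" for x using e[OF lin_closed[OF i that]] ri[OF that] by simp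
  qed
qed

text \<open>The comparison theorem with the lifting property as a hypothesis \<open>step\<close>: it
  is used with projective modules as source and with bar modules as source, and these lift for
  different reasons. \<open>Z n\<close> contains the elements to be hit: cycles in positive degree,
  the kernel of an augmentation in degree 0.\<close>

lemma chain_lift:
  assumes dP: "\<And>n. dP n \<in> lin_maps S (P (Suc n)) (P n)"
    and dPP: "\<And>n x. x \<in> carrier (P (Suc (Suc n))) \<Longrightarrow> dP n (dP (Suc n) x) = \<zero>\<^bsub>P n\<^esub>"
    and ag: "\<And>n. abelian_group (P n)" "\<And>n. abelian_group (E n)"
    and \<phi>0: "\<phi>0 \<in> lin_maps S (P 0) (E 0)" "\<And>x. x \<in> carrier (P (Suc 0)) \<Longrightarrow> \<phi>0 (dP 0 x) \<in> Z 0"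
    and Z: "\<And>n y. y \<in> carrier (E (Suc n)) \<Longrightarrow> dE n y = \<zero>\<^bsub>E n\<^esub> \<Longrightarrow> y \<in> Z (Suc n)"
    and step: "\<And>n f. f \<in> lin_maps S (P (Suc n)) (E n) \<Longrightarrow> (\<And>x. x \<in> carrier (P (Suc n)) \<Longrightarrow> f x \<in> Z n) \<Longrightarrow>
      \<exists>g\<in>lin_maps S (P (Suc n)) (E (Suc n)). \<forall>x\<in>carrier (P (Suc n)). dE n (g x) = f x"
  shows "\<exists>\<phi>. \<phi> 0 = \<phi>0 \<and> (\<forall>n. \<phi> n \<in> lin_maps S (P n) (E n)) \<and>
    (\<forall>n. \<forall>x\<in>carrier (P (Suc n)). dE n (\<phi> (Suc n) x) = \<phi> n (dP n x))"
proof -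
  \<comment> \<open>The invariant of the recursion is that \<open>\<phi>\<close> after the
    differential takes values in \<open>Z n\<close>, which is what the next lifting step asks for;
    the last clause fixes the start.\<close>
  let ?Q = "\<lambda>n \<phi>. \<phi> \<in> lin_maps S (P n) (E n) \<and> (\<forall>x\<in>carrier (P (Suc n)). \<phi> (dP n x) \<in> Z n) \<and> (n = 0 \<longrightarrow> \<phi> = \<phi>0)"
  let ?R = "\<lambda>n \<phi> \<psi>. \<forall>x\<in>carrier (P (Suc n)). dE n (\<psi> x) = \<phi> (dP n x)"
  have "\<exists>\<phi>. \<forall>n. ?Q n (\<phi> n) \<and> ?R n (\<phi> n) (\<phi> (Suc n))"
  proof (rule dependent_nat_choice)
    show "\<exists>\<phi>. ?Q 0 \<phi>" using \<phi>0 by blast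
    fix \<phi> n assume \<phi>: "?Q n \<phi>"
    obtain \<psi> where \<psi>: "\<psi> \<in> lin_maps S (P (Suc n)) (E (Suc n))" "\<forall>x\<in>carrier (P (Suc n)). dE n (\<psi> x) = \<phi> (dP n x)"
      using step[of "\<lambda>x. \<phi> (dP n x)" n] lin_comp[OF dP] \<phi> by metis
    have "\<psi> (dP (Suc n) x) \<in> Z (Suc n)" if x: "x \<in> carrier (P (Suc (Suc n)))" for x
    proof (rule Z)
      have dx: "dP (Suc n) x \<in> carrier (P (Suc n))" by (rule lin_closed[OF dP x])
      show "\<psi> (dP (Suc n) x) \<in> carrier (E (Suc n))" by (rule lin_closed[OF \<psi>(1) dx])
      have "\<phi> \<zero>\<^bsub>P n\<^esub> = \<zero>\<^bsub>E n\<^esub>" using lin_zero[OF _ ag] \<phi> by blast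
      then show "dE n (\<psi> (dP (Suc n) x)) = \<zero>\<^bsub>E n\<^esub>" using \<psi>(2) dx dPP[OF x] by simp
    qed
    then show "\<exists>\<psi>. ?Q (Suc n) \<psi> \<and> ?R n \<phi> \<psi>" using \<psi> by blast
  qed
  then show ?thesis by blast
qed

text \<open>\<open>D\<close> is meant to be the difference of two lifts of one map, so a chain map
  killed by the augmentation. Each new piece of the homotopy lifts D - h d. This is a cycle because
  the previous piece satisfies d h = D on boundaries.\<close>

lemma chain_null_homotopy:
  assumes dP: "\<And>n. dP n \<in> lin_maps S (P (Suc n)) (P n)"
    and dPP: "\<And>n x. x \<in> carrier (P (Suc (Suc n))) \<Longrightarrow> dP n (dP (Suc n) x) = \<zero>\<^bsub>P n\<^esub>"
    and mod: "\<And>n. left_module S (P n)" "\<And>n. left_module S (E n)"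
    and dE: "\<And>n. dE n \<in> lin_maps S (E (Suc n)) (E n)"
    and D: "\<And>n. D n \<in> lin_maps S (P n) (E n)" "\<And>x. x \<in> carrier (P 0) \<Longrightarrow> D 0 x \<in> Z 0"
      "\<And>n x. x \<in> carrier (P (Suc n)) \<Longrightarrow> dE n (D (Suc n) x) = D n (dP n x)"
    and Z: "\<And>n y. y \<in> carrier (E (Suc n)) \<Longrightarrow> dE n y = \<zero>\<^bsub>E n\<^esub> \<Longrightarrow> y \<in> Z (Suc n)"
    and step: "\<And>n f. f \<in> lin_maps S (P n) (E n) \<Longrightarrow> (\<And>x. x \<in> carrier (P n) \<Longrightarrow> f x \<in> Z n) \<Longrightarrow>
      \<exists>g\<in>lin_maps S (P n) (E (Suc n)). \<forall>x\<in>carrier (P n). dE n (g x) = f x"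
  shows "\<exists>h. (\<forall>n. h n \<in> lin_maps S (P n) (E (Suc n))) \<and> (\<forall>x\<in>carrier (P 0). dE 0 (h 0 x) = D 0 x) \<and>
    (\<forall>n. \<forall>x\<in>carrier (P (Suc n)). dE (Suc n) (h (Suc n) x) = D (Suc n) x \<ominus>\<^bsub>E (Suc n)\<^esub> h n (dP n x))"
proof -
  have ag: "abelian_group (P n)" "abelian_group (E n)" for n using mod by (auto simp: left_module_def)
  let ?Q = "\<lambda>n h. h \<in> lin_maps S (P n) (E (Suc n)) \<and> (\<forall>x\<in>carrier (P (Suc n)). dE n (h (dP n x)) = D n (dP n x)) \<and>
    (n = 0 \<longrightarrow> (\<forall>x\<in>carrier (P 0). dE 0 (h x) = D 0 x))"
  let ?R = "\<lambda>n h h'. \<forall>x\<in>carrier (P (Suc n)). dE (Suc n) (h' x) = D (Suc n) x \<ominus>\<^bsub>E (Suc n)\<^esub> h (dP n x)"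
  have "\<exists>h. \<forall>n. ?Q n (h n) \<and> ?R n (h n) (h (Suc n))"
  proof (rule dependent_nat_choice)
    obtain h where "h \<in> lin_maps S (P 0) (E (Suc 0))" "\<forall>x\<in>carrier (P 0). dE 0 (h x) = D 0 x" using step[OF D(1,2)] by blast
    then show "\<exists>h. ?Q 0 h" using lin_closed[OF dP] by blast
    fix h n assume h: "?Q n h"
    then have hl: "h \<in> lin_maps S (P n) (E (Suc n))" by blast
    interpret En: abelian_group "E n" by (rule ag)
    interpret Esn: abelian_group "E (Suc n)" by (rule ag)
    let ?f = "\<lambda>x. D (Suc n) x \<ominus>\<^bsub>E (Suc n)\<^esub> h (dP n x)"
    have fl: "?f \<in> lin_maps S (P (Suc n)) (E (Suc n))" by (rule lin_minus_fun[OF mod(2) D(1) lin_comp[OF dP hl]])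
    have "?f x \<in> Z (Suc n)" if x: "x \<in> carrier (P (Suc n))" for x
    proof (rule Z[OF lin_closed[OF fl x]])
      note dx = lin_closed[OF dP x]
      show "dE n (?f x) = \<zero>\<^bsub>E n\<^esub>"
        using h x lin_minus[OF dE ag(2) ag(2) lin_closed[OF D(1) x] lin_closed[OF hl dx]] D(3)[OF x]
          En.minus_eq_zero_iff lin_closed[OF D(1) dx] by simp
    qed
    then obtain h' where h': "h' \<in> lin_maps S (P (Suc n)) (E (Suc (Suc n)))" "\<forall>x\<in>carrier (P (Suc n)). dE (Suc n) (h' x) = ?f x"
      using step[OF fl] by blast
    have "dE (Suc n) (h' (dP (Suc n) x)) = D (Suc n) (dP (Suc n) x)" if x: "x \<in> carrier (P (Suc (Suc n)))" for x
      using h'(2) lin_closed[OF dP x] dPP[OF x] lin_zero[OF hl ag] Esn.minus_zero_right lin_closed[OF D(1) lin_closed[OF dP x]] by simp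
    then show "\<exists>h'. ?Q (Suc n) h' \<and> ?R n h h'" using h' by blast
  qed
  then obtain h where h: "\<forall>n. ?Q n (h n) \<and> ?R n (h n) (h (Suc n))" by (rule exE)
  show ?thesis
  proof (rule exI[of _ h], intro conjI allI)
    show "h n \<in> lin_maps S (P n) (E (Suc n))" for n using h by simp
    show "\<forall>x\<in>carrier (P 0). dE 0 (h 0 x) = D 0 x" using h by simp
    show "?R n (h n) (h (Suc n))" for n using h by simp
  qed
qed

section \<open>Tensor products of modules\<close>

text \<open>Homogeneity over \<open>K\<close> is imposed on the first argument, since
  \<open>P\<close> has scalars in \<open>S\<close> and no action of \<open>K\<close> of its
  own.\<close>

definition balanced ::
  "('k, 'm) ring_scheme \<Rightarrow> ('s, 'n) ring_scheme \<Rightarrow> ('k, 'v) module \<Rightarrow> ('v \<Rightarrow> 's \<Rightarrow> 'v)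
     \<Rightarrow> ('s, 'w) module \<Rightarrow> ('k, 'u) module \<Rightarrow> ('v \<Rightarrow> 'w \<Rightarrow> 'u) \<Rightarrow> bool" where
  "balanced K S M act P V \<phi> \<longleftrightarrow>
     (\<forall>p\<in>carrier P. (\<lambda>m. \<phi> m p) \<in> lin_maps K M V) \<and>
     (\<forall>m\<in>carrier M. \<forall>p\<in>carrier P. \<forall>p'\<in>carrier P. \<phi> m (p \<oplus>\<^bsub>P\<^esub> p') = \<phi> m p \<oplus>\<^bsub>V\<^esub> \<phi> m p') \<and>
     (\<forall>m\<in>carrier M. \<forall>s\<in>carrier S. \<forall>p\<in>carrier P. \<phi> (act m s) p = \<phi> m (s \<odot>\<^bsub>P\<^esub> p))"

locale tensor =
  fixes K :: "('k, 'm) ring_scheme" and S :: "('s, 'n) ring_scheme" and M :: "('k, 'v) module"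
    and act :: "'v \<Rightarrow> 's \<Rightarrow> 'v" and P :: "('s, 'w) module"
  assumes M: "module K M" and P: "abelian_group P"
    and act_closed: "\<And>m s. m \<in> carrier M \<Longrightarrow> s \<in> carrier S \<Longrightarrow> act m s \<in> carrier M"
    and smult_closed: "\<And>p s. p \<in> carrier P \<Longrightarrow> s \<in> carrier S \<Longrightarrow> s \<odot>\<^bsub>P\<^esub> p \<in> carrier P"
begin

interpretation M: module K M by (rule M)
interpretation P: abelian_group P by (rule P)

abbreviation "TT \<equiv> tens K S M act P"
abbreviation "tp \<equiv> tens_pure K S M act P"

lemma pres: "presentation K (carrier M \<times> carrier P) (tens_rels K S M act P)"
proof (rule presentation.intro)
  show "cring K" by (rule M.R.is_cring)
  interpret F: module K "free_mod K (carrier M \<times> carrier P)" by (rule free_mod_module) (rule M.R.is_cring)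
  have g: "free_gen K (m, p) \<in> carrier (free_mod K (carrier M \<times> carrier P))" if "m \<in> carrier M" "p \<in> carrier P" for m p
    by (rule free_gen_closed[OF M.R.ring_axioms]) (use that in simp)
  show "tens_rels K S M act P \<subseteq> carrier (free_mod K (carrier M \<times> carrier P))"
    unfolding tens_rels_def Let_def by (auto simp: g act_closed smult_closed)
qed

lemma TT_module: "module K TT"
  unfolding tens_def by (rule presentation.presented_module[OF pres])

lemma TT_ag: "abelian_group TT" by (rule module_abelian_group[OF TT_module])

lemma tp_closed: "m \<in> carrier M \<Longrightarrow> p \<in> carrier P \<Longrightarrow> tp m p \<in> carrier TT"
  unfolding tens_def tens_pure_def by (rule presentation.gen_class_closed[OF pres]) simp

lemma tp_balanced: "balanced K S M act P TT tp"
proof -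
  let ?F = "free_mod K (carrier M \<times> carrier P)"
  interpret F: module K ?F by (rule free_mod_module) (rule M.R.is_cring)
  obtain q where q: "q \<in> lin_maps K ?F TT" and pq: "\<And>x. gen_class K (carrier M \<times> carrier P) (tens_rels K S M act P) x = q (free_gen K x)"
    and rel: "\<And>f g. f \<in> carrier ?F \<Longrightarrow> g \<in> carrier ?F \<Longrightarrow> f \<ominus>\<^bsub>?F\<^esub> g \<in> tens_rels K S M act P \<Longrightarrow> q f = q g"
    using presentation.gen_class_lin[OF pres] unfolding tens_def[symmetric] by metis
  have tq: "tp m p = q (free_gen K (m, p))" for m p by (simp add: tens_pure_def pq)
  have g: "free_gen K (m, p) \<in> carrier ?F" if "m \<in> carrier M" "p \<in> carrier P" for m p
    by (rule free_gen_closed[OF M.R.ring_axioms]) (use that in simp)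
  let ?g = "free_gen K"
  show ?thesis unfolding balanced_def
  proof (intro conjI ballI)
    fix p assume p: "p \<in> carrier P"
    show "(\<lambda>m. tp m p) \<in> lin_maps K M TT"
    proof (rule lin_mapsI)
      show "tp m p \<in> carrier TT" if "m \<in> carrier M" for m by (rule tp_closed[OF that p])
      show "tp (m \<oplus>\<^bsub>M\<^esub> m') p = tp m p \<oplus>\<^bsub>TT\<^esub> tp m' p" if m: "m \<in> carrier M" "m' \<in> carrier M" for m m'
      proof -
        have "?g (m \<oplus>\<^bsub>M\<^esub> m', p) \<ominus>\<^bsub>?F\<^esub> (?g (m, p) \<oplus>\<^bsub>?F\<^esub> ?g (m', p)) \<in> tens_rels K S M act P"
          unfolding tens_rels_def Let_def using m p by blast
        from rel[OF g F.M.a_closed[OF g g] this] show ?thesis using m p by (simp add: tq lin_add[OF q g g])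
      qed
      show "tp (c \<odot>\<^bsub>M\<^esub> m) p = c \<odot>\<^bsub>TT\<^esub> tp m p" if m: "c \<in> carrier K" "m \<in> carrier M" for c m
      proof -
        have "?g (c \<odot>\<^bsub>M\<^esub> m, p) \<ominus>\<^bsub>?F\<^esub> c \<odot>\<^bsub>?F\<^esub> ?g (m, p) \<in> tens_rels K S M act P"
          unfolding tens_rels_def Let_def using m p by blast
        from rel[OF g F.smult_closed[OF _ g] this] show ?thesis using m p by (simp add: tq lin_smult[OF q _ g])
      qed
    qed
  next
    fix m p p' assume m: "m \<in> carrier M" "p \<in> carrier P" "p' \<in> carrier P"
    have "?g (m, p \<oplus>\<^bsub>P\<^esub> p') \<ominus>\<^bsub>?F\<^esub> (?g (m, p) \<oplus>\<^bsub>?F\<^esub> ?g (m, p')) \<in> tens_rels K S M act P"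
      unfolding tens_rels_def Let_def using m by blast
    from rel[OF g F.M.a_closed[OF g g] this] show "tp m (p \<oplus>\<^bsub>P\<^esub> p') = tp m p \<oplus>\<^bsub>TT\<^esub> tp m p'" using m by (simp add: tq lin_add[OF q g g])
  next
    fix m s p assume m: "m \<in> carrier M" "s \<in> carrier S" "p \<in> carrier P"
    have "?g (act m s, p) \<ominus>\<^bsub>?F\<^esub> ?g (m, s \<odot>\<^bsub>P\<^esub> p) \<in> tens_rels K S M act P"
      unfolding tens_rels_def Let_def using m by blast
    from rel[OF g g this] show "tp (act m s) p = tp m (s \<odot>\<^bsub>P\<^esub> p)" using m by (simp add: tq act_closed smult_closed)
  qed
qed

lemma tens_lift:
  assumes V: "module K V" and \<phi>: "balanced K S M act P V \<phi>"
  shows "lift K V (\<lambda>(m, p). \<phi> m p) \<in> lin_maps K TT V"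
    and "m \<in> carrier M \<Longrightarrow> p \<in> carrier P \<Longrightarrow> lift K V (\<lambda>(m, p). \<phi> m p) (tp m p) = \<phi> m p"
proof -
  let ?F = "free_mod K (carrier M \<times> carrier P)" and ?\<phi> = "\<lambda>(m, p). \<phi> m p"
  interpret V: module K V by fact
  interpret F: module K ?F by (rule free_mod_module) (rule M.R.is_cring)
  have 1: "\<And>p. p \<in> carrier P \<Longrightarrow> (\<lambda>m. \<phi> m p) \<in> lin_maps K M V"
    and 2: "\<And>m p p'. m \<in> carrier M \<Longrightarrow> p \<in> carrier P \<Longrightarrow> p' \<in> carrier P \<Longrightarrow> \<phi> m (p \<oplus>\<^bsub>P\<^esub> p') = \<phi> m p \<oplus>\<^bsub>V\<^esub> \<phi> m p'"
    and 3: "\<And>m s p. m \<in> carrier M \<Longrightarrow> s \<in> carrier S \<Longrightarrow> p \<in> carrier P \<Longrightarrow> \<phi> (act m s) p = \<phi> m (s \<odot>\<^bsub>P\<^esub> p)"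
    using \<phi> by (auto simp: balanced_def)
  note cl = lin_closed[OF 1]
  have FF: "?\<phi> \<in> carrier M \<times> carrier P \<rightarrow> carrier V" using cl by auto
  note l = lext_lin[OF module_left_module[OF V] FF]
  note G = F.M.abelian_group_axioms V.M.abelian_group_axioms
  have g: "free_gen K (m, p) \<in> carrier ?F" if "m \<in> carrier M" "p \<in> carrier P" for m p
    by (rule free_gen_closed[OF M.R.ring_axioms]) (use that in simp)
  have e: "lext K V ?\<phi> (free_gen K (m, p)) = \<phi> m p" if "m \<in> carrier M" "p \<in> carrier P" for m p
    using lext_gen[OF module_left_module[OF V] FF, of "(m, p)"] that by simp
  have L0: "lext K V ?\<phi> r = \<zero>\<^bsub>V\<^esub>" if "r \<in> tens_rels K S M act P" for r
    using that unfolding tens_rels_def Let_def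
  proof (elim UnE CollectE exE conjE, goal_cases)
    case (1 m m' p)
    then show ?case
      using lin_add[OF \<open>\<And>p. p \<in> carrier P \<Longrightarrow> (\<lambda>m. \<phi> m p) \<in> lin_maps K M V\<close>, of p m m'] cl
      by (simp add: lin_minus[OF l G] lin_add[OF l] g e V.M.minus_eq_zero_iff)
  next
    case (2 m p p')
    then show ?case
      using \<open>\<And>m p p'. m \<in> carrier M \<Longrightarrow> p \<in> carrier P \<Longrightarrow> p' \<in> carrier P \<Longrightarrow> \<phi> m (p \<oplus>\<^bsub>P\<^esub> p') = \<phi> m p \<oplus>\<^bsub>V\<^esub> \<phi> m p'\<close> cl
      by (simp add: lin_minus[OF l G] lin_add[OF l] g e V.M.minus_eq_zero_iff)
  next
    case (3 c m p)
    then show ?case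
      using lin_smult[OF \<open>\<And>p. p \<in> carrier P \<Longrightarrow> (\<lambda>m. \<phi> m p) \<in> lin_maps K M V\<close>, of p c m] cl
      by (simp add: lin_minus[OF l G] lin_smult[OF l] g e V.M.minus_eq_zero_iff)
  next
    case (4 m s p)
    then show ?case
      using \<open>\<And>m s p. m \<in> carrier M \<Longrightarrow> s \<in> carrier S \<Longrightarrow> p \<in> carrier P \<Longrightarrow> \<phi> (act m s) p = \<phi> m (s \<odot>\<^bsub>P\<^esub> p)\<close> cl
      by (simp add: lin_minus[OF l G] g e V.M.minus_eq_zero_iff act_closed smult_closed)
  qed
  show "lift K V ?\<phi> \<in> lin_maps K TT V"
    unfolding tens_def by (rule presentation.lift_lin[OF pres V FF L0])
  show "lift K V ?\<phi> (tp m p) = \<phi> m p" if "m \<in> carrier M" "p \<in> carrier P"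
    unfolding tens_pure_def using presentation.lift_gen[OF pres V FF L0, of "(m, p)"] that by simp
qed

text \<open>Scalars are absorbed into the first factor, so sums of pure tensors exhaust the
  space.\<close>

lemma tens_induct [consumes 1, case_names zero add pure]:
  assumes u: "u \<in> carrier TT" and P0: "Q \<zero>\<^bsub>TT\<^esub>"
    and add: "\<And>u v. \<lbrakk>u \<in> carrier TT; v \<in> carrier TT; Q u; Q v\<rbrakk> \<Longrightarrow> Q (u \<oplus>\<^bsub>TT\<^esub> v)"
    and pure: "\<And>m p. \<lbrakk>m \<in> carrier M; p \<in> carrier P\<rbrakk> \<Longrightarrow> Q (tp m p)"
  shows "Q u"
proof -
  have l: "(\<lambda>m. tp m p) \<in> lin_maps K M TT" if "p \<in> carrier P" for p using tp_balanced that by (auto simp: balanced_def)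
  have "Q (c \<odot>\<^bsub>TT\<^esub> gen_class K (carrier M \<times> carrier P) (tens_rels K S M act P) x)" if c: "c \<in> carrier K" and "x \<in> carrier M \<times> carrier P" for c x
  proof -
    obtain m p where x: "x = (m, p)" "m \<in> carrier M" "p \<in> carrier P" using \<open>x \<in> carrier M \<times> carrier P\<close> by blast
    have "c \<odot>\<^bsub>TT\<^esub> tp m p = tp (c \<odot>\<^bsub>M\<^esub> m) p" using lin_smult[OF l[OF x(3)] c x(2)] by simp
    then show ?thesis using pure[of "c \<odot>\<^bsub>M\<^esub> m" p] c x by (simp add: tens_pure_def)
  qed
  then show ?thesis
    using presentation.presented_induct[OF pres, of u Q] u P0 add unfolding tens_def by blast
qed

lemma tens_eqI:
  assumes V: "module K V" and f: "f \<in> lin_maps K TT V" and g: "g \<in> lin_maps K TT V"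
    and eq: "\<And>m p. m \<in> carrier M \<Longrightarrow> p \<in> carrier P \<Longrightarrow> f (tp m p) = g (tp m p)" and u: "u \<in> carrier TT"
  shows "f u = g u"
  using u
proof (induction u rule: tens_induct)
  case zero then show ?case using lin_zero[OF f TT_ag module_abelian_group[OF V]] lin_zero[OF g TT_ag module_abelian_group[OF V]] by simp
next
  case (add u v) then show ?case by (simp add: lin_add[OF f] lin_add[OF g])
next
  case (pure m p) then show ?case by (rule eq)
qed

end

section \<open>The enveloping algebra and the bar resolution\<close>

text \<open>Several records below share their additive part with a known group but differ from it in
  type or in the scalar action; this carries the group axioms over.\<close>

lemma abelian_group_cong:
  assumes "abelian_group V" "carrier W = carrier V" "add W = add V" "\<zero>\<^bsub>W\<^esub> = \<zero>\<^bsub>V\<^esub>"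
  shows "abelian_group W"
proof (rule abelian_groupI)
  interpret V: abelian_group V by fact
  show "\<exists>y\<in>carrier W. y \<oplus>\<^bsub>W\<^esub> x = \<zero>\<^bsub>W\<^esub>" if "x \<in> carrier W" for x
    by (rule bexI[of _ "\<ominus>\<^bsub>V\<^esub> x"]) (use that assms in \<open>simp_all add: V.l_neg\<close>)
qed (use assms in \<open>simp_all add: abelian_group_def abelian_monoid.a_closed abelian_monoid.zero_closed abelian_monoid.a_assoc
   abelian_monoid.a_comm abelian_monoid.a_lcomm abelian_monoid.l_zero abelian_monoid.r_zero\<close>)

lemma lin_maps_cong:
  assumes "carrier W' = carrier W" "add W' = add W" "smult W' = smult W"
  shows "lin_maps K V W' = lin_maps K V W" "lin_maps K W' V = lin_maps K W V"
  using assms by (simp_all add: lin_maps_def)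

lemma (in tensor) balanced_cong:
  assumes "balanced K S M act P V \<phi>" and eq: "\<And>m p. m \<in> carrier M \<Longrightarrow> p \<in> carrier P \<Longrightarrow> \<phi> m p = \<psi> m p"
  shows "balanced K S M act P V \<psi>"
proof -
  interpret M: module K M by (rule M)
  interpret P: abelian_group P by (rule P)
  show ?thesis unfolding balanced_def
  proof (intro conjI ballI)
    fix p assume p: "p \<in> carrier P"
    have "(\<lambda>m. \<phi> m p) \<in> lin_maps K M V" using assms(1) p by (simp add: balanced_def)
    then show "(\<lambda>m. \<psi> m p) \<in> lin_maps K M V" by (rule lin_cong) (simp_all add: eq p)
  qed (use assms(1) in \<open>simp_all add: balanced_def eq[symmetric] act_closed smult_closed\<close>)
qed

context kalg begin

abbreviation E where "E \<equiv> env_alg K A"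

abbreviation env_tens where "env_tens \<equiv> tens K K A (scal A) (opp_alg A)"

definition ep where
  "ep a b = tens_pure K K A (scal A) (opp_alg A) a b"

lemma opp_simps: "carrier (opp_alg A) = AC" "add (opp_alg A) = add A" "zero (opp_alg A) = zero A"
  "smult (opp_alg A) = smult A" "x \<otimes>\<^bsub>opp_alg A\<^esub> y = y \<otimes> x"
  by (simp_all add: opp_alg_def)

lemma env_tensor: "tensor K K A (scal A) (opp_alg A)"
proof (rule tensor.intro)
  show "module K A" by (rule AM.module_axioms)
  show "abelian_group (opp_alg A)" by (rule abelian_group_cong[OF AM.M.abelian_group_axioms]) (simp_all add: opp_simps)
qed (simp_all add: opp_simps)

lemma env_simps: "carrier E = carrier env_tens" "add E = add env_tens" "zero E = zero env_tens" "smult E = smult env_tens"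
  by (simp_all add: env_alg_def tensor_alg_def Let_def)

lemma ep_one: "\<one>\<^bsub>E\<^esub> = ep \<one> \<one>"
  by (simp add: env_alg_def tensor_alg_def Let_def ep_def) (simp add: opp_alg_def)

lemma env_mult_def: "u \<otimes>\<^bsub>E\<^esub> v = lift K env_tens (\<lambda>(a, b). lift K env_tens (\<lambda>(a', b'). ep (a \<otimes> a') (b' \<otimes> b)) v) u"
  by (simp add: env_alg_def tensor_alg_def Let_def ep_def opp_simps)

lemma env_lin: "lin_maps K V E = lin_maps K V env_tens" "lin_maps K E V = lin_maps K env_tens V"
  by (rule lin_maps_cong; simp add: env_simps)+

lemma ep_closed: "a \<in> AC \<Longrightarrow> b \<in> AC \<Longrightarrow> ep a b \<in> carrier E"
  using tensor.tp_closed[OF env_tensor] by (simp add: ep_def env_simps opp_simps)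

lemma ep_lin: "b \<in> AC \<Longrightarrow> (\<lambda>a. ep a b) \<in> lin_maps K A E"
  using tensor.tp_balanced[OF env_tensor] by (simp add: balanced_def env_lin opp_simps ep_def)

lemma ep_add2: "a \<in> AC \<Longrightarrow> b \<in> AC \<Longrightarrow> b' \<in> AC \<Longrightarrow> ep a (b \<oplus> b') = ep a b \<oplus>\<^bsub>E\<^esub> ep a b'"
  using tensor.tp_balanced[OF env_tensor] by (simp add: balanced_def env_simps opp_simps ep_def)

lemma ep_smult2: "c \<in> carrier K \<Longrightarrow> a \<in> AC \<Longrightarrow> b \<in> AC \<Longrightarrow> ep a (c \<odot> b) = ep (c \<odot> a) b"
  using tensor.tp_balanced[OF env_tensor] by (simp add: balanced_def opp_simps ep_def)

lemma env_tens_module: "module K env_tens"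
  by (rule tensor.TT_module[OF env_tensor])

text \<open>\<open>\<psi>\<close> is the expression occurring in a definition, possibly a nested
  \<open>lift\<close>, and \<open>\<phi>\<close> is a form of it in which bilinearity is visible;
  the two agree on the carrier.\<close>

lemma env_lift:
  assumes V: "module K V" and 1: "\<And>b. b \<in> AC \<Longrightarrow> (\<lambda>a. \<phi> a b) \<in> lin_maps K A V"
    and 2: "\<And>a b b'. a \<in> AC \<Longrightarrow> b \<in> AC \<Longrightarrow> b' \<in> AC \<Longrightarrow> \<phi> a (b \<oplus> b') = \<phi> a b \<oplus>\<^bsub>V\<^esub> \<phi> a b'"
    and 3: "\<And>a b c. a \<in> AC \<Longrightarrow> b \<in> AC \<Longrightarrow> c \<in> carrier K \<Longrightarrow> \<phi> (c \<odot> a) b = \<phi> a (c \<odot> b)"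
    and eq: "\<And>a b. a \<in> AC \<Longrightarrow> b \<in> AC \<Longrightarrow> \<phi> a b = \<psi> a b"
  shows "lift K V (\<lambda>(a, b). \<psi> a b) \<in> lin_maps K E V"
    and "a \<in> AC \<Longrightarrow> b \<in> AC \<Longrightarrow> lift K V (\<lambda>(a, b). \<psi> a b) (ep a b) = \<psi> a b"
proof -
  have b: "balanced K K A (scal A) (opp_alg A) V \<psi>"
  proof (rule tensor.balanced_cong[OF env_tensor])
    show "balanced K K A (scal A) (opp_alg A) V \<phi>" unfolding balanced_def opp_simps using 1 2 3 by blast
  qed (simp add: opp_simps eq)
  show "lift K V (\<lambda>(a, b). \<psi> a b) \<in> lin_maps K E V"
    unfolding env_lin by (rule tensor.tens_lift(1)[OF env_tensor V b])
  show "lift K V (\<lambda>(a, b). \<psi> a b) (ep a b) = \<psi> a b" if "a \<in> AC" "b \<in> AC"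
    unfolding ep_def by (rule tensor.tens_lift(2)[OF env_tensor V b]) (use that in \<open>simp_all add: opp_simps\<close>)
qed

lemma ep_mult:
  assumes a: "a \<in> AC" "b \<in> AC" and a': "a' \<in> AC" "b' \<in> AC"
  shows "ep a b \<otimes>\<^bsub>E\<^esub> ep a' b' = ep (a \<otimes> a') (b' \<otimes> b)"
proof -
  have l: "(\<lambda>x. ep (h x) b) \<in> lin_maps K A env_tens" if "h \<in> lin_maps K A A" "b \<in> AC" for h b
    using lin_comp[OF that(1) ep_lin[OF that(2)]] by (simp add: env_lin)
  note add2 = ep_add2[unfolded env_simps]
  have inner: "lift K env_tens (\<lambda>(x, y). ep (a \<otimes> x) (y \<otimes> b)) (ep a' b') = ep (a \<otimes> a') (b' \<otimes> b)"
    if a: "a \<in> AC" "b \<in> AC" for a b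
    by (rule env_lift(2)[OF env_tens_module _ _ _ refl a'])
      (use a in \<open>auto intro!: l lmult_lin simp: AR.l_distr add2 smult_mult mult_smult ep_smult2\<close>)
  have "ep a b \<otimes>\<^bsub>E\<^esub> ep a' b' = lift K env_tens (\<lambda>(x, y). ep (a \<otimes> x) (y \<otimes> b)) (ep a' b')"
    unfolding env_mult_def
    by (rule env_lift(2)[where \<phi> = "\<lambda>a b. ep (a \<otimes> a') (b' \<otimes> b)"
          and \<psi> = "\<lambda>a b. lift K env_tens (\<lambda>(x, y). ep (a \<otimes> x) (y \<otimes> b)) (ep a' b')", OF env_tens_module _ _ _ _ a])
      (use a' in \<open>auto intro!: l rmult_lin simp: AR.r_distr add2 smult_mult mult_smult ep_smult2 inner\<close>)
  then show ?thesis using inner[OF a] by simp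
qed

lemma env_induct [consumes 1, case_names zero add ep]:
  assumes s: "s \<in> carrier E" and 0: "Q \<zero>\<^bsub>E\<^esub>"
    and add: "\<And>u v. \<lbrakk>u \<in> carrier E; v \<in> carrier E; Q u; Q v\<rbrakk> \<Longrightarrow> Q (u \<oplus>\<^bsub>E\<^esub> v)"
    and ep: "\<And>a b. \<lbrakk>a \<in> AC; b \<in> AC\<rbrakk> \<Longrightarrow> Q (ep a b)"
  shows "Q s"
  using tensor.tens_induct[OF env_tensor, of s Q] s 0 add ep unfolding env_simps opp_simps ep_def by blast

abbreviation ract where "ract \<equiv> env_right_act K A"

lemma
  assumes x: "x \<in> AC"
  shows ract_lin: "ract x \<in> lin_maps K E A"
    and ract_ep: "a \<in> AC \<Longrightarrow> b \<in> AC \<Longrightarrow> ract x (ep a b) = b \<otimes> x \<otimes> a"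
proof -
  note l = env_lift[OF AM.module_axioms, of "\<lambda>a b. b \<otimes> x \<otimes> a" "\<lambda>a b. b \<otimes> x \<otimes> a"]
  show "ract x \<in> lin_maps K E A" unfolding env_right_act_def
    by (rule l(1)) (use x in \<open>auto intro!: lmult_lin simp: AR.l_distr smult_mult mult_smult\<close>)
  show "a \<in> AC \<Longrightarrow> b \<in> AC \<Longrightarrow> ract x (ep a b) = b \<otimes> x \<otimes> a" unfolding env_right_act_def
    by (rule l(2)) (use x in \<open>auto intro!: lmult_lin simp: AR.l_distr smult_mult mult_smult\<close>)
qed

abbreviation L where "L \<equiv> env_left_mod K A"

lemma L_simps: "carrier L = AC" "add L = add A" "zero L = zero A"
  by (simp_all add: env_left_mod_def)

lemma
  assumes x: "x \<in> AC"
  shows L_smult_lin: "(\<lambda>s. s \<odot>\<^bsub>L\<^esub> x) \<in> lin_maps K E A"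
    and L_smult_ep: "a \<in> AC \<Longrightarrow> b \<in> AC \<Longrightarrow> ep a b \<odot>\<^bsub>L\<^esub> x = a \<otimes> x \<otimes> b"
proof -
  have s: "s \<odot>\<^bsub>L\<^esub> x = lift K A (\<lambda>(a, b). a \<otimes> x \<otimes> b) s" for s by (simp add: env_left_mod_def)
  note l = env_lift[OF AM.module_axioms, of "\<lambda>a b. a \<otimes> x \<otimes> b" "\<lambda>a b. a \<otimes> x \<otimes> b"]
  show "(\<lambda>s. s \<odot>\<^bsub>L\<^esub> x) \<in> lin_maps K E A" unfolding s
    by (rule l(1)) (use x in \<open>auto intro!: lin_comp[OF rmult_lin rmult_lin] simp: AR.r_distr smult_mult mult_smult\<close>)
  show "a \<in> AC \<Longrightarrow> b \<in> AC \<Longrightarrow> ep a b \<odot>\<^bsub>L\<^esub> x = a \<otimes> x \<otimes> b" unfolding s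
    by (rule l(2)) (use x in \<open>auto intro!: lin_comp[OF rmult_lin rmult_lin] simp: AR.r_distr smult_mult mult_smult\<close>)
qed

lemma lmul_rmul: "x \<in> AC \<Longrightarrow> y \<in> AC \<Longrightarrow> u \<in> TC (Suc m) \<Longrightarrow>
    lmul (Suc m) x (rmul (Suc m) y u) = rmul (Suc m) y (lmul (Suc m) x u)"
proof (rule tpow_eqI[OF tpow_module lin_comp[OF rmul_lin lmul_lin] lin_comp[OF lmul_lin rmul_lin]])
  fix xs assume x: "x \<in> AC" and y: "y \<in> AC" and "xs \<in> TG (Suc m)"
  then obtain zs z where z: "xs = zs @ [z]" "z \<in> AC" "zs \<in> TG m" by (metis gens_snoc_E)
  show "lmul (Suc m) x (rmul (Suc m) y (pt (Suc m) xs)) = rmul (Suc m) y (lmul (Suc m) x (pt (Suc m) xs))"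
  proof (cases zs)
    \<comment> \<open>With a single factor both multiplications hit the same entry, and they commute
      by associativity of A.\<close>
    case Nil
    then have "m = 0" using z(3) by (simp add: gens_iff)
    then show ?thesis using x y z Nil rmul_pure[OF y z(2), of "[]" 0] rmul_pure[OF y AR.m_closed[OF x z(2)], of "[]" 0]
      by (simp add: lmul_pure gens_simps AR.m_assoc)
  next
    case (Cons w ws)
    then obtain k where k: "m = Suc k" "w \<in> AC" "ws \<in> TG k" using z(3) by (cases m) (auto simp: gens_iff)
    show ?thesis using x y z(1,2) Cons k rmul_pure[OF y z(2), of "w # ws" "Suc k"] rmul_pure[OF y z(2), of "(x \<otimes> w) # ws" "Suc k"]
      by (simp add: lmul_pure gens_simps)
  qed
qed

lemma lmul_lin2: "u \<in> TC (Suc m) \<Longrightarrow> (\<lambda>x. lmul (Suc m) x u) \<in> lin_maps K A (T (Suc m))"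
proof -
  assume u: "u \<in> TC (Suc m)"
  show ?thesis
  proof (rule lin_mapsI)
    show "lmul (Suc m) x u \<in> TC (Suc m)" if "x \<in> AC" for x using lin_closed[OF lmul_lin[OF that] u] .
    show "lmul (Suc m) (x \<oplus> y) u = lmul (Suc m) x u \<oplus>\<^bsub>T (Suc m)\<^esub> lmul (Suc m) y u" if "x \<in> AC" "y \<in> AC" for x y
      by (rule tpow_eqI[OF tpow_module _ _ _ u])
        (use that in \<open>auto intro!: lmul_lin lin_add_fun[OF tpow_lm] elim!: gens_Suc_E simp: lmul_pure AR.l_distr lin_add[OF mlin_Cons(2)[OF pure_mlin]]\<close>)
    show "lmul (Suc m) (c \<odot> x) u = c \<odot>\<^bsub>T (Suc m)\<^esub> lmul (Suc m) x u" if "c \<in> carrier K" "x \<in> AC" for c x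
      by (rule tpow_eqI[OF tpow_module _ _ _ u])
        (use that in \<open>auto intro!: lmul_lin lin_smult_fun[OF tpow_module] elim!: gens_Suc_E simp: lmul_pure smult_mult lin_smult[OF mlin_Cons(2)[OF pure_mlin]]\<close>)
  qed
qed

lemma rmul_lin2: "u \<in> TC (Suc m) \<Longrightarrow> (\<lambda>x. rmul (Suc m) x u) \<in> lin_maps K A (T (Suc m))"
proof -
  assume u: "u \<in> TC (Suc m)"
  show ?thesis
  proof (rule lin_mapsI)
    show "rmul (Suc m) x u \<in> TC (Suc m)" if "x \<in> AC" for x using lin_closed[OF rmul_lin[OF that] u] .
    show "rmul (Suc m) (x \<oplus> y) u = rmul (Suc m) x u \<oplus>\<^bsub>T (Suc m)\<^esub> rmul (Suc m) y u" if "x \<in> AC" "y \<in> AC" for x y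
      by (rule tpow_eqI[OF tpow_module _ _ _ u])
        (use that in \<open>auto intro!: rmul_lin lin_add_fun[OF tpow_lm] elim!: gens_snoc_E simp: rmul_pure AR.r_distr lin_add[OF mlin_Cons(4)[OF pure_mlin]]\<close>)
    show "rmul (Suc m) (c \<odot> x) u = c \<odot>\<^bsub>T (Suc m)\<^esub> rmul (Suc m) x u" if "c \<in> carrier K" "x \<in> AC" for c x
      by (rule tpow_eqI[OF tpow_module _ _ _ u])
        (use that in \<open>auto intro!: rmul_lin lin_smult_fun[OF tpow_module] elim!: gens_snoc_E simp: rmul_pure mult_smult lin_smult[OF mlin_Cons(4)[OF pure_mlin]]\<close>)
  qed
qed

section \<open>The bar modules over the enveloping algebra\<close>

abbreviation B where "B n \<equiv> bar_mod K A n"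

lemma B_simps: "carrier (B n) = TC (Suc (Suc n))" "add (B n) = add (T (Suc (Suc n)))" "\<zero>\<^bsub>B n\<^esub> = \<zero>\<^bsub>T (Suc (Suc n))\<^esub>"
  by (simp_all add: bar_mod_def Let_def)

lemma gens2_E:
  assumes xs: "xs \<in> TG (Suc (Suc n))"
    and C: "\<And>x ys z. xs = x # ys @ [z] \<Longrightarrow> x \<in> AC \<Longrightarrow> ys \<in> TG n \<Longrightarrow> z \<in> AC \<Longrightarrow> C"
  shows C
  using xs
proof (rule gens_Suc_E)
  fix x xs' assume x: "xs = x # xs'" "x \<in> AC" and xs': "xs' \<in> TG (Suc n)"
  show C using xs' by (rule gens_snoc_E) (use C x in simp)
qed

lemma
  assumes u: "u \<in> TC (Suc (Suc n))"
  shows B_smult_lin: "(\<lambda>s. s \<odot>\<^bsub>B n\<^esub> u) \<in> lin_maps K E (T (Suc (Suc n)))"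
    and B_smult_ep: "a \<in> AC \<Longrightarrow> b \<in> AC \<Longrightarrow> ep a b \<odot>\<^bsub>B n\<^esub> u = lmul (Suc (Suc n)) a (rmul (Suc (Suc n)) b u)"
proof -
  let ?T = "T (Suc (Suc n))" and ?p = "pt (Suc (Suc n))"
  let ?G = "\<lambda>a b xs. ?p ((a \<otimes> hd xs) # butlast (tl xs) @ [last xs \<otimes> b])"
  have s: "s \<odot>\<^bsub>B n\<^esub> u = lift K ?T (\<lambda>(a, b). lift K ?T (?G a b) u) s" for s by (simp add: bar_mod_def Let_def)
  have G: "lift K ?T (?G a b) u = lmul (Suc (Suc n)) a (rmul (Suc (Suc n)) b u)" if a: "a \<in> AC" and b: "b \<in> AC" for a b
  proof -
    have e: "lmul (Suc (Suc n)) a (rmul (Suc (Suc n)) b (?p xs)) = ?G a b xs" if mem: "xs \<in> TG (Suc (Suc n))" for xs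
    proof -
      obtain x ys z where xs: "xs = x # ys @ [z]" "x \<in> AC" "ys \<in> TG n" "z \<in> AC" using mem by (rule gens2_E)
      show ?thesis using xs(2-) a b rmul_pure[OF b xs(4), of "x # ys" "Suc n"] unfolding xs(1) by (simp add: lmul_pure gens_simps)
    qed
    have m: "mlin K A (Suc (Suc n)) ?T (?G a b)"
      by (rule mlin_cong[OF mlin_comp[OF mlin_comp[OF pure_mlin rmul_lin[OF b]] lmul_lin[OF a]] e AM.module_axioms])
    show ?thesis
      by (rule tpow_eqI[OF tpow_module tpow_lift(1)[OF tpow_module m] lin_comp[OF rmul_lin[OF b] lmul_lin[OF a]] _ u])
        (simp only: tpow_lift(2)[OF tpow_module m] e)
  qed
  let ?\<phi> = "\<lambda>a b. lmul (Suc (Suc n)) a (rmul (Suc (Suc n)) b u)"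
  have c: "rmul (Suc (Suc n)) b u \<in> carrier ?T" if "b \<in> AC" for b by (rule lin_closed[OF rmul_lin[OF that] u])
  have 1: "(\<lambda>a. ?\<phi> a b) \<in> lin_maps K A ?T" if "b \<in> AC" for b by (rule lmul_lin2[OF c[OF that]])
  have 2: "?\<phi> a (b \<oplus> b') = ?\<phi> a b \<oplus>\<^bsub>?T\<^esub> ?\<phi> a b'" if "a \<in> AC" "b \<in> AC" "b' \<in> AC" for a b b'
    using that by (simp add: lin_add[OF rmul_lin2[OF u]] lin_add[OF lmul_lin] c)
  have 3: "?\<phi> (k \<odot> a) b = ?\<phi> a (k \<odot> b)" if "a \<in> AC" "b \<in> AC" "k \<in> carrier K" for a b k
    using that by (simp add: lin_smult[OF rmul_lin2[OF u]] lin_smult[OF lmul_lin] lin_smult[OF lmul_lin2] c)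
  note l = env_lift[OF tpow_module 1 2 3 G[symmetric]]
  show "(\<lambda>s. s \<odot>\<^bsub>B n\<^esub> u) \<in> lin_maps K E ?T" unfolding s by (rule l(1); assumption)
  show "ep a b \<odot>\<^bsub>B n\<^esub> u = ?\<phi> a b" if ab: "a \<in> AC" "b \<in> AC"
    unfolding s G[OF ab, symmetric] by (rule l(2)) (assumption | rule ab)+
qed

end

text \<open>The ring axioms of the enveloping algebra are supplied by the given resolutions: their
  terms are left modules, and \<open>left_module\<close> includes the axioms of the ring that
  acts.\<close>

locale env_kalg = kalg K A for K :: "('k, 'm) ring_scheme" and A :: "('k, 'a) module" (structure) +
  assumes ringE: "ring (env_alg K A)"
begin

sublocale ER: ring "env_alg K A" by (rule ringE)

text \<open>The module axioms are extended from elementary tensors by \<open>env_induct\<close>.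
  \<open>V\<close> has the additive group of \<open>M\<close> but scalars in \<open>K\<close>, so
  that linearity in \<open>s\<close> can be expressed by \<open>lin_maps\<close>.\<close>

lemma env_left_moduleI:
  assumes M: "abelian_group M"
    and l: "\<And>x. x \<in> carrier M \<Longrightarrow> (\<lambda>s. s \<odot>\<^bsub>M\<^esub> x) \<in> lin_maps K E V" "carrier V = carrier M" "add V = add M" "zero V = zero M"
    and r: "\<And>a b x y. a \<in> AC \<Longrightarrow> b \<in> AC \<Longrightarrow> x \<in> carrier M \<Longrightarrow> y \<in> carrier M \<Longrightarrow>
      ep a b \<odot>\<^bsub>M\<^esub> (x \<oplus>\<^bsub>M\<^esub> y) = ep a b \<odot>\<^bsub>M\<^esub> x \<oplus>\<^bsub>M\<^esub> ep a b \<odot>\<^bsub>M\<^esub> y"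
    and m: "\<And>a b a' b' x. a \<in> AC \<Longrightarrow> b \<in> AC \<Longrightarrow> a' \<in> AC \<Longrightarrow> b' \<in> AC \<Longrightarrow> x \<in> carrier M \<Longrightarrow>
      ep (a \<otimes> a') (b' \<otimes> b) \<odot>\<^bsub>M\<^esub> x = ep a b \<odot>\<^bsub>M\<^esub> (ep a' b' \<odot>\<^bsub>M\<^esub> x)"
    and one: "\<And>x. x \<in> carrier M \<Longrightarrow> ep \<one> \<one> \<odot>\<^bsub>M\<^esub> x = x"
  shows "left_module E M"
proof (rule left_moduleI[OF ringE M])
  interpret M: abelian_group M by fact
  have V: "abelian_group V" by (rule abelian_group_cong[OF M l(2,3,4)])
  show c: "s \<odot>\<^bsub>M\<^esub> x \<in> carrier M" if "s \<in> carrier E" "x \<in> carrier M" for s x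
    using lin_closed[OF l(1)[OF that(2)] that(1)] l(2) by simp
  show ld: "(s \<oplus>\<^bsub>E\<^esub> s') \<odot>\<^bsub>M\<^esub> x = (s \<odot>\<^bsub>M\<^esub> x) \<oplus>\<^bsub>M\<^esub> (s' \<odot>\<^bsub>M\<^esub> x)" if "s \<in> carrier E" "s' \<in> carrier E" "x \<in> carrier M" for s s' x
    using lin_add[OF l(1)[OF that(3)] that(1,2)] l(3) by simp
  have z: "\<zero>\<^bsub>E\<^esub> \<odot>\<^bsub>M\<^esub> x = \<zero>\<^bsub>M\<^esub>" if "x \<in> carrier M" for x
    using lin_zero[OF l(1)[OF that] ER.abelian_group_axioms V] l(4) by simp
  show rd: "s \<odot>\<^bsub>M\<^esub> (x \<oplus>\<^bsub>M\<^esub> y) = (s \<odot>\<^bsub>M\<^esub> x) \<oplus>\<^bsub>M\<^esub> (s \<odot>\<^bsub>M\<^esub> y)" if "s \<in> carrier E" "x \<in> carrier M" "y \<in> carrier M" for s x y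
    using that(1)
  proof (induction s rule: env_induct)
    case zero show ?case using that by (simp add: z)
  next
    case (add s t)
    then show ?case using that c[OF add(1) that(2)] c[OF add(1) that(3)] c[OF add(2) that(2)] c[OF add(2) that(3)]
      by (simp add: ld M.a_ac)
  next
    case (ep a b) then show ?case using that by (simp add: r)
  qed
  have rz: "s \<odot>\<^bsub>M\<^esub> \<zero>\<^bsub>M\<^esub> = \<zero>\<^bsub>M\<^esub>" if "s \<in> carrier E" for s
    using rd[OF that, of "\<zero>\<^bsub>M\<^esub>" "\<zero>\<^bsub>M\<^esub>"] c[OF that, of "\<zero>\<^bsub>M\<^esub>"] by (metis M.add.r_cancel_one' M.l_zero M.zero_closed)
  show "(s \<otimes>\<^bsub>E\<^esub> s') \<odot>\<^bsub>M\<^esub> x = s \<odot>\<^bsub>M\<^esub> (s' \<odot>\<^bsub>M\<^esub> x)" if s: "s \<in> carrier E" and s': "s' \<in> carrier E" and x: "x \<in> carrier M" for s s' x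
    using s
  proof (induction s rule: env_induct)
    case zero show ?case using x s' c[OF s' x] by (simp add: z)
  next
    case (add s t)
    then show ?case using s' x c[OF s' x] by (simp add: ER.l_distr ld)
  next
    case (ep a b)
    then have e: "ep a b \<in> carrier E" by (rule ep_closed)
    show ?case using s'
    proof (induction s' rule: env_induct)
      case zero show ?case using x e by (simp add: z rz)
    next
      case (add s t)
      then show ?case using e x c[OF add(1) x] c[OF add(2) x] by (simp add: ER.r_distr ld rd)
    next
      case (ep a' b')
      then show ?case using \<open>a \<in> AC\<close> \<open>b \<in> AC\<close> x by (simp add: ep_mult m)
    qed
  qed
  show "\<one>\<^bsub>E\<^esub> \<odot>\<^bsub>M\<^esub> x = x" if "x \<in> carrier M" for x using one[OF that] by (simp add: ep_one)
qed

lemma B_module: "left_module E (B n)"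
proof (rule env_left_moduleI[where V = "T (Suc (Suc n))"])
  have c: "rmul (Suc (Suc n)) b u \<in> TC (Suc (Suc n))" if "b \<in> AC" "u \<in> TC (Suc (Suc n))" for b u
    by (rule lin_closed[OF rmul_lin[OF that(1)] that(2)])
  have c': "lmul (Suc (Suc n)) b u \<in> TC (Suc (Suc n))" if "b \<in> AC" "u \<in> TC (Suc (Suc n))" for b u
    by (rule lin_closed[OF lmul_lin[OF that(1)] that(2)])
  show "abelian_group (B n)" by (rule abelian_group_cong[OF tpow_ag]) (simp_all add: B_simps)
  fix x assume x: "x \<in> carrier (B n)"
  then have x': "x \<in> TC (Suc (Suc n))" by (simp add: B_simps)
  show "(\<lambda>s. s \<odot>\<^bsub>B n\<^esub> x) \<in> lin_maps K E (T (Suc (Suc n)))" by (rule B_smult_lin[OF x'])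
  show "ep \<one> \<one> \<odot>\<^bsub>B n\<^esub> x = x" by (simp add: B_smult_ep x' lmul_one rmul_one)
  fix a b assume a: "a \<in> AC" "b \<in> AC"
  show "ep a b \<odot>\<^bsub>B n\<^esub> (x \<oplus>\<^bsub>B n\<^esub> y) = ep a b \<odot>\<^bsub>B n\<^esub> x \<oplus>\<^bsub>B n\<^esub> ep a b \<odot>\<^bsub>B n\<^esub> y" if "y \<in> carrier (B n)" for y
    using that x' a by (simp add: B_simps B_smult_ep lin_add[OF rmul_lin] lin_add[OF lmul_lin] c)
  fix a' b' assume a': "a' \<in> AC" "b' \<in> AC"
  show "ep (a \<otimes> a') (b' \<otimes> b) \<odot>\<^bsub>B n\<^esub> x = ep a b \<odot>\<^bsub>B n\<^esub> (ep a' b' \<odot>\<^bsub>B n\<^esub> x)"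
    using a a' x' by (simp add: B_smult_ep c c' lmul_rmul rmul_rmul[symmetric] lmul_lmul[symmetric])
qed (simp_all add: B_simps)

lemma L_module: "left_module E L"
proof (rule env_left_moduleI[where V = A])
  show "abelian_group L" by (rule abelian_group_cong[OF AM.M.abelian_group_axioms]) (simp_all add: L_simps)
qed (auto simp: L_simps L_smult_ep AR.r_distr AR.l_distr AR.m_assoc intro: L_smult_lin)

lemma E_linI:
  assumes P: "left_module E P" and P': "left_module E P'"
    and c: "\<And>x. x \<in> carrier P \<Longrightarrow> f x \<in> carrier P'"
    and add: "\<And>x y. x \<in> carrier P \<Longrightarrow> y \<in> carrier P \<Longrightarrow> f (x \<oplus>\<^bsub>P\<^esub> y) = f x \<oplus>\<^bsub>P'\<^esub> f y"
    and sm: "\<And>a b x. a \<in> AC \<Longrightarrow> b \<in> AC \<Longrightarrow> x \<in> carrier P \<Longrightarrow> f (ep a b \<odot>\<^bsub>P\<^esub> x) = ep a b \<odot>\<^bsub>P'\<^esub> f x"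
  shows "f \<in> lin_maps E P P'"
proof (rule lin_mapsI)
  interpret P: left_module E P by fact
  interpret P': left_module E P' by fact
  have f0: "f \<zero>\<^bsub>P\<^esub> = \<zero>\<^bsub>P'\<^esub>" using add[of "\<zero>\<^bsub>P\<^esub>" "\<zero>\<^bsub>P\<^esub>"] c[of "\<zero>\<^bsub>P\<^esub>"]
    by (metis P'.M.add.r_cancel_one' P.M.l_zero P.M.zero_closed)
  show "f (s \<odot>\<^bsub>P\<^esub> x) = s \<odot>\<^bsub>P'\<^esub> f x" if s: "s \<in> carrier E" and x: "x \<in> carrier P" for s x
    using s
  proof (induction s rule: env_induct)
    case zero show ?case using x c by (simp add: P.act_zero_l P'.act_zero_l f0)
  next
    case (add s t) then show ?case using x c by (simp add: P.act_l_distr P'.act_l_distr assms(4) P.act_closed)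
  next
    case (ep a b) then show ?case using x by (simp add: sm)
  qed
qed (use c add in auto)

text \<open>Restriction of scalars along the map c \<mapsto> c 1 \<otimes> 1 into the enveloping
  algebra.\<close>

definition res where
  "res P = \<lparr>carrier = carrier P, mult = undefined, one = undefined, zero = \<zero>\<^bsub>P\<^esub>, add = add P,
     smult = (\<lambda>c x. ep (c \<odot> \<one>) \<one> \<odot>\<^bsub>P\<^esub> x)\<rparr>"

lemma res_simps: "carrier (res P) = carrier P" "add (res P) = add P" "zero (res P) = zero P"
  "c \<odot>\<^bsub>res P\<^esub> x = ep (c \<odot> \<one>) \<one> \<odot>\<^bsub>P\<^esub> x"
  by (simp_all add: res_def)

lemma ep_central:
  assumes "c \<in> carrier K" "a \<in> AC" "b \<in> AC"
  shows "ep (c \<odot> \<one>) \<one> \<otimes>\<^bsub>E\<^esub> ep a b = ep (c \<odot> a) b" "ep a b \<otimes>\<^bsub>E\<^esub> ep (c \<odot> \<one>) \<one> = ep (c \<odot> a) b"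
  using assms by (simp_all add: ep_mult smult_mult mult_smult)

lemma E_lin_res: "f \<in> lin_maps E P P' \<Longrightarrow> f \<in> lin_maps K (res P) (res P')"
  by (rule lin_mapsI) (auto simp: res_simps lin_closed lin_add ep_closed intro: lin_smult)

context
  fixes P :: "(('a \<times> 'a \<Rightarrow> 'k) set, 'p) module" assumes P: "left_module E P"
begin

interpretation P: left_module E P by (rule P)

lemma res_module: "module K (res P)"
proof (rule moduleI)
  show "cring K" by (rule AM.R.is_cring)
  show "abelian_group (res P)" by (rule abelian_group_cong[OF P.M.abelian_group_axioms]) (simp_all add: res_simps)
  have e: "ep (c \<odot> \<one>) \<one> \<in> carrier E" if "c \<in> carrier K" for c using that by (simp add: ep_closed)
  fix a x assume a: "a \<in> carrier K" and x: "x \<in> carrier (res P)"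
  show "a \<odot>\<^bsub>res P\<^esub> x \<in> carrier (res P)" using a x e by (simp add: res_simps P.act_closed)
  show "a \<odot>\<^bsub>res P\<^esub> (x \<oplus>\<^bsub>res P\<^esub> y) = a \<odot>\<^bsub>res P\<^esub> x \<oplus>\<^bsub>res P\<^esub> a \<odot>\<^bsub>res P\<^esub> y" if "y \<in> carrier (res P)" for y
    using a x e that by (simp add: res_simps P.act_r_distr)
  fix b assume b: "b \<in> carrier K"
  show "(a \<oplus>\<^bsub>K\<^esub> b) \<odot>\<^bsub>res P\<^esub> x = a \<odot>\<^bsub>res P\<^esub> x \<oplus>\<^bsub>res P\<^esub> b \<odot>\<^bsub>res P\<^esub> x"
    using a b x e by (simp add: res_simps AM.smult_l_distr lin_add[OF ep_lin] P.act_l_distr)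
  have "ep ((a \<otimes>\<^bsub>K\<^esub> b) \<odot> \<one>) \<one> = ep (a \<odot> \<one>) \<one> \<otimes>\<^bsub>E\<^esub> ep (b \<odot> \<one>) \<one>"
    using a b by (simp add: ep_central(1) AM.smult_assoc1)
  then show "(a \<otimes>\<^bsub>K\<^esub> b) \<odot>\<^bsub>res P\<^esub> x = a \<odot>\<^bsub>res P\<^esub> (b \<odot>\<^bsub>res P\<^esub> x)"
    using a b x e by (simp add: res_simps P.act_assoc)
next
  show "\<one>\<^bsub>K\<^esub> \<odot>\<^bsub>res P\<^esub> x = x" if "x \<in> carrier (res P)" for x
    using that P.act_one by (simp add: res_simps ep_one[symmetric])
qed

lemma ep_act_lin1: "z \<in> AC \<Longrightarrow> m \<in> carrier P \<Longrightarrow> (\<lambda>x. ep x z \<odot>\<^bsub>P\<^esub> m) \<in> lin_maps K A (res P)"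
  by (rule lin_mapsI) (auto simp: res_simps P.act_closed ep_closed lin_add[OF ep_lin] P.act_l_distr P.act_assoc[symmetric] ep_central)

lemma ep_act_lin2: "x \<in> AC \<Longrightarrow> m \<in> carrier P \<Longrightarrow> (\<lambda>z. ep x z \<odot>\<^bsub>P\<^esub> m) \<in> lin_maps K A (res P)"
  by (rule lin_mapsI) (auto simp: res_simps P.act_closed ep_closed ep_add2 ep_smult2 P.act_l_distr P.act_assoc[symmetric] ep_central)

lemma ep_act_lin: "x \<in> AC \<Longrightarrow> z \<in> AC \<Longrightarrow> (\<lambda>m. ep x z \<odot>\<^bsub>P\<^esub> m) \<in> lin_maps K (res P) (res P)"
  by (rule lin_mapsI) (auto simp: res_simps P.act_closed ep_closed P.act_r_distr P.act_assoc[symmetric] ep_central)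

lemma B_lin_res:
  assumes f: "f \<in> lin_maps E (B n) P"
  shows "f \<in> lin_maps K (T (Suc (Suc n))) (res P)"
proof (rule lin_mapsI)
  fix c u assume c: "c \<in> carrier K" and u: "u \<in> TC (Suc (Suc n))"
  have "ep (c \<odot> \<one>) \<one> \<odot>\<^bsub>B n\<^esub> u = c \<odot>\<^bsub>T (Suc (Suc n))\<^esub> u"
    using c u by (simp add: B_smult_ep rmul_one lin_smult[OF lmul_lin2] lmul_one)
  then show "f (c \<odot>\<^bsub>T (Suc (Suc n))\<^esub> u) = c \<odot>\<^bsub>res P\<^esub> f u"
    using lin_smult[OF f, of "ep (c \<odot> \<one>) \<one>" u] c u by (simp add: ep_closed B_simps res_simps)
qed (use lin_closed[OF f] lin_add[OF f] in \<open>simp_all add: B_simps res_simps\<close>)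

lemma lin_res_B:
  assumes f: "f \<in> lin_maps E P (B n)"
  shows "f \<in> lin_maps K (res P) (T (Suc (Suc n)))"
proof (rule lin_mapsI)
  fix c x assume c: "c \<in> carrier K" and x: "x \<in> carrier (res P)"
  have fx: "f x \<in> TC (Suc (Suc n))" using lin_closed[OF f] x by (simp add: B_simps res_simps)
  have "ep (c \<odot> \<one>) \<one> \<odot>\<^bsub>B n\<^esub> f x = c \<odot>\<^bsub>T (Suc (Suc n))\<^esub> f x"
    using c fx by (simp add: B_smult_ep rmul_one lin_smult[OF lmul_lin2] lmul_one)
  then show "f (c \<odot>\<^bsub>res P\<^esub> x) = c \<odot>\<^bsub>T (Suc (Suc n))\<^esub> f x"
    using lin_smult[OF f, of "ep (c \<odot> \<one>) \<one>" x] c x by (simp add: ep_closed res_simps)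
qed (use lin_closed[OF f] lin_add[OF f] in \<open>simp_all add: B_simps res_simps\<close>)

end

text \<open>Tensors with units at both ends generate the bar module; the two sides of the action
  restore the outer entries.\<close>

lemma bar_ep: "x \<in> AC \<Longrightarrow> z \<in> AC \<Longrightarrow> ys \<in> TG n \<Longrightarrow>
    ep x z \<odot>\<^bsub>B n\<^esub> pt (Suc (Suc n)) (\<one> # ys @ [\<one>]) = pt (Suc (Suc n)) (x # ys @ [z])"
  using rmul_pure[of z "\<one>" "\<one> # ys" "Suc n"]
  by (simp add: B_smult_ep pure_closed gens_simps gens_iff lmul_pure)

text \<open>\<open>B n\<close> is the enveloping algebra tensored with the n-fold tensor power.
  Since \<open>K\<close> is a field, the map v \<mapsto> f (1 \<otimes> v \<otimes> 1) lifts
  linearly along \<open>p\<close>, and the action of the outer factors extends this lift.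
  Projectivity of the bar modules enters the proof in this form.\<close>

lemma bar_lift_ex:
  assumes M: "left_module E M" and M': "left_module E M'"
    and p: "p \<in> lin_maps E M M'" and f: "f \<in> lin_maps E (B n) M'"
    and img: "\<And>x. x \<in> carrier (B n) \<Longrightarrow> \<exists>m\<in>carrier M. p m = f x"
  shows "\<exists>g\<in>lin_maps E (B n) M. \<forall>x\<in>carrier (B n). p (g x) = f x"
proof -
  interpret M: left_module E M by fact
  interpret M': left_module E M' by fact
  let ?one = "\<lambda>v. tcons (Suc n) \<one> (tsnoc n \<one> v)"
  have one: "?one \<in> lin_maps K (T n) (T (Suc (Suc n)))" by (rule lin_comp[OF tsnoc_lin tcons_lin]) simp_all
  have onep: "?one (pt n ys) = pt (Suc (Suc n)) (\<one> # ys @ [\<one>])" if "ys \<in> TG n" for ys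
    using that by (simp add: tsnoc_pure tcons_pure gens_simps)
  have F: "(\<lambda>v. f (?one v)) \<in> lin_maps K (T n) (res M')" by (rule lin_comp[OF one B_lin_res[OF M' f]])
  have "\<exists>g\<in>lin_maps K (T n) (res M). \<forall>v\<in>TC n. p (g v) = f (?one v)"
  proof (rule vector_space_lift[OF field_K tpow_module res_module[OF M] res_module[OF M'] E_lin_res[OF p] F])
    show "\<exists>m\<in>carrier (res M). p m = f (?one v)" if "v \<in> TC n" for v
      using img[of "?one v"] lin_closed[OF one that] by (simp add: B_simps res_simps)
  qed
  then obtain g0 where g0: "g0 \<in> lin_maps K (T n) (res M)" and pg0: "\<And>v. v \<in> TC n \<Longrightarrow> p (g0 v) = f (?one v)" by blast
  have g0c: "g0 v \<in> carrier M" if "v \<in> TC n" for v using lin_closed[OF g0 that] by (simp add: res_simps)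
  \<comment> \<open>The extension of \<open>g0\<close> by the action, written on lists so that it
    becomes a multilinear map.\<close>
  let ?G = "\<lambda>zs. ep (hd zs) (last zs) \<odot>\<^bsub>M\<^esub> g0 (pt n (butlast (tl zs)))"
  have G: "mlin K A (Suc (Suc n)) (res M) ?G"
  proof (rule mlin_ConsI)
    fix x assume x: "x \<in> AC"
    show "mlin K A (Suc n) (res M) (\<lambda>xs. ?G (x # xs))"
    proof (rule mlin_snocI)
      fix z assume z: "z \<in> AC"
      show "mlin K A n (res M) (\<lambda>xs. ?G (x # xs @ [z]))"
        using mlin_comp[OF mlin_comp[OF pure_mlin g0] ep_act_lin[OF M x z]] by simp
    next
      fix xs assume "xs \<in> TG n"
      then show "(\<lambda>z. ?G (x # xs @ [z])) \<in> lin_maps K A (res M)"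
        using ep_act_lin2[OF M x g0c[OF pure_closed]] by simp
    qed
  next
    fix xs assume "xs \<in> TG (Suc n)"
    then obtain z ys where "xs = ys @ [z]" "z \<in> AC" "ys \<in> TG n" by (rule gens_snoc_E)
    then show "(\<lambda>x. ?G (x # xs)) \<in> lin_maps K A (res M)"
      using ep_act_lin1[OF M _ g0c[OF pure_closed]] by simp
  qed
  define g where "g = lift K (res M) ?G"
  have gl: "g \<in> lin_maps K (T (Suc (Suc n))) (res M)" unfolding g_def by (rule tpow_lift(1)[OF res_module[OF M] G])
  have gp: "g (pt (Suc (Suc n)) (x # ys @ [z])) = ep x z \<odot>\<^bsub>M\<^esub> g0 (pt n ys)"
    if "x \<in> AC" "ys \<in> TG n" "z \<in> AC" for x ys z
    unfolding g_def using tpow_lift(2)[OF res_module[OF M] G, of "x # ys @ [z]"] that by (simp add: gens_simps)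
  have gE: "g \<in> lin_maps E (B n) M"
  proof (rule E_linI[OF B_module M])
    show "g x \<in> carrier M" if "x \<in> carrier (B n)" for x using lin_closed[OF gl] that by (simp add: B_simps res_simps)
    show "g (x \<oplus>\<^bsub>B n\<^esub> y) = g x \<oplus>\<^bsub>M\<^esub> g y" if "x \<in> carrier (B n)" "y \<in> carrier (B n)" for x y
      using lin_add[OF gl] that by (simp add: B_simps res_simps)
    fix a b u assume ab: "a \<in> AC" "b \<in> AC" and "u \<in> carrier (B n)"
    then have u: "u \<in> TC (Suc (Suc n))" by (simp add: B_simps)
    have "g (lmul (Suc (Suc n)) a (rmul (Suc (Suc n)) b u)) = ep a b \<odot>\<^bsub>M\<^esub> g u"
    proof (rule tpow_eqI[OF res_module[OF M] lin_comp[OF lin_comp[OF rmul_lin[OF ab(2)] lmul_lin[OF ab(1)]] gl]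
          lin_comp[OF gl ep_act_lin[OF M ab]] _ u])
      fix xs assume "xs \<in> TG (Suc (Suc n))"
      then obtain x ys z where xs: "xs = x # ys @ [z]" "x \<in> AC" "ys \<in> TG n" "z \<in> AC" by (rule gens2_E)
      show "g (lmul (Suc (Suc n)) a (rmul (Suc (Suc n)) b (pt (Suc (Suc n)) xs))) = ep a b \<odot>\<^bsub>M\<^esub> g (pt (Suc (Suc n)) xs)"
        unfolding xs(1) using rmul_pure[OF ab(2) xs(4), of "x # ys" "Suc n"] xs(2-) ab
        by (simp add: lmul_pure gens_simps gp M.act_assoc[symmetric] ep_closed ep_mult g0c pure_closed)
    qed
    then show "g (ep a b \<odot>\<^bsub>B n\<^esub> u) = ep a b \<odot>\<^bsub>M\<^esub> g u" using ab u by (simp add: B_smult_ep)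
  qed
  show ?thesis
  proof (intro bexI[OF _ gE] ballI)
    fix u assume "u \<in> carrier (B n)"
    then have u: "u \<in> TC (Suc (Suc n))" by (simp add: B_simps)
    show "p (g u) = f u"
    proof (rule tpow_eqI[OF res_module[OF M'] lin_comp[OF gl E_lin_res[OF p]] B_lin_res[OF M' f] _ u])
      fix xs assume "xs \<in> TG (Suc (Suc n))"
      then obtain x ys z where xs: "xs = x # ys @ [z]" "x \<in> AC" "ys \<in> TG n" "z \<in> AC" by (rule gens2_E)
      have "p (g (pt (Suc (Suc n)) xs)) = ep x z \<odot>\<^bsub>M'\<^esub> f (?one (pt n ys))"
        unfolding xs(1) using xs(2-) by (simp add: gp lin_smult[OF p] ep_closed g0c pure_closed pg0)
      also have "\<dots> = f (ep x z \<odot>\<^bsub>B n\<^esub> ?one (pt n ys))"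
        using xs(2-) lin_closed[OF one pure_closed] by (simp add: lin_smult[OF f] ep_closed B_simps)
      also have "\<dots> = f (pt (Suc (Suc n)) xs)" using xs by (simp add: onep bar_ep)
      finally show "p (g (pt (Suc (Suc n)) xs)) = f (pt (Suc (Suc n)) xs)" .
    qed
  qed
qed

lemma bar_E_lin: "bd (Suc (Suc n)) \<in> lin_maps E (B (Suc n)) (B n)"
  by (rule E_linI[OF B_module B_module])
    (simp_all add: B_simps lin_closed[OF bar_lin] lin_add[OF bar_lin] B_smult_ep bar_lmul bar_rmul lin_closed[OF rmul_lin])

section \<open>The augmentation of the bar resolution\<close>

definition aug where
  "aug = lift K A (\<lambda>xs. xs ! 0 \<otimes> xs ! 1)"

lemma aug_mlin: "mlin K A (Suc (Suc 0)) A (\<lambda>xs. xs ! 0 \<otimes> xs ! 1)"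
  by (intro mlin_ConsI mlin_0I) (auto simp: gens_iff length_Suc_conv intro: lmult_lin rmult_lin)

lemma aug_lin: "aug \<in> lin_maps K (T (Suc (Suc 0))) A"
  unfolding aug_def by (rule tpow_lift(1)[OF AM.module_axioms aug_mlin])

lemma aug_pure: "x \<in> AC \<Longrightarrow> y \<in> AC \<Longrightarrow> aug (pt (Suc (Suc 0)) [x, y]) = x \<otimes> y"
  unfolding aug_def using tpow_lift(2)[OF AM.module_axioms aug_mlin, of "[x, y]"] by (simp add: gens_iff)

lemma gens_2E: assumes "xs \<in> TG (Suc (Suc 0))" obtains x y where "xs = [x, y]" "x \<in> AC" "y \<in> AC"
  using assms by (auto simp: gens_iff length_Suc_conv)

lemma aug_E_lin: "aug \<in> lin_maps E (B 0) L"
proof (rule E_linI[OF B_module L_module])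
  fix a b u assume ab: "a \<in> AC" "b \<in> AC" and "u \<in> carrier (B 0)"
  then have u: "u \<in> TC (Suc (Suc 0))" by (simp add: B_simps)
  have "aug (lmul (Suc (Suc 0)) a (rmul (Suc (Suc 0)) b u)) = a \<otimes> aug u \<otimes> b"
  proof (rule tpow_eqI[OF AM.module_axioms lin_comp[OF lin_comp[OF rmul_lin[OF ab(2)] lmul_lin[OF ab(1)]] aug_lin]
        lin_comp[OF lin_comp[OF aug_lin lmult_lin[OF ab(1)]] rmult_lin[OF ab(2)]] _ u])
    fix xs assume "xs \<in> TG (Suc (Suc 0))"
    then obtain x y where xs: "xs = [x, y]" "x \<in> AC" "y \<in> AC" by (rule gens_2E)
    show "aug (lmul (Suc (Suc 0)) a (rmul (Suc (Suc 0)) b (pt (Suc (Suc 0)) xs))) = a \<otimes> aug (pt (Suc (Suc 0)) xs) \<otimes> b"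
      unfolding xs(1) using rmul_pure[OF ab(2) xs(3), of "[x]" "Suc 0"] xs(2,3) ab
      by (simp add: lmul_pure gens_iff aug_pure AR.m_assoc)
  qed
  then show "aug (ep a b \<odot>\<^bsub>B 0\<^esub> u) = ep a b \<odot>\<^bsub>L\<^esub> aug u"
    using ab u lin_closed[OF aug_lin u] by (simp add: B_smult_ep L_smult_ep)
qed (simp_all add: B_simps L_simps lin_closed[OF aug_lin] lin_add[OF aug_lin])

lemma aug_bar:
  assumes u: "u \<in> carrier (T (Suc (Suc (Suc 0))))" shows "aug (bd (Suc (Suc 0)) u) = \<zero>"
proof (rule tpow_eqI[OF AM.module_axioms lin_comp[OF bar_lin aug_lin] lin_zero_fun[OF module_left_module[OF AM.module_axioms]] _ u])
  fix xs assume "xs \<in> TG (Suc (Suc (Suc 0)))"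
  then obtain x xs' where xs: "xs = x # xs'" "x \<in> AC" "xs' \<in> TG (Suc (Suc 0))" by (rule gens_Suc_E)
  obtain y z where y: "xs' = [y, z]" "y \<in> AC" "z \<in> AC" using xs(3) by (rule gens_2E)
  have b1: "bd (Suc 0) (pt (Suc (Suc 0)) [y, z]) = pt (Suc 0) [y \<otimes> z]"
    using y by (subst bar_pure) (auto simp: gens_iff face_def signed_0 lessThan_Suc pure_closed)
  show "aug (bd (Suc (Suc 0)) (pt (Suc (Suc (Suc 0))) xs)) = \<zero>"
    unfolding xs(1) bar_Cons_pure[OF xs(2,3)] using xs(2) y b1
    by (simp add: lmul_pure tcons_pure gens_iff lin_minus[OF aug_lin tpow_ag AM.M.abelian_group_axioms] pure_closed aug_pure AR.m_assoc
      AM.M.minus_eq_zero_iff)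
qed

text \<open>Because the lowest bar differential is the augmentation, read in tensors of order one,
  exactness at the end of the resolution becomes an instance of \<open>bar_exact\<close>.\<close>

lemma bar_1_aug:
  assumes u: "u \<in> TC (Suc (Suc 0))" shows "bd (Suc 0) u = pt (Suc 0) [aug u]"
proof (rule tpow_eqI[OF tpow_module bar_lin lin_comp[OF aug_lin] _ u])
  show "(\<lambda>x. pt (Suc 0) [x]) \<in> lin_maps K A (T (Suc 0))" using mlin_lin[OF pure_mlin, of "[]" "[]" "Suc 0"] by simp
  fix xs assume "xs \<in> TG (Suc (Suc 0))"
  then obtain y z where y: "xs = [y, z]" "y \<in> AC" "z \<in> AC" by (rule gens_2E)
  show "bd (Suc 0) (pt (Suc (Suc 0)) xs) = pt (Suc 0) [aug (pt (Suc (Suc 0)) xs)]"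
    unfolding y(1) using y(2,3) by (subst bar_pure) (auto simp: gens_iff face_def signed_0 lessThan_Suc pure_closed aug_pure)
qed

lemma bar_exact_aug:
  assumes u: "u \<in> TC (Suc (Suc 0))" and "aug u = \<zero>"
  shows "bd (Suc (Suc 0)) (tcons (Suc (Suc 0)) \<one> u) = u"
proof (rule bar_exact[OF u])
  have "(\<lambda>x. pt (Suc 0) [x]) \<in> lin_maps K A (T (Suc 0))" using mlin_lin[OF pure_mlin, of "[]" "[]" "Suc 0"] by simp
  from lin_zero[OF this AM.M.abelian_group_axioms tpow_ag] show "bd (Suc 0) u = \<zero>\<^bsub>T (Suc 0)\<^esub>"
    unfolding bar_1_aug[OF u] assms(2) .
qed

end

section \<open>Hochschild homology and the first two columns\<close>

lemma uminus_eq_zero: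
  assumes "abelian_group V" "x \<in> carrier V" "\<ominus>\<^bsub>V\<^esub> x = \<zero>\<^bsub>V\<^esub>" shows "x = \<zero>\<^bsub>V\<^esub>"
proof -
  interpret V: abelian_group V by fact
  have "x = \<ominus>\<^bsub>V\<^esub> (\<ominus>\<^bsub>V\<^esub> x)" using assms(2) by simp
  then show ?thesis unfolding assms(3) by simp
qed

context kalg begin

lemma cols2: "p \<in> cols two_cols (int m) \<longleftrightarrow> p = 0 \<or> (p = 1 \<and> 0 < m)"
  "p \<in> cols {0, Suc 0} (int m) \<longleftrightarrow> p = 0 \<or> (p = Suc 0 \<and> 0 < m)"
  "p \<in> cols {0, Suc 0} (1 + int m) \<longleftrightarrow> p = 0 \<or> p = Suc 0"
  by (auto simp: cols_def)

lemma row2: "row (int m) 0 = m" "row (int (Suc m)) (Suc 0) = m" "row (1 + int m) 0 = Suc m" "row (1 + int m) (Suc 0) = m"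
  by (simp_all add: row_def nat_add_distrib)

lemma Tot_zero_closed: "\<zero>\<^bsub>Tot K A J n\<^esub> \<in> carrier (Tot K A J n)"
  using Tot_module[of J n] by (simp add: module_def abelian_group_def abelian_monoid.zero_closed)

lemma Tot2_closed:
  assumes "x \<in> carrier (Tot K A two_cols (int m))"
  shows "x 0 \<in> TC (Suc m)" "m = Suc k \<Longrightarrow> x 1 \<in> TC (Suc k)"
  using Tot_closed[OF assms, of 0] Tot_closed[OF assms, of 1] by (simp_all add: cols2 row2)

lemma int_pred: "int (Suc k) - 1 = int k" "int k + 1 = int (Suc k)"
  by simp_all

lemma Tot2_d:
  assumes x: "x \<in> carrier (Tot K A two_cols (int (Suc k)))"
  shows "Tot_d K A two_cols (int (Suc k)) x 0 = hoch_d K A (Suc k) (x 0) \<oplus>\<^bsub>T (Suc k)\<^esub> (x 1 \<ominus>\<^bsub>T (Suc k)\<^esub> cyc K A k (x 1))"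
    and "k = Suc j \<Longrightarrow> Tot_d K A two_cols (int (Suc k)) x 1 = \<ominus>\<^bsub>T (Suc j)\<^esub> bd (Suc j) (x 1)"
proof -
  have "0 \<in> cols two_cols (int (Suc k) - 1)" unfolding int_pred by (simp add: cols2)
  from Tot_d_comp[OF this, of x]
  show "Tot_d K A two_cols (int (Suc k)) x 0 = hoch_d K A (Suc k) (x 0) \<oplus>\<^bsub>T (Suc k)\<^esub> (x 1 \<ominus>\<^bsub>T (Suc k)\<^esub> cyc K A k (x 1))"
    unfolding int_pred row2 by (simp add: CC_vert_def CC_horiz_def CC_def)
  assume k: "k = Suc j"
  have x1: "x 1 \<in> TC (Suc (Suc j))" using Tot2_closed(2)[OF x] k by simp
  have "1 \<in> cols two_cols (int (Suc k) - 1)" unfolding int_pred by (simp add: cols2 k)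
  from Tot_d_comp[OF this, of x]
  show "Tot_d K A two_cols (int (Suc k)) x 1 = \<ominus>\<^bsub>T (Suc j)\<^esub> bd (Suc j) (x 1)"
    unfolding int_pred One_nat_def k row2 using lin_closed[OF bar_lin x1]
    by (simp add: CC_vert_def CC_def)
qed

text \<open>The Hochschild complex as column 0 of the first two columns. It induces an isomorphism
  on homology, because column 1 with differential \<open>-b'\<close> is contractible; this is the
  content of \<open>emb_boundary_iff\<close> and \<open>HT_rep\<close>.\<close>

definition emb where
  "emb m x = (\<lambda>p\<in>cols two_cols (int m). if p = 0 then x else \<zero>\<^bsub>T (Suc (row (int m) p))\<^esub>)"

lemma emb_simps: "emb m x 0 = x" "emb (Suc k) x (Suc 0) = \<zero>\<^bsub>T (Suc k)\<^esub>"
  using row2(2)[of k] by (simp_all add: emb_def cols2)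

lemma emb_lin: "emb m \<in> lin_maps K (T (Suc m)) (Tot K A two_cols (int m))"
  unfolding emb_def[abs_def] Tot_def CC_def
proof (rule dsum_family_lin)
  fix p assume "p \<in> cols two_cols (int m)"
  show "(\<lambda>x. if p = 0 then x else \<zero>\<^bsub>T (Suc (row (int m) p))\<^esub>) \<in> lin_maps K (T (Suc m)) (T (Suc (row (int m) p)))"
    using lin_zero_fun[OF tpow_lm] lin_id[of K "T (Suc m)"] by (cases "p = 0") (simp_all add: row2)
qed

lemma emb_closed: "x \<in> TC (Suc m) \<Longrightarrow> emb m x \<in> carrier (Tot K A two_cols (int m))"
  by (rule lin_closed[OF emb_lin])

lemma Tot2_ext:
  assumes "x \<in> carrier (Tot K A two_cols (int m))" "y \<in> carrier (Tot K A two_cols (int m))"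
    and "x 0 = y 0" "\<And>k. m = Suc k \<Longrightarrow> x 1 = y 1"
  shows "x = y"
  by (rule Tot_ext[OF assms(1,2)]) (use assms(3,4) in \<open>auto simp: cols2 gr0_conv_Suc\<close>)

lemma emb_d:
  assumes x: "x \<in> TC (Suc (Suc m))"
  shows "Tot_d K A two_cols (int (Suc m)) (emb (Suc m) x) = emb m (hoch_d K A (Suc m) x)"
proof -
  note e = emb_closed[OF x]
  note h = lin_closed[OF hoch_lin x]
  have d: "Tot_d K A two_cols (int (Suc m)) (emb (Suc m) x) \<in> carrier (Tot K A two_cols (int m))"
    using lin_closed[OF Tot_d_lin e] unfolding int_pred .
  have c0: "cyc K A m \<zero>\<^bsub>T (Suc m)\<^esub> = \<zero>\<^bsub>T (Suc m)\<^esub>" by (rule lin_zero[OF cyc_lin tpow_ag tpow_ag])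
  show ?thesis
  proof (rule Tot2_ext[OF d emb_closed[OF h]])
    show "Tot_d K A two_cols (int (Suc m)) (emb (Suc m) x) 0 = emb m (hoch_d K A (Suc m) x) 0"
      unfolding Tot2_d(1)[OF e] using h by (simp add: emb_simps c0 TM.M.minus_zero_right)
    fix k assume k: "m = Suc k"
    have b0: "bd (Suc k) \<zero>\<^bsub>T (Suc (Suc k))\<^esub> = \<zero>\<^bsub>T (Suc k)\<^esub>" by (rule lin_zero[OF bar_lin tpow_ag tpow_ag])
    show "Tot_d K A two_cols (int (Suc m)) (emb (Suc m) x) 1 = emb m (hoch_d K A (Suc m) x) 1"
      unfolding Tot2_d(2)[OF e k] unfolding k by (simp add: emb_simps b0)
  qed
qed

text \<open>In degree 0 there is no condition to satisfy: \<open>hoch_d K A 0\<close> would lead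
  into the tensor power of order zero, which is not part of the complex.\<close>

definition hcyc where
  "hcyc m = {x \<in> TC (Suc m). \<forall>k. m = Suc k \<longrightarrow> hoch_d K A (Suc k) x = \<zero>\<^bsub>T (Suc k)\<^esub>}"

definition hbd where
  "hbd m = hoch_d K A (Suc m) ` TC (Suc (Suc m))"

abbreviation "Z2 \<equiv> cycles (Tot K A two_cols) (Tot_d K A two_cols)"
abbreviation "B2 \<equiv> boundaries (Tot K A two_cols) (Tot_d K A two_cols)"
abbreviation "cl2 \<equiv> hclass (Tot K A two_cols) (Tot_d K A two_cols)"

lemma Tot_neg: "n < 0 \<Longrightarrow> x \<in> carrier (Tot K A J n) \<Longrightarrow> y \<in> carrier (Tot K A J n) \<Longrightarrow> x = y"
  by (rule Tot_ext) (auto simp: cols_def)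

lemma emb_cycle_iff: "x \<in> TC (Suc m) \<Longrightarrow> emb m x \<in> Z2 (int m) \<longleftrightarrow> x \<in> hcyc m"
proof (cases m)
  case 0
  assume x: "x \<in> TC (Suc m)"
  have "Tot_d K A two_cols 0 (emb 0 x) = \<zero>\<^bsub>Tot K A two_cols (- 1)\<^esub>"
  proof (rule Tot_neg)
    show "(- 1 :: int) < 0" by simp
    show "Tot_d K A two_cols 0 (emb 0 x) \<in> carrier (Tot K A two_cols (- 1))"
      using lin_closed[OF Tot_d_lin, of "emb 0 x" two_cols 0] emb_closed[OF x] 0 by simp
    show "\<zero>\<^bsub>Tot K A two_cols (- 1)\<^esub> \<in> carrier (Tot K A two_cols (- 1))" by (rule Tot_zero_closed)
  qed
  then show ?thesis using x emb_closed[OF x] 0 by (simp add: cycles_def hcyc_def)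
next
  case (Suc k)
  assume x: "x \<in> TC (Suc m)"
  have z: "emb k \<zero>\<^bsub>T (Suc k)\<^esub> = \<zero>\<^bsub>Tot K A two_cols (int k)\<^esub>"
    by (rule lin_zero[OF emb_lin tpow_ag module_abelian_group[OF Tot_module]])
  have "emb k y = \<zero>\<^bsub>Tot K A two_cols (int k)\<^esub> \<longleftrightarrow> y = \<zero>\<^bsub>T (Suc k)\<^esub>" for y
    using emb_simps(1)[of k] z by metis
  then show ?thesis using x emb_closed[OF x] emb_d[of x k] Suc by (simp add: cycles_def hcyc_def)
qed

text \<open>If x = b z0 + (1 - t) z1 with b' z1 = 0, then z1 = b' w for w = 1 \<otimes> z1, and (1 -
  t) b' w = b (1 - t) w. So \<open>x\<close> is already a boundary inside column 0.\<close>

lemma emb_boundary_iff: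
  assumes x: "x \<in> TC (Suc m)"
  shows "emb m x \<in> B2 (int m) \<longleftrightarrow> x \<in> hbd m"
proof
  assume "x \<in> hbd m"
  then obtain y where y: "y \<in> TC (Suc (Suc m))" "x = hoch_d K A (Suc m) y" by (auto simp: hbd_def)
  show "emb m x \<in> B2 (int m)" unfolding boundaries_def int_pred y(2) emb_d[OF y(1), symmetric]
    by (rule imageI) (rule emb_closed[OF y(1)])
next
  assume "emb m x \<in> B2 (int m)"
  then obtain z where z: "z \<in> carrier (Tot K A two_cols (int (Suc m)))" "emb m x = Tot_d K A two_cols (int (Suc m)) z"
    unfolding boundaries_def int_pred by blast
  have z0: "z 0 \<in> TC (Suc (Suc m))" and z1: "z 1 \<in> TC (Suc m)" using Tot2_closed[OF z(1)] by auto
  have xe: "x = hoch_d K A (Suc m) (z 0) \<oplus>\<^bsub>T (Suc m)\<^esub> (z 1 \<ominus>\<^bsub>T (Suc m)\<^esub> cyc K A m (z 1))"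
    unfolding Tot2_d(1)[OF z(1), symmetric] z(2)[symmetric] emb_simps ..
  \<comment> \<open>The component of the total boundary in column 1 vanishes, as
    \<open>emb m x\<close> has none there; for m = 0 there is nothing below and \<open>bar_0\<close>
    applies.\<close>
  have "bd m (z 1) = \<zero>\<^bsub>T m\<^esub>"
  proof (cases m)
    case 0 then show ?thesis using bar_0 z1 by simp
  next
    case (Suc j)
    have "\<ominus>\<^bsub>T (Suc j)\<^esub> bd (Suc j) (z 1) = \<zero>\<^bsub>T (Suc j)\<^esub>"
      unfolding Tot2_d(2)[OF z(1) Suc, symmetric] z(2)[symmetric] using emb_simps(2)[of j x] Suc by simp
    then show ?thesis using uminus_eq_zero[OF tpow_ag lin_closed[OF bar_lin]] z1 Suc by simp
  qed
  then have ex: "bd (Suc m) (tcons (Suc m) \<one> (z 1)) = z 1" by (rule bar_exact[OF z1])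
  let ?w = "tcons (Suc m) \<one> (z 1)"
  have w: "?w \<in> TC (Suc (Suc m))" by (rule lin_closed[OF tcons_lin z1]) simp
  have w': "?w \<ominus>\<^bsub>T (Suc (Suc m))\<^esub> cyc K A (Suc m) ?w \<in> TC (Suc (Suc m))"
    using w lin_closed[OF cyc_lin w] by simp
  have "x = hoch_d K A (Suc m) (z 0 \<oplus>\<^bsub>T (Suc (Suc m))\<^esub> (?w \<ominus>\<^bsub>T (Suc (Suc m))\<^esub> cyc K A (Suc m) ?w))"
    unfolding lin_add[OF hoch_lin z0 w'] hoch_one_minus_cyc[OF w] ex by (rule xe)
  then show "x \<in> hbd m" unfolding hbd_def by (rule image_eqI) (use z0 w' in simp)
qed

text \<open>The component of a cycle in column 1 is a cycle for \<open>b'\<close>, hence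
  \<open>b'\<close> of something, and subtracting a suitable total boundary removes it.\<close>

lemma HT_rep:
  assumes \<zeta>: "\<zeta> \<in> carrier (HT K A (int m))"
  obtains x where "x \<in> hcyc m" "\<zeta> = cl2 (int m) (emb m x)"
proof -
  interpret C: chain_complex K "Tot K A two_cols" "Tot_d K A two_cols" by (rule Tot_complex)
  obtain z where z: "z \<in> Z2 (int m)" "\<zeta> = cl2 (int m) z" using C.homology_rep \<zeta> unfolding HT_def by metis
  note zc = C.cycle_closed[OF z(1)]
  have "\<exists>x\<in>TC (Suc m). emb m x \<in> Z2 (int m) \<and> cl2 (int m) z = cl2 (int m) (emb m x)"
  proof (cases m)
    case 0
    have z0: "z 0 \<in> TC (Suc m)" by (rule Tot2_closed[OF zc])
    have "z = emb m (z 0)" by (rule Tot2_ext[OF zc emb_closed[OF z0]]) (simp_all add: emb_simps 0)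
    then show ?thesis using z0 z(1) by metis
  next
    case (Suc k)
    have z0: "z 0 \<in> TC (Suc (Suc k))" and z1: "z 1 \<in> TC (Suc k)" using Tot2_closed[OF zc] Suc by auto
    have dz: "Tot_d K A two_cols (int (Suc k)) z = \<zero>\<^bsub>Tot K A two_cols (int k)\<^esub>"
      using z(1) unfolding Suc cycles_def int_pred by simp
    have "bd k (z 1) = \<zero>\<^bsub>T k\<^esub>"
    proof (cases k)
      case 0 then show ?thesis using bar_0 z1 by simp
    next
      case (Suc j)
      have "1 \<in> cols two_cols (int k)" by (simp add: cols2 Suc)
      from Tot_zero[OF this] have "\<ominus>\<^bsub>T (Suc j)\<^esub> bd (Suc j) (z 1) = \<zero>\<^bsub>T (Suc j)\<^esub>"
        using Tot2_d(2)[OF zc[unfolded \<open>m = Suc k\<close>] Suc] dz Suc row2(2)[of j] by simp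
      then show ?thesis using uminus_eq_zero[OF tpow_ag lin_closed[OF bar_lin]] z1 Suc by simp
    qed
    then have ex: "bd (Suc k) (tcons (Suc k) \<one> (z 1)) = z 1" by (rule bar_exact[OF z1])
    let ?y = "tcons (Suc k) \<one> (z 1)"
    have y: "?y \<in> TC (Suc (Suc k))" by (rule lin_closed[OF tcons_lin z1]) simp
    \<comment> \<open>The minus sign before \<open>?y\<close> compensates the one in the
      differential \<open>-b'\<close> of column 1, so that the boundary of \<open>?w\<close> has
      exactly \<open>z 1\<close> there.\<close>
    let ?w = "\<lambda>p\<in>cols two_cols (int (Suc m)). if p = 0 then \<zero>\<^bsub>T (Suc (Suc m))\<^esub> else \<ominus>\<^bsub>T (Suc (Suc k))\<^esub> ?y"
    have w: "?w \<in> carrier (Tot K A two_cols (int (Suc m)))"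
      unfolding Tot_def dsum_family_def partial_object.simps
    proof (rule restrict_PiE_iff[THEN iffD2], rule ballI)
      fix p assume p: "p \<in> cols two_cols (int (Suc m))"
      show "(if p = 0 then \<zero>\<^bsub>T (Suc (Suc m))\<^esub> else \<ominus>\<^bsub>T (Suc (Suc k))\<^esub> ?y) \<in> carrier (CC K A p (row (int (Suc m)) p))"
      proof (cases "p = 0")
        case True then show ?thesis by (simp only: CC_def row2(1) if_True simp_thms TM.M.zero_closed)
      next
        case False
        then have p1: "p = Suc 0" using p unfolding cols2(1) by simp
        have "\<ominus>\<^bsub>T (Suc (Suc k))\<^esub> ?y \<in> TC (Suc m)" using y Suc by simp
        then show ?thesis unfolding p1 row2(2) CC_def by simp
      qed
    qed
    have w01: "?w 0 = \<zero>\<^bsub>T (Suc (Suc m))\<^esub>" "?w 1 = \<ominus>\<^bsub>T (Suc (Suc k))\<^esub> ?y" by (simp_all add: cols2)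
    have dw: "Tot_d K A two_cols (int (Suc m)) ?w \<in> carrier (Tot K A two_cols (int m))"
      using lin_closed[OF Tot_d_lin w] unfolding int_pred .
    have dwB: "Tot_d K A two_cols (int (Suc m)) ?w \<in> B2 (int m)" unfolding boundaries_def int_pred by (rule imageI[OF w])
    have dw1: "Tot_d K A two_cols (int (Suc m)) ?w 1 = z 1"
      unfolding Tot2_d(2)[OF w Suc] w01 using ex lin_uminus[OF bar_lin tpow_ag tpow_ag y] z1 by simp
    let ?t = "z \<ominus>\<^bsub>Tot K A two_cols (int m)\<^esub> Tot_d K A two_cols (int (Suc m)) ?w"
    have tZ: "?t \<in> Z2 (int m)" using C.cycle_minus[OF z(1)] dwB C.boundaries_cycles by blast
    note tc = C.cycle_closed[OF tZ]
    have m1: "1 \<in> cols two_cols (int m)" by (simp add: cols2 Suc)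
    have "?t 1 = z 1 \<ominus>\<^bsub>T (Suc (row (int m) 1))\<^esub> Tot_d K A two_cols (int (Suc m)) ?w 1"
      by (rule lin_minus[OF Tot_proj[OF m1] module_abelian_group[OF Tot_module] tpow_ag zc dw])
    also have "\<dots> = \<zero>\<^bsub>T (Suc k)\<^esub>" unfolding dw1 using z1 row2(2)[of k] by (simp add: TM.M.minus_eq_zero_iff Suc)
    finally have t1: "?t 1 = \<zero>\<^bsub>T (Suc k)\<^esub>" .
    have t0: "?t 0 \<in> TC (Suc m)" by (rule Tot2_closed[OF tc])
    have te: "?t = emb m (?t 0)"
      by (rule Tot2_ext[OF tc emb_closed[OF t0]]) (use t1 emb_simps(2)[of k "?t 0"] in \<open>simp_all add: emb_simps Suc\<close>)
    have "cl2 (int m) ?t = cl2 (int m) z"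
      unfolding C.hclass_minus[OF z(1) subsetD[OF C.boundaries_cycles dwB]]
      using C.hclass_zero_iff[OF subsetD[OF C.boundaries_cycles dwB]] dwB
        abelian_group.minus_zero_right[OF C.homology_abelian_group C.hclass_closed[OF z(1)]] by simp
    then show ?thesis using te tZ t0 by metis
  qed
  then show ?thesis using that emb_cycle_iff z(2) by metis
qed

lemma cl2_emb_eq:
  assumes x: "x \<in> hcyc m" and y: "y \<in> hcyc m"
  shows "cl2 (int m) (emb m x) = cl2 (int m) (emb m y) \<longleftrightarrow> x \<ominus>\<^bsub>T (Suc m)\<^esub> y \<in> hbd m"
proof -
  interpret C: chain_complex K "Tot K A two_cols" "Tot_d K A two_cols" by (rule Tot_complex)
  have c: "x \<in> TC (Suc m)" "y \<in> TC (Suc m)" using x y by (auto simp: hcyc_def)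
  have e: "emb m x \<ominus>\<^bsub>Tot K A two_cols (int m)\<^esub> emb m y = emb m (x \<ominus>\<^bsub>T (Suc m)\<^esub> y)"
    by (rule lin_minus[OF emb_lin tpow_ag module_abelian_group[OF Tot_module] c, symmetric])
  show ?thesis using C.hclass_eq_iff[of "emb m x" "int m" "emb m y"] x y c emb_cycle_iff e emb_boundary_iff[of "x \<ominus>\<^bsub>T (Suc m)\<^esub> y" m] by simp
qed

lemma mu_lin2: "u \<in> TC (Suc (Suc m)) \<Longrightarrow> (\<lambda>a. mu m a u) \<in> lin_maps K A (T (Suc m))"
proof -
  assume u: "u \<in> TC (Suc (Suc m))"
  have p: "mu m a (pt (Suc (Suc m)) (y # ys @ [z])) = pt (Suc m) ((z \<otimes> a \<otimes> y) # ys)"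
    if "a \<in> AC" "y \<in> AC" "ys \<in> TG m" "z \<in> AC" for a y ys z
    by (rule mu_pure) (use that in auto)
  show ?thesis
  proof (rule lin_mapsI)
    show "mu m x u \<in> TC (Suc m)" if "x \<in> AC" for x using lin_closed[OF mu_lin[OF that] u] .
    show "mu m (x \<oplus> y) u = mu m x u \<oplus>\<^bsub>T (Suc m)\<^esub> mu m y u" if "x \<in> AC" "y \<in> AC" for x y
      by (rule tpow_eqI[OF tpow_module _ _ _ u])
        (use that in \<open>auto intro!: mu_lin lin_add_fun[OF tpow_lm] elim!: gens2_E simp: p AR.l_distr AR.r_distr lin_add[OF mlin_Cons(2)[OF pure_mlin]]\<close>)
    show "mu m (c \<odot> x) u = c \<odot>\<^bsub>T (Suc m)\<^esub> mu m x u" if "c \<in> carrier K" "x \<in> AC" for c x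
      by (rule tpow_eqI[OF tpow_module _ _ _ u])
        (use that in \<open>auto intro!: mu_lin lin_smult_fun[OF tpow_module] elim!: gens2_E simp: p smult_mult mult_smult lin_smult[OF mlin_Cons(2)[OF pure_mlin]]\<close>)
  qed
qed

text \<open>The balancing relation over the enveloping algebra: it allows factors to be moved
  between the coefficient \<open>a\<close> and the two ends of a bar tensor.\<close>

lemma mu_lmul_rmul:
  assumes a: "a \<in> AC" and y: "y \<in> AC" and z: "z \<in> AC" and w: "w \<in> TC (Suc (Suc m))"
  shows "mu m a (lmul (Suc (Suc m)) y (rmul (Suc (Suc m)) z w)) = mu m (z \<otimes> a \<otimes> y) w"
proof (rule tpow_eqI[OF tpow_module lin_comp[OF lin_comp[OF rmul_lin[OF z] lmul_lin[OF y]] mu_lin[OF a]] mu_lin _ w])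
  fix xs assume "xs \<in> TG (Suc (Suc m))"
  then show "mu m a (lmul (Suc (Suc m)) y (rmul (Suc (Suc m)) z (pt (Suc (Suc m)) xs))) = mu m (z \<otimes> a \<otimes> y) (pt (Suc (Suc m)) xs)"
  proof (rule gens2_E)
    fix x ys v assume xs: "xs = x # ys @ [v]" "x \<in> AC" "ys \<in> TG m" "v \<in> AC"
    show ?thesis unfolding xs(1) using rmul_pure[OF z xs(4), of "x # ys" "Suc m"] xs(2-) a y z
      by (simp add: lmul_pure mu_pure gens_simps AR.m_assoc)
  qed
qed (use a y z in simp)

text \<open>Since \<open>mu\<close> reaches every pure tensor, equations in the Hochschild complex
  may be tested on its values, where equivariant maps of bar modules can be applied.\<close>

lemma mu_eqI:
  assumes "module K V" "f \<in> lin_maps K (T (Suc m)) V" "g \<in> lin_maps K (T (Suc m)) V"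
    and "\<And>a u. a \<in> AC \<Longrightarrow> u \<in> TC (Suc (Suc m)) \<Longrightarrow> f (mu m a u) = g (mu m a u)" and "v \<in> TC (Suc m)"
  shows "f v = g v"
proof (rule tpow_eqI[OF assms(1,2,3) _ assms(5)])
  fix xs assume "xs \<in> TG (Suc m)"
  then obtain a ys where a: "xs = a # ys" "a \<in> AC" "ys \<in> TG m" by (rule gens_Suc_E)
  show "f (pt (Suc m) xs) = g (pt (Suc m) xs)"
    unfolding a(1) pure_as_mu[OF a(2,3)] by (rule assms(4)) (use a in \<open>simp_all add: pure_closed gens_simps\<close>)
qed

end

context env_kalg begin

text \<open>The map obtained by tensoring an equivariant \<open>\<chi>\<close> on the bar module
  with A, its source read as a tensor power and its target described by a balanced pairing
  \<open>\<nu>\<close>. With \<open>mu\<close> for \<open>\<nu>\<close> the target is again a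
  Hochschild complex, with pure tensors it is the complex computing Tor.\<close>

definition ind where
  "ind n V \<nu> \<chi> = lift K V (\<lambda>xs. \<nu> (hd xs) (\<chi> (pt (Suc (Suc n)) (\<one> # tl xs @ [\<one>]))))"

lemma
  assumes P: "left_module E P" and V: "module K V" and \<chi>: "\<chi> \<in> lin_maps E (B n) P"
    and \<nu>1: "\<And>p. p \<in> carrier P \<Longrightarrow> (\<lambda>a. \<nu> a p) \<in> lin_maps K A V"
    and \<nu>2: "\<And>a. a \<in> AC \<Longrightarrow> \<nu> a \<in> lin_maps K (res P) V"
    and \<nu>3: "\<And>a x y p. a \<in> AC \<Longrightarrow> x \<in> AC \<Longrightarrow> y \<in> AC \<Longrightarrow> p \<in> carrier P \<Longrightarrow>
      \<nu> (y \<otimes> a \<otimes> x) p = \<nu> a (ep x y \<odot>\<^bsub>P\<^esub> p)"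
  shows ind_lin: "ind n V \<nu> \<chi> \<in> lin_maps K (T (Suc n)) V"
    and ind_mu: "a \<in> AC \<Longrightarrow> u \<in> TC (Suc (Suc n)) \<Longrightarrow> ind n V \<nu> \<chi> (mu n a u) = \<nu> a (\<chi> u)"
proof -
  interpret P: left_module E P by fact
  note \<chi>' = B_lin_res[OF P \<chi>]
  have \<chi>c: "\<chi> u \<in> carrier P" if "u \<in> TC (Suc (Suc n))" for u using lin_closed[OF \<chi>'] that by (simp add: res_simps)
  let ?F = "\<lambda>xs. \<nu> (hd xs) (\<chi> (pt (Suc (Suc n)) (\<one> # tl xs @ [\<one>])))"
  have m: "mlin K A (Suc n) V ?F"
  proof (rule mlin_ConsI)
    show "mlin K A n V (\<lambda>xs. ?F (x # xs))" if x: "x \<in> AC" for x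
      using mlin_comp[OF mlin_comp[OF mlin_Cons(3)[OF mlin_Cons(1)[OF pure_mlin, of "\<one>"], of "\<one>"] \<chi>'] \<nu>2[OF x]] by simp
    show "(\<lambda>x. ?F (x # xs)) \<in> lin_maps K A V" if "xs \<in> TG n" for xs
      using \<nu>1[OF \<chi>c[OF pure_closed]] that by (simp add: gens_simps)
  qed
  show l: "ind n V \<nu> \<chi> \<in> lin_maps K (T (Suc n)) V" unfolding ind_def by (rule tpow_lift(1)[OF V m])
  assume a: "a \<in> AC" and u: "u \<in> TC (Suc (Suc n))"
  show "ind n V \<nu> \<chi> (mu n a u) = \<nu> a (\<chi> u)"
  proof (rule tpow_eqI[OF V lin_comp[OF mu_lin[OF a] l] lin_comp[OF \<chi>' \<nu>2[OF a]] _ u])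
    fix xs assume "xs \<in> TG (Suc (Suc n))"
    then show "ind n V \<nu> \<chi> (mu n a (pt (Suc (Suc n)) xs)) = \<nu> a (\<chi> (pt (Suc (Suc n)) xs))"
    proof (rule gens2_E)
      fix x ys y assume xs: "xs = x # ys @ [y]" "x \<in> AC" "ys \<in> TG n" "y \<in> AC"
      let ?p = "pt (Suc (Suc n)) (\<one> # ys @ [\<one>])"
      have p: "?p \<in> TC (Suc (Suc n))" using xs by (simp add: pure_closed gens_simps)
      have "ind n V \<nu> \<chi> (mu n a (pt (Suc (Suc n)) xs)) = \<nu> (y \<otimes> a \<otimes> x) (\<chi> ?p)"
        unfolding xs(1) mu_pure[OF a xs(2,3,4)] ind_def
        by (subst tpow_lift(2)[OF V m]) (use a xs in \<open>simp_all add: gens_simps\<close>)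
      also have "\<dots> = \<nu> a (\<chi> (ep x y \<odot>\<^bsub>B n\<^esub> ?p))"
        using a xs p by (simp add: \<nu>3 \<chi>c lin_smult[OF \<chi>] ep_closed B_simps)
      finally show ?thesis unfolding bar_ep[OF xs(2,4,3)] xs(1) .
    qed
  qed
qed

lemma
  assumes \<chi>: "\<chi> \<in> lin_maps E (B n) (B m)"
  shows indB_lin: "ind n (T (Suc m)) (mu m) \<chi> \<in> lin_maps K (T (Suc n)) (T (Suc m))"
    and indB_mu: "a \<in> AC \<Longrightarrow> u \<in> TC (Suc (Suc n)) \<Longrightarrow> ind n (T (Suc m)) (mu m) \<chi> (mu n a u) = mu m a (\<chi> u)"
proof -
  note r = lin_res_B[OF B_module lin_id, of m]
  have 1: "(\<lambda>a. mu m a p) \<in> lin_maps K A (T (Suc m))" if "p \<in> carrier (B m)" for p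
    using mu_lin2 that by (simp add: B_simps)
  have 2: "mu m a \<in> lin_maps K (res (B m)) (T (Suc m))" if "a \<in> AC" for a
    using lin_comp[OF r mu_lin[OF that]] by simp
  have 3: "mu m (y \<otimes> a \<otimes> x) p = mu m a (ep x y \<odot>\<^bsub>B m\<^esub> p)"
    if "a \<in> AC" "x \<in> AC" "y \<in> AC" "p \<in> carrier (B m)" for a x y p
    using that by (simp add: B_simps B_smult_ep mu_lmul_rmul)
  show "ind n (T (Suc m)) (mu m) \<chi> \<in> lin_maps K (T (Suc n)) (T (Suc m))"
    by (rule ind_lin[OF B_module tpow_module \<chi> 1 2 3])
  show "a \<in> AC \<Longrightarrow> u \<in> TC (Suc (Suc n)) \<Longrightarrow> ind n (T (Suc m)) (mu m) \<chi> (mu n a u) = mu m a (\<chi> u)"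
    by (rule ind_mu[OF B_module tpow_module \<chi> 1 2 3])
qed

definition ZB where
  "ZB n = {u \<in> TC (Suc (Suc n)). if n = 0 then aug u = \<zero> else bd (Suc n) u = \<zero>\<^bsub>T (Suc n)\<^esub>}"

lemma ZB_bar: "u \<in> ZB n \<Longrightarrow> \<exists>v\<in>carrier (B (Suc n)). bd (Suc (Suc n)) v = u"
  using bar_exact_aug[of u] bar_exact[of u "Suc n"] lin_closed[OF tcons_lin[OF AR.one_closed], of u "Suc (Suc n)"]
  by (auto simp: ZB_def B_simps split: if_splits)

text \<open>\<open>\<Phi>\<close> and the identity are two lifts of the identity of A to the bar
  resolution, hence homotopic. Tensoring the homotopy with A gives b (H x) = I x - x - H (b x),
  where I is induced by \<open>\<Phi>\<close>, and the last term vanishes on a cycle. It serves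
  twice: for a composite of comparison maps with another resolution, and for the projection onto the
  relative bar complex.\<close>

lemma bar_self_null_homotopy:
  assumes \<Phi>: "\<And>n. \<Phi> n \<in> lin_maps E (B n) (B n)"
    and d: "\<And>n u. u \<in> carrier (T (Suc (Suc (Suc n)))) \<Longrightarrow> bd (Suc (Suc n)) (\<Phi> (Suc n) u) = \<Phi> n (bd (Suc (Suc n)) u)"
    and a: "\<And>u. u \<in> TC (Suc (Suc 0)) \<Longrightarrow> aug (\<Phi> 0 u) = aug u"
    and x: "x \<in> hcyc n"
  shows "ind n (T (Suc n)) (mu n) (\<Phi> n) x \<ominus>\<^bsub>T (Suc n)\<^esub> x \<in> hbd n"
proof -
  have m: "module K (T n)" for n by (rule tpow_module)
  let ?D = "\<lambda>n u. \<Phi> n u \<ominus>\<^bsub>B n\<^esub> u"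
  have Dl: "?D n \<in> lin_maps E (B n) (B n)" for n by (rule lin_minus_fun[OF B_module \<Phi> lin_id])
  \<comment> \<open>\<open>B n\<close> and the tensor power share carrier and addition but are
    different records, so their subtractions have to be matched.\<close>
  have minus: "u \<ominus>\<^bsub>B n\<^esub> v = u \<ominus>\<^bsub>T (Suc (Suc n))\<^esub> v" if "u \<in> carrier (B n)" "v \<in> carrier (B n)" for u v n
  proof -
    interpret Bn: left_module E "B n" by (rule B_module)
    have "\<ominus>\<^bsub>T (Suc (Suc n))\<^esub> v = \<ominus>\<^bsub>B n\<^esub> v"
      by (rule TM.M.minus_equality) (use that Bn.M.l_neg[OF that(2)] Bn.M.a_inv_closed[OF that(2)] in \<open>simp_all add: B_simps\<close>)
    then show ?thesis by (simp add: a_minus_def B_simps)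
  qed
  have \<Phi>c: "\<Phi> n u \<in> TC (Suc (Suc n))" if "u \<in> TC (Suc (Suc n))" for u n
    using lin_closed[OF \<Phi>] that by (simp add: B_simps)
  have "\<exists>h. (\<forall>n. h n \<in> lin_maps E (B n) (B (Suc n))) \<and> (\<forall>u\<in>carrier (B 0). bd (Suc (Suc 0)) (h 0 u) = ?D 0 u) \<and>
    (\<forall>n. \<forall>u\<in>carrier (B (Suc n)). bd (Suc (Suc (Suc n))) (h (Suc n) u) = ?D (Suc n) u \<ominus>\<^bsub>B (Suc n)\<^esub> h n (bd (Suc (Suc n)) u))"
  proof (rule chain_null_homotopy[where dE = "\<lambda>n. bd (Suc (Suc n))" and dP = "\<lambda>n. bd (Suc (Suc n))" and Z = ZB])
    show "?D 0 u \<in> ZB 0" if "u \<in> carrier (B 0)" for u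
      using that \<Phi>c[of u 0] lin_closed[OF aug_lin] abelian_group.minus_closed[OF tpow_ag] lin_minus[OF aug_lin tpow_ag AM.M.abelian_group_axioms]
        minus[of "\<Phi> 0 u" 0 u]
      by (simp add: ZB_def B_simps a AM.M.minus_eq_zero_iff)
    show "bd (Suc (Suc n)) (?D (Suc n) u) = ?D n (bd (Suc (Suc n)) u)" if "u \<in> carrier (B (Suc n))" for n u
      using that \<Phi>c[of u "Suc n"] \<Phi>c[of "bd (Suc (Suc n)) u" n] lin_closed[OF bar_lin, of u "Suc (Suc n)"]
      by (simp add: B_simps minus lin_minus[OF bar_lin tpow_ag tpow_ag] d)
    show "\<exists>g\<in>lin_maps E (B n) (B (Suc n)). \<forall>x\<in>carrier (B n). bd (Suc (Suc n)) (g x) = f x"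
      if "f \<in> lin_maps E (B n) (B n)" "\<And>x. x \<in> carrier (B n) \<Longrightarrow> f x \<in> ZB n" for n f
      by (rule bar_lift_ex[OF B_module B_module bar_E_lin that(1)]) (rule ZB_bar[OF that(2)])
  qed (use Dl B_module bar_E_lin bar_bar in \<open>simp_all add: B_simps ZB_def\<close>)
  then obtain h where h: "\<And>n. h n \<in> lin_maps E (B n) (B (Suc n))"
    and h0: "\<And>u. u \<in> carrier (B 0) \<Longrightarrow> bd (Suc (Suc 0)) (h 0 u) = ?D 0 u"
    and hS: "\<And>n u. u \<in> carrier (B (Suc n)) \<Longrightarrow>
      bd (Suc (Suc (Suc n))) (h (Suc n) u) = ?D (Suc n) u \<ominus>\<^bsub>B (Suc n)\<^esub> h n (bd (Suc (Suc n)) u)" by blast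
  let ?I = "ind n (T (Suc n)) (mu n) (\<Phi> n)" and ?H = "\<lambda>n. ind n (T (Suc (Suc n))) (mu (Suc n)) (h n)"
  have hc: "h n u \<in> carrier (T (Suc (Suc (Suc n))))" if "u \<in> TC (Suc (Suc n))" for n u
    using lin_closed[OF h] that by (simp add: B_simps)
  have xc: "x \<in> TC (Suc n)" using x by (simp add: hcyc_def)
  have muc: "mu n a u \<in> TC (Suc n)" if "a \<in> AC" "u \<in> TC (Suc (Suc n))" for n a u by (rule lin_closed[OF mu_lin[OF that(1)] that(2)])
  have "hoch_d K A (Suc n) (?H n x) = ?I x \<ominus>\<^bsub>T (Suc n)\<^esub> x"
  proof (cases n)
    case 0
    show ?thesis unfolding 0
    proof (rule mu_eqI[OF tpow_module lin_comp[OF indB_lin[OF h] hoch_lin] lin_minus_fun[OF tpow_lm indB_lin[OF \<Phi>] lin_id] _ xc[unfolded 0]])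
      fix a u assume a: "a \<in> AC" and u: "u \<in> TC (Suc (Suc 0))"
      show "hoch_d K A (Suc 0) (?H 0 (mu 0 a u)) = ind 0 (T (Suc 0)) (mu 0) (\<Phi> 0) (mu 0 a u) \<ominus>\<^bsub>T (Suc 0)\<^esub> mu 0 a u"
        unfolding indB_mu[OF h a u] indB_mu[OF \<Phi> a u] hoch_mu[OF a hc[OF u]]
        using h0[of u] u \<Phi>c[OF u] minus[of "\<Phi> 0 u" 0 u] by (simp add: B_simps lin_minus[OF mu_lin[OF a] tpow_ag tpow_ag])
    qed
  next
    case (Suc k)
    have e: "hoch_d K A (Suc (Suc k)) (?H (Suc k) v) =
      (ind (Suc k) (T (Suc (Suc k))) (mu (Suc k)) (\<Phi> (Suc k)) v \<ominus>\<^bsub>T (Suc (Suc k))\<^esub> v) \<ominus>\<^bsub>T (Suc (Suc k))\<^esub> ?H k (hoch_d K A (Suc k) v)"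
      if "v \<in> TC (Suc (Suc k))" for v
    proof (rule mu_eqI[OF tpow_module lin_comp[OF indB_lin[OF h] hoch_lin]
          lin_minus_fun[OF tpow_lm lin_minus_fun[OF tpow_lm indB_lin[OF \<Phi>] lin_id] lin_comp[OF hoch_lin indB_lin[OF h]]] _ that])
      fix a u assume a: "a \<in> AC" and u: "u \<in> carrier (T (Suc (Suc (Suc k))))"
      note bu = lin_closed[OF bar_lin u]
      have Bc: "u \<in> carrier (B (Suc k))" "\<Phi> (Suc k) u \<in> carrier (B (Suc k))" "?D (Suc k) u \<in> carrier (B (Suc k))"
        "h k (bd (Suc (Suc k)) u) \<in> carrier (B (Suc k))"
        using u \<Phi>c[OF u] lin_closed[OF Dl] hc[OF bu] by (simp_all add: B_simps)
      have "bd (Suc (Suc (Suc k))) (h (Suc k) u) =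
        (\<Phi> (Suc k) u \<ominus>\<^bsub>T (Suc (Suc (Suc k)))\<^esub> u) \<ominus>\<^bsub>T (Suc (Suc (Suc k)))\<^esub> h k (bd (Suc (Suc k)) u)"
        unfolding hS[OF Bc(1)] minus[OF Bc(3,4)] unfolding minus[OF Bc(2,1)] ..
      then show "hoch_d K A (Suc (Suc k)) (?H (Suc k) (mu (Suc k) a u)) =
        (ind (Suc k) (T (Suc (Suc k))) (mu (Suc k)) (\<Phi> (Suc k)) (mu (Suc k) a u) \<ominus>\<^bsub>T (Suc (Suc k))\<^esub> mu (Suc k) a u)
          \<ominus>\<^bsub>T (Suc (Suc k))\<^esub> ?H k (hoch_d K A (Suc k) (mu (Suc k) a u))"
        unfolding indB_mu[OF h a u] indB_mu[OF \<Phi> a u] hoch_mu[OF a hc[OF u]] hoch_mu[OF a u] indB_mu[OF h a bu]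
        using u \<Phi>c[OF u] hc[OF bu] by (simp add: lin_minus[OF mu_lin[OF a] tpow_ag tpow_ag])
    qed
    have "hoch_d K A (Suc k) x = \<zero>\<^bsub>T (Suc k)\<^esub>" using x Suc by (simp add: hcyc_def)
    then show ?thesis using e[of x] xc lin_zero[OF indB_lin[OF h] tpow_ag tpow_ag, of k]
      TM.M.minus_zero_right[OF TM.M.minus_closed[OF lin_closed[OF indB_lin[OF \<Phi>]]]] unfolding Suc by simp
  qed
  then show ?thesis unfolding hbd_def by (rule image_eqI[OF sym]) (rule lin_closed[OF indB_lin[OF h] xc])
qed

end

section \<open>Hochschild homology as a derived functor\<close>

lemma zero_mod_module: assumes "cring K" shows "module K zero_mod"
proof (rule moduleI[OF assms])
  show "abelian_group zero_mod" by (rule abelian_groupI) (auto simp: zero_mod_def)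
qed (auto simp: zero_mod_def)

lemma bij_betw_trivial:
  assumes "\<And>x y. x \<in> V \<Longrightarrow> y \<in> V \<Longrightarrow> x = y" "\<And>x y. x \<in> W \<Longrightarrow> y \<in> W \<Longrightarrow> x = y" "x0 \<in> V" "f \<in> V \<rightarrow> W"
  shows "bij_betw f V W"
  unfolding bij_betw_def
proof
  show "inj_on f V" using assms(1) by (intro inj_onI)
  show "f ` V = W"
  proof (intro subset_antisym subsetI)
    show "y \<in> W" if "y \<in> f ` V" for y using that assms(4) by auto
    show "y \<in> f ` V" if "y \<in> W" for y
      by (rule image_eqI[OF assms(2)[OF that] assms(3)]) (use assms(3,4) in auto)
  qed
qed

lemma (in chain_complex) homology_trivial:
  assumes "\<And>x y. x \<in> carrier (X n) \<Longrightarrow> y \<in> carrier (X n) \<Longrightarrow> x = y"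
    and "u \<in> carrier (homology X d n)" "v \<in> carrier (homology X d n)"
  shows "u = v"
proof -
  obtain x where x: "x \<in> cycles X d n" "u = hclass X d n x" using homology_rep[OF assms(2)] .
  obtain y where y: "y \<in> cycles X d n" "v = hclass X d n y" using homology_rep[OF assms(3)] .
  show ?thesis unfolding x(2) y(2) assms(1)[OF cycle_closed[OF x(1)] cycle_closed[OF y(1)]] ..
qed

context env_kalg begin

section \<open>Tensoring with A over the enveloping algebra\<close>

abbreviation TP where
  "TP P \<equiv> tens K E A ract P"
abbreviation tp where
  "tp P \<equiv> tens_pure K E A ract P"

lemma TP_tensor: assumes "left_module E P" shows "tensor K E A ract P"
proof -
  interpret P: left_module E P by fact
  show ?thesis
    by (rule tensor.intro) (auto intro: AM.module_axioms P.M.abelian_group_axioms P.act_closed lin_closed[OF ract_lin])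
qed

context
  fixes P :: "(('a \<times> 'a \<Rightarrow> 'k) set, 'p) module" assumes P: "left_module E P"
begin

interpretation P: left_module E P by (rule P)
interpretation TE: tensor K E A ract P by (rule TP_tensor[OF P])

lemma TP_module: "module K (TP P)" by (rule TE.TT_module)

text \<open>Compatibility with all of the enveloping algebra follows from the case of elementary
  tensors \<open>ep x y\<close>, by induction on the scalar.\<close>

lemma TP_lift:
  assumes V: "module K V"
    and \<nu>1: "\<And>p. p \<in> carrier P \<Longrightarrow> (\<lambda>a. \<nu> a p) \<in> lin_maps K A V"
    and \<nu>2: "\<And>a. a \<in> AC \<Longrightarrow> \<nu> a \<in> lin_maps K (res P) V"
    and \<nu>3: "\<And>a x y p. a \<in> AC \<Longrightarrow> x \<in> AC \<Longrightarrow> y \<in> AC \<Longrightarrow> p \<in> carrier P \<Longrightarrow>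
      \<nu> (y \<otimes> a \<otimes> x) p = \<nu> a (ep x y \<odot>\<^bsub>P\<^esub> p)"
  shows "lift K V (\<lambda>(a, p). \<nu> a p) \<in> lin_maps K (TP P) V"
    and "a \<in> AC \<Longrightarrow> p \<in> carrier P \<Longrightarrow> lift K V (\<lambda>(a, p). \<nu> a p) (tp P a p) = \<nu> a p"
proof -
  have add: "\<nu> a (p \<oplus>\<^bsub>P\<^esub> q) = \<nu> a p \<oplus>\<^bsub>V\<^esub> \<nu> a q" if "a \<in> AC" "p \<in> carrier P" "q \<in> carrier P" for a p q
    using lin_add[OF \<nu>2[OF that(1)], of p q] that by (simp add: res_simps)
  note Vag = module_abelian_group[OF V]
  have z2: "\<nu> a \<zero>\<^bsub>P\<^esub> = \<zero>\<^bsub>V\<^esub>" if "a \<in> AC" for a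
    using lin_zero[OF \<nu>2[OF that] module_abelian_group[OF res_module[OF P]] Vag] by (simp add: res_simps)
  have b: "\<nu> (ract m s) p = \<nu> m (s \<odot>\<^bsub>P\<^esub> p)" if m: "m \<in> AC" and s: "s \<in> carrier E" and p: "p \<in> carrier P" for m s p
    using s
  proof (induction s rule: env_induct)
    case zero
    show ?case using lin_zero[OF ract_lin[OF m] ER.abelian_group_axioms AM.M.abelian_group_axioms] lin_zero[OF \<nu>1[OF p] AM.M.abelian_group_axioms Vag]
        m p by (simp add: P.act_zero_l z2)
  next
    case (add s t)
    then show ?case using m p
      by (simp add: lin_add[OF ract_lin[OF m]] lin_add[OF \<nu>1[OF p]] lin_closed[OF ract_lin[OF m]] P.act_l_distr P.act_closed
        \<open>\<And>a p q. a \<in> AC \<Longrightarrow> p \<in> carrier P \<Longrightarrow> q \<in> carrier P \<Longrightarrow> \<nu> a (p \<oplus>\<^bsub>P\<^esub> q) = \<nu> a p \<oplus>\<^bsub>V\<^esub> \<nu> a q\<close>)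
  next
    case (ep a b) then show ?case using m p by (simp add: ract_ep \<nu>3)
  qed
  have bal: "balanced K E A ract P V \<nu>" unfolding balanced_def using \<nu>1 add b by simp
  show "lift K V (\<lambda>(a, p). \<nu> a p) \<in> lin_maps K (TP P) V" by (rule TE.tens_lift(1)[OF V bal])
  show "a \<in> AC \<Longrightarrow> p \<in> carrier P \<Longrightarrow> lift K V (\<lambda>(a, p). \<nu> a p) (tp P a p) = \<nu> a p" by (rule TE.tens_lift(2)[OF V bal])
qed

lemma tp1: "p \<in> carrier P \<Longrightarrow> (\<lambda>a. tp P a p) \<in> lin_maps K A (TP P)"
  using TE.tp_balanced by (simp add: balanced_def)

lemma tp_act: "a \<in> AC \<Longrightarrow> x \<in> AC \<Longrightarrow> y \<in> AC \<Longrightarrow> p \<in> carrier P \<Longrightarrow>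
      tp P (y \<otimes> a \<otimes> x) p = tp P a (ep x y \<odot>\<^bsub>P\<^esub> p)"
  using TE.tp_balanced by (simp add: balanced_def ract_ep[symmetric] ep_closed)

lemma tp2: assumes a: "a \<in> AC" shows "tp P a \<in> lin_maps K (res P) (TP P)"
proof (rule lin_mapsI)
  show "tp P a x \<in> carrier (TP P)" if "x \<in> carrier (res P)" for x using that a TE.tp_closed by (simp add: res_simps)
  show "tp P a (x \<oplus>\<^bsub>res P\<^esub> y) = tp P a x \<oplus>\<^bsub>TP P\<^esub> tp P a y" if "x \<in> carrier (res P)" "y \<in> carrier (res P)" for x y
    using that a TE.tp_balanced by (simp add: res_simps balanced_def)
  show "tp P a (c \<odot>\<^bsub>res P\<^esub> x) = c \<odot>\<^bsub>TP P\<^esub> tp P a x" if "c \<in> carrier K" "x \<in> carrier (res P)" for c x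
    using tp_act[OF a, of "c \<odot> \<one>" "\<one>" x] that a lin_smult[OF tp1, of x c a] by (simp add: res_simps mult_smult)
qed

lemma TP_eqI:
  assumes "module K V" "f \<in> lin_maps K (TP P) V" "g \<in> lin_maps K (TP P) V"
    and "\<And>m p. m \<in> AC \<Longrightarrow> p \<in> carrier P \<Longrightarrow> f (tp P m p) = g (tp P m p)" and "u \<in> carrier (TP P)"
  shows "f u = g u"
  by (rule TE.tens_eqI[OF assms])

end

definition TPmap where
  "TPmap P' f = lift K (TP P') (\<lambda>(a, x). tp P' a (f x))"

lemma
  assumes P: "left_module E P" and P': "left_module E P'" and f: "f \<in> lin_maps E P P'"
  shows TPmap_lin: "TPmap P' f \<in> lin_maps K (TP P) (TP P')"
    and TPmap_tp: "a \<in> AC \<Longrightarrow> p \<in> carrier P \<Longrightarrow> TPmap P' f (tp P a p) = tp P' a (f p)"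
proof -
  have 1: "(\<lambda>a. tp P' a (f p)) \<in> lin_maps K A (TP P')" if "p \<in> carrier P" for p
    by (rule tp1[OF P' lin_closed[OF f that]])
  have 2: "(\<lambda>p. tp P' a (f p)) \<in> lin_maps K (res P) (TP P')" if "a \<in> AC" for a
    by (rule lin_comp[OF E_lin_res[OF f] tp2[OF P' that]])
  have 3: "tp P' (y \<otimes> a \<otimes> x) (f p) = tp P' a (f (ep x y \<odot>\<^bsub>P\<^esub> p))"
    if "a \<in> AC" "x \<in> AC" "y \<in> AC" "p \<in> carrier P" for a x y p
    using that by (simp add: tp_act[OF P'] lin_closed[OF f] lin_smult[OF f] ep_closed)
  show "TPmap P' f \<in> lin_maps K (TP P) (TP P')" unfolding TPmap_def by (rule TP_lift(1)[OF P TP_module[OF P'] 1 2 3])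
  show "a \<in> AC \<Longrightarrow> p \<in> carrier P \<Longrightarrow> TPmap P' f (tp P a p) = tp P' a (f p)"
    unfolding TPmap_def by (rule TP_lift(2)[OF P TP_module[OF P'] 1 2 3])
qed

text \<open>From the Tor complex to the Hochschild complex: the identification inside
  \<open>theta_chain\<close>, for an equivariant map \<open>f\<close> into a bar module.\<close>

definition tmu where
  "tmu m f = lift K (T (Suc m)) (\<lambda>(a, x). mu m a (f x))"

lemma
  assumes P: "left_module E P" and f: "f \<in> lin_maps E P (B m)"
  shows tmu_lin: "tmu m f \<in> lin_maps K (TP P) (T (Suc m))"
    and tmu_tp: "a \<in> AC \<Longrightarrow> p \<in> carrier P \<Longrightarrow> tmu m f (tp P a p) = mu m a (f p)"
proof -
  note f' = lin_res_B[OF P f]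
  have fc: "f p \<in> TC (Suc (Suc m))" if "p \<in> carrier P" for p using lin_closed[OF f that] by (simp add: B_simps)
  have 1: "(\<lambda>a. mu m a (f p)) \<in> lin_maps K A (T (Suc m))" if "p \<in> carrier P" for p
    by (rule mu_lin2[OF fc[OF that]])
  have 2: "(\<lambda>p. mu m a (f p)) \<in> lin_maps K (res P) (T (Suc m))" if "a \<in> AC" for a
    by (rule lin_comp[OF f' mu_lin[OF that]])
  have 3: "mu m (y \<otimes> a \<otimes> x) (f p) = mu m a (f (ep x y \<odot>\<^bsub>P\<^esub> p))"
    if "a \<in> AC" "x \<in> AC" "y \<in> AC" "p \<in> carrier P" for a x y p
    using that by (simp add: lin_smult[OF f] ep_closed fc B_smult_ep mu_lmul_rmul)
  show "tmu m f \<in> lin_maps K (TP P) (T (Suc m))" unfolding tmu_def by (rule TP_lift(1)[OF P tpow_module 1 2 3])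
  show "a \<in> AC \<Longrightarrow> p \<in> carrier P \<Longrightarrow> tmu m f (tp P a p) = mu m a (f p)"
    unfolding tmu_def by (rule TP_lift(2)[OF P tpow_module 1 2 3])
qed

text \<open>The direction opposite to \<open>tmu\<close>, from an equivariant map out of a bar
  module; it is used with the comparison map from the bar resolution to the given one.\<close>

lemma
  assumes P: "left_module E P" and f: "f \<in> lin_maps E (B n) P"
  shows omega_lin: "ind n (TP P) (tp P) f \<in> lin_maps K (T (Suc n)) (TP P)"
    and omega_mu: "a \<in> AC \<Longrightarrow> u \<in> TC (Suc (Suc n)) \<Longrightarrow> ind n (TP P) (tp P) f (mu n a u) = tp P a (f u)"
proof -
  note c = tp1[OF P] tp2[OF P] tp_act[OF P]
  show "ind n (TP P) (tp P) f \<in> lin_maps K (T (Suc n)) (TP P)" by (rule ind_lin[OF P TP_module[OF P] f c])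
  show "a \<in> AC \<Longrightarrow> u \<in> TC (Suc (Suc n)) \<Longrightarrow> ind n (TP P) (tp P) f (mu n a u) = tp P a (f u)"
    by (rule ind_mu[OF P TP_module[OF P] f c])
qed

end

section \<open>Comparison of a projective resolution with the bar resolution\<close>

locale resn = kalg K A for K :: "('k, 'm) ring_scheme" and A :: "('k, 'a) module" (structure) +
  fixes Q :: "(('a \<times> 'a \<Rightarrow> 'k) set, 'p, 'a) resolution"
  assumes Q: "proj_resolution (env_alg K A) (env_left_mod K A) Q"
begin

abbreviation P where "P \<equiv> rmod Q"
abbreviation dQ where "dQ \<equiv> rdiff Q"

lemma P_proj: "projective E (P n)" using Q by (simp add: proj_resolution_def)

lemma P_mod: "left_module E (P n)" using P_proj by (simp add: projective_def)

sublocale env_kalg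
  using P_mod[of 0] by (intro env_kalg.intro env_kalg_axioms.intro kalg_axioms) (simp add: left_module_def)

lemma dQ_lin: "dQ n \<in> lin_maps E (P (Suc n)) (P n)"
  using Q by (cases n) (simp_all add: proj_resolution_def exact_at_def)

lemma raug_lin: "raug Q \<in> lin_maps E (P 0) L"
  using Q by (simp add: proj_resolution_def exact_at_def)

lemma raug_surj: "a \<in> AC \<Longrightarrow> \<exists>x\<in>carrier (P 0). raug Q x = a"
proof -
  assume "a \<in> AC"
  then have "a \<in> raug Q ` carrier (P 0)" using Q by (simp add: proj_resolution_def L_simps)
  then show ?thesis by blast
qed

lemma dQ_dQ: assumes x: "x \<in> carrier (P (Suc (Suc n)))" shows "dQ n (dQ (Suc n) x) = \<zero>\<^bsub>P n\<^esub>"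
proof -
  have "dQ (Suc n) ` carrier (P (Suc (Suc n))) = {v \<in> carrier (P (Suc n)). dQ n v = \<zero>\<^bsub>P n\<^esub>}"
    using Q by (simp add: proj_resolution_def exact_at_def)
  then show ?thesis using imageI[OF x, of "dQ (Suc n)"] by simp
qed

lemma raug_dQ: assumes x: "x \<in> carrier (P (Suc 0))" shows "raug Q (dQ 0 x) = \<zero>"
proof -
  have "dQ 0 ` carrier (P (Suc 0)) = {v \<in> carrier (P 0). raug Q v = \<zero>\<^bsub>L\<^esub>}"
    using Q by (simp add: proj_resolution_def exact_at_def)
  then show ?thesis using imageI[OF x, of "dQ 0"] by (simp add: L_simps)
qed

definition ZQ :: "nat \<Rightarrow> 'p set" where
  "ZQ n = {x \<in> carrier (P n). if n = 0 then raug Q x = \<zero> else dQ (n - 1) x = \<zero>\<^bsub>P (n - 1)\<^esub>}"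

lemma ZQ_d: assumes "x \<in> ZQ n" shows "\<exists>y\<in>carrier (P (Suc n)). dQ n y = x"
proof -
  have "x \<in> dQ n ` carrier (P (Suc n))"
  proof (cases n)
    case 0
    have "dQ 0 ` carrier (P (Suc 0)) = {v \<in> carrier (P 0). raug Q v = \<zero>\<^bsub>L\<^esub>}"
      using Q by (simp add: proj_resolution_def exact_at_def)
    then show ?thesis using assms 0 by (simp add: ZQ_def L_simps)
  next
    case (Suc k)
    have "dQ (Suc k) ` carrier (P (Suc (Suc k))) = {v \<in> carrier (P (Suc k)). dQ k v = \<zero>\<^bsub>P k\<^esub>}"
      using Q by (simp add: proj_resolution_def exact_at_def)
    then show ?thesis using assms Suc by (simp add: ZQ_def)
  qed
  then show ?thesis by blast
qed

lemma Pag: "abelian_group (P n)" using P_mod by (simp add: left_module_def)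

lemma Bag: "abelian_group (B n)" using B_module by (simp add: left_module_def)

text \<open>The terms of the given resolution lift by projectivity, against the bar complex, whose
  exactness comes from prepending the unit.\<close>

lemma bar_lift_exists: "\<exists>\<phi>. bar_lift K A Q \<phi>"
proof -
  have "\<exists>\<phi>0\<in>lin_maps E (P 0) (B 0). \<forall>x\<in>carrier (P 0). aug (\<phi>0 x) = raug Q x"
  proof (rule projective_lift[OF P_proj B_module L_module aug_E_lin raug_lin])
    fix x assume "x \<in> carrier (P 0)"
    then have "raug Q x \<in> AC" using lin_closed[OF raug_lin] by (simp add: L_simps)
    then show "\<exists>m\<in>carrier (B 0). aug m = raug Q x"
      by (intro bexI[of _ "pt (Suc (Suc 0)) [raug Q x, \<one>]"]) (simp_all add: aug_pure B_simps pure_closed gens_iff)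
  qed
  then obtain \<phi>0 where \<phi>0: "\<phi>0 \<in> lin_maps E (P 0) (B 0)" "\<And>x. x \<in> carrier (P 0) \<Longrightarrow> aug (\<phi>0 x) = raug Q x" by blast
  have "\<exists>\<phi>. \<phi> 0 = \<phi>0 \<and> (\<forall>n. \<phi> n \<in> lin_maps E (P n) (B n)) \<and>
    (\<forall>n. \<forall>x\<in>carrier (P (Suc n)). bd (Suc (Suc n)) (\<phi> (Suc n) x) = \<phi> n (dQ n x))"
  proof (rule chain_lift[where Z = ZB])
    show "\<phi>0 (dQ 0 x) \<in> ZB 0" if "x \<in> carrier (P (Suc 0))" for x
      using lin_closed[OF \<phi>0(1) lin_closed[OF dQ_lin that]] \<phi>0(2)[OF lin_closed[OF dQ_lin that]] raug_dQ[OF that] by (simp add: ZB_def B_simps)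
    show "\<exists>g\<in>lin_maps E (P (Suc n)) (B (Suc n)). \<forall>x\<in>carrier (P (Suc n)). bd (Suc (Suc n)) (g x) = f x"
      if "f \<in> lin_maps E (P (Suc n)) (B n)" "\<And>x. x \<in> carrier (P (Suc n)) \<Longrightarrow> f x \<in> ZB n" for n f
      by (rule projective_lift[OF P_proj B_module B_module bar_E_lin that(1)]) (rule ZB_bar[OF that(2)])
  qed (use \<phi>0 dQ_lin dQ_dQ Pag Bag in \<open>simp_all add: ZB_def B_simps\<close>)
  then obtain \<phi> where \<phi>: "\<phi> 0 = \<phi>0" "\<And>n. \<phi> n \<in> lin_maps E (P n) (B n)"
    "\<And>n x. x \<in> carrier (P (Suc n)) \<Longrightarrow> bd (Suc (Suc n)) (\<phi> (Suc n) x) = \<phi> n (dQ n x)" by blast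
  have "bar_lift K A Q \<phi>"
    unfolding bar_lift_def aug_def[symmetric] using \<phi> \<phi>0(2) by simp
  then show ?thesis by blast
qed

text \<open>The roles are exchanged: the bar modules lift by \<open>bar_lift_ex\<close>, against the
  exactness of the given resolution.\<close>

lemma back_lift_exists:
  obtains \<psi> where "\<And>n. \<psi> n \<in> lin_maps E (B n) (P n)"
    "\<And>n u. u \<in> carrier (T (Suc (Suc (Suc n)))) \<Longrightarrow> dQ n (\<psi> (Suc n) u) = \<psi> n (bd (Suc (Suc n)) u)"
    "\<And>u. u \<in> TC (Suc (Suc 0)) \<Longrightarrow> raug Q (\<psi> 0 u) = aug u"
proof -
  have "\<exists>\<psi>0\<in>lin_maps E (B 0) (P 0). \<forall>u\<in>carrier (B 0). raug Q (\<psi>0 u) = aug u"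
  proof (rule bar_lift_ex[OF P_mod L_module raug_lin aug_E_lin])
    fix u assume "u \<in> carrier (B 0)"
    then show "\<exists>m\<in>carrier (P 0). raug Q m = aug u" using raug_surj lin_closed[OF aug_lin] by (simp add: B_simps)
  qed
  then obtain \<psi>0 where \<psi>0: "\<psi>0 \<in> lin_maps E (B 0) (P 0)" "\<And>u. u \<in> carrier (B 0) \<Longrightarrow> raug Q (\<psi>0 u) = aug u" by blast
  have "\<exists>\<psi>. \<psi> 0 = \<psi>0 \<and> (\<forall>n. \<psi> n \<in> lin_maps E (B n) (P n)) \<and>
    (\<forall>n. \<forall>u\<in>carrier (B (Suc n)). dQ n (\<psi> (Suc n) u) = \<psi> n (bd (Suc (Suc n)) u))"
  proof (rule chain_lift[where Z = ZQ])
    show "\<psi>0 (bd (Suc (Suc 0)) u) \<in> ZQ 0" if "u \<in> carrier (B (Suc 0))" for u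
    proof -
      have b: "bd (Suc (Suc 0)) u \<in> carrier (B 0)" by (rule lin_closed[OF bar_E_lin that])
      show ?thesis using lin_closed[OF \<psi>0(1) b] \<psi>0(2)[OF b] aug_bar[of u] that by (simp add: ZQ_def B_simps)
    qed
    show "\<exists>g\<in>lin_maps E (B (Suc n)) (P (Suc n)). \<forall>x\<in>carrier (B (Suc n)). dQ n (g x) = f x"
      if "f \<in> lin_maps E (B (Suc n)) (P n)" "\<And>x. x \<in> carrier (B (Suc n)) \<Longrightarrow> f x \<in> ZQ n" for n f
      by (rule bar_lift_ex[OF P_mod P_mod dQ_lin that(1)]) (rule ZQ_d[OF that(2)])
    show "bd (Suc (Suc n)) (bd (Suc (Suc (Suc n))) x) = \<zero>\<^bsub>B n\<^esub>" if "x \<in> carrier (B (Suc (Suc n)))" for n x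
      using bar_bar that by (simp add: B_simps)
  qed (use \<psi>0 bar_E_lin Pag Bag in \<open>simp_all add: ZQ_def\<close>)
  then obtain \<psi> where \<psi>: "\<psi> 0 = \<psi>0" "\<And>n. \<psi> n \<in> lin_maps E (B n) (P n)"
    "\<And>n u. u \<in> carrier (B (Suc n)) \<Longrightarrow> dQ n (\<psi> (Suc n) u) = \<psi> n (bd (Suc (Suc n)) u)" by blast
  show ?thesis by (rule that[of \<psi>]) (use \<psi> \<psi>0(2) in \<open>simp_all add: B_simps\<close>)
qed

lemma tor_cx_int: "tor_cx K A Q (int m) = TP (P m)"
  by (simp add: tor_cx_def)

lemma tor_d_int: "tor_d K A Q (int (Suc m)) = TPmap (P m) (dQ m)"
proof
  fix u
  have "nat (int (Suc m) - 1) = m" by simp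
  then show "tor_d K A Q (int (Suc m)) u = TPmap (P m) (dQ m) u"
    unfolding tor_d_def TPmap_def int_pred tor_cx_int by simp
qed

lemma int_cases3: obtains "n < 0" | "n = int 0" | m where "n = int (Suc m)"
proof (cases "n < 0")
  case False
  then obtain k where "n = int k" using nonneg_int_cases by (metis not_less)
  then show ?thesis using that by (cases k) auto
qed

lemma tor_cx_module: "module K (tor_cx K A Q n)"
  using zero_mod_module[OF AM.R.is_cring] TP_module[OF P_mod] by (cases "n < 0") (simp_all add: tor_cx_def)

lemma dT_lin: "TPmap (P m) (dQ m) \<in> lin_maps K (TP (P (Suc m))) (TP (P m))"
  by (rule TPmap_lin[OF P_mod P_mod dQ_lin])

lemma TPag: "abelian_group (TP (P m))" by (rule module_abelian_group[OF TP_module[OF P_mod]])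

lemma tp_zero: "a \<in> AC \<Longrightarrow> tp (P m) a \<zero>\<^bsub>P m\<^esub> = \<zero>\<^bsub>TP (P m)\<^esub>"
  using lin_zero[OF tp2[OF P_mod] module_abelian_group[OF res_module[OF P_mod]] TPag, of a m] by (simp add: res_simps)

lemma tor_complex: "chain_complex K (tor_cx K A Q) (tor_d K A Q)"
proof (rule chain_complex.intro)
  fix n :: int
  show "module K (tor_cx K A Q n)" by (rule tor_cx_module)
  have z: "tor_d K A Q k = (\<lambda>_. \<zero>\<^bsub>tor_cx K A Q (k - 1)\<^esub>)" if "k \<le> 0" for k using that by (auto simp: tor_d_def)
  show "tor_d K A Q n \<in> lin_maps K (tor_cx K A Q n) (tor_cx K A Q (n - 1))"
  proof (cases n rule: int_cases3)
    case (3 m)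
    show ?thesis using dT_lin unfolding 3 int_pred tor_cx_int tor_d_int .
  qed (use z lin_zero_fun[OF module_left_module[OF tor_cx_module]] in auto)
  show "tor_d K A Q (n - 1) (tor_d K A Q n x) = \<zero>\<^bsub>tor_cx K A Q (n - 1 - 1)\<^esub>" if x: "x \<in> carrier (tor_cx K A Q n)" for x
  proof (cases "n - 1 \<le> 0")
    case True then show ?thesis using z by simp
  next
    case False
    then have "n = int (Suc (Suc (nat (n - 2))))" by simp
    then obtain m where n: "n = int (Suc (Suc m))" by blast
    have x': "x \<in> carrier (TP (P (Suc (Suc m))))" using x unfolding n tor_cx_int .
    have "TPmap (P m) (dQ m) (TPmap (P (Suc m)) (dQ (Suc m)) x) = \<zero>\<^bsub>TP (P m)\<^esub>"
      by (rule TP_eqI[OF P_mod TP_module[OF P_mod] lin_comp[OF dT_lin dT_lin] lin_zero_fun[OF module_left_module[OF TP_module[OF P_mod]]] _ x'])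
        (simp add: TPmap_tp[OF P_mod P_mod dQ_lin] lin_closed[OF dQ_lin] dQ_dQ tp_zero)
    then show ?thesis unfolding n int_pred tor_cx_int tor_d_int .
  qed
qed

context
  fixes \<phi> assumes \<phi>: "bar_lift K A Q \<phi>"
begin

lemma \<phi>_lin: "\<phi> n \<in> lin_maps E (P n) (B n)" using \<phi> by (simp add: bar_lift_def)

lemma \<phi>_d: "x \<in> carrier (P (Suc n)) \<Longrightarrow> bd (Suc (Suc n)) (\<phi> (Suc n) x) = \<phi> n (dQ n x)"
  using \<phi> by (simp add: bar_lift_def)

lemma \<phi>_aug: "x \<in> carrier (P 0) \<Longrightarrow> aug (\<phi> 0 x) = raug Q x"
  using \<phi> by (simp add: bar_lift_def aug_def)

lemma \<phi>_closed: "x \<in> carrier (P n) \<Longrightarrow> \<phi> n x \<in> TC (Suc (Suc n))"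
  using lin_closed[OF \<phi>_lin] by (simp add: B_simps)

lemma theta_chain_int: "theta_chain K A \<phi> (int m) u = emb m (tmu m (\<phi> m) u)"
  unfolding theta_chain_def emb_def
proof (rule restrict_ext)
  fix p assume "p \<in> cols two_cols (int m)"
  show "(let T = CC K A p (row (int m) p) in
     if p = 0 then lift K T (\<lambda>(a, x). lift K T (\<lambda>xs.
         pt (Suc (row (int m) p)) ((last xs \<otimes> a \<otimes> hd xs) # butlast (tl xs))) (\<phi> (nat (int m)) x)) u
     else \<zero>\<^bsub>T\<^esub>) = (if p = 0 then tmu m (\<phi> m) u else \<zero>\<^bsub>T (Suc (row (int m) p))\<^esub>)"
    by (cases "p = 0") (simp_all add: Let_def CC_def row2 tmu_def mu_def)
qed

lemma tmu_d:
  assumes u: "u \<in> carrier (TP (P (Suc m)))"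
  shows "hoch_d K A (Suc m) (tmu (Suc m) (\<phi> (Suc m)) u) = tmu m (\<phi> m) (TPmap (P m) (dQ m) u)"
  by (rule TP_eqI[OF P_mod tpow_module lin_comp[OF tmu_lin[OF P_mod \<phi>_lin] hoch_lin]
        lin_comp[OF dT_lin tmu_lin[OF P_mod \<phi>_lin]] _ u])
    (simp add: tmu_tp[OF P_mod \<phi>_lin] TPmap_tp[OF P_mod P_mod dQ_lin] lin_closed[OF dQ_lin] hoch_mu \<phi>_closed \<phi>_d)

lemma theta_chain_map: "chain_map K (tor_cx K A Q) (tor_d K A Q) (Tot K A two_cols) (Tot_d K A two_cols) (theta_chain K A \<phi>)"
proof (rule chain_map.intro[OF tor_complex Tot_complex], rule chain_map_axioms.intro)
  fix n :: int
  have pos: "theta_chain K A \<phi> (int m) \<in> lin_maps K (tor_cx K A Q (int m)) (Tot K A two_cols (int m))" for m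
    using lin_comp[OF tmu_lin[OF P_mod \<phi>_lin[of m]] emb_lin] unfolding theta_chain_int[abs_def] tor_cx_int .
  \<comment> \<open>In negative degree there are no columns, so the carrier consists of a single
    family and every equation between its members holds by \<open>Tot_neg\<close>.\<close>
  have neg: "theta_chain K A \<phi> n u \<in> carrier (Tot K A two_cols n)" if "n < 0" for u
    using that by (auto simp: theta_chain_def Tot_def dsum_family_def cols_def)
  show l: "theta_chain K A \<phi> n \<in> lin_maps K (tor_cx K A Q n) (Tot K A two_cols n)"
  proof (cases n rule: int_cases3)
    case 1
    interpret S: module K "Tot K A two_cols n" by (rule Tot_module)
    show ?thesis
      by (rule lin_mapsI; (rule Tot_neg[OF 1])?) (rule neg[OF 1] S.M.a_closed S.smult_closed | assumption)+
  qed (erule ssubst, rule pos)+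
  interpret C: chain_complex K "tor_cx K A Q" "tor_d K A Q" by (rule tor_complex)
  show "Tot_d K A two_cols n (theta_chain K A \<phi> n x) = theta_chain K A \<phi> (n - 1) (tor_d K A Q n x)" if x: "x \<in> carrier (tor_cx K A Q n)" for x
  proof (cases n rule: int_cases3)
    case (3 m)
    have x': "x \<in> carrier (TP (P (Suc m)))" using x unfolding 3 tor_cx_int .
    show ?thesis unfolding 3 int_pred theta_chain_int tor_d_int emb_d[OF lin_closed[OF tmu_lin[OF P_mod \<phi>_lin] x']] tmu_d[OF x'] ..
  next
    case 1
    have "theta_chain K A \<phi> (n - 1) u \<in> carrier (Tot K A two_cols (n - 1))" for u
      using 1 by (auto simp: theta_chain_def Tot_def dsum_family_def cols_def)
    then show ?thesis by (intro Tot_neg[of "n - 1"]) (use 1 lin_closed[OF Tot_d_lin lin_closed[OF l x]] in auto)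
  next
    case 2
    have "theta_chain K A \<phi> (n - 1) u \<in> carrier (Tot K A two_cols (n - 1))" for u
      using 2 by (auto simp: theta_chain_def Tot_def dsum_family_def cols_def)
    then show ?thesis by (intro Tot_neg[of "n - 1"]) (use 2 lin_closed[OF Tot_d_lin lin_closed[OF l x]] in auto)
  qed
qed

lemma theta_lin: "theta K A \<phi> n \<in> lin_maps K (HH K A Q n) (HT K A n)"
  unfolding theta_def HH_def HT_def by (rule chain_map.hmap_lin[OF theta_chain_map])

text \<open>With comparison maps \<open>\<phi>\<close> and \<open>\<psi>\<close> in both directions,
  injectivity uses a homotopy from \<open>\<psi> \<phi>\<close> to the identity on the given
  resolution, and surjectivity one from \<open>\<phi> \<psi>\<close> to the identity on the bar
  resolution.\<close>

lemma theta_bij: "bij_betw (theta K A \<phi> n) (carrier (HH K A Q n)) (carrier (HT K A n))"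
proof (cases "n < 0")
  case True
  interpret C: chain_complex K "tor_cx K A Q" "tor_d K A Q" by (rule tor_complex)
  interpret D: chain_complex K "Tot K A two_cols" "Tot_d K A two_cols" by (rule Tot_complex)
  show ?thesis
  proof (rule bij_betw_trivial)
    show "x = y" if "x \<in> carrier (HH K A Q n)" "y \<in> carrier (HH K A Q n)" for x y
      using C.homology_trivial[of n x y] that True unfolding HH_def by (simp add: tor_cx_def zero_mod_def)
    show "x = y" if "x \<in> carrier (HT K A n)" "y \<in> carrier (HT K A n)" for x y
      using D.homology_trivial[of n x y] Tot_neg[OF True] that unfolding HT_def by blast
    show "\<zero>\<^bsub>HH K A Q n\<^esub> \<in> carrier (HH K A Q n)"
      using C.homology_abelian_group[of n] unfolding HH_def by (simp add: abelian_group_def abelian_monoid.zero_closed)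
    show "theta K A \<phi> n \<in> carrier (HH K A Q n) \<rightarrow> carrier (HT K A n)" using lin_closed[OF theta_lin] by blast
  qed
next
  case False
  then obtain m where n: "n = int m" using nonneg_int_cases by (metis not_less)
  interpret th: chain_map K "tor_cx K A Q" "tor_d K A Q" "Tot K A two_cols" "Tot_d K A two_cols" "theta_chain K A \<phi>"
    by (rule theta_chain_map)
  let ?t = "theta K A \<phi> n"
  obtain \<psi> where \<psi>: "\<And>n. \<psi> n \<in> lin_maps E (B n) (P n)"
    and \<psi>_d: "\<And>n u. u \<in> carrier (T (Suc (Suc (Suc n)))) \<Longrightarrow> dQ n (\<psi> (Suc n) u) = \<psi> n (bd (Suc (Suc n)) u)"
    and \<psi>_aug: "\<And>u. u \<in> TC (Suc (Suc 0)) \<Longrightarrow> raug Q (\<psi> 0 u) = aug u" by (rule back_lift_exists) blast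
  have \<psi>c: "\<psi> k u \<in> carrier (P k)" if "u \<in> TC (Suc (Suc k))" for k u using lin_closed[OF \<psi>] that by (simp add: B_simps)
  \<comment> \<open>What \<open>\<psi>\<close> induces after tensoring with A: a chain map from the
    Hochschild complex back to the Tor complex.\<close>
  let ?w = "\<lambda>k. ind k (TP (P k)) (tp (P k)) (\<psi> k)"
  note wl = omega_lin[OF P_mod \<psi>] and wm = omega_mu[OF P_mod \<psi>]
  have w_d: "TPmap (P k) (dQ k) (?w (Suc k) x) = ?w k (hoch_d K A (Suc k) x)" if x: "x \<in> TC (Suc (Suc k))" for k x
    by (rule mu_eqI[OF TP_module[OF P_mod] lin_comp[OF wl dT_lin] lin_comp[OF hoch_lin wl] _ x])
      (simp add: wm TPmap_tp[OF P_mod P_mod dQ_lin] \<psi>c \<psi>_d hoch_mu lin_closed[OF bar_lin])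
  have tc: "?t (hclass (tor_cx K A Q) (tor_d K A Q) n u) = cl2 (int m) (emb m (tmu m (\<phi> m) u))"
    if "u \<in> cycles (tor_cx K A Q) (tor_d K A Q) n" for u
    using th.hmap_hclass[OF that] unfolding theta_def n theta_chain_int .
  show ?thesis unfolding bij_betw_def
  proof (intro conjI subset_antisym subsetI)
    interpret HHm: module K "HH K A Q n" unfolding HH_def by (rule th.X.homology_module)
    interpret HTm: module K "HT K A n" by (rule HT_module)
    have ker: "\<zeta> = \<zero>\<^bsub>HH K A Q n\<^esub>" if z: "\<zeta> \<in> carrier (HH K A Q n)" and t0: "?t \<zeta> = \<zero>\<^bsub>HT K A n\<^esub>" for \<zeta>
    proof -
      obtain u where u: "u \<in> cycles (tor_cx K A Q) (tor_d K A Q) n" "\<zeta> = hclass (tor_cx K A Q) (tor_d K A Q) n u"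
        using th.X.homology_rep z unfolding HH_def by metis
      have uc: "u \<in> carrier (TP (P m))" using th.X.cycle_closed[OF u(1)] unfolding n tor_cx_int .
      let ?x = "tmu m (\<phi> m) u"
      have xc: "?x \<in> TC (Suc m)" by (rule lin_closed[OF tmu_lin[OF P_mod \<phi>_lin] uc])
      have ez: "emb m ?x \<in> Z2 (int m)" using th.f_cycle[OF u(1)] unfolding n theta_chain_int .
      have "cl2 (int m) (emb m ?x) = \<zero>\<^bsub>homology (Tot K A two_cols) (Tot_d K A two_cols) (int m)\<^esub>"
        using t0 unfolding u(2) tc[OF u(1)] HT_def n[symmetric] by simp
      then have "?x \<in> hbd m" using th.Y.hclass_zero_iff[OF ez] emb_boundary_iff[OF xc] by simp
      then obtain v where v: "v \<in> TC (Suc (Suc m))" "?x = hoch_d K A (Suc m) v" by (auto simp: hbd_def)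
      \<comment> \<open>The difference of two lifts of the identity of A, hence a chain map that the
        augmentation kills.\<close>
      let ?D = "\<lambda>k x. \<psi> k (\<phi> k x) \<ominus>\<^bsub>P k\<^esub> x"
      have Dl: "?D k \<in> lin_maps E (P k) (P k)" for k by (rule lin_minus_fun[OF P_mod lin_comp[OF \<phi>_lin \<psi>] lin_id])
      have "\<exists>h. (\<forall>k. h k \<in> lin_maps E (P k) (P (Suc k))) \<and> (\<forall>x\<in>carrier (P 0). dQ 0 (h 0 x) = ?D 0 x) \<and>
        (\<forall>k. \<forall>x\<in>carrier (P (Suc k)). dQ (Suc k) (h (Suc k) x) = ?D (Suc k) x \<ominus>\<^bsub>P (Suc k)\<^esub> h k (dQ k x))"
      proof (rule chain_null_homotopy[where Z = ZQ])
        show "?D 0 x \<in> ZQ 0" if x: "x \<in> carrier (P 0)" for x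
        proof -
          have c: "\<psi> 0 (\<phi> 0 x) \<in> carrier (P 0)" by (rule \<psi>c[OF \<phi>_closed[OF x]])
          have "raug Q (?D 0 x) = raug Q (\<psi> 0 (\<phi> 0 x)) \<ominus>\<^bsub>L\<^esub> raug Q x"
            by (rule lin_minus[OF raug_lin Pag _ c x]) (use L_module in \<open>simp add: left_module_def\<close>)
          also have "\<dots> = \<zero>\<^bsub>L\<^esub>"
            using \<psi>_aug[OF \<phi>_closed[OF x]] \<phi>_aug[OF x] lin_closed[OF raug_lin x] L_module
            by (simp add: abelian_group.minus_eq_zero_iff left_module_def)
          finally show ?thesis using abelian_group.minus_closed[OF Pag c x] by (simp add: ZQ_def L_simps)
        qed
        show "dQ k (?D (Suc k) x) = ?D k (dQ k x)" if x: "x \<in> carrier (P (Suc k))" for k x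
          using lin_minus[OF dQ_lin Pag Pag \<psi>c[OF \<phi>_closed[OF x]] x] \<psi>_d[OF \<phi>_closed[OF x]] \<phi>_d[OF x] by simp
        show "\<exists>g\<in>lin_maps E (P k) (P (Suc k)). \<forall>x\<in>carrier (P k). dQ k (g x) = f x"
          if "f \<in> lin_maps E (P k) (P k)" "\<And>x. x \<in> carrier (P k) \<Longrightarrow> f x \<in> ZQ k" for k f
          by (rule projective_lift[OF P_proj P_mod P_mod dQ_lin that(1)]) (rule ZQ_d[OF that(2)])
      qed (use Dl P_mod dQ_lin dQ_dQ in \<open>simp_all add: ZQ_def\<close>)
      then obtain h where h: "\<And>k. h k \<in> lin_maps E (P k) (P (Suc k))"
        and h0: "\<And>x. x \<in> carrier (P 0) \<Longrightarrow> dQ 0 (h 0 x) = ?D 0 x"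
        and hS: "\<And>k x. x \<in> carrier (P (Suc k)) \<Longrightarrow> dQ (Suc k) (h (Suc k) x) = ?D (Suc k) x \<ominus>\<^bsub>P (Suc k)\<^esub> h k (dQ k x)" by blast
      let ?H = "\<lambda>k. TPmap (P (Suc k)) (h k)"
      note Hl = TPmap_lin[OF P_mod P_mod h] and Ht = TPmap_tp[OF P_mod P_mod h]
      interpret TPm: module K "TP (P m)" by (rule TP_module[OF P_mod])
      have tpm: "tp (P k) a (x \<ominus>\<^bsub>P k\<^esub> y) = tp (P k) a x \<ominus>\<^bsub>TP (P k)\<^esub> tp (P k) a y"
        if "a \<in> AC" "x \<in> carrier (P k)" "y \<in> carrier (P k)" for k a x y
      proof -
        interpret Pk: abelian_group "P k" by (rule Pag)
        interpret Rk: module K "res (P k)" by (rule res_module[OF P_mod])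
        have "\<ominus>\<^bsub>res (P k)\<^esub> y = \<ominus>\<^bsub>P k\<^esub> y"
          by (rule Rk.M.minus_equality) (use that Pk.l_neg in \<open>simp_all add: res_simps\<close>)
        then have "x \<ominus>\<^bsub>res (P k)\<^esub> y = x \<ominus>\<^bsub>P k\<^esub> y" by (simp add: a_minus_def res_simps)
        then show ?thesis using lin_minus[OF tp2[OF P_mod that(1)] Rk.M.abelian_group_axioms TPag, of x y] that by (simp add: res_simps)
      qed
      have wt: "?w k (tmu k (\<phi> k) (tp (P k) a x)) = tp (P k) a (\<psi> k (\<phi> k x))" if "a \<in> AC" "x \<in> carrier (P k)" for k a x
        using that by (simp add: tmu_tp[OF P_mod \<phi>_lin] wm \<phi>_closed)
      \<comment> \<open>The homotopy formula tensored with A; its term H (d u) drops out because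
        \<open>u\<close> is a cycle.\<close>
      have main: "TPmap (P m) (dQ m) (?H m u) = ?w m ?x \<ominus>\<^bsub>TP (P m)\<^esub> u"
      proof (cases m)
        case 0
        show ?thesis unfolding 0
          by (rule TP_eqI[OF P_mod TP_module[OF P_mod] lin_comp[OF Hl dT_lin]
              lin_minus_fun[OF module_left_module[OF TP_module[OF P_mod]] lin_comp[OF tmu_lin[OF P_mod \<phi>_lin] wl] lin_id] _ uc[unfolded 0]])
            (simp add: Ht TPmap_tp[OF P_mod P_mod dQ_lin] lin_closed[OF h] h0 wt tpm \<psi>c \<phi>_closed)
      next
        case (Suc k)
        note lmk = module_left_module[OF TP_module[OF P_mod]]
        have "TPmap (P (Suc k)) (dQ (Suc k)) (?H (Suc k) u) =
          (?w (Suc k) (tmu (Suc k) (\<phi> (Suc k)) u) \<ominus>\<^bsub>TP (P (Suc k))\<^esub> u) \<ominus>\<^bsub>TP (P (Suc k))\<^esub> ?H k (TPmap (P k) (dQ k) u)"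
        proof (rule TP_eqI[OF P_mod TP_module[OF P_mod] lin_comp[OF Hl dT_lin]
              lin_minus_fun[OF lmk lin_minus_fun[OF lmk lin_comp[OF tmu_lin[OF P_mod \<phi>_lin] wl] lin_id] lin_comp[OF dT_lin Hl]] _ uc[unfolded Suc]])
          fix a x assume a: "a \<in> AC" and x: "x \<in> carrier (P (Suc k))"
          have c: "?D (Suc k) x \<in> carrier (P (Suc k))" "h k (dQ k x) \<in> carrier (P (Suc k))"
            using lin_closed[OF Dl x] lin_closed[OF h lin_closed[OF dQ_lin x]] by auto
          show "TPmap (P (Suc k)) (dQ (Suc k)) (?H (Suc k) (tp (P (Suc k)) a x)) =
            (?w (Suc k) (tmu (Suc k) (\<phi> (Suc k)) (tp (P (Suc k)) a x)) \<ominus>\<^bsub>TP (P (Suc k))\<^esub> tp (P (Suc k)) a x)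
              \<ominus>\<^bsub>TP (P (Suc k))\<^esub> ?H k (TPmap (P k) (dQ k) (tp (P (Suc k)) a x))"
            using a x by (simp add: Ht TPmap_tp[OF P_mod P_mod dQ_lin] lin_closed[OF h] lin_closed[OF dQ_lin] hS wt tpm[OF a c] tpm \<psi>c \<phi>_closed)
        qed
        moreover have "TPmap (P k) (dQ k) u = \<zero>\<^bsub>TP (P k)\<^esub>"
          using u(1) unfolding n Suc cycles_def int_pred tor_d_int tor_cx_int by simp
        ultimately show ?thesis unfolding Suc
          using lin_zero[OF Hl TPag TPag, of k] abelian_group.minus_zero_right[OF TPag]
            abelian_group.minus_closed[OF TPag lin_closed[OF wl lin_closed[OF tmu_lin[OF P_mod \<phi>_lin]]] ] uc Suc by simp
      qed
      have wx: "?w m ?x = TPmap (P m) (dQ m) (?w (Suc m) v)" unfolding v(2) w_d[OF v(1)] ..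
      have c: "?w (Suc m) v \<in> carrier (TP (P (Suc m)))" "?H m u \<in> carrier (TP (P (Suc m)))"
        "?w m ?x \<in> carrier (TP (P m))"
        using lin_closed[OF wl v(1)] lin_closed[OF Hl uc] lin_closed[OF wl xc] by auto
      \<comment> \<open>Since the image of \<open>u\<close> is b v, applying \<open>?w\<close> to it
        gives the boundary of \<open>?w (Suc m) v\<close>. By \<open>main\<close>, \<open>u\<close>
        itself is then the boundary of the difference formed here.\<close>
      have "TPmap (P m) (dQ m) (?w (Suc m) v \<ominus>\<^bsub>TP (P (Suc m))\<^esub> ?H m u) = ?w m ?x \<ominus>\<^bsub>TP (P m)\<^esub> (?w m ?x \<ominus>\<^bsub>TP (P m)\<^esub> u)"
        unfolding lin_minus[OF dT_lin TPag TPag c(1,2)] main wx ..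
      also have "\<dots> = u" using c(3) uc by algebra
      finally have "u \<in> TPmap (P m) (dQ m) ` carrier (TP (P (Suc m)))"
        by (rule image_eqI[OF sym]) (rule abelian_group.minus_closed[OF TPag c(1,2)])
      moreover have "int m + 1 = int (Suc m)" by simp
      ultimately have "u \<in> boundaries (tor_cx K A Q) (tor_d K A Q) n"
        unfolding boundaries_def n by (simp only: tor_d_int tor_cx_int)
      then show ?thesis using th.X.hclass_zero_iff[OF u(1)] unfolding u(2) HH_def by simp
    qed
    show "inj_on ?t (carrier (HH K A Q n))"
    proof (rule inj_onI)
      fix x y assume xy: "x \<in> carrier (HH K A Q n)" "y \<in> carrier (HH K A Q n)" "?t x = ?t y"
      have "?t (x \<ominus>\<^bsub>HH K A Q n\<^esub> y) = \<zero>\<^bsub>HT K A n\<^esub>"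
        using lin_minus[OF theta_lin HHm.M.abelian_group_axioms HTm.M.abelian_group_axioms xy(1,2)] xy lin_closed[OF theta_lin]
          HTm.M.minus_eq_zero_iff by simp
      then have "x \<ominus>\<^bsub>HH K A Q n\<^esub> y = \<zero>\<^bsub>HH K A Q n\<^esub>" by (intro ker HHm.M.minus_closed xy)
      then show "x = y" using HHm.M.minus_eq_zero_iff[OF xy(1,2)] by simp
    qed
    show "y \<in> carrier (HT K A n)" if "y \<in> ?t ` carrier (HH K A Q n)" for y using that lin_closed[OF theta_lin] by auto
    show "\<zeta> \<in> ?t ` carrier (HH K A Q n)" if z: "\<zeta> \<in> carrier (HT K A n)" for \<zeta>
    proof -
      obtain x where x: "x \<in> hcyc m" "\<zeta> = cl2 (int m) (emb m x)" using HT_rep z unfolding n by metis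
      have xc: "x \<in> TC (Suc m)" using x(1) by (simp add: hcyc_def)
      \<comment> \<open>The preimage comes from a representative in column 0 by the backward
        comparison; going forth again changes it only by a boundary.\<close>
      let ?u = "?w m x"
      have uc: "?u \<in> carrier (TP (P m))" by (rule lin_closed[OF wl xc])
      have uz: "?u \<in> cycles (tor_cx K A Q) (tor_d K A Q) n"
      proof (cases m)
        case 0
        then show ?thesis using uc unfolding cycles_def n by (simp add: tor_cx_def tor_d_def)
      next
        case (Suc k)
        have "TPmap (P k) (dQ k) ?u = \<zero>\<^bsub>TP (P k)\<^esub>"
          using w_d[of x k] xc x(1) lin_zero[OF wl tpow_ag TPag, of k] Suc by (simp add: hcyc_def)
        then show ?thesis using uc unfolding n Suc cycles_def int_pred tor_d_int tor_cx_int by simp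
      qed
      let ?I = "ind m (T (Suc m)) (mu m) (\<lambda>u. \<phi> m (\<psi> m u))"
      have pp: "(\<lambda>u. \<phi> k (\<psi> k u)) \<in> lin_maps E (B k) (B k)" for k by (rule lin_comp[OF \<psi> \<phi>_lin])
      have "tmu m (\<phi> m) (?w m x) = ?I x"
        by (rule mu_eqI[OF tpow_module lin_comp[OF wl tmu_lin[OF P_mod \<phi>_lin]] indB_lin[OF pp] _ xc])
          (simp add: wm indB_mu[OF pp] tmu_tp[OF P_mod \<phi>_lin] \<psi>c)
      moreover have "?I x \<ominus>\<^bsub>T (Suc m)\<^esub> x \<in> hbd m"
        by (rule bar_self_null_homotopy[where \<Phi> = "\<lambda>k u. \<phi> k (\<psi> k u)", OF pp _ _ x(1)])
          (simp_all add: \<phi>_d \<psi>_d \<phi>_aug \<psi>_aug \<psi>c)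
      ultimately have b: "tmu m (\<phi> m) ?u \<ominus>\<^bsub>T (Suc m)\<^esub> x \<in> hbd m" by simp
      have tcyc: "tmu m (\<phi> m) ?u \<in> hcyc m"
        using th.f_cycle[OF uz] emb_cycle_iff[OF lin_closed[OF tmu_lin[OF P_mod \<phi>_lin] uc]] unfolding n theta_chain_int by simp
      have "\<zeta> = ?t (hclass (tor_cx K A Q) (tor_d K A Q) n ?u)"
        unfolding tc[OF uz] x(2) using cl2_emb_eq[OF tcyc x(1)] b by simp
      then show ?thesis by (rule image_eqI) (use th.X.hclass_closed[OF uz] in \<open>simp add: HH_def\<close>)
    qed
  qed
qed

end

lemma HH_module: "module K (HH K A Q n)"
  unfolding HH_def by (rule chain_complex.homology_module[OF tor_complex])

end

section \<open>Triangular algebras\<close>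

lemma (in kalg) smult_both_lin: "h \<in> AC \<Longrightarrow> (\<lambda>x. h \<otimes> x \<otimes> h) \<in> lin_maps K A A"
  by (rule lin_comp[OF lmult_lin rmult_lin])

locale triangular = env_kalg K A for K :: "('k, 'm) ring_scheme" and A :: "('k, 'a) module" (structure) +
  fixes f g :: 'a
  assumes f_closed: "f \<in> carrier A" and g_closed: "g \<in> carrier A"
    and ff: "f \<otimes> f = f" and gg: "g \<otimes> g = g" and fg: "f \<otimes> g = \<zero>" and gf: "g \<otimes> f = \<zero>"
    and f_plus_g: "f \<oplus> g = \<one>" and gxf: "x \<in> carrier A \<Longrightarrow> g \<otimes> x \<otimes> f = \<zero>"
begin

lemmas idem_closed = f_closed g_closed

lemma split_right: assumes x: "x \<in> AC" shows "x \<otimes> f \<oplus> x \<otimes> g = x"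
  using x idem_closed by (simp add: AR.r_distr[symmetric] f_plus_g)

lemma split_left: assumes x: "x \<in> AC" shows "f \<otimes> x \<oplus> g \<otimes> x = x"
  using x idem_closed by (simp add: AR.l_distr[symmetric] f_plus_g)

lemma mult_idem: assumes "x \<in> AC" shows "x \<otimes> f \<otimes> f = x \<otimes> f" "x \<otimes> g \<otimes> g = x \<otimes> g"
  using assms idem_closed by (simp_all add: AR.m_assoc ff gg)

lemma gxg: assumes x: "x \<in> AC" shows "g \<otimes> x \<otimes> g = g \<otimes> x"
  using split_right[of "g \<otimes> x"] x idem_closed by (simp add: gxf)

lemma fxf: assumes x: "x \<in> AC" shows "f \<otimes> x \<otimes> f = x \<otimes> f"
  using split_left[of "x \<otimes> f"] x idem_closed by (simp add: gxf AR.m_assoc[symmetric])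

text \<open>As f x f = x f, compression by \<open>f\<close> is right multiplication by
  \<open>f\<close>, and x f y f = x y f by the same rule applied to y.\<close>

sublocale pf: alg_hom K A A "\<lambda>x. f \<otimes> x \<otimes> f"
proof (intro alg_hom.intro alg_hom_axioms.intro kalg_axioms smult_both_lin f_closed)
  show "f \<otimes> (x \<otimes> y) \<otimes> f = f \<otimes> x \<otimes> f \<otimes> (f \<otimes> y \<otimes> f)" if "x \<in> AC" "y \<in> AC" for x y
    unfolding fxf[OF that(1)] fxf[OF that(2)] fxf[OF AR.m_closed[OF that]]
    using that idem_closed fxf[OF that(2)] by (simp add: AR.m_assoc)
qed

text \<open>Dually g x g = g x, so here compression is left multiplication.\<close>

sublocale pg: alg_hom K A A "\<lambda>x. g \<otimes> x \<otimes> g"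
proof (intro alg_hom.intro alg_hom_axioms.intro kalg_axioms smult_both_lin g_closed)
  show "g \<otimes> (x \<otimes> y) \<otimes> g = g \<otimes> x \<otimes> g \<otimes> (g \<otimes> y \<otimes> g)" if "x \<in> AC" "y \<in> AC" for x y
    unfolding gxg[OF that(1)] gxg[OF that(2)] gxg[OF AR.m_closed[OF that]]
    using that idem_closed gxg[OF that(1)] by (simp add: AR.m_assoc[symmetric])
qed

section \<open>The projection onto the relative bar complex\<close>

lemma tcons_closed: "x \<in> AC \<Longrightarrow> u \<in> TC m \<Longrightarrow> tcons m x u \<in> TC (Suc m)"
  and lmul_closed: "x \<in> AC \<Longrightarrow> v \<in> TC (Suc m) \<Longrightarrow> lmul (Suc m) x v \<in> TC (Suc m)"
  and rmul_closed: "x \<in> AC \<Longrightarrow> v \<in> TC (Suc m) \<Longrightarrow> rmul (Suc m) x v \<in> TC (Suc m)"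
  by (rule lin_closed[OF tcons_lin] lin_closed[OF lmul_lin] lin_closed[OF rmul_lin]; assumption)+

lemma tcons_0: "u \<in> TC m \<Longrightarrow> tcons m \<zero> u = \<zero>\<^bsub>T (Suc m)\<^esub>"
  by (rule lin_zero[OF tcons_lin2 AM.M.abelian_group_axioms tpow_ag])

text \<open>The element f \<otimes> f + g \<otimes> g is the separability idempotent of the
  subalgebra spanned by \<open>f\<close> and \<open>g\<close>; inserting it behind \<open>x\<close>
  picks a representative of the tensor product over that subalgebra.\<close>

definition pcons where
  "pcons m x u = tcons (Suc m) (x \<otimes> f) (lmul (Suc m) f u) \<oplus>\<^bsub>T (Suc (Suc m))\<^esub> tcons (Suc m) (x \<otimes> g) (lmul (Suc m) g u)"

lemma pcons_lin: "x \<in> AC \<Longrightarrow> pcons m x \<in> lin_maps K (T (Suc m)) (T (Suc (Suc m)))"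
  unfolding pcons_def[abs_def]
  by (intro lin_add_fun[OF tpow_lm] lin_comp[OF lmul_lin tcons_lin]) (simp_all add: idem_closed)

lemma pcons_lin2: "u \<in> TC (Suc m) \<Longrightarrow> (\<lambda>x. pcons m x u) \<in> lin_maps K A (T (Suc (Suc m)))"
  unfolding pcons_def
  by (intro lin_add_fun[OF tpow_lm] lin_comp[OF rmult_lin tcons_lin2]) (simp_all add: idem_closed lmul_closed)

lemma lmul_pcons: "x \<in> AC \<Longrightarrow> y \<in> AC \<Longrightarrow> u \<in> TC (Suc m) \<Longrightarrow>
    lmul (Suc (Suc m)) y (pcons m x u) = pcons m (y \<otimes> x) u"
  by (simp add: pcons_def lin_add[OF lmul_lin] tcons_closed lmul_closed idem_closed lmul_tcons AR.m_assoc)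

lemma rmul_pcons: "x \<in> AC \<Longrightarrow> y \<in> AC \<Longrightarrow> u \<in> TC (Suc m) \<Longrightarrow>
    rmul (Suc (Suc m)) y (pcons m x u) = pcons m x (rmul (Suc m) y u)"
  by (simp add: pcons_def lin_add[OF rmul_lin] tcons_closed lmul_closed rmul_closed idem_closed rmul_tcons lmul_rmul)

text \<open>The recursion of \<open>bar_tcons\<close> persists: multiplying out the inserted element
  gives f f + g g = 1, and left multiplication by the idempotents passes through the bar
  differential of the tail.\<close>

lemma bar_pcons:
  assumes x: "x \<in> AC" and u: "u \<in> TC (Suc (Suc m))"
  shows "bd (Suc (Suc m)) (pcons (Suc m) x u) = lmul (Suc (Suc m)) x u \<ominus>\<^bsub>T (Suc (Suc m))\<^esub> pcons m x (bd (Suc m) u)"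
proof -
  have t: "bd (Suc (Suc m)) (tcons (Suc (Suc m)) (x \<otimes> h) (lmul (Suc (Suc m)) h u)) =
    lmul (Suc (Suc m)) (x \<otimes> h) u \<ominus>\<^bsub>T (Suc (Suc m))\<^esub> tcons (Suc m) (x \<otimes> h) (lmul (Suc m) h (bd (Suc m) u))"
    if "h \<in> AC" "h \<otimes> h = h" for h
    using that x u by (simp add: bar_tcons lmul_closed lmul_lmul AR.m_assoc bar_lmul)
  have l: "lmul (Suc (Suc m)) (x \<otimes> f) u \<oplus>\<^bsub>T (Suc (Suc m))\<^esub> lmul (Suc (Suc m)) (x \<otimes> g) u = lmul (Suc (Suc m)) x u"
    using lin_add[OF lmul_lin2[OF u], of "x \<otimes> f" "x \<otimes> g"] x idem_closed by (simp add: split_right)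
  have c: "lmul (Suc (Suc m)) (x \<otimes> h) u \<in> TC (Suc (Suc m))"
    "tcons (Suc m) (x \<otimes> h) (lmul (Suc m) h (bd (Suc m) u)) \<in> TC (Suc (Suc m))" if "h \<in> AC" for h
    using that x u by (simp_all add: lmul_closed tcons_closed lin_closed[OF bar_lin])
  have alg: "(a \<ominus>\<^bsub>T (Suc (Suc m))\<^esub> b) \<oplus>\<^bsub>T (Suc (Suc m))\<^esub> (a' \<ominus>\<^bsub>T (Suc (Suc m))\<^esub> b') =
    (a \<oplus>\<^bsub>T (Suc (Suc m))\<^esub> a') \<ominus>\<^bsub>T (Suc (Suc m))\<^esub> (b \<oplus>\<^bsub>T (Suc (Suc m))\<^esub> b')"
    if "a \<in> TC (Suc (Suc m))" "b \<in> TC (Suc (Suc m))" "a' \<in> TC (Suc (Suc m))" "b' \<in> TC (Suc (Suc m))" for a b a' b'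
    using that by algebra
  have "bd (Suc (Suc m)) (pcons (Suc m) x u) =
    bd (Suc (Suc m)) (tcons (Suc (Suc m)) (x \<otimes> f) (lmul (Suc (Suc m)) f u)) \<oplus>\<^bsub>T (Suc (Suc m))\<^esub>
    bd (Suc (Suc m)) (tcons (Suc (Suc m)) (x \<otimes> g) (lmul (Suc (Suc m)) g u))"
    unfolding pcons_def by (rule lin_add[OF bar_lin]) (use x u idem_closed in \<open>simp_all add: tcons_closed lmul_closed\<close>)
  also have "\<dots> = lmul (Suc (Suc m)) x u \<ominus>\<^bsub>T (Suc (Suc m))\<^esub> pcons m x (bd (Suc m) u)"
    unfolding t[OF f_closed ff] t[OF g_closed gg] alg[OF c[OF f_closed] c[OF g_closed]] l pcons_def ..
  finally show ?thesis .
qed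

primrec pl :: "nat \<Rightarrow> 'a list \<Rightarrow> ('a list \<Rightarrow> 'k) set" where
  "pl 0 xs = pt (Suc 0) xs"
| "pl (Suc m) xs = pcons m (hd xs) (pl m (tl xs))"

lemma pl_mlin: "mlin K A (Suc m) (T (Suc m)) (pl m)"
proof (induction m)
  case 0
  show ?case by (rule mlin_cong[OF pure_mlin]) (simp_all add: AM.module_axioms)
next
  case (Suc m)
  show ?case
    by (rule mlin_ConsI) (simp_all add: mlin_comp[OF Suc pcons_lin] pcons_lin2 mlin_closed[OF Suc])
qed

text \<open>The projection of the bar resolution onto the subcomplex that is relative to the subalgebra spanned by
  \<open>f\<close> and \<open>g\<close>: it inserts \<open>f \<otimes> f + g \<otimes> g\<close> between any two neighbouring tensor factors.\<close>

definition PP where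
  "PP m = lift K (T (Suc m)) (pl m)"

lemma PP_lin: "PP m \<in> lin_maps K (T (Suc m)) (T (Suc m))"
  unfolding PP_def by (rule tpow_lift(1)[OF tpow_module pl_mlin])

lemma PP_pure: "xs \<in> TG (Suc m) \<Longrightarrow> PP m (pt (Suc m) xs) = pl m xs"
  unfolding PP_def by (rule tpow_lift(2)[OF tpow_module pl_mlin])

lemma PP_0: "u \<in> TC (Suc 0) \<Longrightarrow> PP 0 u = u"
  by (rule tpow_eqI[OF tpow_module PP_lin lin_id]) (simp_all add: PP_pure)

lemma PP_tcons: "x \<in> AC \<Longrightarrow> u \<in> TC (Suc m) \<Longrightarrow> PP (Suc m) (tcons (Suc m) x u) = pcons m x (PP m u)"
  by (rule tpow_eqI[OF tpow_module lin_comp[OF tcons_lin PP_lin] lin_comp[OF PP_lin pcons_lin]])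
    (simp_all add: tcons_pure PP_pure gens_simps)

lemma PP_Cons: "x \<in> AC \<Longrightarrow> xs \<in> TG (Suc m) \<Longrightarrow>
    PP (Suc m) (pt (Suc (Suc m)) (x # xs)) = pcons m x (PP m (pt (Suc m) xs))"
  by (simp add: PP_pure gens_simps)

lemmas PP_closed = lin_closed[OF PP_lin]

lemma PP_lmul:
  assumes y: "y \<in> AC" and u: "u \<in> TC (Suc (Suc m))"
  shows "PP (Suc m) (lmul (Suc (Suc m)) y u) = lmul (Suc (Suc m)) y (PP (Suc m) u)"
proof (rule tpow_eqI[OF tpow_module lin_comp[OF lmul_lin[OF y] PP_lin] lin_comp[OF PP_lin lmul_lin[OF y]] _ u])
  fix xs assume "xs \<in> TG (Suc (Suc m))"
  then obtain x ys where x: "xs = x # ys" "x \<in> AC" "ys \<in> TG (Suc m)" by (rule gens_Suc_E)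
  show "PP (Suc m) (lmul (Suc (Suc m)) y (pt (Suc (Suc m)) xs)) = lmul (Suc (Suc m)) y (PP (Suc m) (pt (Suc (Suc m)) xs))"
    unfolding x(1) using y x(2,3) by (simp add: lmul_pure PP_Cons lmul_pcons PP_closed pure_closed)
qed

lemma PP_rmul:
  assumes y: "y \<in> AC" and u: "u \<in> TC (Suc m)"
  shows "PP m (rmul (Suc m) y u) = rmul (Suc m) y (PP m u)"
  using u
proof (induction m arbitrary: u)
  case 0
  then show ?case by (simp add: PP_0 rmul_closed y)
next
  case (Suc m)
  show ?case
  proof (rule tpow_eqI[OF tpow_module lin_comp[OF rmul_lin[OF y] PP_lin] lin_comp[OF PP_lin rmul_lin[OF y]] _ Suc.prems])
    fix xs assume "xs \<in> TG (Suc (Suc m))"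
    then obtain x ys where x: "xs = x # ys" "x \<in> AC" "ys \<in> TG (Suc m)" by (rule gens_Suc_E)
    have "PP (Suc m) (rmul (Suc (Suc m)) y (tcons (Suc m) x (pt (Suc m) ys))) =
      rmul (Suc (Suc m)) y (PP (Suc m) (tcons (Suc m) x (pt (Suc m) ys)))"
      using x(2,3) y by (simp add: rmul_tcons pure_closed PP_tcons rmul_closed Suc.IH rmul_pcons PP_closed)
    then show "PP (Suc m) (rmul (Suc (Suc m)) y (pt (Suc (Suc m)) xs)) = rmul (Suc (Suc m)) y (PP (Suc m) (pt (Suc (Suc m)) xs))"
      unfolding x(1) tcons_pure[OF x(2,3)] .
  qed
qed

lemma pcons_pure: "x \<in> AC \<Longrightarrow> y \<in> AC \<Longrightarrow> ys \<in> TG m \<Longrightarrow>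
    pcons m x (pt (Suc m) (y # ys)) = pt (Suc (Suc m)) ((x \<otimes> f) # (f \<otimes> y) # ys) \<oplus>\<^bsub>T (Suc (Suc m))\<^esub>
      pt (Suc (Suc m)) ((x \<otimes> g) # (g \<otimes> y) # ys)"
  by (simp add: pcons_def lmul_pure tcons_pure gens_simps idem_closed)

lemma PP_pure2: "x \<in> AC \<Longrightarrow> y \<in> AC \<Longrightarrow> PP (Suc 0) (pt (Suc (Suc 0)) [x, y]) =
    pt (Suc (Suc 0)) [x \<otimes> f, f \<otimes> y] \<oplus>\<^bsub>T (Suc (Suc 0))\<^esub> pt (Suc (Suc 0)) [x \<otimes> g, g \<otimes> y]"
  by (simp add: PP_Cons gens_simps PP_0 pure_closed pcons_pure)

lemma PP_aug:
  assumes u: "u \<in> TC (Suc (Suc 0))" shows "aug (PP (Suc 0) u) = aug u"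
proof (rule tpow_eqI[OF AM.module_axioms lin_comp[OF PP_lin aug_lin] aug_lin _ u])
  fix xs assume "xs \<in> TG (Suc (Suc 0))"
  then obtain x y where xs: "xs = [x, y]" "x \<in> AC" "y \<in> AC" by (rule gens_2E)
  have "x \<otimes> f \<otimes> (f \<otimes> y) \<oplus> x \<otimes> g \<otimes> (g \<otimes> y) = (x \<otimes> f \<oplus> x \<otimes> g) \<otimes> y"
    using xs idem_closed by (simp add: AR.m_assoc[symmetric] mult_idem AR.l_distr)
  then show "aug (PP (Suc 0) (pt (Suc (Suc 0)) xs)) = aug (pt (Suc (Suc 0)) xs)"
    unfolding xs(1) using xs(2,3) idem_closed by (simp add: PP_pure2 lin_add[OF aug_lin] pure_closed gens_simps aug_pure split_right)
qed

text \<open>Prepending with \<open>pcons\<close> obeys the same recursion as prepending with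
  \<open>tcons\<close>, and \<open>PP\<close> turns one into the other; the lowest case is
  compatibility with the augmentation.\<close>

lemma PP_bar:
  assumes u: "u \<in> TC (Suc (Suc m))"
  shows "bd (Suc m) (PP (Suc m) u) = PP m (bd (Suc m) u)"
  using u
proof (induction m arbitrary: u)
  case 0
  have "bd (Suc 0) (PP (Suc 0) u) = bd (Suc 0) u"
    by (simp only: bar_1_aug[OF 0] bar_1_aug[OF PP_closed[OF 0]] PP_aug[OF 0])
  then show ?case by (simp add: PP_0 lin_closed[OF bar_lin 0])
next
  case (Suc m)
  show ?case
  proof (rule tpow_eqI[OF tpow_module lin_comp[OF PP_lin bar_lin] lin_comp[OF bar_lin PP_lin] _ Suc.prems])
    fix xs assume "xs \<in> TG (Suc (Suc (Suc m)))"
    then obtain x ys where x: "xs = x # ys" "x \<in> AC" "ys \<in> TG (Suc (Suc m))" by (rule gens_Suc_E)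
    let ?u = "pt (Suc (Suc m)) ys"
    have uc: "?u \<in> TC (Suc (Suc m))" by (rule pure_closed[OF x(3)])
    note b = lin_closed[OF bar_lin uc]
    have "bd (Suc (Suc m)) (PP (Suc (Suc m)) (pt (Suc (Suc (Suc m))) xs)) =
      lmul (Suc (Suc m)) x (PP (Suc m) ?u) \<ominus>\<^bsub>T (Suc (Suc m))\<^esub> pcons m x (PP m (bd (Suc m) ?u))"
      unfolding x(1) PP_Cons[OF x(2,3)] bar_pcons[OF x(2) PP_closed[OF uc]] Suc.IH[OF uc] ..
    also have "\<dots> = PP (Suc m) (lmul (Suc (Suc m)) x ?u \<ominus>\<^bsub>T (Suc (Suc m))\<^esub> tcons (Suc m) x (bd (Suc m) ?u))"
      unfolding lin_minus[OF PP_lin tpow_ag tpow_ag lmul_closed[OF x(2) uc] tcons_closed[OF x(2) b]] PP_lmul[OF x(2) uc] PP_tcons[OF x(2) b] ..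
    also have "\<dots> = PP (Suc m) (bd (Suc (Suc m)) (pt (Suc (Suc (Suc m))) xs))"
      unfolding x(1) tcons_pure[OF x(2,3), symmetric] bar_tcons[OF x(2) uc] ..
    finally show "bd (Suc (Suc m)) (PP (Suc (Suc m)) (pt (Suc (Suc (Suc m))) xs)) =
      PP (Suc m) (bd (Suc (Suc m)) (pt (Suc (Suc (Suc m))) xs))" .
  qed
qed

lemma PP_E_lin: "PP (Suc n) \<in> lin_maps E (B n) (B n)"
  by (rule E_linI[OF B_module B_module]) (simp_all add: B_simps PP_closed lin_add[OF PP_lin] B_smult_ep PP_lmul PP_rmul rmul_closed)

lemma map_gens_idem: "h \<in> AC \<Longrightarrow> xs \<in> TG m \<Longrightarrow> map (\<lambda>x. h \<otimes> x \<otimes> h) xs \<in> TG m"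
  by (auto simp: gens_iff)

lemma pure_0: "ys \<in> TG m \<Longrightarrow> pt (Suc m) (\<zero> # ys) = \<zero>\<^bsub>T (Suc m)\<^esub>"
  using tcons_0[OF pure_closed] by (simp add: tcons_pure)

lemma pure_0': assumes "x \<in> AC" "ys \<in> TG m" shows "pt (Suc (Suc m)) (x # \<zero> # ys) = \<zero>\<^bsub>T (Suc (Suc m))\<^esub>"
  using assms lin_zero[OF tcons_lin[OF assms(1)] tpow_ag tpow_ag, of "Suc m"] tcons_pure[OF assms(1), of "\<zero> # ys" "Suc m"]
  by (simp add: pure_0 gens_simps)

text \<open>An \<open>f\<close> at the right end propagates to the left: an entry followed by
  \<open>f\<close> cannot be preceded by an inserted \<open>g\<close>, because g y f = 0. So only
  the term with \<open>f\<close> in every gap survives.\<close>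

lemma rmul_PP:
  "x \<in> AC \<Longrightarrow> xs \<in> TG m \<Longrightarrow>
    rmul (Suc m) f (PP m (pt (Suc m) (x # xs))) = pt (Suc m) ((x \<otimes> f) # map (\<lambda>x. f \<otimes> x \<otimes> f) xs)"
proof (induction m arbitrary: x xs)
  case 0
  then have "xs = []" by (simp add: gens_iff)
  then show ?case using 0 rmul_pure[OF f_closed 0(1), of "[]" 0] by (simp add: PP_pure gens_simps)
next
  case (Suc m)
  obtain y ys where y: "xs = y # ys" "y \<in> AC" "ys \<in> TG m" using Suc.prems(2) by (rule gens_Suc_E)
  have "rmul (Suc (Suc m)) f (PP (Suc m) (pt (Suc (Suc m)) (x # xs))) =
    pcons m x (pt (Suc m) ((y \<otimes> f) # map (\<lambda>x. f \<otimes> x \<otimes> f) ys))"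
    using Suc.prems y by (simp add: PP_Cons rmul_pcons f_closed PP_closed pure_closed gens_simps Suc.IH)
  also have "\<dots> = pt (Suc (Suc m)) ((x \<otimes> f) # map (\<lambda>x. f \<otimes> x \<otimes> f) xs)"
    using Suc.prems(1) y map_gens_idem[OF f_closed y(3)] idem_closed
    by (simp add: pcons_pure AR.m_assoc[symmetric] gxf pure_0' pure_closed gens_simps)
  finally show ?case .
qed

text \<open>The mirror image: a \<open>g\<close> at the left end propagates to the right, since g x
  f = 0 excludes an \<open>f\<close> from the next gap.\<close>

lemma lmul_PP:
  "y \<in> AC \<Longrightarrow> xs \<in> TG m \<Longrightarrow>
    lmul (Suc m) g (PP m (pt (Suc m) (xs @ [y]))) = pt (Suc m) (map (\<lambda>x. g \<otimes> x \<otimes> g) xs @ [g \<otimes> y])"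
proof (induction m arbitrary: xs)
  case 0
  then have "xs = []" by (simp add: gens_iff)
  then show ?case using 0 by (simp add: PP_pure gens_simps lmul_pure g_closed)
next
  case (Suc m)
  obtain x ys where x: "xs = x # ys" "x \<in> AC" "ys \<in> TG m" using Suc.prems(2) by (rule gens_Suc_E)
  have u: "PP m (pt (Suc m) (ys @ [y])) \<in> TC (Suc m)" using x Suc.prems(1) by (simp add: PP_closed pure_closed gens_simps)
  have "lmul (Suc (Suc m)) g (PP (Suc m) (pt (Suc (Suc m)) (xs @ [y]))) =
    pcons m (g \<otimes> x) (PP m (pt (Suc m) (ys @ [y])))"
    unfolding x(1) append_Cons using x(2,3) Suc.prems(1) u by (simp add: PP_Cons gens_simps lmul_pcons g_closed)
  also have "\<dots> = pt (Suc (Suc m)) (map (\<lambda>x. g \<otimes> x \<otimes> g) xs @ [g \<otimes> y])"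
    unfolding pcons_def using u x Suc.prems(1) map_gens_idem[OF g_closed x(3)] idem_closed
    by (simp add: gxf tcons_0 lmul_closed tcons_closed Suc.IH tcons_pure pure_closed gens_simps)
  finally show ?case .
qed

text \<open>The coefficient splits as a = f a + g a. The balancing relation moves \<open>f\<close>
  to the right end of the bar tensor, and g a = g a g provides a \<open>g\<close> for the left end;
  then one term survives in each summand.\<close>

lemma tmap_split:
  assumes u: "u \<in> TC (Suc n)"
  shows "ind n (T (Suc n)) (mu n) (PP (Suc n)) u = pf.tmap (Suc n) u \<oplus>\<^bsub>T (Suc n)\<^esub> pg.tmap (Suc n) u"
proof (rule tpow_eqI[OF tpow_module indB_lin[OF PP_E_lin] lin_add_fun[OF tpow_lm pf.tmap_lin pg.tmap_lin] _ u])
  fix xs assume xs: "xs \<in> TG (Suc n)"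
  then obtain a ys where a: "xs = a # ys" "a \<in> AC" "ys \<in> TG n" by (rule gens_Suc_E)
  let ?w = "pt (Suc (Suc n)) (\<one> # ys @ [\<one>])"
  have w: "?w \<in> TC (Suc (Suc n))" using a by (simp add: pure_closed gens_simps)
  note Pw = PP_closed[OF w]
  have mf: "mu n (f \<otimes> a) (PP (Suc n) ?w) = pt (Suc n) (map (\<lambda>x. f \<otimes> x \<otimes> f) xs)"
  proof -
    have "mu n (f \<otimes> a) (PP (Suc n) ?w) = mu n a (rmul (Suc (Suc n)) f (PP (Suc n) ?w))"
      using mu_lmul_rmul[OF a(2) AR.one_closed f_closed Pw] a(2) f_closed Pw by (simp add: lmul_one rmul_closed)
    also have "\<dots> = mu n a (pt (Suc (Suc n)) (f # map (\<lambda>x. f \<otimes> x \<otimes> f) ys @ [f]))"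
      using a f_closed by (simp add: rmul_PP gens_simps ff)
    also have "\<dots> = pt (Suc n) (map (\<lambda>x. f \<otimes> x \<otimes> f) xs)"
      using a f_closed by (simp add: mu_pure map_gens_idem)
    finally show ?thesis .
  qed
  have mg: "mu n (g \<otimes> a) (PP (Suc n) ?w) = pt (Suc n) (map (\<lambda>x. g \<otimes> x \<otimes> g) xs)"
  proof -
    have "mu n (g \<otimes> a) (PP (Suc n) ?w) = mu n (g \<otimes> a) (lmul (Suc (Suc n)) g (PP (Suc n) ?w))"
      using mu_lmul_rmul[OF AR.m_closed[OF g_closed a(2)] g_closed AR.one_closed Pw] a(2) g_closed Pw gxg[OF a(2)] by (simp add: rmul_one)
    also have "\<dots> = mu n (g \<otimes> a) (pt (Suc (Suc n)) (g # map (\<lambda>x. g \<otimes> x \<otimes> g) ys @ [g]))"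
      using lmul_PP[of "\<one>" "\<one> # ys" "Suc n"] a g_closed by (simp add: gens_simps gg)
    also have "\<dots> = pt (Suc n) (map (\<lambda>x. g \<otimes> x \<otimes> g) xs)"
      using a g_closed by (simp add: mu_pure map_gens_idem AR.m_assoc[symmetric] gg)
    finally show ?thesis .
  qed
  have "ind n (T (Suc n)) (mu n) (PP (Suc n)) (pt (Suc n) xs) = mu n (f \<otimes> a \<oplus> g \<otimes> a) (PP (Suc n) ?w)"
    unfolding a(1) pure_as_mu[OF a(2,3)] indB_mu[OF PP_E_lin a(2) w] split_left[OF a(2)] ..
  also have "\<dots> = pf.tmap (Suc n) (pt (Suc n) xs) \<oplus>\<^bsub>T (Suc n)\<^esub> pg.tmap (Suc n) (pt (Suc n) xs)"
    using a(2) idem_closed by (simp add: lin_add[OF mu_lin2[OF Pw]] mf mg pf.tmap_pure[OF xs] pg.tmap_pure[OF xs])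
  finally show "ind n (T (Suc n)) (mu n) (PP (Suc n)) (pt (Suc n) xs) =
    pf.tmap (Suc n) (pt (Suc n) xs) \<oplus>\<^bsub>T (Suc n)\<^esub> pg.tmap (Suc n) (pt (Suc n) xs)" .
qed

end

section \<open>Splitting the homology of a triangular algebra\<close>

lemma alg_hom_comp:
  assumes "alg_hom K A B f" "alg_hom K B C g" shows "alg_hom K A C (\<lambda>x. g (f x))"
proof -
  interpret f: alg_hom K A B f by fact
  interpret g: alg_hom K B C g by fact
  show ?thesis
    by (intro alg_hom.intro alg_hom_axioms.intro f.A.kalg_axioms g.B.kalg_axioms lin_comp[OF f.f_lin g.f_lin])
      (simp add: f.f_mult g.f_mult lin_closed[OF f.f_lin])
qed

lemma (in kalg) alg_hom_id: "alg_hom K A A (\<lambda>x. x)"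
  by (intro alg_hom.intro alg_hom_axioms.intro kalg_axioms lin_id) simp

text \<open>Total complexes contain only tensor powers of positive order. There the zero map induces
  zero, because a pure tensor has an entry to be annihilated; on the power of order zero it would
  not.\<close>

lemma hm_zero:
  assumes "alg_hom K A B (\<lambda>_. \<zero>\<^bsub>B\<^esub>)" and \<zeta>: "\<zeta> \<in> carrier (homology (Tot K A J) (Tot_d K A J) n)"
  shows "alg_hom.hm K B (\<lambda>_. \<zero>\<^bsub>B\<^esub>) J n \<zeta> = \<zero>\<^bsub>homology (Tot K B J) (Tot_d K B J) n\<^esub>"
proof -
  interpret f: alg_hom K A B "\<lambda>_. \<zero>\<^bsub>B\<^esub>" by fact
  interpret c: chain_map K "Tot K A J" "Tot_d K A J" "Tot K B J" "Tot_d K B J" "f.totmap J" by (rule f.totmap_chain)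
  have t: "f.tmap (Suc m) u = \<zero>\<^bsub>f.B.T (Suc m)\<^esub>" if u: "u \<in> carrier (f.A.T (Suc m))" for m u
  proof (rule f.A.tpow_eqI[OF f.B.tpow_module f.tmap_lin lin_zero_fun[OF f.B.tpow_lm] _ u])
    fix xs assume xs: "xs \<in> tpow_gens A (Suc m)"
    then obtain y ys where y: "xs = y # ys" "ys \<in> tpow_gens A m" by (rule gens_Suc_E)
    show "f.tmap (Suc m) (pure K A (Suc m) xs) = \<zero>\<^bsub>f.B.T (Suc m)\<^esub>"
      unfolding f.tmap_pure[OF xs] unfolding y(1) list.map
      by (rule lin_zero[OF mlin_Cons(2)[OF f.B.pure_mlin f.map_gens[OF y(2)]] f.B.AM.M.abelian_group_axioms f.B.tpow_ag])
  qed
  obtain z where z: "z \<in> cycles (Tot K A J) (Tot_d K A J) n" "\<zeta> = hclass (Tot K A J) (Tot_d K A J) n z"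
    using c.X.homology_rep \<zeta> by metis
  note zc = c.X.cycle_closed[OF z(1)]
  have "f.totmap J n z = \<zero>\<^bsub>Tot K B J n\<^esub>"
    by (rule f.B.Tot_ext[OF c.f_closed[OF zc] f.B.Tot_zero_closed]) (use f.A.Tot_closed[OF zc] f.B.Tot_zero in \<open>simp add: f.totmap_def t\<close>)
  moreover have "\<zero>\<^bsub>Tot K B J n\<^esub> \<in> boundaries (Tot K B J) (Tot_d K B J) n"
    unfolding boundaries_def using lin_zero[OF f.B.Tot_d_lin, of J "n + 1"] module_abelian_group[OF f.B.Tot_module] f.B.Tot_zero_closed
    by (intro image_eqI[of _ _ "\<zero>\<^bsub>Tot K B J (n + 1)\<^esub>"]) simp_all
  ultimately show ?thesis unfolding f.hm_def z(2) c.hmap_hclass[OF z(1)]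
    using c.Y.hclass_zero_iff[OF subsetD[OF c.Y.boundaries_cycles]] by simp
qed

lemma (in alg_hom) totmap_emb:
  assumes x: "x \<in> carrier (A.T (Suc m))" shows "totmap two_cols (int m) (A.emb m x) = B.emb m (tmap (Suc m) x)"
  unfolding totmap_def B.emb_def
proof (rule restrict_ext)
  fix p assume p: "p \<in> cols two_cols (int m)"
  show "tmap (Suc (row (int m) p)) (A.emb m x p) = (if p = 0 then tmap (Suc m) x else \<zero>\<^bsub>B.T (Suc (row (int m) p))\<^esub>)"
    using p lin_zero[OF tmap_lin A.tpow_ag B.tpow_ag] by (simp add: A.emb_def A.row2)
qed

text \<open>Reduces induced maps on the homology of the first two columns to chains in column 0,
  where \<open>tmap_split\<close> applies.\<close>

lemma (in alg_hom) hm_cl2: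
  assumes x: "x \<in> A.hcyc m" shows "hm two_cols (int m) (A.cl2 (int m) (A.emb m x)) = B.cl2 (int m) (B.emb m (tmap (Suc m) x))"
    and "tmap (Suc m) x \<in> B.hcyc m"
proof -
  interpret c: chain_map K "Tot K A two_cols" "Tot_d K A two_cols" "Tot K B two_cols" "Tot_d K B two_cols" "totmap two_cols" by (rule totmap_chain)
  have xc: "x \<in> carrier (A.T (Suc m))" using x by (simp add: A.hcyc_def)
  have z: "A.emb m x \<in> A.Z2 (int m)" using A.emb_cycle_iff[OF xc] x by blast
  show "hm two_cols (int m) (A.cl2 (int m) (A.emb m x)) = B.cl2 (int m) (B.emb m (tmap (Suc m) x))"
    unfolding hm_def c.hmap_hclass[OF z] totmap_emb[OF xc] ..
  show "tmap (Suc m) x \<in> B.hcyc m"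
    using c.f_cycle[OF z] unfolding totmap_emb[OF xc] B.emb_cycle_iff[OF lin_closed[OF tmap_lin xc]] .
qed

context triangular begin

abbreviation "HJ J n \<equiv> homology (Tot K A J) (Tot_d K A J) n"

lemma HJ_module: "module K (HJ J n)"
  by (rule chain_complex.homology_module[OF Tot_complex])

lemma H_neg: assumes n: "n < 0" and "u \<in> carrier (HJ J n)" "v \<in> carrier (HJ J n)" shows "u = v"
proof -
  interpret D: chain_complex K "Tot K A J" "Tot_d K A J" by (rule Tot_complex)
  show ?thesis by (rule D.homology_trivial[of n]) (use Tot_neg[OF n] assms in blast)+
qed

lemma HT_split:
  assumes \<zeta>: "\<zeta> \<in> carrier (HJ two_cols n)" shows "\<zeta> = pf.hm two_cols n \<zeta> \<oplus>\<^bsub>HJ two_cols n\<^esub> pg.hm two_cols n \<zeta>"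
proof -
  interpret D: chain_complex K "Tot K A two_cols" "Tot_d K A two_cols" by (rule Tot_complex)
  interpret H: module K "HJ two_cols n" by (rule HJ_module)
  note c = lin_closed[OF pf.hm_lin \<zeta>] lin_closed[OF pg.hm_lin \<zeta>]
  show ?thesis
  proof (cases "n < 0")
    case True
    then show ?thesis by (rule H_neg[OF _ \<zeta> H.M.a_closed[OF c]])
  next
    case False
    then obtain m where n: "n = int m" using nonneg_int_cases by (metis not_less)
    obtain x where x: "x \<in> hcyc m" "\<zeta> = cl2 (int m) (emb m x)" using HT_rep \<zeta> unfolding n HT_def by metis
    have xc: "x \<in> TC (Suc m)" using x(1) by (simp add: hcyc_def)
    let ?a = "pf.tmap (Suc m) x" and ?b = "pg.tmap (Suc m) x"
    note a = pf.hm_cl2[OF x(1)] and b = pg.hm_cl2[OF x(1)]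
    have ac: "?a \<in> TC (Suc m)" "?b \<in> TC (Suc m)" using a(2) b(2) by (simp_all add: hcyc_def)
    have z: "emb m ?a \<in> Z2 (int m)" "emb m ?b \<in> Z2 (int m)" using emb_cycle_iff ac a(2) b(2) by auto
    have e: "emb m (?a \<oplus>\<^bsub>T (Suc m)\<^esub> ?b) = emb m ?a \<oplus>\<^bsub>Tot K A two_cols (int m)\<^esub> emb m ?b" by (rule lin_add[OF emb_lin ac])
    have ab: "?a \<oplus>\<^bsub>T (Suc m)\<^esub> ?b \<in> hcyc m"
      using D.cycle_add[OF z] emb_cycle_iff[OF TM.M.a_closed[OF ac]] unfolding e[symmetric] by blast
    have "?a \<oplus>\<^bsub>T (Suc m)\<^esub> ?b \<ominus>\<^bsub>T (Suc m)\<^esub> x \<in> hbd m"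
      unfolding tmap_split[OF xc, symmetric]
      \<comment> \<open>The index is n + 1 because \<open>B n\<close> consists of tensors of order n
        + 2, on which \<open>PP (Suc n)\<close> acts.\<close>
      by (rule bar_self_null_homotopy[where \<Phi> = "\<lambda>n. PP (Suc n)", OF PP_E_lin PP_bar PP_aug x(1)])
    then have "cl2 (int m) (emb m (?a \<oplus>\<^bsub>T (Suc m)\<^esub> ?b)) = cl2 (int m) (emb m x)" using cl2_emb_eq[OF ab x(1)] by blast
    then show ?thesis unfolding n x(2) a(1) b(1) e D.hclass_add[OF z] ..
  qed
qed

lemma HC_split:
  "\<zeta> \<in> carrier (HJ UNIV n) \<Longrightarrow> \<zeta> = pf.hm UNIV n \<zeta> \<oplus>\<^bsub>HJ UNIV n\<^esub> pg.hm UNIV n \<zeta>"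
\<comment> \<open>Connes' sequence lowers the degree by two. The measure is offset by 2 so that it
  still decreases from degrees 0 and 1 into negative degrees, where homology is trivial.\<close>
proof (induction "nat (n + 2)" arbitrary: n \<zeta> rule: less_induct)
  case less
  interpret H: module K "HJ UNIV n" by (rule HJ_module)
  note \<zeta> = less.prems
  note c = lin_closed[OF pf.hm_lin] lin_closed[OF pg.hm_lin]
  show ?case
  proof (cases "n < 0")
    case True
    then show ?thesis by (rule H_neg[OF _ \<zeta> H.M.a_closed[OF c[OF \<zeta>]]])
  next
    case False
    interpret H2: module K "HJ UNIV (n - 2)" by (rule HJ_module)
    interpret HT: module K "HT K A n" by (rule HT_module)
    note ag = H.M.abelian_group_axioms
    let ?P = "pf.hm UNIV n" and ?Q = "pg.hm UNIV n"
    define d where "d = \<zeta> \<ominus>\<^bsub>HJ UNIV n\<^esub> (?P \<zeta> \<oplus>\<^bsub>HJ UNIV n\<^esub> ?Q \<zeta>)"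
    have dc: "d \<in> carrier (HJ UNIV n)" unfolding d_def using \<zeta> c[OF \<zeta>] by simp
    have z: "alg_hom K A A (\<lambda>_. \<zero>)"
      by (intro alg_hom.intro alg_hom_axioms.intro kalg_axioms lin_zero_fun module_left_module AM.module_axioms) simp
    \<comment> \<open>The compressions compose like orthogonal idempotents already on the algebra,
      and functoriality carries this to homology.\<close>
    have PP: "?P (?P \<zeta>) = ?P \<zeta>"
      by (rule hm_comp[OF pf.alg_hom_axioms pf.alg_hom_axioms pf.alg_hom_axioms _ \<zeta>])
        (use idem_closed in \<open>simp add: AR.m_assoc[symmetric] ff mult_idem\<close>)
    have QQ: "?Q (?Q \<zeta>) = ?Q \<zeta>"
      by (rule hm_comp[OF pg.alg_hom_axioms pg.alg_hom_axioms pg.alg_hom_axioms _ \<zeta>])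
        (use idem_closed in \<open>simp add: AR.m_assoc[symmetric] gg mult_idem\<close>)
    have PQ: "?P (?Q \<zeta>) = \<zero>\<^bsub>HJ UNIV n\<^esub>"
      unfolding hm_zero[OF z \<zeta>, symmetric]
      by (rule hm_comp[OF pg.alg_hom_axioms pf.alg_hom_axioms z _ \<zeta>])
        (use idem_closed in \<open>simp add: AR.m_assoc[symmetric] fg\<close>)
    have QP: "?Q (?P \<zeta>) = \<zero>\<^bsub>HJ UNIV n\<^esub>"
      unfolding hm_zero[OF z \<zeta>, symmetric]
      by (rule hm_comp[OF pf.alg_hom_axioms pg.alg_hom_axioms z _ \<zeta>])
        (use idem_closed in \<open>simp add: AR.m_assoc[symmetric] gf\<close>)
    have Pd: "?P d = \<zero>\<^bsub>HJ UNIV n\<^esub>" "?Q d = \<zero>\<^bsub>HJ UNIV n\<^esub>"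
      unfolding d_def using \<zeta> c[OF \<zeta>]
      by (simp_all add: lin_minus[OF pf.hm_lin ag ag] lin_minus[OF pg.hm_lin ag ag] lin_add[OF pf.hm_lin] lin_add[OF pg.hm_lin]
        PP QQ PQ QP H.M.minus_eq_zero_iff)
    have Sc: "connes_S K A n \<xi> \<in> carrier (HJ UNIV (n - 2))" if "\<xi> \<in> carrier (HJ UNIV n)" for \<xi>
      using lin_closed[OF HS_lin] that by (simp add: HC_def)
    have "connes_S K A n d = connes_S K A n \<zeta> \<ominus>\<^bsub>HJ UNIV (n - 2)\<^esub> connes_S K A n (?P \<zeta> \<oplus>\<^bsub>HJ UNIV n\<^esub> ?Q \<zeta>)"
      unfolding d_def using \<zeta> c[OF \<zeta>] ag H2.M.abelian_group_axioms
      by (intro lin_minus[OF HS_lin[unfolded HC_def]]) simp_all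
    also have "connes_S K A n (?P \<zeta> \<oplus>\<^bsub>HJ UNIV n\<^esub> ?Q \<zeta>) = connes_S K A n (?P \<zeta>) \<oplus>\<^bsub>HJ UNIV (n - 2)\<^esub> connes_S K A n (?Q \<zeta>)"
      by (rule lin_add[OF HS_lin[unfolded HC_def] c[OF \<zeta>]])
    also have "\<dots> = connes_S K A n \<zeta>"
      using less.hyps[OF _ Sc[OF \<zeta>]] False pf.hm_HS[of \<zeta> n] pg.hm_HS[of \<zeta> n] \<zeta> by (simp add: HC_def)
    finally have Sd: "connes_S K A n d = \<zero>\<^bsub>HJ UNIV (n - 2)\<^esub>" using Sc[OF \<zeta>] by (simp add: H2.M.minus_eq_zero_iff)
    have "exact_at K (HT K A n) (HI n) (HC K A n) (connes_S K A n) (HC K A (n - 2))"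
      using connes_row by (simp add: exact_row_def)
    then have "HI n ` carrier (HT K A n) = {v \<in> carrier (HC K A n). connes_S K A n v = \<zero>\<^bsub>HC K A (n - 2)\<^esub>}"
      by (simp add: exact_at_def)
    then have "d \<in> HI n ` carrier (HT K A n)" using dc Sd by (simp add: HC_def)
    then obtain h where h: "h \<in> carrier (HT K A n)" "d = HI n h" by blast
    have hc: "pf.hm two_cols n h \<in> carrier (HT K A n)" "pg.hm two_cols n h \<in> carrier (HT K A n)"
      using lin_closed[OF pf.hm_lin] lin_closed[OF pg.hm_lin] h(1) by (simp_all add: HT_def)
    \<comment> \<open>\<open>h\<close> is fixed by the sum of the compressions. Naturality of
      \<open>HI\<close> passes this on to \<open>d\<close>, which both compressions kill.\<close>
    have "d = HI n (pf.hm two_cols n h \<oplus>\<^bsub>HT K A n\<^esub> pg.hm two_cols n h)"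
      unfolding h(2) using HT_split[of h n] h(1) by (simp add: HT_def)
    also have "\<dots> = ?P d \<oplus>\<^bsub>HJ UNIV n\<^esub> ?Q d"
      unfolding lin_add[OF HI_lin hc] h(2) pf.hm_HI[OF h(1)] pg.hm_HI[OF h(1)] HC_def ..
    finally have "d = \<zero>\<^bsub>HJ UNIV n\<^esub>" unfolding Pd by simp
    then show ?thesis unfolding d_def using H.M.minus_eq_zero_iff \<zeta> c[OF \<zeta>] by simp
  qed
qed

end

section \<open>Corner algebras\<close>

context kalg begin

text \<open>Equations in place of the image in \<open>peirce\<close>, so that membership in a corner
  can be decided by rewriting.\<close>

lemma corner_mem:
  assumes p: "p \<in> AC" "p \<otimes> p = p"
  shows "x \<in> carrier (corner A p) \<longleftrightarrow> x \<in> AC \<and> p \<otimes> x = x \<and> x \<otimes> p = x"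
proof
  assume "x \<in> carrier (corner A p)"
  then obtain y where y: "y \<in> AC" "x = p \<otimes> y \<otimes> p" by (auto simp: corner_def peirce_def)
  have "p \<otimes> (p \<otimes> y \<otimes> p) = p \<otimes> y \<otimes> p" using p y(1) by (simp add: AR.m_assoc[symmetric])
  then show "x \<in> AC \<and> p \<otimes> x = x \<and> x \<otimes> p = x" unfolding y(2) using p y(1) by (simp add: AR.m_assoc)
next
  assume x: "x \<in> AC \<and> p \<otimes> x = x \<and> x \<otimes> p = x"
  then have "x = p \<otimes> x \<otimes> p" by simp
  then have "x \<in> peirce A p p" unfolding peirce_def by (rule image_eqI) (use x in simp)
  then show "x \<in> carrier (corner A p)" by (simp add: corner_def)
qed

lemma corner_ops: "add (corner A p) = add A" "mult (corner A p) = mult A" "smult (corner A p) = smult A"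
  "\<zero>\<^bsub>corner A p\<^esub> = \<zero>" "\<one>\<^bsub>corner A p\<^esub> = p"
  by (simp_all add: corner_def)

lemma corner_one: "corner A \<one> = A"
proof -
  have "peirce A \<one> \<one> = (\<lambda>x. x) ` AC" unfolding peirce_def by (rule image_cong) simp_all
  then show ?thesis by (simp add: corner_def)
qed

lemma corner_kalg:
  assumes p: "p \<in> AC" "p \<otimes> p = p" shows "kalg K (corner A p)"
proof -
  note m = corner_mem[OF p]
  have neg: "\<ominus> x \<in> carrier (corner A p)" if "x \<in> carrier (corner A p)" for x
    using that p unfolding m by (simp add: AR.r_minus AR.l_minus)
  have ag: "abelian_group (corner A p)"
  proof (rule abelian_groupI)
    show "\<exists>y\<in>carrier (corner A p). y \<oplus>\<^bsub>corner A p\<^esub> x = \<zero>\<^bsub>corner A p\<^esub>" if "x \<in> carrier (corner A p)" for x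
      using neg[OF that] that unfolding corner_ops by (intro bexI[of _ "\<ominus> x"]) (simp_all add: m AM.M.l_neg)
  qed (use p in \<open>simp_all add: m corner_ops AR.r_distr AR.l_distr AM.M.a_ac\<close>)
  have "monoid (corner A p)"
    by (rule monoidI) (use p in \<open>simp_all add: m corner_ops AR.m_assoc, simp_all add: m corner_ops AR.m_assoc[symmetric]\<close>)
  then have "ring (corner A p)"
    by (intro ringI ag) (use p in \<open>simp_all add: m corner_ops AR.r_distr AR.l_distr\<close>)
  moreover have "module K (corner A p)"
    by (rule moduleI[OF AM.R.is_cring ag])
      (use p in \<open>simp_all add: m corner_ops smult_mult mult_smult AM.smult_l_distr AM.smult_r_distr AM.smult_assoc1\<close>)
  ultimately show ?thesis
    unfolding kalg_def k_algebra_def using field_K by (simp add: corner_ops m smult_mult mult_smult)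
qed

lemma corner_incl:
  assumes p: "p \<in> AC" "p \<otimes> p = p" and q: "q \<in> AC" "q \<otimes> q = q"
    and pq: "p \<otimes> q = p" "q \<otimes> p = p"
  shows "alg_hom K (corner A p) (corner A q) (\<lambda>x. x)"
proof (intro alg_hom.intro alg_hom_axioms.intro corner_kalg p q lin_mapsI)
  show "x \<in> carrier (corner A q)" if "x \<in> carrier (corner A p)" for x
    using that p q pq AR.m_assoc[of q p x] AR.m_assoc[of x p q] by (auto simp: corner_mem)
qed (simp_all add: corner_ops)

text \<open>On the corner of h + h' one has h x y h = h x h y h + h x h' y h, and the last term
  contains both h x h' and h' y h, one of which vanishes. The target corner may belong to an
  idempotent \<open>q\<close> above \<open>h\<close>: this is how the compression by e2' is made to
  land in A2.\<close>

lemma corner_compress: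
  assumes h: "h \<in> AC" "h \<otimes> h = h" and h': "h' \<in> AC" and hh': "h' \<otimes> h' = h'" "h \<otimes> h' = \<zero>" "h' \<otimes> h = \<zero>"
    and q: "q \<in> AC" "q \<otimes> q = q" and hq: "h \<otimes> q = h" "q \<otimes> h = h"
    and orient: "(\<forall>x\<in>AC. h \<otimes> x \<otimes> h' = \<zero>) \<or> (\<forall>x\<in>AC. h' \<otimes> x \<otimes> h = \<zero>)"
  shows "alg_hom K (corner A (h \<oplus> h')) (corner A q) (\<lambda>x. h \<otimes> x \<otimes> h)"
proof (intro alg_hom.intro alg_hom_axioms.intro corner_kalg q)
  let ?p = "h \<oplus> h'"
  show p: "?p \<in> AC" "?p \<otimes> ?p = ?p" using h h' hh' by (simp_all add: AR.r_distr AR.l_distr)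
  note m = corner_mem[OF p]
  show "(\<lambda>x. h \<otimes> x \<otimes> h) \<in> lin_maps K (corner A ?p) (corner A q)"
  proof (rule lin_mapsI)
    show "h \<otimes> x \<otimes> h \<in> carrier (corner A q)" if "x \<in> carrier (corner A ?p)" for x
    proof -
      have x: "x \<in> AC" using that by (simp add: m)
      have "q \<otimes> (h \<otimes> x \<otimes> h) = h \<otimes> x \<otimes> h" using x h q hq by (simp add: AR.m_assoc[symmetric])
      moreover have "h \<otimes> x \<otimes> h \<otimes> q = h \<otimes> x \<otimes> h" using x h q hq by (simp add: AR.m_assoc)
      ultimately show ?thesis using x h q by (simp add: corner_mem)
    qed
  qed (use h in \<open>simp_all add: m corner_ops AR.r_distr AR.l_distr smult_mult mult_smult\<close>)
  fix x y assume "x \<in> carrier (corner A ?p)" "y \<in> carrier (corner A ?p)"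
  then have xy: "x \<in> AC" "y \<in> AC" and py: "?p \<otimes> y = y" by (simp_all add: m)
  have z: "h \<otimes> x \<otimes> h' \<otimes> y \<otimes> h = \<zero>"
    using orient
  proof
    assume "\<forall>x\<in>AC. h \<otimes> x \<otimes> h' = \<zero>"
    then show ?thesis using xy h by simp
  next
    assume "\<forall>x\<in>AC. h' \<otimes> x \<otimes> h = \<zero>"
    moreover have "h \<otimes> x \<otimes> h' \<otimes> y \<otimes> h = h \<otimes> x \<otimes> (h' \<otimes> y \<otimes> h)" using xy h(1) h' by (simp add: AR.m_assoc)
    ultimately show ?thesis using xy h by simp
  qed
  have hh: "h \<otimes> x \<otimes> h \<otimes> (h \<otimes> y \<otimes> h) = h \<otimes> x \<otimes> (h \<otimes> h) \<otimes> y \<otimes> h" using xy h(1) by (simp add: AR.m_assoc)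
  have "h \<otimes> (x \<otimes> y) \<otimes> h = h \<otimes> (x \<otimes> (?p \<otimes> y)) \<otimes> h" by (simp only: py)
  also have "\<dots> = h \<otimes> x \<otimes> ?p \<otimes> y \<otimes> h" using xy h(1) h' by (simp add: AR.m_assoc)
  also have "\<dots> = h \<otimes> x \<otimes> h \<otimes> y \<otimes> h \<oplus> h \<otimes> x \<otimes> h' \<otimes> y \<otimes> h" using xy h(1) h' by (simp add: AR.r_distr AR.l_distr)
  also have "\<dots> = h \<otimes> x \<otimes> h \<otimes> (h \<otimes> y \<otimes> h)"
    unfolding z hh h(2) using xy h(1) by simp
  finally show "h \<otimes> (x \<otimes>\<^bsub>corner A ?p\<^esub> y) \<otimes> h = (h \<otimes> x \<otimes> h) \<otimes>\<^bsub>corner A q\<^esub> (h \<otimes> y \<otimes> h)"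
    by (simp only: corner_ops)
qed

end

section \<open>Mayer--Vietoris columns\<close>

text \<open>The inverse is part of the data, because \<open>connes_B\<close> is defined with the
  explicit inverse of \<open>theta\<close>.\<close>

definition lin_iso where
  "lin_iso K V W \<theta> \<psi> \<longleftrightarrow> \<theta> \<in> lin_maps K V W \<and> \<psi> \<in> lin_maps K W V \<and>
    (\<forall>x\<in>carrier V. \<psi> (\<theta> x) = x) \<and> (\<forall>y\<in>carrier W. \<theta> (\<psi> y) = y)"

lemma lin_iso_id: "lin_iso K V V (\<lambda>x. x) (\<lambda>x. x)"
  by (simp add: lin_iso_def lin_id)

lemma lin_iso_prod: "lin_iso K V W \<theta> \<psi> \<Longrightarrow> lin_iso K V' W' \<theta>' \<psi>' \<Longrightarrow>
    lin_iso K (dsum V V') (dsum W W') (map_prod \<theta> \<theta>') (map_prod \<psi> \<psi>')"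
  by (auto simp: lin_iso_def lin_map_prod dsum_simps)

lemma lin_iso_inv_into:
  assumes V: "module K V" and f: "f \<in> lin_maps K V W" and b: "bij_betw f (carrier V) (carrier W)"
  shows "lin_iso K V W f (inv_into (carrier V) f)"
  unfolding lin_iso_def using f lin_inv_into[OF V f b] b
  by (auto simp: bij_betw_def inv_into_f_f f_inv_into_f)

lemma lin_iso_exact_at:
  assumes ex: "exact_at K U f V g W"
    and U: "lin_iso K U' U \<theta>U \<psi>U" and V: "lin_iso K V' V \<theta>V \<psi>V" and W: "lin_iso K W' W \<theta>W \<psi>W"
    and ag: "abelian_group W'" "abelian_group W"
  shows "exact_at K U' (\<lambda>x. \<psi>V (f (\<theta>U x))) V' (\<lambda>x. \<psi>W (g (\<theta>V x))) W'"
proof (rule exact_atI)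
  have f: "f \<in> lin_maps K U V" and g: "g \<in> lin_maps K V W" and im: "f ` carrier U = {v \<in> carrier V. g v = \<zero>\<^bsub>W\<^esub>}"
    using ex by (auto simp: exact_at_def)
  have l: "\<theta>U \<in> lin_maps K U' U" "\<psi>U \<in> lin_maps K U U'" "\<theta>V \<in> lin_maps K V' V" "\<psi>V \<in> lin_maps K V V'"
    "\<theta>W \<in> lin_maps K W' W" "\<psi>W \<in> lin_maps K W W'" using U V W by (auto simp: lin_iso_def)
  note c = l[THEN lin_closed] lin_closed[OF f] lin_closed[OF g]
  show "(\<lambda>x. \<psi>V (f (\<theta>U x))) \<in> lin_maps K U' V'" by (rule lin_comp[OF lin_comp[OF l(1) f] l(4)])
  show "(\<lambda>x. \<psi>W (g (\<theta>V x))) \<in> lin_maps K V' W'" by (rule lin_comp[OF lin_comp[OF l(3) g] l(6)])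
  fix v
  { assume "v \<in> (\<lambda>x. \<psi>V (f (\<theta>U x))) ` carrier U'"
    then obtain x where x: "x \<in> carrier U'" "v = \<psi>V (f (\<theta>U x))" by blast
    have "g (f (\<theta>U x)) = \<zero>\<^bsub>W\<^esub>" using imageI[OF c(1)[OF x(1)], of f] unfolding im by simp
    then show "v \<in> {v \<in> carrier V'. \<psi>W (g (\<theta>V v)) = \<zero>\<^bsub>W'\<^esub>}"
      using x V lin_zero[OF l(6) ag(2,1)] by (simp add: lin_iso_def c) }
  { assume v: "v \<in> {v \<in> carrier V'. \<psi>W (g (\<theta>V v)) = \<zero>\<^bsub>W'\<^esub>}"
    then have vV: "v \<in> carrier V'" and z: "\<psi>W (g (\<theta>V v)) = \<zero>\<^bsub>W'\<^esub>" by auto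
    have "g (\<theta>V v) = \<theta>W (\<psi>W (g (\<theta>V v)))" using W vV by (simp add: lin_iso_def c)
    also have "\<dots> = \<zero>\<^bsub>W\<^esub>" unfolding z by (rule lin_zero[OF l(5) ag])
    finally have "\<theta>V v \<in> f ` carrier U" unfolding im using vV c by simp
    then obtain u where u: "u \<in> carrier U" "\<theta>V v = f u" by blast
    show "v \<in> (\<lambda>x. \<psi>V (f (\<theta>U x))) ` carrier U'"
      by (rule image_eqI[of _ _ "\<psi>U u"]) (use u vV U V u(2)[symmetric] in \<open>simp_all add: lin_iso_def c\<close>) }
qed

lemma lin_iso_exact_row:
  assumes "exact_row K X Y I S B" and Z: "\<And>n. lin_iso K (Z n) (X n) (\<theta> n) (\<psi> n)"
    and ag: "\<And>n. abelian_group (Z n)" "\<And>n. abelian_group (X n)" "\<And>n. abelian_group (Y n)"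
  shows "exact_row K Z Y (\<lambda>n x. I n (\<theta> n x)) S (\<lambda>n y. \<psi> (n - 1) (B n y))"
  unfolding exact_row_def
proof (intro allI conjI)
  fix n
  have ex: "exact_at K (X n) (I n) (Y n) (S n) (Y (n - 2))" "exact_at K (Y n) (S n) (Y (n - 2)) (B n) (X (n - 1))"
    "exact_at K (Y (n - 2)) (B n) (X (n - 1)) (I (n - 1)) (Y (n - 1))" using assms(1) by (auto simp: exact_row_def)
  note i = lin_iso_exact_at[OF _ _ _ _ ag(3,3)] lin_iso_exact_at[OF _ _ _ _ ag(1,2)]
  show "exact_at K (Z n) (\<lambda>x. I n (\<theta> n x)) (Y n) (S n) (Y (n - 2))" by (rule i(1)[OF ex(1) Z lin_iso_id lin_iso_id])
  show "exact_at K (Y n) (S n) (Y (n - 2)) (\<lambda>y. \<psi> (n - 1) (B n y)) (Z (n - 1))" by (rule i(2)[OF ex(2) lin_iso_id lin_iso_id Z])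
  show "exact_at K (Y (n - 2)) (\<lambda>y. \<psi> (n - 1) (B n y)) (Z (n - 1)) (\<lambda>x. I (n - 1) (\<theta> (n - 1) x)) (Y (n - 1))"
    by (rule i(1)[OF ex(3) lin_iso_id Z lin_iso_id])
qed

lemma lin_iso_exact_column:
  assumes "exact_column K X Y Z \<alpha> \<beta> \<delta>"
    and X: "\<And>n. lin_iso K (X' n) (X n) (\<theta>X n) (\<psi>X n)" and Y: "\<And>n. lin_iso K (Y' n) (Y n) (\<theta>Y n) (\<psi>Y n)"
    and Z: "\<And>n. lin_iso K (Z' n) (Z n) (\<theta>Z n) (\<psi>Z n)"
    and ag: "\<And>n. abelian_group (X' n)" "\<And>n. abelian_group (X n)" "\<And>n. abelian_group (Y' n)" "\<And>n. abelian_group (Y n)"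
      "\<And>n. abelian_group (Z' n)" "\<And>n. abelian_group (Z n)"
  shows "exact_column K X' Y' Z' (\<lambda>n x. \<psi>Y n (\<alpha> n (\<theta>X n x))) (\<lambda>n x. \<psi>Z n (\<beta> n (\<theta>Y n x))) (\<lambda>n x. \<psi>X (n - 1) (\<delta> n (\<theta>Z n x)))"
  unfolding exact_column_def
proof (intro allI conjI)
  fix n
  have ex: "exact_at K (X n) (\<alpha> n) (Y n) (\<beta> n) (Z n)" "exact_at K (Y n) (\<beta> n) (Z n) (\<delta> n) (X (n - 1))"
    "exact_at K (Z n) (\<delta> n) (X (n - 1)) (\<alpha> (n - 1)) (Y (n - 1))" using assms(1) by (auto simp: exact_column_def)
  show "exact_at K (X' n) (\<lambda>x. \<psi>Y n (\<alpha> n (\<theta>X n x))) (Y' n) (\<lambda>x. \<psi>Z n (\<beta> n (\<theta>Y n x))) (Z' n)"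
    by (rule lin_iso_exact_at[OF ex(1) X Y Z ag(5,6)])
  show "exact_at K (Y' n) (\<lambda>x. \<psi>Z n (\<beta> n (\<theta>Y n x))) (Z' n) (\<lambda>x. \<psi>X (n - 1) (\<delta> n (\<theta>Z n x))) (X' (n - 1))"
    by (rule lin_iso_exact_at[OF ex(2) Y Z X ag(1,2)])
  show "exact_at K (Z' n) (\<lambda>x. \<psi>X (n - 1) (\<delta> n (\<theta>Z n x))) (X' (n - 1)) (\<lambda>x. \<psi>Y (n - 1) (\<alpha> (n - 1) (\<theta>X (n - 1) x))) (Y' (n - 1))"
    by (rule lin_iso_exact_at[OF ex(3) Z X Y ag(3,4)])
qed

text \<open>Conjugation affects the Hochschild terms of both rows, where \<open>theta\<close> lives;
  the cyclic terms and the maps between them stay as they are.\<close>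

lemma lin_iso_rows_commute:
  assumes rc: "rows_commute r X Y I S B I' S' B' f g"
    and Z: "\<And>n. lin_iso K (Z n) (X n) (\<theta> n) (\<psi> n)" and Z': "\<And>n. lin_iso K (Z' n) (X' n) (\<theta>' n) (\<psi>' n)"
    and f: "\<And>n x. x \<in> carrier (X n) \<Longrightarrow> f n x \<in> carrier (X' (n - r))"
    and B: "\<And>n y. y \<in> carrier (Y (n - 2)) \<Longrightarrow> B n y \<in> carrier (X (n - 1))"
  shows "rows_commute r Z Y (\<lambda>n x. I n (\<theta> n x)) S (\<lambda>n y. \<psi> (n - 1) (B n y))
    (\<lambda>n x. I' n (\<theta>' n x)) S' (\<lambda>n y. \<psi>' (n - 1) (B' n y)) (\<lambda>n x. \<psi>' (n - r) (f n (\<theta> n x))) g"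
  unfolding rows_commute_def
proof (intro allI conjI ballI)
  fix n
  note rc' = rc[unfolded rows_commute_def, rule_format, of n]
  have \<theta>c: "\<theta> n x \<in> carrier (X n)" if "x \<in> carrier (Z n)" for x
    using that Z[of n] unfolding lin_iso_def by (blast intro: lin_closed)
  show "g n (I n (\<theta> n x)) = I' (n - r) (\<theta>' (n - r) (\<psi>' (n - r) (f n (\<theta> n x))))" if "x \<in> carrier (Z n)" for x
    using rc' \<theta>c[OF that] Z'[of "n - r"] f[OF \<theta>c[OF that]] by (simp add: lin_iso_def)
  show "g (n - 2) (S n y) = S' (n - r) (g n y)" if "y \<in> carrier (Y n)" for y using rc' that by blast
  have e: "n - 1 - r = n - r - 1" by simp
  show "\<psi>' (n - 1 - r) (f (n - 1) (\<theta> (n - 1) (\<psi> (n - 1) (B n y)))) = \<psi>' (n - r - 1) (B' (n - r) (g (n - 2) y))"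
    if "y \<in> carrier (Y (n - 2))" for y
    unfolding e using rc' that Z[of "n - 1"] B[OF that] by (simp add: lin_iso_def)
qed

section \<open>The diagram attached to corner algebras\<close>

abbreviation HX where
  "HX K J A \<equiv> homology (Tot K A J) (Tot_d K A J)"

text \<open>Collects the algebra maps behind \<open>split_mayer_vietoris\<close>, so that Hochschild
  and cyclic homology are treated at once, told apart by the set \<open>J\<close> of columns.
  \<open>\<pi>2\<close> and \<open>\<kappa>\<close> are different maps into A2: the former is a
  retraction for the inclusion of A2, the latter complements \<open>\<pi>1\<close> on homology and
  will be compression by e2'.\<close>

locale corner_diagram =
  fixes K :: "('k, 'm) ring_scheme" and C A1 A2 R :: "('k, 'a) module" and \<pi>1 \<pi>2 \<rho>1 \<rho>2 \<kappa> :: "'a \<Rightarrow> 'a"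
  assumes j1: "alg_hom K C A1 (\<lambda>x. x)" and j2: "alg_hom K C A2 (\<lambda>x. x)"
    and i1: "alg_hom K A1 R (\<lambda>x. x)" and i2: "alg_hom K A2 R (\<lambda>x. x)"
    and p1: "alg_hom K R A1 \<pi>1" and p2: "alg_hom K R A2 \<pi>2" and r1: "alg_hom K A1 C \<rho>1" and r2: "alg_hom K A2 C \<rho>2"
    and q: "alg_hom K R A2 \<kappa>"
    and r1j1: "\<And>x. x \<in> carrier C \<Longrightarrow> \<rho>1 x = x" and p1i1: "\<And>x. x \<in> carrier A1 \<Longrightarrow> \<pi>1 x = x"
    and p2i2: "\<And>x. x \<in> carrier A2 \<Longrightarrow> \<pi>2 x = x"
    and p2i1: "\<And>x. x \<in> carrier A1 \<Longrightarrow> \<pi>2 x = \<rho>1 x" and p1i2: "\<And>x. x \<in> carrier A2 \<Longrightarrow> \<pi>1 x = \<rho>2 x"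
    and split: "\<And>J n \<zeta>. J = two_cols \<or> J = UNIV \<Longrightarrow> \<zeta> \<in> carrier (HX K J R n) \<Longrightarrow>
      \<zeta> = alg_hom.hm K R \<pi>1 J n \<zeta> \<oplus>\<^bsub>HX K J R n\<^esub> alg_hom.hm K R \<kappa> J n \<zeta>"
begin

sublocale kC: kalg K C using j1 by (simp add: alg_hom_def)
sublocale k1: kalg K A1 using j1 by (simp add: alg_hom_def)
sublocale k2: kalg K A2 using j2 by (simp add: alg_hom_def)
sublocale kR: kalg K R using i1 by (simp add: alg_hom_def)

definition mv_a where
  "mv_a J n x = (incl_map K J A1 n x, \<ominus>\<^bsub>HX K J A2 n\<^esub> incl_map K J A2 n x)"

definition mv_b where
  "mv_b J n = (\<lambda>(y, z). incl_map K J R n y \<oplus>\<^bsub>HX K J R n\<^esub> incl_map K J R n z)"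

definition mv_d where "mv_d J n x = \<zero>\<^bsub>HX K J C (n - 1)\<^esub>"

lemma HX_module: "module K (HX K J C n)" "module K (HX K J A1 n)" "module K (HX K J A2 n)" "module K (HX K J R n)"
  by (rule chain_complex.homology_module, rule kC.Tot_complex k1.Tot_complex k2.Tot_complex kR.Tot_complex)+

lemma mv_exact:
  assumes J: "J = two_cols \<or> J = UNIV"
  shows "exact_column K (HX K J C) (\<lambda>n. dsum (HX K J A1 n) (HX K J A2 n)) (HX K J R) (mv_a J) (mv_b J) (mv_d J)"
proof -
  note incl = incl_map_hm[OF j1] incl_map_hm[OF j2] incl_map_hm[OF i1]
  have h: "alg_hom.hm K C \<rho>1 J n (incl_map K J A1 n x) = x" if x: "x \<in> carrier (HX K J C n)" for n x
    unfolding incl by (rule trans[OF hm_comp[OF j1 r1 kC.alg_hom_id _ x] hm_id[OF kC.alg_hom_id refl x]]) (rule r1j1)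
  have ij: "incl_map K J R n (incl_map K J A1 n x) = incl_map K J R n (incl_map K J A2 n x)" if x: "x \<in> carrier (HX K J C n)" for n x
    unfolding incl hm_comp[OF j1 i1 alg_hom_comp[OF j1 i1] refl x] hm_comp[OF j2 i2 alg_hom_comp[OF j1 i1] refl x] ..
  have p1i1': "alg_hom.hm K A1 \<pi>1 J n (incl_map K J R n x) = x" if x: "x \<in> carrier (HX K J A1 n)" for n x
    unfolding incl by (rule trans[OF hm_comp[OF i1 p1 k1.alg_hom_id _ x] hm_id[OF k1.alg_hom_id refl x]]) (rule p1i1)
  have p2i2': "alg_hom.hm K A2 \<pi>2 J n (incl_map K J R n x) = x" if x: "x \<in> carrier (HX K J A2 n)" for n x
    unfolding incl by (rule trans[OF hm_comp[OF i2 p2 k2.alg_hom_id _ x] hm_id[OF k2.alg_hom_id refl x]]) (rule p2i2)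
  have p2i1': "alg_hom.hm K A2 \<pi>2 J n (incl_map K J R n x) = incl_map K J A2 n (alg_hom.hm K C \<rho>1 J n x)" if x: "x \<in> carrier (HX K J A1 n)" for n x
    unfolding incl by (rule trans[OF hm_comp[OF i1 p2 alg_hom_comp[OF r1 j2] _ x] sym[OF hm_comp[OF r1 j2 alg_hom_comp[OF r1 j2] refl x]]]) (rule p2i1)
  have p1i2': "alg_hom.hm K A1 \<pi>1 J n (incl_map K J R n x) = incl_map K J A1 n (alg_hom.hm K C \<rho>2 J n x)" if x: "x \<in> carrier (HX K J A2 n)" for n x
    unfolding incl by (rule trans[OF hm_comp[OF i2 p1 alg_hom_comp[OF r2 j1] _ x] sym[OF hm_comp[OF r2 j1 alg_hom_comp[OF r2 j1] refl x]]]) (rule p1i2)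
  \<comment> \<open>The preimages are the images under \<open>\<pi>1\<close> and
    \<open>\<kappa>\<close>; composed with the inclusions these are endomorphisms of R, and
    \<open>split\<close> applies.\<close>
  have surj: "\<exists>y\<in>carrier (HX K J A1 n). \<exists>z\<in>carrier (HX K J A2 n). x = incl_map K J R n y \<oplus>\<^bsub>HX K J R n\<^esub> incl_map K J R n z"
    if x: "x \<in> carrier (HX K J R n)" for n x
  proof (intro bexI)
    show "x = incl_map K J R n (alg_hom.hm K A1 \<pi>1 J n x) \<oplus>\<^bsub>HX K J R n\<^esub> incl_map K J R n (alg_hom.hm K A2 \<kappa> J n x)"
      unfolding incl hm_comp[OF p1 i1 alg_hom_comp[OF p1 i1] refl x] hm_comp[OF q i2 alg_hom_comp[OF q i2] refl x]
      by (rule split[OF J x])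
    show "alg_hom.hm K A1 \<pi>1 J n x \<in> carrier (HX K J A1 n)" by (rule lin_closed[OF alg_hom.hm_lin[OF p1] x])
    show "alg_hom.hm K A2 \<kappa> J n x \<in> carrier (HX K J A2 n)" by (rule lin_closed[OF alg_hom.hm_lin[OF q] x])
  qed
  note l = alg_hom.hm_lin[OF j1, of J, folded incl] alg_hom.hm_lin[OF j2, of J, folded incl] alg_hom.hm_lin[OF i1, of J, folded incl]
    alg_hom.hm_lin[OF i2, of J, folded incl] alg_hom.hm_lin[OF p1, of J] alg_hom.hm_lin[OF p2, of J] alg_hom.hm_lin[OF r1, of J] alg_hom.hm_lin[OF r2, of J]
  note mv = split_mayer_vietoris[OF HX_module l h ij p1i1' p2i2' p2i1' p1i2' surj]
  show ?thesis unfolding exact_column_def mv_a_def[abs_def] mv_b_def mv_d_def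
    by (intro allI conjI mv(1) mv(2)[OF _ _ _ _ _ _ _ HX_module(1)] mv(3)[OF _ _ _ _ _ _ _ HX_module(4)])
qed

lemma incl_lin: "incl_map K J A1 n \<in> lin_maps K (HX K J C n) (HX K J A1 n)" "incl_map K J A2 n \<in> lin_maps K (HX K J C n) (HX K J A2 n)"
  "incl_map K J R n \<in> lin_maps K (HX K J A1 n) (HX K J R n)" "incl_map K J R n \<in> lin_maps K (HX K J A2 n) (HX K J R n)"
  unfolding incl_map_hm[OF j1] incl_map_hm[OF j2] incl_map_hm[OF i1]
  by (rule alg_hom.hm_lin[OF j1] alg_hom.hm_lin[OF j2] alg_hom.hm_lin[OF i1] alg_hom.hm_lin[OF i2])+

lemmas incl_nat = alg_hom.hm_HI[OF j1] alg_hom.hm_HS[OF j1] alg_hom.hm_HB[OF j1] alg_hom.hm_HI[OF j2] alg_hom.hm_HS[OF j2] alg_hom.hm_HB[OF j2]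
  alg_hom.hm_HI[OF i1] alg_hom.hm_HS[OF i1] alg_hom.hm_HB[OF i1] alg_hom.hm_HI[OF i2] alg_hom.hm_HS[OF i2] alg_hom.hm_HB[OF i2]

lemmas incl_nat' = incl_nat[folded incl_map_hm[OF j1] incl_map_hm[OF j2] incl_map_hm[OF i1]]

lemma HTC: "HX K two_cols A = HT K A" "HX K UNIV A = HC K A"
  by (simp_all add: HT_def HC_def)

lemma mv_a_commute:
  "rows_commute 0 (HT K C) (HC K C) kC.HI (connes_S K C) kC.HB
    (\<lambda>n. map_prod (k1.HI n) (k2.HI n)) (\<lambda>n. map_prod (connes_S K A1 n) (connes_S K A2 n)) (\<lambda>n. map_prod (k1.HB n) (k2.HB n))
    (mv_a two_cols) (mv_a UNIV)"
proof -
  note cl = lin_closed[OF incl_lin(2)[of two_cols, unfolded HTC]] lin_closed[OF incl_lin(2)[of UNIV, unfolded HTC]]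
  note ag = module_abelian_group[OF k2.HT_module] module_abelian_group[OF k2.HC_module]
  show ?thesis unfolding rows_commute_def mv_a_def HTC diff_zero
    by (simp add: incl_nat'(1-6) cl lin_uminus[OF k2.HI_lin ag] lin_uminus[OF k2.HS_lin ag(2,2)] lin_uminus[OF k2.HB_lin ag(2,1)] del: One_nat_def)
qed

lemma mv_b_commute:
  "rows_commute 0 (\<lambda>n. dsum (HT K A1 n) (HT K A2 n)) (\<lambda>n. dsum (HC K A1 n) (HC K A2 n))
    (\<lambda>n. map_prod (k1.HI n) (k2.HI n)) (\<lambda>n. map_prod (connes_S K A1 n) (connes_S K A2 n)) (\<lambda>n. map_prod (k1.HB n) (k2.HB n))
    kR.HI (connes_S K R) kR.HB (mv_b two_cols) (mv_b UNIV)"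
proof -
  note cl = lin_closed[OF incl_lin(3)[of two_cols, unfolded HTC]] lin_closed[OF incl_lin(4)[of two_cols, unfolded HTC]]
    lin_closed[OF incl_lin(3)[of UNIV, unfolded HTC]] lin_closed[OF incl_lin(4)[of UNIV, unfolded HTC]]
  show ?thesis unfolding rows_commute_def mv_b_def HTC diff_zero
    by (auto simp: dsum_simps incl_nat'(7-12) cl lin_add[OF kR.HI_lin] lin_add[OF kR.HS_lin] lin_add[OF kR.HB_lin] simp del: One_nat_def)
qed

lemma mv_d_commute: "rows_commute 1 (HT K R) (HC K R) kR.HI (connes_S K R) kR.HB kC.HI (connes_S K C) kC.HB (mv_d two_cols) (mv_d UNIV)"
proof -
  note ag = module_abelian_group[OF kC.HT_module] module_abelian_group[OF kC.HC_module]
  have e: "kC.HB (n - 1) \<zero>\<^bsub>HC K C (n - 3)\<^esub> = \<zero>\<^bsub>HT K C (n - 2)\<^esub>" for n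
    using lin_zero[OF kC.HB_lin[of "n - 1"] ag(2,1)] by simp
  show ?thesis unfolding rows_commute_def mv_d_def HTC
    by (auto simp: lin_zero[OF kC.HI_lin ag] lin_zero[OF kC.HS_lin ag(2,2)] e)
qed

end

context env_kalg begin

text \<open>Each of the three orientations yields, for i = 1 and i = 2, that one of e R ei' and ei'
  R e vanishes; this makes all compressions multiplicative by
  \<open>corner_compress\<close>.\<close>

lemma oriented_corner_diagram:
  assumes o: "oriented_by A e e1' e2'"
  defines "e1 \<equiv> e1' \<oplus> e" and "e2 \<equiv> e2' \<oplus> e"
  shows "\<exists>\<pi>1 \<pi>2 \<rho>1 \<rho>2 \<kappa>. corner_diagram K (corner A e) (corner A e1) (corner A e2) A \<pi>1 \<pi>2 \<rho>1 \<rho>2 \<kappa>"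
proof -
  have c: "e \<in> AC" "e1' \<in> AC" "e2' \<in> AC"
    and i: "e \<otimes> e = e" "e1' \<otimes> e1' = e1'" "e2' \<otimes> e2' = e2'"
    and z: "e \<otimes> e1' = \<zero>" "e1' \<otimes> e = \<zero>" "e \<otimes> e2' = \<zero>" "e2' \<otimes> e = \<zero>"
      "e1' \<otimes> e2' = \<zero>" "e2' \<otimes> e1' = \<zero>"
    and one: "e1 \<oplus> e2' = \<one>"
    using o by (auto simp: oriented_by_def orthogonal_idempotents_def e1_def)
  have ec: "e1 \<in> AC" "e2 \<in> AC" using c by (simp_all add: e1_def e2_def)
  have one': "e2 \<oplus> e1' = \<one>" "e2' \<oplus> e1 = \<one>" "e \<oplus> e1' = e1" "e \<oplus> e2' = e2"
    unfolding one[symmetric] using c by (simp_all add: e1_def e2_def AM.M.a_ac)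
  have ei: "e1 \<otimes> e1 = e1" "e2 \<otimes> e2 = e2" "e1 \<otimes> e = e" "e \<otimes> e1 = e" "e2 \<otimes> e = e" "e \<otimes> e2 = e"
    "e1 \<otimes> e2' = \<zero>" "e2' \<otimes> e1 = \<zero>" "e2 \<otimes> e1' = \<zero>" "e1' \<otimes> e2 = \<zero>"
    "e1 \<otimes> e2 = e" "e2 \<otimes> e1 = e" "e2 \<otimes> e2' = e2'" "e2' \<otimes> e2 = e2'"
    using c i z by (simp_all add: e1_def e2_def AR.r_distr AR.l_distr)
  have pz: "a \<otimes> x \<otimes> b = \<zero>" if "peirce A a b = {\<zero>}" "x \<in> AC" for a b x
    using that by (metis imageI peirce_def singletonD)
  have x12: "e1' \<otimes> x \<otimes> e2' = \<zero>" "e2' \<otimes> x \<otimes> e1' = \<zero>" if "x \<in> AC" for x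
    using o pz[OF _ that] by (auto simp: oriented_by_def)
  have o1: "(\<forall>x\<in>AC. e \<otimes> x \<otimes> e1' = \<zero>) \<or> (\<forall>x\<in>AC. e1' \<otimes> x \<otimes> e = \<zero>)"
    and o2: "(\<forall>x\<in>AC. e \<otimes> x \<otimes> e2' = \<zero>) \<or> (\<forall>x\<in>AC. e2' \<otimes> x \<otimes> e = \<zero>)"
    using o pz unfolding oriented_by_def by metis+
  \<comment> \<open>The vanishing of e1' R e2' and e2' R e1' removes the primed summand of e1 and of
    e2.\<close>
  have d: "e1 \<otimes> x \<otimes> e2' = e \<otimes> x \<otimes> e2'" "e2' \<otimes> x \<otimes> e1 = e2' \<otimes> x \<otimes> e"
    "e2 \<otimes> x \<otimes> e1' = e \<otimes> x \<otimes> e1'" "e1' \<otimes> x \<otimes> e2 = e1' \<otimes> x \<otimes> e" if "x \<in> AC" for x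
    using that c x12[OF that] by (simp_all add: e1_def e2_def AR.r_distr AR.l_distr)
  have o3: "(\<forall>x\<in>AC. e1 \<otimes> x \<otimes> e2' = \<zero>) \<or> (\<forall>x\<in>AC. e2' \<otimes> x \<otimes> e1 = \<zero>)"
    using o2 d by simp
  have o4: "(\<forall>x\<in>AC. e2 \<otimes> x \<otimes> e1' = \<zero>) \<or> (\<forall>x\<in>AC. e1' \<otimes> x \<otimes> e2 = \<zero>)"
    using o1 d by simp
  have o5: "(\<forall>x\<in>AC. e2' \<otimes> x \<otimes> e1 = \<zero>) \<or> (\<forall>x\<in>AC. e1 \<otimes> x \<otimes> e2' = \<zero>)"
    using o3 by blast
  have cl: "\<one> \<in> AC" "\<one> \<otimes> \<one> = \<one>" by simp_all
  have u: "f \<otimes> \<one> = f" "\<one> \<otimes> f = f" if "f \<in> AC" for f using that by simp_all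
  note incl = corner_incl[OF ec(1) ei(1) cl u[OF ec(1)], unfolded corner_one] corner_incl[OF ec(2) ei(2) cl u[OF ec(2)], unfolded corner_one]
  note m1 = corner_mem[OF ec(1) ei(1)] and m2 = corner_mem[OF ec(2) ei(2)] and m = corner_mem[OF c(1) i(1)]
  have "corner_diagram K (corner A e) (corner A e1) (corner A e2) A (\<lambda>x. e1 \<otimes> x \<otimes> e1) (\<lambda>x. e2 \<otimes> x \<otimes> e2)
    (\<lambda>x. e \<otimes> x \<otimes> e) (\<lambda>x. e \<otimes> x \<otimes> e) (\<lambda>x. e2' \<otimes> x \<otimes> e2')"
  proof (rule corner_diagram.intro)
    show "alg_hom K (corner A e) (corner A e1) (\<lambda>x. x)" by (rule corner_incl[OF c(1) i(1) ec(1) ei(1) ei(4) ei(3)])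
    show "alg_hom K (corner A e) (corner A e2) (\<lambda>x. x)" by (rule corner_incl[OF c(1) i(1) ec(2) ei(2) ei(6) ei(5)])
    show "alg_hom K (corner A e1) A (\<lambda>x. x)" "alg_hom K (corner A e2) A (\<lambda>x. x)" by (rule incl)+
    show "alg_hom K A (corner A e1) (\<lambda>x. e1 \<otimes> x \<otimes> e1)"
      using corner_compress[OF ec(1) ei(1) c(3) i(3) ei(7,8) ec(1) ei(1) ei(1) ei(1) o3] unfolding one corner_one .
    show "alg_hom K A (corner A e2) (\<lambda>x. e2 \<otimes> x \<otimes> e2)"
      using corner_compress[OF ec(2) ei(2) c(2) i(2) ei(9,10) ec(2) ei(2) ei(2) ei(2) o4] unfolding one' corner_one .
    show "alg_hom K (corner A e1) (corner A e) (\<lambda>x. e \<otimes> x \<otimes> e)"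
      using corner_compress[OF c(1) i(1) c(2) i(2) z(1,2) c(1) i(1) i(1) i(1) o1] unfolding one' .
    show "alg_hom K (corner A e2) (corner A e) (\<lambda>x. e \<otimes> x \<otimes> e)"
      using corner_compress[OF c(1) i(1) c(3) i(3) z(3,4) c(1) i(1) i(1) i(1) o2] unfolding one' .
    show "alg_hom K A (corner A e2) (\<lambda>x. e2' \<otimes> x \<otimes> e2')"
      using corner_compress[OF c(3) i(3) ec(1) ei(1) ei(8,7) ec(2) ei(2) ei(14) ei(13) o5] unfolding one' corner_one .
    show "e \<otimes> x \<otimes> e = x" if "x \<in> carrier (corner A e)" for x using that by (simp add: m)
    show "e1 \<otimes> x \<otimes> e1 = x" if "x \<in> carrier (corner A e1)" for x using that by (simp add: m1)
    show "e2 \<otimes> x \<otimes> e2 = x" if "x \<in> carrier (corner A e2)" for x using that by (simp add: m2)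
    \<comment> \<open>Since e1 e2 = e2 e1 = e, compressing an element of A1 by e2 is the same as
      compressing it by e; so inclusion into R followed by retraction onto A2 factors through
      C.\<close>
    show "e2 \<otimes> x \<otimes> e2 = e \<otimes> x \<otimes> e" if "x \<in> carrier (corner A e1)" for x
    proof -
      have x: "x \<in> AC" "e1 \<otimes> x = x" "x \<otimes> e1 = x" using that by (simp_all add: m1)
      have "e2 \<otimes> x \<otimes> e2 = e2 \<otimes> (e1 \<otimes> x \<otimes> e1) \<otimes> e2" by (simp only: x)
      also have "\<dots> = (e2 \<otimes> e1) \<otimes> x \<otimes> (e1 \<otimes> e2)" using x(1) ec by (simp add: AR.m_assoc)
      finally show ?thesis unfolding ei .
    qed
    show "e1 \<otimes> x \<otimes> e1 = e \<otimes> x \<otimes> e" if "x \<in> carrier (corner A e2)" for x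
    proof -
      have x: "x \<in> AC" "e2 \<otimes> x = x" "x \<otimes> e2 = x" using that by (simp_all add: m2)
      have "e1 \<otimes> x \<otimes> e1 = e1 \<otimes> (e2 \<otimes> x \<otimes> e2) \<otimes> e1" by (simp only: x)
      also have "\<dots> = (e1 \<otimes> e2) \<otimes> x \<otimes> (e2 \<otimes> e1)" using x(1) ec by (simp add: AR.m_assoc)
      finally show ?thesis unfolding ei .
    qed
    fix J n \<zeta> assume J: "J = two_cols \<or> J = UNIV" and \<zeta>: "\<zeta> \<in> carrier (HX K J A n)"
    show "\<zeta> = alg_hom.hm K A (\<lambda>x. e1 \<otimes> x \<otimes> e1) J n \<zeta> \<oplus>\<^bsub>HX K J A n\<^esub> alg_hom.hm K A (\<lambda>x. e2' \<otimes> x \<otimes> e2') J n \<zeta>"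
      using o3
    proof
      assume "\<forall>x\<in>AC. e1 \<otimes> x \<otimes> e2' = \<zero>"
      \<comment> \<open>Here the triangular pair is f = e2' and g = e1, so the two summands come in
        the opposite order and have to be commuted.\<close>
      then interpret t: triangular K A e2' e1
        by unfold_locales (use c i z ec ei one' in auto)
      interpret H: module K "HX K J A n" by (rule t.HJ_module)
      show ?thesis using J \<zeta> t.HT_split[of \<zeta> n] t.HC_split[of \<zeta> n]
          H.M.a_comm[OF lin_closed[OF t.pf.hm_lin \<zeta>] lin_closed[OF t.pg.hm_lin \<zeta>]] by auto
    next
      assume "\<forall>x\<in>AC. e2' \<otimes> x \<otimes> e1 = \<zero>"
      then interpret t: triangular K A e1 e2'
        by unfold_locales (use c i z ec ei one in auto)
      show ?thesis using J \<zeta> t.HT_split[of \<zeta> n] t.HC_split[of \<zeta> n] by auto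
    qed
  qed
  then show ?thesis by blast
qed

end

theorem theorem3p6:
  fixes K :: "'k ring" and R C A1 A2 :: "('k, 'a) module" and e e1' e2' :: 'a
    and QR :: "(('a \<times> 'a \<Rightarrow> 'k) set, 'p, 'a) resolution"
    and QC :: "(('a \<times> 'a \<Rightarrow> 'k) set, 'q, 'a) resolution"
    and Q1 :: "(('a \<times> 'a \<Rightarrow> 'k) set, 'r, 'a) resolution"
    and Q2 :: "(('a \<times> 'a \<Rightarrow> 'k) set, 's, 'a) resolution"
  assumes "field K" and "k_algebra K R" and "oriented_by R e e1' e2'"
    and A1: "A1 = corner R (e1' \<oplus>\<^bsub>R\<^esub> e)"
    and A2: "A2 = corner R (e2' \<oplus>\<^bsub>R\<^esub> e)"
    and C: "C = corner R e"
    and "proj_resolution (env_alg K R) (env_left_mod K R) QR"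
    and "proj_resolution (env_alg K C) (env_left_mod K C) QC"
    and "proj_resolution (env_alg K A1) (env_left_mod K A1) Q1"
    and "proj_resolution (env_alg K A2) (env_left_mod K A2) Q2"
  shows "\<exists>\<phi>R \<phi>C \<phi>1 \<phi>2 \<alpha>H \<beta>H \<delta>H \<alpha>HC \<beta>HC \<delta>HC.
    \<comment> \<open>identification of Hochschild homology with the homology of the first two columns\<close>
    bar_lift K R QR \<phi>R \<and> bar_lift K C QC \<phi>C \<and> bar_lift K A1 Q1 \<phi>1 \<and> bar_lift K A2 Q2 \<phi>2 \<and>
    (\<forall>n. bij_betw (theta K R \<phi>R n) (carrier (HH K R QR n)) (carrier (HT K R n)) \<and>
         bij_betw (theta K C \<phi>C n) (carrier (HH K C QC n)) (carrier (HT K C n)) \<and>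
         bij_betw (theta K A1 \<phi>1 n) (carrier (HH K A1 Q1 n)) (carrier (HT K A1 n)) \<and>
         bij_betw (theta K A2 \<phi>2 n) (carrier (HH K A2 Q2 n)) (carrier (HT K A2 n))) \<and>
    \<comment> \<open>rows\<close>
    exact_row K (HH K R QR) (HC K R)
      (connes_I K R \<phi>R) (connes_S K R) (connes_B K R QR \<phi>R) \<and>
    exact_row K (HH K C QC) (HC K C)
      (connes_I K C \<phi>C) (connes_S K C) (connes_B K C QC \<phi>C) \<and>
    exact_row K (\<lambda>n. dsum (HH K A1 Q1 n) (HH K A2 Q2 n)) (\<lambda>n. dsum (HC K A1 n) (HC K A2 n))
      (\<lambda>n. map_prod (connes_I K A1 \<phi>1 n) (connes_I K A2 \<phi>2 n))
      (\<lambda>n. map_prod (connes_S K A1 n) (connes_S K A2 n))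
      (\<lambda>n. map_prod (connes_B K A1 Q1 \<phi>1 n) (connes_B K A2 Q2 \<phi>2 n)) \<and>
    \<comment> \<open>columns\<close>
    exact_column K (HH K C QC) (\<lambda>n. dsum (HH K A1 Q1 n) (HH K A2 Q2 n)) (HH K R QR) \<alpha>H \<beta>H \<delta>H \<and>
    exact_column K (HC K C) (\<lambda>n. dsum (HC K A1 n) (HC K A2 n)) (HC K R) \<alpha>HC \<beta>HC \<delta>HC \<and>
    mv_maps K two_cols A1 A2 R (HH K C QC) (HH K A1 Q1) (HH K A2 Q2)
      (theta K C \<phi>C) (theta K A1 \<phi>1) (theta K A2 \<phi>2) (theta K R \<phi>R) \<alpha>H \<beta>H \<and>
    mv_maps K UNIV A1 A2 R (HC K C) (HC K A1) (HC K A2)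
      (\<lambda>_. id) (\<lambda>_. id) (\<lambda>_. id) (\<lambda>_. id) \<alpha>HC \<beta>HC \<and>
    \<comment> \<open>squares\<close>
    rows_commute 1 (HH K R QR) (HC K R)
      (connes_I K R \<phi>R) (connes_S K R) (connes_B K R QR \<phi>R)
      (connes_I K C \<phi>C) (connes_S K C) (connes_B K C QC \<phi>C) \<delta>H \<delta>HC \<and>
    rows_commute 0 (HH K C QC) (HC K C)
      (connes_I K C \<phi>C) (connes_S K C) (connes_B K C QC \<phi>C)
      (\<lambda>n. map_prod (connes_I K A1 \<phi>1 n) (connes_I K A2 \<phi>2 n))
      (\<lambda>n. map_prod (connes_S K A1 n) (connes_S K A2 n))
      (\<lambda>n. map_prod (connes_B K A1 Q1 \<phi>1 n) (connes_B K A2 Q2 \<phi>2 n)) \<alpha>H \<alpha>HC \<and>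
    rows_commute 0 (\<lambda>n. dsum (HH K A1 Q1 n) (HH K A2 Q2 n)) (\<lambda>n. dsum (HC K A1 n) (HC K A2 n))
      (\<lambda>n. map_prod (connes_I K A1 \<phi>1 n) (connes_I K A2 \<phi>2 n))
      (\<lambda>n. map_prod (connes_S K A1 n) (connes_S K A2 n))
      (\<lambda>n. map_prod (connes_B K A1 Q1 \<phi>1 n) (connes_B K A2 Q2 \<phi>2 n))
      (connes_I K R \<phi>R) (connes_S K R) (connes_B K R QR \<phi>R) \<beta>H \<beta>HC"
proof -
  interpret RR: resn K R QR by unfold_locales fact+
  interpret RC: resn K C QC
    using kalg.corner_kalg[OF RR.kalg_axioms, of e] assms(3,8) by (simp add: C resn_def resn_axioms_def oriented_by_def orthogonal_idempotents_def)
  obtain \<pi>1 \<pi>2 \<rho>1 \<rho>2 \<kappa> where "corner_diagram K C A1 A2 R \<pi>1 \<pi>2 \<rho>1 \<rho>2 \<kappa>"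
    using RR.oriented_corner_diagram[OF assms(3)] unfolding A1 A2 C by blast
  then interpret D: corner_diagram K C A1 A2 R \<pi>1 \<pi>2 \<rho>1 \<rho>2 \<kappa> .
  interpret R1: resn K A1 Q1 using D.k1.kalg_axioms assms(9) by (simp add: resn_def resn_axioms_def)
  interpret R2: resn K A2 Q2 using D.k2.kalg_axioms assms(10) by (simp add: resn_def resn_axioms_def)
  obtain \<phi>R where \<phi>R: "bar_lift K R QR \<phi>R" using RR.bar_lift_exists by blast
  obtain \<phi>C where \<phi>C: "bar_lift K C QC \<phi>C" using RC.bar_lift_exists by blast
  obtain \<phi>1 where \<phi>1: "bar_lift K A1 Q1 \<phi>1" using R1.bar_lift_exists by blast
  obtain \<phi>2 where \<phi>2: "bar_lift K A2 Q2 \<phi>2" using R2.bar_lift_exists by blast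
  let ?\<theta>R = "theta K R \<phi>R" and ?\<theta>C = "theta K C \<phi>C" and ?\<theta>1 = "theta K A1 \<phi>1" and ?\<theta>2 = "theta K A2 \<phi>2"
  let ?\<psi>R = "\<lambda>n. inv_into (carrier (HH K R QR n)) (?\<theta>R n)" and ?\<psi>C = "\<lambda>n. inv_into (carrier (HH K C QC n)) (?\<theta>C n)"
  let ?\<psi>1 = "\<lambda>n. inv_into (carrier (HH K A1 Q1 n)) (?\<theta>1 n)" and ?\<psi>2 = "\<lambda>n. inv_into (carrier (HH K A2 Q2 n)) (?\<theta>2 n)"
  note bij = RR.theta_bij[OF \<phi>R] RC.theta_bij[OF \<phi>C] R1.theta_bij[OF \<phi>1] R2.theta_bij[OF \<phi>2]
  note isoR = lin_iso_inv_into[OF RR.HH_module RR.theta_lin[OF \<phi>R] bij(1)]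
    and isoC = lin_iso_inv_into[OF RC.HH_module RC.theta_lin[OF \<phi>C] bij(2)]
    and iso1 = lin_iso_inv_into[OF R1.HH_module R1.theta_lin[OF \<phi>1] bij(3)]
    and iso2 = lin_iso_inv_into[OF R2.HH_module R2.theta_lin[OF \<phi>2] bij(4)]
  let ?\<theta>A = "\<lambda>n. map_prod (?\<theta>1 n) (?\<theta>2 n)" and ?\<psi>A = "\<lambda>n. map_prod (?\<psi>1 n) (?\<psi>2 n)"
  let ?A = "\<lambda>n. dsum (HH K A1 Q1 n) (HH K A2 Q2 n)" and ?AC = "\<lambda>n. dsum (HC K A1 n) (HC K A2 n)" and ?AT = "\<lambda>n. dsum (HT K A1 n) (HT K A2 n)"
  have iso12: "lin_iso K (?A n) (?AT n) (?\<theta>A n) (?\<psi>A n)" for n by (rule lin_iso_prod[OF iso1 iso2])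
  have agA: "abelian_group (?A n)" "abelian_group (?AT n)" for n
    by (rule module_abelian_group[OF dsum_module[OF R1.HH_module R2.HH_module]] module_abelian_group[OF dsum_module[OF D.k1.HT_module D.k2.HT_module]])+
  note ag = module_abelian_group[OF RR.HH_module] module_abelian_group[OF RC.HH_module]
    module_abelian_group[OF R1.HH_module] module_abelian_group[OF R2.HH_module]
  note agT = module_abelian_group[OF RR.HT_module] module_abelian_group[OF RC.HT_module]
    module_abelian_group[OF D.k1.HT_module] module_abelian_group[OF D.k2.HT_module]
  note agC = module_abelian_group[OF RR.HC_module] module_abelian_group[OF RC.HC_module]
    module_abelian_group[OF D.k1.HC_module] module_abelian_group[OF D.k2.HC_module]
  \<comment> \<open>Connes' maps for Tor are, by definition, those for the first two columns
    composed with \<open>theta\<close> or its inverse, so all that is known for \<open>HT\<close> is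
    carried over by conjugation.\<close>
  have connes: "connes_I K A \<phi> = (\<lambda>n x. kalg.HI K A n (theta K A \<phi> n x))"
    "connes_B K A Q \<phi> = (\<lambda>n y. inv_into (carrier (HH K A Q (n - 1))) (theta K A \<phi> (n - 1)) (kalg.HB K A n y))"
    if "kalg K A" for A :: "('k, 'a) module" and Q :: "(('a \<times> 'a \<Rightarrow> 'k) set, 'x, 'a) resolution" and \<phi> :: "nat \<Rightarrow> 'x \<Rightarrow> ('a list \<Rightarrow> 'k) set"
    by (simp_all add: fun_eq_iff connes_I_def connes_B_def kalg.HI_def[OF that] kalg.HB_def[OF that])
  note cR = connes[OF RR.kalg_axioms] and cC = connes[OF RC.kalg_axioms] and c1 = connes[OF D.k1.kalg_axioms] and c2 = connes[OF D.k2.kalg_axioms]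
  have row1: "exact_row K (HH K A1 Q1) (HC K A1) (connes_I K A1 \<phi>1) (connes_S K A1) (connes_B K A1 Q1 \<phi>1)"
    unfolding c1 by (rule lin_iso_exact_row[OF D.k1.connes_row iso1 ag(3) agT(3) agC(3)])
  have row2: "exact_row K (HH K A2 Q2) (HC K A2) (connes_I K A2 \<phi>2) (connes_S K A2) (connes_B K A2 Q2 \<phi>2)"
    unfolding c2 by (rule lin_iso_exact_row[OF D.k2.connes_row iso2 ag(4) agT(4) agC(4)])
  have c12: "(\<lambda>n. map_prod (connes_I K A1 \<phi>1 n) (connes_I K A2 \<phi>2 n)) = (\<lambda>n x. map_prod (D.k1.HI n) (D.k2.HI n) (?\<theta>A n x))"
    "(\<lambda>n. map_prod (connes_B K A1 Q1 \<phi>1 n) (connes_B K A2 Q2 \<phi>2 n)) = (\<lambda>n y. ?\<psi>A (n - 1) (map_prod (D.k1.HB n) (D.k2.HB n) y))"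
    by (auto simp: fun_eq_iff c1 c2)
  note col = lin_iso_exact_column[OF D.mv_exact[of two_cols, unfolded D.HTC, OF disjI1[OF refl]] isoC iso12 isoR ag(2) agT(2) agA ag(1) agT(1)]
  \<comment> \<open>On Tor the vertical maps are those on the first two columns, conjugated by
    \<open>theta\<close>; the columns of cyclic homology use the maps on total homology as they
    are.\<close>
  let ?\<alpha> = "\<lambda>n x. ?\<psi>A n (D.mv_a two_cols n (?\<theta>C n x))" and ?\<beta> = "\<lambda>n y. ?\<psi>R n (D.mv_b two_cols n (?\<theta>A n y))"
    and ?\<delta> = "\<lambda>n x. ?\<psi>C (n - 1) (D.mv_d two_cols n (?\<theta>R n x))"
  have ex: "exact_at K (HT K C n) (D.mv_a two_cols n) (?AT n) (D.mv_b two_cols n) (HT K R n)"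
    "exact_at K (?AT n) (D.mv_b two_cols n) (HT K R n) (D.mv_d two_cols n) (HT K C (n - 1))" for n
    using D.mv_exact[of two_cols, unfolded D.HTC, OF disjI1[OF refl]] by (simp_all add: exact_column_def)
  have l: "D.mv_a two_cols n \<in> lin_maps K (HT K C n) (?AT n)" "D.mv_b two_cols n \<in> lin_maps K (?AT n) (HT K R n)"
    "D.mv_d two_cols n \<in> lin_maps K (HT K R n) (HT K C (n - 1))" for n
    using ex unfolding exact_at_def by blast+
  have HB12: "map_prod (D.k1.HB n) (D.k2.HB n) y \<in> carrier (?AT (n - 1))" if "y \<in> carrier (?AC (n - 2))" for n y
    by (rule lin_closed[OF lin_map_prod[OF D.k1.HB_lin D.k2.HB_lin] that])
  note sqR = lin_iso_rows_commute[OF D.mv_d_commute isoR isoC lin_closed[OF l(3)] lin_closed[OF RR.HB_lin]]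
  note sqC = lin_iso_rows_commute[OF D.mv_a_commute isoC iso12, unfolded diff_zero, OF lin_closed[OF l(1)] lin_closed[OF RC.HB_lin]]
    and sqA = lin_iso_rows_commute[OF D.mv_b_commute iso12 isoR, unfolded diff_zero, OF lin_closed[OF l(2)] HB12]
  have mvH: "mv_maps K two_cols A1 A2 R (HH K C QC) (HH K A1 Q1) (HH K A2 Q2) ?\<theta>C ?\<theta>1 ?\<theta>2 ?\<theta>R ?\<alpha> ?\<beta>"
    unfolding mv_maps_def
  proof (intro allI conjI ballI)
    fix n
    have mv_a_c: "incl_map K two_cols A1 n (?\<theta>C n x) \<in> carrier (HT K A1 n) \<and>
      \<ominus>\<^bsub>HX K two_cols A2 n\<^esub> incl_map K two_cols A2 n (?\<theta>C n x) \<in> carrier (HT K A2 n)" if "x \<in> carrier (HH K C QC n)" for x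
      using lin_closed[OF l(1) lin_closed[OF RC.theta_lin[OF \<phi>C] that]] unfolding D.mv_a_def dsum_simps by blast
    show "?\<theta>1 n (fst (?\<alpha> n x)) = incl_map K two_cols A1 n (?\<theta>C n x)" if "x \<in> carrier (HH K C QC n)" for x
      using mv_a_c[OF that] iso1[of n] unfolding D.mv_a_def lin_iso_def by simp
    show "?\<theta>2 n (snd (?\<alpha> n x)) = \<ominus>\<^bsub>HX K two_cols A2 n\<^esub> incl_map K two_cols A2 n (?\<theta>C n x)" if "x \<in> carrier (HH K C QC n)" for x
      using mv_a_c[OF that] iso2[of n] unfolding D.mv_a_def lin_iso_def by simp
    show "?\<theta>R n (?\<beta> n (y, z)) = incl_map K two_cols R n (?\<theta>1 n y) \<oplus>\<^bsub>HX K two_cols R n\<^esub> incl_map K two_cols R n (?\<theta>2 n z)"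
      if y: "y \<in> carrier (HH K A1 Q1 n)" and z: "z \<in> carrier (HH K A2 Q2 n)" for y z
    proof -
      have "(?\<theta>1 n y, ?\<theta>2 n z) \<in> carrier (?AT n)"
        using lin_closed[OF R1.theta_lin[OF \<phi>1] y] lin_closed[OF R2.theta_lin[OF \<phi>2] z] unfolding dsum_simps by blast
      from lin_closed[OF l(2) this] show ?thesis using isoR[of n] unfolding lin_iso_def map_prod_simp by (simp add: D.mv_b_def)
    qed
  qed
  have mvC: "mv_maps K UNIV A1 A2 R (HC K C) (HC K A1) (HC K A2) (\<lambda>_. id) (\<lambda>_. id) (\<lambda>_. id) (\<lambda>_. id) (D.mv_a UNIV) (D.mv_b UNIV)"
    unfolding mv_maps_def by (simp add: D.mv_a_def D.mv_b_def)
  show ?thesis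
    by (intro exI[of _ \<phi>R] exI[of _ \<phi>C] exI[of _ \<phi>1] exI[of _ \<phi>2] exI[of _ ?\<alpha>] exI[of _ ?\<beta>] exI[of _ ?\<delta>]
        exI[of _ "D.mv_a UNIV"] exI[of _ "D.mv_b UNIV"] exI[of _ "D.mv_d UNIV"] conjI allI \<phi>R \<phi>C \<phi>1 \<phi>2 bij)
      (unfold c12, unfold cR cC, (rule lin_iso_exact_row[OF RR.connes_row isoR ag(1) agT(1) agC(1)]
        lin_iso_exact_row[OF RC.connes_row isoC ag(2) agT(2) agC(2)]
        exact_row_dsum[OF row1 row2, unfolded c12] col
        D.mv_exact[of UNIV, unfolded D.HTC, OF disjI2[OF refl]] mvH mvC sqR sqC sqA | assumption)+)
qed

end
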